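(* The category of Gray-categories and strict Gray-functors $G\text{-}Cat_{st}$ with product $\otimes^{st}_{st}$ and inner-hom $G\text{-}Cat^{st}_{st}(-,-)$, i.e. $(G\text{-}Cat_{st},\otimes^{st}_{st},G\text{-}Cat^{st}_{st}(-,-))$, is biclosed monoidal.
   Context: Gray-categories are categories enriched in 2-categories with the pseudo Gray tensor product; strict functors are Gray-functors. $[f|g]$ is $f$ followed by $g$. For Gray-categories $\mathcal B,\mathcal C$, the Gray-category $G\text{-}Cat^{st}_{st}(\mathcal B,\mathcal C)$ has strict Gray-functors as objects; 1-cells are strict transformations $\alpha:F\to G$, i.e. families of 1-cells $\alpha(B):F(B)\to G(B)$ strictly natural with respect to 1-, 2- and 3-cells of $\mathcal B$ (all structure 2- and 3-cells of the transformation are identities); 2-cells are strict modifications $\Gamma:\alpha\Rightarrow\beta$, i.e. families of 2-cells $\Gamma(B):\alpha(B)\Rightarrow\beta(B)$ with $[\Gamma(B)|G(f)]=[F(f)|\Gamma(B')]$ for every 1-cell $f:B\to B'$, and, for every 2-cell $a:f\Rightarrow g$ of $\mathcal B$, compatible with $a$ in the sense that the interchange 3-cell of $\Gamma(B)$ and $G(a)$ agrees with (the appropriately directed) interchange 3-cell of $F(a)$ and $\Gamma(B')$; this is the modification axiom with all structure 3-cells identities; 3-cells are perturbations, i.e. families of 3-cells $\Pi_B:\Gamma(B)\Rrightarrow\Lambda(B)$ strictly natural with respect to 1-cells. Compositions are componentwise, and the interchange 3-cell of $\Gamma,\Lambda$ has at $B$ the interchange 3-cell of $\Gamma(B),\Lambda(B)$.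 A quasi-functor $H:\mathcal A\times\mathcal B\to\mathcal C$ of type $(st,st)$ is the data of a strict Gray-functor $H^t:\mathcal A\to G\text{-}Cat^{st}_{st}(\mathcal B,\mathcal C)$, unpacked in $\mathcal C$: strict Gray-functors $H(A,-)=H^t(A)$ and $H(-,B)$ (evaluation of $H^t$ at $B$), agreeing on objects, satisfying the equations expressing that $H^t$ lands in, and is a Gray-functor to, $G\text{-}Cat^{st}_{st}(\mathcal B,\mathcal C)$ (all structure cells are identities). $\mathcal A\otimes^{st}_{st}\mathcal B$ is the Gray-category presented by generators: objects $A\otimes B$ and cells $A\otimes y$, $x\otimes B$ for all higher cells $y$ of $\mathcal B$, $x$ of $\mathcal A$; subject to exactly the relations making $J(A,-)=A\otimes-$, $J(-,B)=-\otimes B$ a quasi-functor $\mathcal A\times\mathcal B\to\mathcal A\otimes^{st}_{st}\mathcal B$ of type $(st,st)$. A monoidal category is biclosed if both $-\otimes\mathcal B$ and $\mathcal B\otimes-$ have right adjoints for each object $\mathcal B$; here the inner-hom (on both sides, the type $st$ being self-opposite) is $G\text{-}Cat^{st}_{st}(\mathcal B,-)$. *)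

theory Defs
  imports "HOL-Library.FuncSet"
begin

section \<open>2-categories and cubical functors\<close>

text \<open>Cells of all dimensions of one structure are drawn from a single type; the dimension is an
  explicit index. A function \<open>s n\<close> taking (n+1)-cells to n-cells gives the iterated
  boundary \<open>bd s n\<close>, taking n-cells to 0-cells; dually for \<open>iid\<close>.\<close>

primrec bd :: "(nat \<Rightarrow> 'a \<Rightarrow> 'a) \<Rightarrow> nat \<Rightarrow> 'a \<Rightarrow> 'a" where
  "bd s 0 x = x"
| "bd s (Suc n) x = bd s n (s n x)"

primrec iid :: "(nat \<Rightarrow> 'a \<Rightarrow> 'a) \<Rightarrow> nat \<Rightarrow> 'a \<Rightarrow> 'a" where
  "iid i 0 x = x"
| "iid i (Suc n) x = i n (iid i n x)"

text \<open>\<open>tsrc n\<close>, \<open>ttgt n\<close> go from (n+1)-cells to n-cells, \<open>tidt n\<close> from n-cells to (n+1)-cells;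
  \<open>thor n\<close> composes n-cells along 0-cells and \<open>tver\<close> composes 2-cells along 1-cells. All
  composites in this theory are written in diagrammatic order.\<close>

record 'a two_cat =
  tcell :: "nat \<Rightarrow> 'a set"
  tsrc :: "nat \<Rightarrow> 'a \<Rightarrow> 'a"
  ttgt :: "nat \<Rightarrow> 'a \<Rightarrow> 'a"
  tidt :: "nat \<Rightarrow> 'a \<Rightarrow> 'a"
  thor :: "nat \<Rightarrow> 'a \<Rightarrow> 'a \<Rightarrow> 'a"
  tver :: "'a \<Rightarrow> 'a \<Rightarrow> 'a"

definition two_category :: "'a two_cat \<Rightarrow> bool" where
  "two_category T \<longleftrightarrow>
    (\<forall>n>2. tcell T n = {}) \<and>
    (\<forall>n. \<forall>x\<in>tcell T (Suc n). tsrc T n x \<in> tcell T n \<and> ttgt T n x \<in> tcell T n) \<and>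
    (\<forall>x\<in>tcell T 2. tsrc T 0 (tsrc T 1 x) = tsrc T 0 (ttgt T 1 x) \<and>
                   ttgt T 0 (tsrc T 1 x) = ttgt T 0 (ttgt T 1 x)) \<and>
    (\<forall>n<2. \<forall>x\<in>tcell T n. tidt T n x \<in> tcell T (Suc n) \<and>
                   tsrc T n (tidt T n x) = x \<and> ttgt T n (tidt T n x) = x) \<and>
    \<comment> \<open>composition along 0-cells\<close>
    (\<forall>n\<in>{1,2}. \<forall>x\<in>tcell T n. \<forall>y\<in>tcell T n. bd (ttgt T) n x = bd (tsrc T) n y \<longrightarrow>
       thor T n x y \<in> tcell T n) \<and>
    (\<forall>x\<in>tcell T 1. \<forall>y\<in>tcell T 1. ttgt T 0 x = tsrc T 0 y \<longrightarrow>
       tsrc T 0 (thor T 1 x y) = tsrc T 0 x \<and> ttgt T 0 (thor T 1 x y) = ttgt T 0 y) \<and>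
    (\<forall>x\<in>tcell T 2. \<forall>y\<in>tcell T 2. bd (ttgt T) 2 x = bd (tsrc T) 2 y \<longrightarrow>
       tsrc T 1 (thor T 2 x y) = thor T 1 (tsrc T 1 x) (tsrc T 1 y) \<and>
       ttgt T 1 (thor T 2 x y) = thor T 1 (ttgt T 1 x) (ttgt T 1 y)) \<and>
    (\<forall>n\<in>{1,2}. \<forall>x\<in>tcell T n. \<forall>y\<in>tcell T n. \<forall>z\<in>tcell T n.
       bd (ttgt T) n x = bd (tsrc T) n y \<and> bd (ttgt T) n y = bd (tsrc T) n z \<longrightarrow>
       thor T n (thor T n x y) z = thor T n x (thor T n y z)) \<and>
    (\<forall>n\<in>{1,2}. \<forall>x\<in>tcell T n.
       thor T n (iid (tidt T) n (bd (tsrc T) n x)) x = x \<and>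
       thor T n x (iid (tidt T) n (bd (ttgt T) n x)) = x) \<and>
    \<comment> \<open>composition along 1-cells\<close>
    (\<forall>x\<in>tcell T 2. \<forall>y\<in>tcell T 2. ttgt T 1 x = tsrc T 1 y \<longrightarrow>
       tver T x y \<in> tcell T 2 \<and>
       tsrc T 1 (tver T x y) = tsrc T 1 x \<and> ttgt T 1 (tver T x y) = ttgt T 1 y) \<and>
    (\<forall>x\<in>tcell T 2. \<forall>y\<in>tcell T 2. \<forall>z\<in>tcell T 2.
       ttgt T 1 x = tsrc T 1 y \<and> ttgt T 1 y = tsrc T 1 z \<longrightarrow>
       tver T (tver T x y) z = tver T x (tver T y z)) \<and>
    (\<forall>x\<in>tcell T 2. tver T (tidt T 1 (tsrc T 1 x)) x = x \<and> tver T x (tidt T 1 (ttgt T 1 x)) = x) \<and>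
    \<comment> \<open>functoriality of horizontal composition\<close>
    (\<forall>x\<in>tcell T 1. \<forall>y\<in>tcell T 1. ttgt T 0 x = tsrc T 0 y \<longrightarrow>
       thor T 2 (tidt T 1 x) (tidt T 1 y) = tidt T 1 (thor T 1 x y)) \<and>
    (\<forall>x\<in>tcell T 2. \<forall>x'\<in>tcell T 2. \<forall>y\<in>tcell T 2. \<forall>y'\<in>tcell T 2.
       ttgt T 1 x = tsrc T 1 x' \<and> ttgt T 1 y = tsrc T 1 y' \<and> bd (ttgt T) 2 x = bd (tsrc T) 2 y \<longrightarrow>
       thor T 2 (tver T x x') (tver T y y') = tver T (thor T 2 x y) (thor T 2 x' y'))"

definition two_functor :: "'a two_cat \<Rightarrow> 'b two_cat \<Rightarrow> (nat \<Rightarrow> 'a \<Rightarrow> 'b) \<Rightarrow> bool" where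
  "two_functor S T F \<longleftrightarrow>
    (\<forall>n. \<forall>x\<in>tcell S n. F n x \<in> tcell T n) \<and>
    (\<forall>n. \<forall>x\<in>tcell S (Suc n). tsrc T n (F (Suc n) x) = F n (tsrc S n x) \<and>
                              ttgt T n (F (Suc n) x) = F n (ttgt S n x)) \<and>
    (\<forall>n<2. \<forall>x\<in>tcell S n. F (Suc n) (tidt S n x) = tidt T n (F n x)) \<and>
    (\<forall>n\<in>{1,2}. \<forall>x\<in>tcell S n. \<forall>y\<in>tcell S n. bd (ttgt S) n x = bd (tsrc S) n y \<longrightarrow>
       F n (thor S n x y) = thor T n (F n x) (F n y)) \<and>
    (\<forall>x\<in>tcell S 2. \<forall>y\<in>tcell S 2. ttgt S 1 x = tsrc S 1 y \<longrightarrow>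
       F 2 (tver S x y) = tver T (F 2 x) (F 2 y))"

definition tinverse :: "'a two_cat \<Rightarrow> 'a \<Rightarrow> 'a \<Rightarrow> bool" where
  "tinverse T x y \<longleftrightarrow> x \<in> tcell T 2 \<and> y \<in> tcell T 2 \<and>
     tsrc T 1 x = ttgt T 1 y \<and> ttgt T 1 x = tsrc T 1 y \<and>
     tver T x y = tidt T 1 (tsrc T 1 x) \<and> tver T y x = tidt T 1 (tsrc T 1 y)"

text \<open>Cubical functors in two variables from R and S to T; by the universal property of the pseudo
  Gray tensor product these are the 2-functors from it to T. \<open>M m n x y\<close> is the value at
  an m-cell x and an n-cell y, relevant only if \<open>m = 0\<close> or \<open>n = 0\<close>; \<open>K p q\<close> is the
  structure 2-cell at a pair of 1-cells.\<close>

definition cubical_functor ::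
  "'a two_cat \<Rightarrow> 'b two_cat \<Rightarrow> 'c two_cat \<Rightarrow> (nat \<Rightarrow> nat \<Rightarrow> 'a \<Rightarrow> 'b \<Rightarrow> 'c) \<Rightarrow> ('a \<Rightarrow> 'b \<Rightarrow> 'c) \<Rightarrow> bool"
  where
  "cubical_functor R S T M K \<longleftrightarrow>
    (\<forall>a\<in>tcell R 0. two_functor S T (\<lambda>n y. M 0 n a y)) \<and>
    (\<forall>b\<in>tcell S 0. two_functor R T (\<lambda>m x. M m 0 x b)) \<and>
    (\<forall>p\<in>tcell R 1. \<forall>q\<in>tcell S 1.
       K p q \<in> tcell T 2 \<and>
       tsrc T 1 (K p q) = thor T 1 (M 1 0 p (tsrc S 0 q)) (M 0 1 (ttgt R 0 p) q) \<and>
       ttgt T 1 (K p q) = thor T 1 (M 0 1 (tsrc R 0 p) q) (M 1 0 p (ttgt S 0 q)) \<and>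
       (\<exists>k. tinverse T (K p q) k)) \<and>
    \<comment> \<open>naturality\<close>
    (\<forall>x\<in>tcell R 2. \<forall>q\<in>tcell S 1.
       tver T (thor T 2 (M 2 0 x (tsrc S 0 q)) (tidt T 1 (M 0 1 (bd (ttgt R) 2 x) q))) (K (ttgt R 1 x) q) =
       tver T (K (tsrc R 1 x) q) (thor T 2 (tidt T 1 (M 0 1 (bd (tsrc R) 2 x) q)) (M 2 0 x (ttgt S 0 q)))) \<and>
    (\<forall>p\<in>tcell R 1. \<forall>y\<in>tcell S 2.
       tver T (thor T 2 (tidt T 1 (M 1 0 p (bd (tsrc S) 2 y))) (M 0 2 (ttgt R 0 p) y)) (K p (ttgt S 1 y)) =
       tver T (K p (tsrc S 1 y)) (thor T 2 (M 0 2 (tsrc R 0 p) y) (tidt T 1 (M 1 0 p (bd (ttgt S) 2 y))))) \<and>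
    \<comment> \<open>identities and composites\<close>
    (\<forall>a\<in>tcell R 0. \<forall>q\<in>tcell S 1. K (tidt R 0 a) q = tidt T 1 (M 0 1 a q)) \<and>
    (\<forall>p\<in>tcell R 1. \<forall>b\<in>tcell S 0. K p (tidt S 0 b) = tidt T 1 (M 1 0 p b)) \<and>
    (\<forall>p\<in>tcell R 1. \<forall>p'\<in>tcell R 1. \<forall>q\<in>tcell S 1. ttgt R 0 p = tsrc R 0 p' \<longrightarrow>
       K (thor R 1 p p') q =
       tver T (thor T 2 (tidt T 1 (M 1 0 p (tsrc S 0 q))) (K p' q))
              (thor T 2 (K p q) (tidt T 1 (M 1 0 p' (ttgt S 0 q))))) \<and>
    (\<forall>p\<in>tcell R 1. \<forall>q\<in>tcell S 1. \<forall>q'\<in>tcell S 1. ttgt S 0 q = tsrc S 0 q' \<longrightarrow>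
       K p (thor S 1 q q') =
       tver T (thor T 2 (K p q) (tidt T 1 (M 0 1 (ttgt R 0 p) q')))
              (thor T 2 (tidt T 1 (M 0 1 (tsrc R 0 p) q)) (K p q')))"

section \<open>Gray-categories and strict Gray-functors\<close>

text \<open>\<open>wh m n x y\<close> is \<open>[x|y]\<close> for an m-cell x and an n-cell y meeting in a 0-cell, relevant only for
  \<open>m, n \<ge> 1\<close> with \<open>m = 1\<close> or \<open>n = 1\<close>; \<open>hor n\<close> composes n-cells along 1-cells and \<open>ver\<close>
  composes 3-cells along 2-cells; \<open>ich x y\<close> is the interchange 3-cell of two
  2-cells x and y meeting in a 0-cell.\<close>

record 'a gray =
  cell :: "nat \<Rightarrow> 'a set"
  src :: "nat \<Rightarrow> 'a \<Rightarrow> 'a"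
  tgt :: "nat \<Rightarrow> 'a \<Rightarrow> 'a"
  idt :: "nat \<Rightarrow> 'a \<Rightarrow> 'a"
  wh :: "nat \<Rightarrow> nat \<Rightarrow> 'a \<Rightarrow> 'a \<Rightarrow> 'a"
  hor :: "nat \<Rightarrow> 'a \<Rightarrow> 'a \<Rightarrow> 'a"
  ver :: "'a \<Rightarrow> 'a \<Rightarrow> 'a"
  ich :: "'a \<Rightarrow> 'a \<Rightarrow> 'a"

abbreviation src0 :: "'a gray \<Rightarrow> nat \<Rightarrow> 'a \<Rightarrow> 'a" where "src0 G \<equiv> bd (src G)"
abbreviation tgt0 :: "'a gray \<Rightarrow> nat \<Rightarrow> 'a \<Rightarrow> 'a" where "tgt0 G \<equiv> bd (tgt G)"

definition hom2 :: "'a gray \<Rightarrow> 'a \<Rightarrow> 'a \<Rightarrow> 'a two_cat" where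
  "hom2 G X Y = \<lparr>
     tcell = (\<lambda>n. {x \<in> cell G (Suc n). src0 G (Suc n) x = X \<and> tgt0 G (Suc n) x = Y}),
     tsrc = (\<lambda>n. src G (Suc n)), ttgt = (\<lambda>n. tgt G (Suc n)), tidt = (\<lambda>n. idt G (Suc n)),
     thor = (\<lambda>n. hor G (Suc n)), tver = ver G \<rparr>"

text \<open>A category enriched in 2-categories with the pseudo Gray tensor product: composition is a
  cubical functor, and the unit and associativity laws, which are equations between 2-functors on
  Gray tensor products, are stated on the generating cells of these.\<close>

definition gray_category :: "'a gray \<Rightarrow> bool" where
  "gray_category G \<longleftrightarrow>
    (\<forall>n>3. cell G n = {}) \<and>
    (\<forall>n. \<forall>x\<in>cell G (Suc n). src G n x \<in> cell G n \<and> tgt G n x \<in> cell G n) \<and>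
    (\<forall>X\<in>cell G 0. \<forall>Y\<in>cell G 0. two_category (hom2 G X Y)) \<and>
    (\<forall>X\<in>cell G 0. idt G 0 X \<in> tcell (hom2 G X X) 0) \<and>
    (\<forall>X\<in>cell G 0. \<forall>Y\<in>cell G 0. \<forall>Z\<in>cell G 0.
       cubical_functor (hom2 G X Y) (hom2 G Y Z) (hom2 G X Z)
         (\<lambda>m n. wh G (Suc m) (Suc n)) (ich G)) \<and>
    (\<forall>n\<ge>1. \<forall>x\<in>cell G n. wh G 1 n (idt G 0 (src0 G n x)) x = x \<and>
                          wh G n 1 x (idt G 0 (tgt0 G n x)) = x) \<and>
    (\<forall>l\<ge>1. \<forall>m\<ge>1. \<forall>n\<ge>1. l = 1 \<and> m = 1 \<or> l = 1 \<and> n = 1 \<or> m = 1 \<and> n = 1 \<longrightarrow>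
       (\<forall>x\<in>cell G l. \<forall>y\<in>cell G m. \<forall>z\<in>cell G n.
          tgt0 G l x = src0 G m y \<and> tgt0 G m y = src0 G n z \<longrightarrow>
          wh G (l + m - 1) n (wh G l m x y) z = wh G l (m + n - 1) x (wh G m n y z))) \<and>
    (\<forall>f\<in>cell G 1. \<forall>x\<in>cell G 2. \<forall>y\<in>cell G 2.
       tgt G 0 f = src0 G 2 x \<and> tgt0 G 2 x = src0 G 2 y \<longrightarrow>
       ich G (wh G 1 2 f x) y = wh G 1 3 f (ich G x y)) \<and>
    (\<forall>x\<in>cell G 2. \<forall>f\<in>cell G 1. \<forall>y\<in>cell G 2.
       tgt0 G 2 x = src G 0 f \<and> tgt G 0 f = src0 G 2 y \<longrightarrow>
       ich G (wh G 2 1 x f) y = ich G x (wh G 1 2 f y)) \<and>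
    (\<forall>x\<in>cell G 2. \<forall>y\<in>cell G 2. \<forall>f\<in>cell G 1.
       tgt0 G 2 x = src0 G 2 y \<and> tgt0 G 2 y = src G 0 f \<longrightarrow>
       ich G x (wh G 2 1 y f) = wh G 3 1 (ich G x y) f)"

text \<open>Functors are made \<open>undefined\<close> off the cells of their domain, so that equality of functors is
  equality of functions.\<close>

definition strict_gray_functor :: "'a gray \<Rightarrow> 'b gray \<Rightarrow> (nat \<Rightarrow> 'a \<Rightarrow> 'b) \<Rightarrow> bool" where
  "strict_gray_functor A B F \<longleftrightarrow> gray_category A \<and> gray_category B \<and>
    (\<forall>n x. x \<notin> cell A n \<longrightarrow> F n x = undefined) \<and>
    (\<forall>X\<in>cell A 0. F 0 X \<in> cell B 0) \<and>
    (\<forall>X\<in>cell A 0. \<forall>Y\<in>cell A 0.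
       two_functor (hom2 A X Y) (hom2 B (F 0 X) (F 0 Y)) (\<lambda>n. F (Suc n))) \<and>
    (\<forall>X\<in>cell A 0. F 1 (idt A 0 X) = idt B 0 (F 0 X)) \<and>
    (\<forall>m\<ge>1. \<forall>n\<ge>1. m = 1 \<or> n = 1 \<longrightarrow>
       (\<forall>x\<in>cell A m. \<forall>y\<in>cell A n. tgt0 A m x = src0 A n y \<longrightarrow>
          F (m + n - 1) (wh A m n x y) = wh B m n (F m x) (F n y))) \<and>
    (\<forall>x\<in>cell A 2. \<forall>y\<in>cell A 2. tgt0 A 2 x = src0 A 2 y \<longrightarrow>
       F 3 (ich A x y) = ich B (F 2 x) (F 2 y))"

definition gray_id :: "'a gray \<Rightarrow> nat \<Rightarrow> 'a \<Rightarrow> 'a" where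
  "gray_id A = (\<lambda>n. restrict (\<lambda>x. x) (cell A n))"

text \<open>\<open>gray_comp A F G\<close> is F, with domain A, followed by G.\<close>

definition gray_comp ::
  "'a gray \<Rightarrow> (nat \<Rightarrow> 'a \<Rightarrow> 'b) \<Rightarrow> (nat \<Rightarrow> 'b \<Rightarrow> 'c) \<Rightarrow> nat \<Rightarrow> 'a \<Rightarrow> 'c" where
  "gray_comp A F G = (\<lambda>n. restrict (\<lambda>x. G n (F n x)) (cell A n))"

definition gray_iso :: "'a gray \<Rightarrow> 'b gray \<Rightarrow> (nat \<Rightarrow> 'a \<Rightarrow> 'b) \<Rightarrow> bool" where
  "gray_iso A B F \<longleftrightarrow> strict_gray_functor A B F \<and>
    (\<exists>G. strict_gray_functor B A G \<and> gray_comp A F G = gray_id A \<and> gray_comp B G F = gray_id B)"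

section \<open>The inner hom\<close>

definition strict_transformation ::
  "'b gray \<Rightarrow> 'c gray \<Rightarrow> (nat \<Rightarrow> 'b \<Rightarrow> 'c) \<Rightarrow> (nat \<Rightarrow> 'b \<Rightarrow> 'c) \<Rightarrow> ('b \<Rightarrow> 'c) \<Rightarrow> bool" where
  "strict_transformation B C F G \<alpha> \<longleftrightarrow>
    strict_gray_functor B C F \<and> strict_gray_functor B C G \<and> \<alpha> \<in> extensional (cell B 0) \<and>
    (\<forall>X\<in>cell B 0. \<alpha> X \<in> cell C 1 \<and> src C 0 (\<alpha> X) = F 0 X \<and> tgt C 0 (\<alpha> X) = G 0 X) \<and>
    (\<forall>n\<ge>1. \<forall>y\<in>cell B n.
       wh C 1 n (\<alpha> (src0 B n y)) (G n y) = wh C n 1 (F n y) (\<alpha> (tgt0 B n y)))"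

text \<open>In the last clause the two interchange 3-cells have opposite directions, whence the
  inverse.\<close>

definition strict_modification ::
  "'b gray \<Rightarrow> 'c gray \<Rightarrow> (nat \<Rightarrow> 'b \<Rightarrow> 'c) \<Rightarrow> (nat \<Rightarrow> 'b \<Rightarrow> 'c) \<Rightarrow> ('b \<Rightarrow> 'c) \<Rightarrow> ('b \<Rightarrow> 'c) \<Rightarrow> ('b \<Rightarrow> 'c) \<Rightarrow> bool"
  where
  "strict_modification B C F G \<alpha> \<beta> \<Gamma> \<longleftrightarrow>
    strict_transformation B C F G \<alpha> \<and> strict_transformation B C F G \<beta> \<and>
    \<Gamma> \<in> extensional (cell B 0) \<and>
    (\<forall>X\<in>cell B 0. \<Gamma> X \<in> cell C 2 \<and> src C 1 (\<Gamma> X) = \<alpha> X \<and> tgt C 1 (\<Gamma> X) = \<beta> X) \<and>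
    (\<forall>f\<in>cell B 1. wh C 2 1 (\<Gamma> (src B 0 f)) (G 1 f) = wh C 1 2 (F 1 f) (\<Gamma> (tgt B 0 f))) \<and>
    (\<forall>a\<in>cell B 2.
       tinverse (hom2 C (F 0 (src0 B 2 a)) (G 0 (tgt0 B 2 a)))
         (ich C (\<Gamma> (src0 B 2 a)) (G 2 a)) (ich C (F 2 a) (\<Gamma> (tgt0 B 2 a))))"

definition perturbation ::
  "'b gray \<Rightarrow> 'c gray \<Rightarrow> (nat \<Rightarrow> 'b \<Rightarrow> 'c) \<Rightarrow> (nat \<Rightarrow> 'b \<Rightarrow> 'c) \<Rightarrow> ('b \<Rightarrow> 'c) \<Rightarrow> ('b \<Rightarrow> 'c) \<Rightarrow>
   ('b \<Rightarrow> 'c) \<Rightarrow> ('b \<Rightarrow> 'c) \<Rightarrow> ('b \<Rightarrow> 'c) \<Rightarrow> bool" where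
  "perturbation B C F G \<alpha> \<beta> \<Gamma> \<Lambda> \<Theta> \<longleftrightarrow>
    strict_modification B C F G \<alpha> \<beta> \<Gamma> \<and> strict_modification B C F G \<alpha> \<beta> \<Lambda> \<and>
    \<Theta> \<in> extensional (cell B 0) \<and>
    (\<forall>X\<in>cell B 0. \<Theta> X \<in> cell C 3 \<and> src C 2 (\<Theta> X) = \<Gamma> X \<and> tgt C 2 (\<Theta> X) = \<Lambda> X) \<and>
    (\<forall>f\<in>cell B 1. wh C 3 1 (\<Theta> (src B 0 f)) (G 1 f) = wh C 1 3 (F 1 f) (\<Theta> (tgt B 0 f)))"

text \<open>\<open>HFun F\<close> is a 0-cell; \<open>HCell s t k\<close> is a higher cell with source s, target t and family of
  components k.\<close>

datatype ('b, 'c) hcell =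
  HFun "nat \<Rightarrow> 'b \<Rightarrow> 'c"
| HCell (hsrc: "('b, 'c) hcell") (htgt: "('b, 'c) hcell") "'b \<Rightarrow> 'c"

primrec hat :: "('b, 'c) hcell \<Rightarrow> 'b \<Rightarrow> 'c" where
  "hat (HFun F) X = F 0 X"
| "hat (HCell s t k) X = k X"

definition hcells :: "'b gray \<Rightarrow> 'c gray \<Rightarrow> nat \<Rightarrow> ('b, 'c) hcell set" where
  "hcells B C n =
    (if n = 0 then {HFun F |F. strict_gray_functor B C F}
     else if n = 1 then {HCell (HFun F) (HFun G) \<alpha> |F G \<alpha>. strict_transformation B C F G \<alpha>}
     else if n = 2 then
       {HCell (HCell (HFun F) (HFun G) \<alpha>) (HCell (HFun F) (HFun G) \<beta>) \<Gamma> |F G \<alpha> \<beta> \<Gamma>.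
          strict_modification B C F G \<alpha> \<beta> \<Gamma>}
     else if n = 3 then
       {HCell (HCell (HCell (HFun F) (HFun G) \<alpha>) (HCell (HFun F) (HFun G) \<beta>) \<Gamma>)
              (HCell (HCell (HFun F) (HFun G) \<alpha>) (HCell (HFun F) (HFun G) \<beta>) \<Lambda>) \<Theta> |F G \<alpha> \<beta> \<Gamma> \<Lambda> \<Theta>.
          perturbation B C F G \<alpha> \<beta> \<Gamma> \<Lambda> \<Theta>}
     else {})"

definition hidt :: "'b gray \<Rightarrow> 'c gray \<Rightarrow> nat \<Rightarrow> ('b, 'c) hcell \<Rightarrow> ('b, 'c) hcell" where
  "hidt B C n x = HCell x x (restrict (\<lambda>X. idt C n (hat x X)) (cell B 0))"

function hwh :: "'b gray \<Rightarrow> 'c gray \<Rightarrow> nat \<Rightarrow> nat \<Rightarrow> ('b, 'c) hcell \<Rightarrow> ('b, 'c) hcell \<Rightarrow> ('b, 'c) hcell"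
  where
  "hwh B C m n x y = HCell
     (if n > 1 then hwh B C m (n - 1) x (hsrc y)
      else if m > 1 then hwh B C (m - 1) n (hsrc x) y else hsrc x)
     (if n > 1 then hwh B C m (n - 1) x (htgt y)
      else if m > 1 then hwh B C (m - 1) n (htgt x) y else htgt y)
     (restrict (\<lambda>X. wh C m n (hat x X) (hat y X)) (cell B 0))"
  by pat_completeness auto
termination by (relation "Wellfounded.measure (\<lambda>(B, C, m, n, x, y). m + n)") auto
declare hwh.simps [simp del]

definition hhor :: "'b gray \<Rightarrow> 'c gray \<Rightarrow> nat \<Rightarrow> ('b, 'c) hcell \<Rightarrow> ('b, 'c) hcell \<Rightarrow> ('b, 'c) hcell" where
  "hhor B C n x y =
    (let c = (\<lambda>k u v. restrict (\<lambda>X. hor C k (hat u X) (hat v X)) (cell B 0));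
         hor2 = (\<lambda>u v. HCell (hsrc u) (htgt v) (c 2 u v))
     in if n = 2 then hor2 x y
        else HCell (hor2 (hsrc x) (hsrc y)) (hor2 (htgt x) (htgt y)) (c n x y))"

definition hver :: "'b gray \<Rightarrow> 'c gray \<Rightarrow> ('b, 'c) hcell \<Rightarrow> ('b, 'c) hcell \<Rightarrow> ('b, 'c) hcell" where
  "hver B C x y = HCell (hsrc x) (htgt y) (restrict (\<lambda>X. ver C (hat x X) (hat y X)) (cell B 0))"

definition hich :: "'b gray \<Rightarrow> 'c gray \<Rightarrow> ('b, 'c) hcell \<Rightarrow> ('b, 'c) hcell \<Rightarrow> ('b, 'c) hcell" where
  "hich B C x y = HCell
     (hhor B C 2 (hwh B C 2 1 x (hsrc y)) (hwh B C 1 2 (htgt x) y))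
     (hhor B C 2 (hwh B C 1 2 (hsrc x) y) (hwh B C 2 1 x (htgt y)))
     (restrict (\<lambda>X. ich C (hat x X) (hat y X)) (cell B 0))"

definition gray_hom :: "'b gray \<Rightarrow> 'c gray \<Rightarrow> ('b, 'c) hcell gray" where
  "gray_hom B C = \<lparr> cell = hcells B C, src = (\<lambda>n. hsrc), tgt = (\<lambda>n. htgt), idt = hidt B C,
     wh = hwh B C, hor = hhor B C, ver = hver B C, ich = hich B C \<rparr>"

text \<open>The action of \<open>gray_hom B -\<close> on a strict functor K with domain C: postcomposition.\<close>

primrec hpost :: "'b gray \<Rightarrow> (nat \<Rightarrow> 'c \<Rightarrow> 'd) \<Rightarrow> ('b, 'c) hcell \<Rightarrow> nat \<Rightarrow> ('b, 'd) hcell" where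
  "hpost B K (HFun F) n = HFun (gray_comp B F K)"
| "hpost B K (HCell s t k) n =
     HCell (hpost B K s (n - 1)) (hpost B K t (n - 1)) (restrict (\<lambda>X. K n (k X)) (cell B 0))"

definition gray_hom_map ::
  "'b gray \<Rightarrow> 'c gray \<Rightarrow> (nat \<Rightarrow> 'c \<Rightarrow> 'd) \<Rightarrow> nat \<Rightarrow> ('b, 'c) hcell \<Rightarrow> ('b, 'd) hcell" where
  "gray_hom_map B C K = (\<lambda>n. restrict (\<lambda>x. hpost B K x n) (cell (gray_hom B C) n))"

text \<open>The family \<open>H\<^sup>t\<close> of cells of \<open>gray_hom B C\<close> attached to data \<open>H m n x y\<close> in two variables,
  relevant for \<open>m = 0\<close> or \<open>n = 0\<close>, that is, to \<open>H(A,-)\<close> and \<open>H(-,B)\<close> agreeing on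
  objects.\<close>

primrec transp :: "'a gray \<Rightarrow> 'b gray \<Rightarrow> (nat \<Rightarrow> nat \<Rightarrow> 'a \<Rightarrow> 'b \<Rightarrow> 'c) \<Rightarrow> nat \<Rightarrow> 'a \<Rightarrow> ('b, 'c) hcell" where
  "transp A B H 0 x = HFun (\<lambda>n. restrict (\<lambda>y. H 0 n x y) (cell B n))"
| "transp A B H (Suc m) x =
     HCell (transp A B H m (src A m x)) (transp A B H m (tgt A m x))
       (restrict (\<lambda>Y. H (Suc m) 0 x Y) (cell B 0))"

definition transpose ::
  "'a gray \<Rightarrow> 'b gray \<Rightarrow> (nat \<Rightarrow> nat \<Rightarrow> 'a \<Rightarrow> 'b \<Rightarrow> 'c) \<Rightarrow> nat \<Rightarrow> 'a \<Rightarrow> ('b, 'c) hcell" where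
  "transpose A B H = (\<lambda>n. restrict (transp A B H n) (cell A n))"

definition quasi_functor ::
  "'a gray \<Rightarrow> 'b gray \<Rightarrow> 'c gray \<Rightarrow> (nat \<Rightarrow> nat \<Rightarrow> 'a \<Rightarrow> 'b \<Rightarrow> 'c) \<Rightarrow> bool" where
  "quasi_functor A B C H \<longleftrightarrow>
    (\<forall>X\<in>cell A 0. strict_gray_functor B C (\<lambda>n. restrict (\<lambda>y. H 0 n X y) (cell B n))) \<and>
    (\<forall>Y\<in>cell B 0. strict_gray_functor A C (\<lambda>m. restrict (\<lambda>x. H m 0 x Y) (cell A m))) \<and>
    strict_gray_functor A (gray_hom B C) (transpose A B H)"

section \<open>The tensor product\<close>

text \<open>Formal cells. \<open>Gen m n x y\<close> is the generator \<open>x \<otimes> y\<close> for an m-cell x and an n-cell y, with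
  \<open>m = 0\<close> or \<open>n = 0\<close>; \<open>IchI\<close> is the inverse of an interchange 3-cell.\<close>

datatype ('a, 'b) trm =
  Gen nat nat 'a 'b
| Idt nat "('a, 'b) trm"
| Wh nat nat "('a, 'b) trm" "('a, 'b) trm"
| Hor nat "('a, 'b) trm" "('a, 'b) trm"
| Ver "('a, 'b) trm" "('a, 'b) trm"
| Ich "('a, 'b) trm" "('a, 'b) trm"
| IchI "('a, 'b) trm" "('a, 'b) trm"

fun dm :: "'a gray \<Rightarrow> 'b gray \<Rightarrow> ('a, 'b) trm \<Rightarrow> ('a, 'b) trm"
  and cd :: "'a gray \<Rightarrow> 'b gray \<Rightarrow> ('a, 'b) trm \<Rightarrow> ('a, 'b) trm" where
  "dm A B (Gen m n x y) =
     (if m > 0 then Gen (m - 1) n (src A (m - 1) x) y else Gen m (n - 1) x (src B (n - 1) y))"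
| "dm A B (Idt n x) = x"
| "dm A B (Wh m n x y) =
     (if n > 1 then Wh m (n - 1) x (dm A B y) else if m > 1 then Wh (m - 1) n (dm A B x) y else dm A B x)"
| "dm A B (Hor n x y) = (if n > 2 then Hor (n - 1) (dm A B x) (dm A B y) else dm A B x)"
| "dm A B (Ver x y) = dm A B x"
| "dm A B (Ich x y) = Hor 2 (Wh 2 1 x (dm A B y)) (Wh 1 2 (cd A B x) y)"
| "dm A B (IchI x y) = Hor 2 (Wh 1 2 (dm A B x) y) (Wh 2 1 x (cd A B y))"
| "cd A B (Gen m n x y) =
     (if m > 0 then Gen (m - 1) n (tgt A (m - 1) x) y else Gen m (n - 1) x (tgt B (n - 1) y))"
| "cd A B (Idt n x) = x"
| "cd A B (Wh m n x y) =
     (if n > 1 then Wh m (n - 1) x (cd A B y) else if m > 1 then Wh (m - 1) n (cd A B x) y else cd A B y)"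
| "cd A B (Hor n x y) = (if n > 2 then Hor (n - 1) (cd A B x) (cd A B y) else cd A B y)"
| "cd A B (Ver x y) = cd A B y"
| "cd A B (Ich x y) = Hor 2 (Wh 1 2 (dm A B x) y) (Wh 2 1 x (cd A B y))"
| "cd A B (IchI x y) = Hor 2 (Wh 2 1 x (dm A B y)) (Wh 1 2 (cd A B x) y)"

abbreviation dms :: "'a gray \<Rightarrow> 'b gray \<Rightarrow> nat \<Rightarrow> ('a, 'b) trm \<Rightarrow> ('a, 'b) trm" where
  "dms A B k \<equiv> (dm A B ^^ k)"
abbreviation cds :: "'a gray \<Rightarrow> 'b gray \<Rightarrow> nat \<Rightarrow> ('a, 'b) trm \<Rightarrow> ('a, 'b) trm" where
  "cds A B k \<equiv> (cd A B ^^ k)"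

text \<open>\<open>teq A B n x y\<close>: x and y are well-formed formal n-cells and denote the same cell of the
  presented Gray-category. So \<open>teq A B n x x\<close> expresses well-formedness, and \<open>teq A B n\<close> is a
  partial equivalence relation.\<close>

inductive teq :: "'a gray \<Rightarrow> 'b gray \<Rightarrow> nat \<Rightarrow> ('a, 'b) trm \<Rightarrow> ('a, 'b) trm \<Rightarrow> bool"
  for A :: "'a gray" and B :: "'b gray" where
  sym: "teq A B n x y \<Longrightarrow> teq A B n y x"
| trans: "teq A B n x y \<Longrightarrow> teq A B n y z \<Longrightarrow> teq A B n x z"
\<comment> \<open>formation and congruence\<close>
| dm: "teq A B (Suc n) x y \<Longrightarrow> teq A B n (dm A B x) (dm A B y)"
| cd: "teq A B (Suc n) x y \<Longrightarrow> teq A B n (cd A B x) (cd A B y)"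
| dm_glob: "teq A B (Suc (Suc n)) x x \<Longrightarrow> teq A B n (dm A B (dm A B x)) (dm A B (cd A B x))"
| cd_glob: "teq A B (Suc (Suc n)) x x \<Longrightarrow> teq A B n (cd A B (dm A B x)) (cd A B (cd A B x))"
| Gen: "x \<in> cell A m \<Longrightarrow> y \<in> cell B n \<Longrightarrow> m = 0 \<or> n = 0 \<Longrightarrow>
    teq A B (m + n) (Gen m n x y) (Gen m n x y)"
| Idt: "teq A B n x x' \<Longrightarrow> n < 3 \<Longrightarrow> teq A B (Suc n) (Idt n x) (Idt n x')"
| Wh: "teq A B m x x' \<Longrightarrow> teq A B n y y' \<Longrightarrow> m \<ge> 1 \<Longrightarrow> n \<ge> 1 \<Longrightarrow> m = 1 \<or> n = 1 \<Longrightarrow>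
    teq A B 0 (cds A B m x) (dms A B n y) \<Longrightarrow> teq A B (m + n - 1) (Wh m n x y) (Wh m n x' y')"
| Hor: "teq A B n x x' \<Longrightarrow> teq A B n y y' \<Longrightarrow> n \<in> {2,3} \<Longrightarrow>
    teq A B 1 (cds A B (n - 1) x) (dms A B (n - 1) y) \<Longrightarrow> teq A B n (Hor n x y) (Hor n x' y')"
| Ver: "teq A B 3 x x' \<Longrightarrow> teq A B 3 y y' \<Longrightarrow> teq A B 2 (cd A B x) (dm A B y) \<Longrightarrow>
    teq A B 3 (Ver x y) (Ver x' y')"
| Ich: "teq A B 2 x x' \<Longrightarrow> teq A B 2 y y' \<Longrightarrow> teq A B 0 (cds A B 2 x) (dms A B 2 y) \<Longrightarrow>
    teq A B 3 (Ich x y) (Ich x' y')"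
| IchI: "teq A B 2 x x' \<Longrightarrow> teq A B 2 y y' \<Longrightarrow> teq A B 0 (cds A B 2 x) (dms A B 2 y) \<Longrightarrow>
    teq A B 3 (IchI x y) (IchI x' y')"
\<comment> \<open>the hom 2-categories\<close>
| Hor_assoc: "teq A B n x x \<Longrightarrow> teq A B n y y \<Longrightarrow> teq A B n z z \<Longrightarrow> n \<in> {2,3} \<Longrightarrow>
    teq A B 1 (cds A B (n - 1) x) (dms A B (n - 1) y) \<Longrightarrow>
    teq A B 1 (cds A B (n - 1) y) (dms A B (n - 1) z) \<Longrightarrow>
    teq A B n (Hor n (Hor n x y) z) (Hor n x (Hor n y z))"
| Hor2_unit_left: "teq A B 2 x x \<Longrightarrow> teq A B 2 (Hor 2 (Idt 1 (dm A B x)) x) x"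
| Hor2_unit_right: "teq A B 2 x x \<Longrightarrow> teq A B 2 (Hor 2 x (Idt 1 (cd A B x))) x"
| Hor3_unit_left: "teq A B 3 x x \<Longrightarrow> teq A B 3 (Hor 3 (Idt 2 (Idt 1 (dms A B 2 x))) x) x"
| Hor3_unit_right: "teq A B 3 x x \<Longrightarrow> teq A B 3 (Hor 3 x (Idt 2 (Idt 1 (cds A B 2 x)))) x"
| Ver_assoc: "teq A B 3 x x \<Longrightarrow> teq A B 3 y y \<Longrightarrow> teq A B 3 z z \<Longrightarrow>
    teq A B 2 (cd A B x) (dm A B y) \<Longrightarrow> teq A B 2 (cd A B y) (dm A B z) \<Longrightarrow>
    teq A B 3 (Ver (Ver x y) z) (Ver x (Ver y z))"
| Ver_unit_left: "teq A B 3 x x \<Longrightarrow> teq A B 3 (Ver (Idt 2 (dm A B x)) x) x"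
| Ver_unit_right: "teq A B 3 x x \<Longrightarrow> teq A B 3 (Ver x (Idt 2 (cd A B x))) x"
| Hor_Idt: "teq A B 2 x x \<Longrightarrow> teq A B 2 y y \<Longrightarrow> teq A B 1 (cd A B x) (dm A B y) \<Longrightarrow>
    teq A B 3 (Hor 3 (Idt 2 x) (Idt 2 y)) (Idt 2 (Hor 2 x y))"
| Hor_Ver: "teq A B 3 x x \<Longrightarrow> teq A B 3 x' x' \<Longrightarrow> teq A B 3 y y \<Longrightarrow> teq A B 3 y' y' \<Longrightarrow>
    teq A B 2 (cd A B x) (dm A B x') \<Longrightarrow> teq A B 2 (cd A B y) (dm A B y') \<Longrightarrow>
    teq A B 1 (cds A B 2 x) (dms A B 2 y) \<Longrightarrow>
    teq A B 3 (Hor 3 (Ver x x') (Ver y y')) (Ver (Hor 3 x y) (Hor 3 x' y'))"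
\<comment> \<open>whiskering with a 1-cell is a 2-functor\<close>
| Wh_Idt_left: "teq A B 1 f f \<Longrightarrow> teq A B n y y \<Longrightarrow> n \<in> {1,2} \<Longrightarrow>
    teq A B 0 (cd A B f) (dms A B n y) \<Longrightarrow>
    teq A B (Suc n) (Wh 1 (Suc n) f (Idt n y)) (Idt n (Wh 1 n f y))"
| Wh_Idt_right: "teq A B 1 f f \<Longrightarrow> teq A B n x x \<Longrightarrow> n \<in> {1,2} \<Longrightarrow>
    teq A B 0 (cds A B n x) (dm A B f) \<Longrightarrow>
    teq A B (Suc n) (Wh (Suc n) 1 (Idt n x) f) (Idt n (Wh n 1 x f))"
| Wh_Hor_left: "teq A B 1 f f \<Longrightarrow> teq A B n y y \<Longrightarrow> teq A B n y' y' \<Longrightarrow> n \<in> {2,3} \<Longrightarrow>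
    teq A B 0 (cd A B f) (dms A B n y) \<Longrightarrow> teq A B 1 (cds A B (n - 1) y) (dms A B (n - 1) y') \<Longrightarrow>
    teq A B n (Wh 1 n f (Hor n y y')) (Hor n (Wh 1 n f y) (Wh 1 n f y'))"
| Wh_Hor_right: "teq A B 1 f f \<Longrightarrow> teq A B n x x \<Longrightarrow> teq A B n x' x' \<Longrightarrow> n \<in> {2,3} \<Longrightarrow>
    teq A B 0 (cds A B n x) (dm A B f) \<Longrightarrow> teq A B 1 (cds A B (n - 1) x) (dms A B (n - 1) x') \<Longrightarrow>
    teq A B n (Wh n 1 (Hor n x x') f) (Hor n (Wh n 1 x f) (Wh n 1 x' f))"
| Wh_Ver_left: "teq A B 1 f f \<Longrightarrow> teq A B 3 y y \<Longrightarrow> teq A B 3 y' y' \<Longrightarrow>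
    teq A B 0 (cd A B f) (dms A B 3 y) \<Longrightarrow> teq A B 2 (cd A B y) (dm A B y') \<Longrightarrow>
    teq A B 3 (Wh 1 3 f (Ver y y')) (Ver (Wh 1 3 f y) (Wh 1 3 f y'))"
| Wh_Ver_right: "teq A B 1 f f \<Longrightarrow> teq A B 3 x x \<Longrightarrow> teq A B 3 x' x' \<Longrightarrow>
    teq A B 0 (cds A B 3 x) (dm A B f) \<Longrightarrow> teq A B 2 (cd A B x) (dm A B x') \<Longrightarrow>
    teq A B 3 (Wh 3 1 (Ver x x') f) (Ver (Wh 3 1 x f) (Wh 3 1 x' f))"
\<comment> \<open>interchange 3-cells\<close>
| Ich_IchI: "teq A B 2 x x \<Longrightarrow> teq A B 2 y y \<Longrightarrow> teq A B 0 (cds A B 2 x) (dms A B 2 y) \<Longrightarrow>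
    teq A B 3 (Ver (Ich x y) (IchI x y)) (Idt 2 (dm A B (Ich x y)))"
| IchI_Ich: "teq A B 2 x x \<Longrightarrow> teq A B 2 y y \<Longrightarrow> teq A B 0 (cds A B 2 x) (dms A B 2 y) \<Longrightarrow>
    teq A B 3 (Ver (IchI x y) (Ich x y)) (Idt 2 (cd A B (Ich x y)))"
| Ich_nat_left: "teq A B 3 x x \<Longrightarrow> teq A B 2 y y \<Longrightarrow> teq A B 0 (cds A B 3 x) (dms A B 2 y) \<Longrightarrow>
    teq A B 3
      (Ver (Hor 3 (Wh 3 1 x (dm A B y)) (Idt 2 (Wh 1 2 (cds A B 2 x) y))) (Ich (cd A B x) y))
      (Ver (Ich (dm A B x) y) (Hor 3 (Idt 2 (Wh 1 2 (dms A B 2 x) y)) (Wh 3 1 x (cd A B y))))"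
| Ich_nat_right: "teq A B 2 x x \<Longrightarrow> teq A B 3 y y \<Longrightarrow> teq A B 0 (cds A B 2 x) (dms A B 3 y) \<Longrightarrow>
    teq A B 3
      (Ver (Hor 3 (Idt 2 (Wh 2 1 x (dms A B 2 y))) (Wh 1 3 (cd A B x) y)) (Ich x (cd A B y)))
      (Ver (Ich x (dm A B y)) (Hor 3 (Wh 1 3 (dm A B x) y) (Idt 2 (Wh 2 1 x (cds A B 2 y)))))"
| Ich_Idt_left: "teq A B 1 f f \<Longrightarrow> teq A B 2 y y \<Longrightarrow> teq A B 0 (cd A B f) (dms A B 2 y) \<Longrightarrow>
    teq A B 3 (Ich (Idt 1 f) y) (Idt 2 (Wh 1 2 f y))"
| Ich_Idt_right: "teq A B 2 x x \<Longrightarrow> teq A B 1 g g \<Longrightarrow> teq A B 0 (cds A B 2 x) (dm A B g) \<Longrightarrow>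
    teq A B 3 (Ich x (Idt 1 g)) (Idt 2 (Wh 2 1 x g))"
| Ich_Hor_left: "teq A B 2 x x \<Longrightarrow> teq A B 2 x' x' \<Longrightarrow> teq A B 2 y y \<Longrightarrow>
    teq A B 1 (cd A B x) (dm A B x') \<Longrightarrow> teq A B 0 (cds A B 2 x) (dms A B 2 y) \<Longrightarrow>
    teq A B 3 (Ich (Hor 2 x x') y)
      (Ver (Hor 3 (Idt 2 (Wh 2 1 x (dm A B y))) (Ich x' y))
           (Hor 3 (Ich x y) (Idt 2 (Wh 2 1 x' (cd A B y)))))"
| Ich_Hor_right: "teq A B 2 x x \<Longrightarrow> teq A B 2 y y \<Longrightarrow> teq A B 2 y' y' \<Longrightarrow>
    teq A B 1 (cd A B y) (dm A B y') \<Longrightarrow> teq A B 0 (cds A B 2 x) (dms A B 2 y) \<Longrightarrow>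
    teq A B 3 (Ich x (Hor 2 y y'))
      (Ver (Hor 3 (Ich x y) (Idt 2 (Wh 1 2 (cd A B x) y')))
           (Hor 3 (Idt 2 (Wh 1 2 (dm A B x) y)) (Ich x y')))"
\<comment> \<open>unit and associativity laws\<close>
| Wh_unit_left: "teq A B n x x \<Longrightarrow> n \<ge> 1 \<Longrightarrow> teq A B n (Wh 1 n (Idt 0 (dms A B n x)) x) x"
| Wh_unit_right: "teq A B n x x \<Longrightarrow> n \<ge> 1 \<Longrightarrow> teq A B n (Wh n 1 x (Idt 0 (cds A B n x))) x"
| Wh_assoc: "teq A B l x x \<Longrightarrow> teq A B m y y \<Longrightarrow> teq A B n z z \<Longrightarrow> l \<ge> 1 \<Longrightarrow> m \<ge> 1 \<Longrightarrow> n \<ge> 1 \<Longrightarrow>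
    l = 1 \<and> m = 1 \<or> l = 1 \<and> n = 1 \<or> m = 1 \<and> n = 1 \<Longrightarrow>
    teq A B 0 (cds A B l x) (dms A B m y) \<Longrightarrow> teq A B 0 (cds A B m y) (dms A B n z) \<Longrightarrow>
    teq A B (l + m + n - 2) (Wh (l + m - 1) n (Wh l m x y) z) (Wh l (m + n - 1) x (Wh m n y z))"
| Ich_Wh_left: "teq A B 1 f f \<Longrightarrow> teq A B 2 x x \<Longrightarrow> teq A B 2 y y \<Longrightarrow>
    teq A B 0 (cd A B f) (dms A B 2 x) \<Longrightarrow> teq A B 0 (cds A B 2 x) (dms A B 2 y) \<Longrightarrow>
    teq A B 3 (Ich (Wh 1 2 f x) y) (Wh 1 3 f (Ich x y))"
| Ich_Wh_mid: "teq A B 2 x x \<Longrightarrow> teq A B 1 f f \<Longrightarrow> teq A B 2 y y \<Longrightarrow>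
    teq A B 0 (cds A B 2 x) (dm A B f) \<Longrightarrow> teq A B 0 (cd A B f) (dms A B 2 y) \<Longrightarrow>
    teq A B 3 (Ich (Wh 2 1 x f) y) (Ich x (Wh 1 2 f y))"
| Ich_Wh_right: "teq A B 2 x x \<Longrightarrow> teq A B 2 y y \<Longrightarrow> teq A B 1 f f \<Longrightarrow>
    teq A B 0 (cds A B 2 x) (dms A B 2 y) \<Longrightarrow> teq A B 0 (cds A B 2 y) (dm A B f) \<Longrightarrow>
    teq A B 3 (Ich x (Wh 2 1 y f)) (Wh 3 1 (Ich x y) f)"
\<comment> \<open>\<open>X \<otimes> -\<close> is a strict functor\<close>
| Gen_right_idt: "X \<in> cell A 0 \<Longrightarrow> y \<in> cell B n \<Longrightarrow> n < 3 \<Longrightarrow>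
    teq A B (Suc n) (Gen 0 (Suc n) X (idt B n y)) (Idt n (Gen 0 n X y))"
| Gen_right_wh: "X \<in> cell A 0 \<Longrightarrow> y \<in> cell B m \<Longrightarrow> y' \<in> cell B n \<Longrightarrow> m \<ge> 1 \<Longrightarrow> n \<ge> 1 \<Longrightarrow> m = 1 \<or> n = 1 \<Longrightarrow>
    tgt0 B m y = src0 B n y' \<Longrightarrow>
    teq A B (m + n - 1) (Gen 0 (m + n - 1) X (wh B m n y y')) (Wh m n (Gen 0 m X y) (Gen 0 n X y'))"
| Gen_right_hor2: "X \<in> cell A 0 \<Longrightarrow> y \<in> cell B 2 \<Longrightarrow> y' \<in> cell B 2 \<Longrightarrow> tgt B 1 y = src B 1 y' \<Longrightarrow>
    teq A B 2 (Gen 0 2 X (hor B 2 y y')) (Hor 2 (Gen 0 2 X y) (Gen 0 2 X y'))"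
| Gen_right_hor3: "X \<in> cell A 0 \<Longrightarrow> y \<in> cell B 3 \<Longrightarrow> y' \<in> cell B 3 \<Longrightarrow>
    tgt B 1 (tgt B 2 y) = src B 1 (src B 2 y') \<Longrightarrow>
    teq A B 3 (Gen 0 3 X (hor B 3 y y')) (Hor 3 (Gen 0 3 X y) (Gen 0 3 X y'))"
| Gen_right_ver: "X \<in> cell A 0 \<Longrightarrow> y \<in> cell B 3 \<Longrightarrow> y' \<in> cell B 3 \<Longrightarrow> tgt B 2 y = src B 2 y' \<Longrightarrow>
    teq A B 3 (Gen 0 3 X (ver B y y')) (Ver (Gen 0 3 X y) (Gen 0 3 X y'))"
| Gen_right_ich: "X \<in> cell A 0 \<Longrightarrow> y \<in> cell B 2 \<Longrightarrow> y' \<in> cell B 2 \<Longrightarrow> tgt0 B 2 y = src0 B 2 y' \<Longrightarrow>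
    teq A B 3 (Gen 0 3 X (ich B y y')) (Ich (Gen 0 2 X y) (Gen 0 2 X y'))"
\<comment> \<open>\<open>- \<otimes> Y\<close> is a strict functor\<close>
| Gen_left_idt: "x \<in> cell A n \<Longrightarrow> Y \<in> cell B 0 \<Longrightarrow> n < 3 \<Longrightarrow>
    teq A B (Suc n) (Gen (Suc n) 0 (idt A n x) Y) (Idt n (Gen n 0 x Y))"
| Gen_left_wh: "x \<in> cell A m \<Longrightarrow> x' \<in> cell A n \<Longrightarrow> Y \<in> cell B 0 \<Longrightarrow> m \<ge> 1 \<Longrightarrow> n \<ge> 1 \<Longrightarrow> m = 1 \<or> n = 1 \<Longrightarrow>
    tgt0 A m x = src0 A n x' \<Longrightarrow>
    teq A B (m + n - 1) (Gen (m + n - 1) 0 (wh A m n x x') Y) (Wh m n (Gen m 0 x Y) (Gen n 0 x' Y))"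
| Gen_left_hor2: "x \<in> cell A 2 \<Longrightarrow> x' \<in> cell A 2 \<Longrightarrow> Y \<in> cell B 0 \<Longrightarrow> tgt A 1 x = src A 1 x' \<Longrightarrow>
    teq A B 2 (Gen 2 0 (hor A 2 x x') Y) (Hor 2 (Gen 2 0 x Y) (Gen 2 0 x' Y))"
| Gen_left_hor3: "x \<in> cell A 3 \<Longrightarrow> x' \<in> cell A 3 \<Longrightarrow> Y \<in> cell B 0 \<Longrightarrow>
    tgt A 1 (tgt A 2 x) = src A 1 (src A 2 x') \<Longrightarrow>
    teq A B 3 (Gen 3 0 (hor A 3 x x') Y) (Hor 3 (Gen 3 0 x Y) (Gen 3 0 x' Y))"
| Gen_left_ver: "x \<in> cell A 3 \<Longrightarrow> x' \<in> cell A 3 \<Longrightarrow> Y \<in> cell B 0 \<Longrightarrow> tgt A 2 x = src A 2 x' \<Longrightarrow>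
    teq A B 3 (Gen 3 0 (ver A x x') Y) (Ver (Gen 3 0 x Y) (Gen 3 0 x' Y))"
| Gen_left_ich: "x \<in> cell A 2 \<Longrightarrow> x' \<in> cell A 2 \<Longrightarrow> Y \<in> cell B 0 \<Longrightarrow> tgt0 A 2 x = src0 A 2 x' \<Longrightarrow>
    teq A B 3 (Gen 3 0 (ich A x x') Y) (Ich (Gen 2 0 x Y) (Gen 2 0 x' Y))"
\<comment> \<open>1-, 2- and 3-cells x of A give strict transformations, strict modifications and perturbations
  \<open>x \<otimes> -\<close>\<close>
| Gen_nat: "x \<in> cell A m \<Longrightarrow> y \<in> cell B n \<Longrightarrow> m \<ge> 1 \<Longrightarrow> n \<ge> 1 \<Longrightarrow> m = 1 \<or> n = 1 \<Longrightarrow>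
    teq A B (m + n - 1)
      (Wh m n (Gen m 0 x (src0 B n y)) (Gen 0 n (tgt0 A m x) y))
      (Wh n m (Gen 0 n (src0 A m x) y) (Gen m 0 x (tgt0 B n y)))"
| Gen_ich: "a \<in> cell A 2 \<Longrightarrow> b \<in> cell B 2 \<Longrightarrow>
    teq A B 3
      (Ich (Gen 2 0 a (src0 B 2 b)) (Gen 0 2 (tgt0 A 2 a) b))
      (IchI (Gen 0 2 (src0 A 2 a) b) (Gen 2 0 a (tgt0 B 2 b)))"

definition cls :: "'a gray \<Rightarrow> 'b gray \<Rightarrow> nat \<Rightarrow> ('a, 'b) trm \<Rightarrow> ('a, 'b) trm set" where
  "cls A B n t = {u. teq A B n t u}"

definition rep :: "('a, 'b) trm set \<Rightarrow> ('a, 'b) trm" where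
  "rep X = (SOME t. t \<in> X)"

definition tensor :: "'a gray \<Rightarrow> 'b gray \<Rightarrow> ('a, 'b) trm set gray" (infixr "\<otimes>\<^sub>G" 70) where
  "A \<otimes>\<^sub>G B = \<lparr>
     cell = (\<lambda>n. {cls A B n t |t. teq A B n t t}),
     src = (\<lambda>n X. cls A B n (dm A B (rep X))),
     tgt = (\<lambda>n X. cls A B n (cd A B (rep X))),
     idt = (\<lambda>n X. cls A B (Suc n) (Idt n (rep X))),
     wh = (\<lambda>m n X Y. cls A B (m + n - 1) (Wh m n (rep X) (rep Y))),
     hor = (\<lambda>n X Y. cls A B n (Hor n (rep X) (rep Y))),
     ver = (\<lambda>X Y. cls A B 3 (Ver (rep X) (rep Y))),
     ich = (\<lambda>X Y. cls A B 3 (Ich (rep X) (rep Y))) \<rparr>"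

text \<open>The universal quasi-functor J.\<close>

definition ten :: "'a gray \<Rightarrow> 'b gray \<Rightarrow> nat \<Rightarrow> nat \<Rightarrow> 'a \<Rightarrow> 'b \<Rightarrow> ('a, 'b) trm set" where
  "ten A B m n x y = cls A B (m + n) (Gen m n x y)"

section \<open>The structure functors\<close>

text \<open>\<open>gray_hom\<close> and \<open>tensor\<close> change the type of cells, and no type is closed under forming function
  types. The category of Gray-categories therefore has objects over all types of cells, and its
  structure functors are polymorphic constants rather than data on one type of objects.\<close>

definition gray_unit :: "unit gray" where
  "gray_unit = \<lparr> cell = (\<lambda>n. if n \<le> 3 then {()} else {}), src = (\<lambda>_ _. ()), tgt = (\<lambda>_ _. ()),
     idt = (\<lambda>_ _. ()), wh = (\<lambda>_ _ _ _. ()), hor = (\<lambda>_ _ _. ()), ver = (\<lambda>_ _. ()), ich = (\<lambda>_ _. ()) \<rparr>"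

text \<open>A strict functor from a tensor product is determined by its values on generators, so the
  structure functors are specified by these values.\<close>

definition tensor_map ::
  "'a gray \<Rightarrow> 'b gray \<Rightarrow> 'c gray \<Rightarrow> 'd gray \<Rightarrow> (nat \<Rightarrow> 'a \<Rightarrow> 'c) \<Rightarrow> (nat \<Rightarrow> 'b \<Rightarrow> 'd) \<Rightarrow>
   nat \<Rightarrow> ('a, 'b) trm set \<Rightarrow> ('c, 'd) trm set" where
  "tensor_map A B A' B' F G = (THE K. strict_gray_functor (A \<otimes>\<^sub>G B) (A' \<otimes>\<^sub>G B') K \<and>
     (\<forall>m n. m = 0 \<or> n = 0 \<longrightarrow> (\<forall>x\<in>cell A m. \<forall>y\<in>cell B n.
        K (m + n) (ten A B m n x y) = ten A' B' m n (F m x) (G n y))))"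

definition assoc ::
  "'a gray \<Rightarrow> 'b gray \<Rightarrow> 'c gray \<Rightarrow> nat \<Rightarrow>
   (('a, 'b) trm set, 'c) trm set \<Rightarrow> ('a, ('b, 'c) trm set) trm set" where
  "assoc A B C = (THE K. strict_gray_functor ((A \<otimes>\<^sub>G B) \<otimes>\<^sub>G C) (A \<otimes>\<^sub>G (B \<otimes>\<^sub>G C)) K \<and>
     (\<forall>l m n. l = 0 \<and> m = 0 \<or> l = 0 \<and> n = 0 \<or> m = 0 \<and> n = 0 \<longrightarrow>
        (\<forall>x\<in>cell A l. \<forall>y\<in>cell B m. \<forall>z\<in>cell C n.
           K (l + m + n) (ten (A \<otimes>\<^sub>G B) C (l + m) n (ten A B l m x y) z) =
           ten A (B \<otimes>\<^sub>G C) l (m + n) x (ten B C m n y z))))"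

definition lunit :: "'a gray \<Rightarrow> nat \<Rightarrow> (unit, 'a) trm set \<Rightarrow> 'a" where
  "lunit A = (THE K. strict_gray_functor (gray_unit \<otimes>\<^sub>G A) A K \<and>
     (\<forall>n. \<forall>x\<in>cell A n. K n (ten gray_unit A 0 n () x) = x))"

definition runit :: "'a gray \<Rightarrow> nat \<Rightarrow> ('a, unit) trm set \<Rightarrow> 'a" where
  "runit A = (THE K. strict_gray_functor (A \<otimes>\<^sub>G gray_unit) A K \<and>
     (\<forall>n. \<forall>x\<in>cell A n. K n (ten A gray_unit n 0 x ()) = x))"

text \<open>The transposes, in either variable, of a strict functor K from a tensor product: those of the
  quasi-functor \<open>K(- \<otimes> -)\<close> and of the one with the two variables exchanged.\<close>

definition curry_right ::
  "'a gray \<Rightarrow> 'b gray \<Rightarrow> (nat \<Rightarrow> ('a, 'b) trm set \<Rightarrow> 'c) \<Rightarrow> nat \<Rightarrow> 'a \<Rightarrow> ('b, 'c) hcell" where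
  "curry_right A B K = transpose A B (\<lambda>m n x y. K (m + n) (ten A B m n x y))"

definition curry_left ::
  "'a gray \<Rightarrow> 'b gray \<Rightarrow> (nat \<Rightarrow> ('b, 'a) trm set \<Rightarrow> 'c) \<Rightarrow> nat \<Rightarrow> 'a \<Rightarrow> ('b, 'c) hcell" where
  "curry_left A B K = transpose A B (\<lambda>m n x y. K (n + m) (ten B A n m y x))"

end

theory Submission
  imports Defs
begin

text \<open>A strict functor out of \<open>A \<otimes> B\<close> is the same thing as a quasi-functor on A and B, because evaluating formal
  cells respects all relations, and a quasi-functor is the same thing as a strict functor from A to the
  inner hom of B, the inner hom being a Gray-category by componentwise calculation. This gives the
  adjunction on the right; the notion of quasi-functor is symmetric in its two variables, which gives
  the adjunction on the left and a symmetry of the tensor product. For the associativity functor one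
  needs a strict functor from \<open>A \<otimes> B\<close> to the inner hom of C and \<open>A \<otimes> (B \<otimes> C)\<close>, hence only a
  quasi-functor on A and B; its inverse is obtained by conjugating an associativity functor with
  symmetries. All coherence equations hold because strict functors out of iterated tensor products
  are determined by their values on generators.\<close>

section \<open>Gray-categories in unpacked form\<close>

text \<open>The axiom for strict modifications relates two interchange 3-cells of opposite
  direction, so it speaks of inverses, which are not an operation of a Gray-category. Formal cells
  therefore carry the constructor \<open>IchI\<close>, evaluation has to choose an inverse, and
  every step involving one rests on \<open>inverse3_unique\<close>. A second obstacle is that a cell
  of the inner hom contains its whole boundary. Since the components of a boundary are the
  boundaries of the components, two cells are equal as soon as their end functors and top families
  agree, and the conditions on a top family have one shape in dimensions 1, 2 and 3
  (\<open>nat_family\<close>). Third, composability of formal cells is itself equality modulo the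
  relations, so well-formedness and equality are derived together, and soundness of evaluation must
  carry control of all boundaries (\<open>good\<close>) through one induction. Finally, building the
  associativity functor from a quasi-functor with values in an inner hom avoids having to compare
  \<open>gray_hom (A \<otimes>\<^sub>G B) C\<close> with
  \<open>gray_hom A (gray_hom B C)\<close>.\<close>

lemma Suc_2_nat [simp]: "Suc 2 = 3"
  by simp

lemma bd_simps [simp]:
  "bd s 1 x = s 0 x" "bd s 2 x = s 0 (s 1 x)" "bd s 3 x = s 0 (s 1 (s 2 x))"
  by (simp_all add: numeral_2_eq_2 numeral_3_eq_3)

lemma iid_simps [simp]:
  "iid i 1 x = i 0 x" "iid i 2 x = i 1 (i 0 x)" "iid i 3 x = i 2 (i 1 (i 0 x))"
  by (simp_all add: numeral_2_eq_2 numeral_3_eq_3)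

text \<open>Dimension one is kept as the numeral \<open>1\<close> instead of \<open>Suc 0\<close>,
  so that all rules at the literal dimensions 1, 2 and 3 share one normal form.\<close>

declare One_nat_def [simp del]
declare One_nat_def [symmetric, simp]

lemma hom2_simps [simp]:
  "tcell (hom2 G X Y) n = {x \<in> cell G (Suc n). src0 G (Suc n) x = X \<and> tgt0 G (Suc n) x = Y}"
  "tsrc (hom2 G X Y) n = src G (Suc n)" "ttgt (hom2 G X Y) n = tgt G (Suc n)"
  "tidt (hom2 G X Y) n = idt G (Suc n)" "thor (hom2 G X Y) n = hor G (Suc n)"
  "tver (hom2 G X Y) = ver G"
  by (simp_all add: hom2_def)

lemma less_3_cases: "(n::nat) < 3 \<Longrightarrow> n = 0 \<or> n = 1 \<or> n = 2"
  by auto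

text \<open>The axioms of a Gray-category, stated for composable cells rather than for the cells of hom
  2-categories; \<open>gray_category_iff\<close> below shows that nothing has changed.\<close>

locale gray_cat =
  fixes G :: "'a gray"
  assumes cell_le: "x \<in> cell G n \<Longrightarrow> n \<le> 3"
    and src_cell: "x \<in> cell G (Suc n) \<Longrightarrow> src G n x \<in> cell G n"
    and tgt_cell: "x \<in> cell G (Suc n) \<Longrightarrow> tgt G n x \<in> cell G n"
    and src_tgt: "x \<in> cell G (Suc (Suc n)) \<Longrightarrow> src G n (tgt G (Suc n) x) = src G n (src G (Suc n) x)"
    and tgt_src: "x \<in> cell G (Suc (Suc n)) \<Longrightarrow> tgt G n (src G (Suc n) x) = tgt G n (tgt G (Suc n) x)"
    and idt_cell: "x \<in> cell G n \<Longrightarrow> n < 3 \<Longrightarrow> idt G n x \<in> cell G (Suc n)"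
    and src_idt: "x \<in> cell G n \<Longrightarrow> n < 3 \<Longrightarrow> src G n (idt G n x) = x"
    and tgt_idt: "x \<in> cell G n \<Longrightarrow> n < 3 \<Longrightarrow> tgt G n (idt G n x) = x"
    and hor2_cell: "\<lbrakk>x \<in> cell G 2; y \<in> cell G 2; tgt G 1 x = src G 1 y\<rbrakk> \<Longrightarrow> hor G 2 x y \<in> cell G 2"
    and src_hor2: "\<lbrakk>x \<in> cell G 2; y \<in> cell G 2; tgt G 1 x = src G 1 y\<rbrakk> \<Longrightarrow>
      src G 1 (hor G 2 x y) = src G 1 x"
    and tgt_hor2: "\<lbrakk>x \<in> cell G 2; y \<in> cell G 2; tgt G 1 x = src G 1 y\<rbrakk> \<Longrightarrow>
      tgt G 1 (hor G 2 x y) = tgt G 1 y"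
    and hor3_cell: "\<lbrakk>x \<in> cell G 3; y \<in> cell G 3; tgt G 1 (tgt G 2 x) = src G 1 (src G 2 y)\<rbrakk> \<Longrightarrow>
      hor G 3 x y \<in> cell G 3"
    and src_hor3: "\<lbrakk>x \<in> cell G 3; y \<in> cell G 3; tgt G 1 (tgt G 2 x) = src G 1 (src G 2 y)\<rbrakk> \<Longrightarrow>
      src G 2 (hor G 3 x y) = hor G 2 (src G 2 x) (src G 2 y)"
    and tgt_hor3: "\<lbrakk>x \<in> cell G 3; y \<in> cell G 3; tgt G 1 (tgt G 2 x) = src G 1 (src G 2 y)\<rbrakk> \<Longrightarrow>
      tgt G 2 (hor G 3 x y) = hor G 2 (tgt G 2 x) (tgt G 2 y)"
    and hor2_assoc: "\<lbrakk>x \<in> cell G 2; y \<in> cell G 2; z \<in> cell G 2; tgt G 1 x = src G 1 y; tgt G 1 y = src G 1 z\<rbrakk> \<Longrightarrow>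
      hor G 2 (hor G 2 x y) z = hor G 2 x (hor G 2 y z)"
    and hor3_assoc: "\<lbrakk>x \<in> cell G 3; y \<in> cell G 3; z \<in> cell G 3; tgt G 1 (tgt G 2 x) = src G 1 (src G 2 y); tgt G 1
        (tgt G 2 y) = src G 1 (src G 2 z)\<rbrakk> \<Longrightarrow>
      hor G 3 (hor G 3 x y) z = hor G 3 x (hor G 3 y z)"
    and hor2_idt_left: "x \<in> cell G 2 \<Longrightarrow> hor G 2 (idt G 1 (src G 1 x)) x = x"
    and hor2_idt_right: "x \<in> cell G 2 \<Longrightarrow> hor G 2 x (idt G 1 (tgt G 1 x)) = x"
    and hor3_idt_left: "x \<in> cell G 3 \<Longrightarrow> hor G 3 (idt G 2 (idt G 1 (src G 1 (src G 2 x)))) x = x"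
    and hor3_idt_right: "x \<in> cell G 3 \<Longrightarrow> hor G 3 x (idt G 2 (idt G 1 (tgt G 1 (tgt G 2 x)))) = x"
    and ver_cell: "\<lbrakk>x \<in> cell G 3; y \<in> cell G 3; tgt G 2 x = src G 2 y\<rbrakk> \<Longrightarrow> ver G x y \<in> cell G 3"
    and src_ver: "\<lbrakk>x \<in> cell G 3; y \<in> cell G 3; tgt G 2 x = src G 2 y\<rbrakk> \<Longrightarrow>
      src G 2 (ver G x y) = src G 2 x"
    and tgt_ver: "\<lbrakk>x \<in> cell G 3; y \<in> cell G 3; tgt G 2 x = src G 2 y\<rbrakk> \<Longrightarrow>
      tgt G 2 (ver G x y) = tgt G 2 y"
    and ver_assoc: "\<lbrakk>x \<in> cell G 3; y \<in> cell G 3; z \<in> cell G 3; tgt G 2 x = src G 2 y; tgt G 2 y = src G 2 z\<rbrakk> \<Longrightarrow> ver G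
        (ver G x y) z = ver G x (ver G y z)"
    and ver_idt_left: "x \<in> cell G 3 \<Longrightarrow> ver G (idt G 2 (src G 2 x)) x = x"
    and ver_idt_right: "x \<in> cell G 3 \<Longrightarrow> ver G x (idt G 2 (tgt G 2 x)) = x"
    and hor_idt: "\<lbrakk>x \<in> cell G 2; y \<in> cell G 2; tgt G 1 x = src G 1 y\<rbrakk> \<Longrightarrow>
      hor G 3 (idt G 2 x) (idt G 2 y) = idt G 2 (hor G 2 x y)"
    and hor_ver: "\<lbrakk>x \<in> cell G 3; x' \<in> cell G 3; y \<in> cell G 3; y' \<in> cell G 3; tgt G 2 x = src G 2 x'; tgt G 2 y = src
        G 2 y'; tgt G 1 (tgt G 2 x) = src G 1 (src G 2 y)\<rbrakk> \<Longrightarrow>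
      hor G 3 (ver G x x') (ver G y y') = ver G (hor G 3 x y) (hor G 3 x' y')"
    and wh_cell: "\<lbrakk>x \<in> cell G m; y \<in> cell G n; m \<ge> 1; n \<ge> 1; m = 1 \<or> n = 1; tgt0 G m x = src0 G n y\<rbrakk> \<Longrightarrow> wh G m n x y
        \<in> cell G (m + n - 1)"
    and src_wh11: "\<lbrakk>x \<in> cell G 1; y \<in> cell G 1; tgt G 0 x = src G 0 y\<rbrakk> \<Longrightarrow>
      src G 0 (wh G 1 1 x y) = src G 0 x"
    and tgt_wh11: "\<lbrakk>x \<in> cell G 1; y \<in> cell G 1; tgt G 0 x = src G 0 y\<rbrakk> \<Longrightarrow>
      tgt G 0 (wh G 1 1 x y) = tgt G 0 y"
    and src_wh_left: "\<lbrakk>x \<in> cell G 1; y \<in> cell G (Suc n); n \<ge> 1; tgt G 0 x = src0 G (Suc n) y\<rbrakk> \<Longrightarrow>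
      src G n (wh G 1 (Suc n) x y) = wh G 1 n x (src G n y)"
    and tgt_wh_left: "\<lbrakk>x \<in> cell G 1; y \<in> cell G (Suc n); n \<ge> 1; tgt G 0 x = src0 G (Suc n) y\<rbrakk> \<Longrightarrow>
      tgt G n (wh G 1 (Suc n) x y) = wh G 1 n x (tgt G n y)"
    and src_wh_right: "\<lbrakk>x \<in> cell G (Suc n); y \<in> cell G 1; n \<ge> 1; tgt0 G (Suc n) x = src G 0 y\<rbrakk> \<Longrightarrow>
      src G n (wh G (Suc n) 1 x y) = wh G n 1 (src G n x) y"
    and tgt_wh_right: "\<lbrakk>x \<in> cell G (Suc n); y \<in> cell G 1; n \<ge> 1; tgt0 G (Suc n) x = src G 0 y\<rbrakk> \<Longrightarrow>
      tgt G n (wh G (Suc n) 1 x y) = wh G n 1 (tgt G n x) y"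
    and wh_idt_left: "\<lbrakk>f \<in> cell G 1; y \<in> cell G n; n \<in> {1,2}; tgt G 0 f = src0 G n y\<rbrakk> \<Longrightarrow>
      wh G 1 (Suc n) f (idt G n y) = idt G n (wh G 1 n f y)"
    and wh_idt_right: "\<lbrakk>x \<in> cell G n; f \<in> cell G 1; n \<in> {1,2}; tgt0 G n x = src G 0 f\<rbrakk> \<Longrightarrow>
      wh G (Suc n) 1 (idt G n x) f = idt G n (wh G n 1 x f)"
    and wh_hor2_left: "\<lbrakk>f \<in> cell G 1; y \<in> cell G 2; y' \<in> cell G 2; tgt G 0 f = src0 G 2 y; tgt G 1 y = src G 1 y'\<rbrakk> \<Longrightarrow>
      wh G 1 2 f (hor G 2 y y') = hor G 2 (wh G 1 2 f y) (wh G 1 2 f y')"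
    and wh_hor2_right: "\<lbrakk>f \<in> cell G 1; x \<in> cell G 2; x' \<in> cell G 2; tgt0 G 2 x = src G 0 f; tgt G 1 x = src G 1 x'\<rbrakk>
        \<Longrightarrow>
      wh G 2 1 (hor G 2 x x') f = hor G 2 (wh G 2 1 x f) (wh G 2 1 x' f)"
    and wh_hor3_left: "\<lbrakk>f \<in> cell G 1; y \<in> cell G 3; y' \<in> cell G 3; tgt G 0 f = src0 G 3 y; tgt G 1 (tgt G 2 y) = src
        G 1 (src G 2 y')\<rbrakk> \<Longrightarrow>
      wh G 1 3 f (hor G 3 y y') = hor G 3 (wh G 1 3 f y) (wh G 1 3 f y')"
    and wh_hor3_right: "\<lbrakk>f \<in> cell G 1; x \<in> cell G 3; x' \<in> cell G 3; tgt0 G 3 x = src G 0 f; tgt G 1 (tgt G 2 x) =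
        src G 1 (src G 2 x')\<rbrakk> \<Longrightarrow>
      wh G 3 1 (hor G 3 x x') f = hor G 3 (wh G 3 1 x f) (wh G 3 1 x' f)"
    and wh_ver_left: "\<lbrakk>f \<in> cell G 1; y \<in> cell G 3; y' \<in> cell G 3; tgt G 0 f = src0 G 3 y; tgt G 2 y = src G 2 y'\<rbrakk> \<Longrightarrow>
      wh G 1 3 f (ver G y y') = ver G (wh G 1 3 f y) (wh G 1 3 f y')"
    and wh_ver_right: "\<lbrakk>f \<in> cell G 1; x \<in> cell G 3; x' \<in> cell G 3; tgt0 G 3 x = src G 0 f; tgt G 2 x = src G 2 x'\<rbrakk> \<Longrightarrow>
      wh G 3 1 (ver G x x') f = ver G (wh G 3 1 x f) (wh G 3 1 x' f)"
    and wh_unit_left: "x \<in> cell G n \<Longrightarrow> n \<ge> 1 \<Longrightarrow> wh G 1 n (idt G 0 (src0 G n x)) x = x"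
    and wh_unit_right: "x \<in> cell G n \<Longrightarrow> n \<ge> 1 \<Longrightarrow> wh G n 1 x (idt G 0 (tgt0 G n x)) = x"
    and wh_assoc: "\<lbrakk>x \<in> cell G l; y \<in> cell G m; z \<in> cell G n; l \<ge> 1; m \<ge> 1; n \<ge> 1; l = 1 \<and> m = 1 \<or> l = 1 \<and> n = 1 \<or> m
        = 1 \<and> n = 1; tgt0 G l x = src0 G m y; tgt0 G m y = src0 G n z\<rbrakk> \<Longrightarrow>
      wh G (l + m - 1) n (wh G l m x y) z = wh G l (m + n - 1) x (wh G m n y z)"
    and ich_cell: "\<lbrakk>x \<in> cell G 2; y \<in> cell G 2; tgt0 G 2 x = src0 G 2 y\<rbrakk> \<Longrightarrow> ich G x y \<in> cell G 3"
    and src_ich: "\<lbrakk>x \<in> cell G 2; y \<in> cell G 2; tgt0 G 2 x = src0 G 2 y\<rbrakk> \<Longrightarrow>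
      src G 2 (ich G x y) = hor G 2 (wh G 2 1 x (src G 1 y)) (wh G 1 2 (tgt G 1 x) y)"
    and tgt_ich: "\<lbrakk>x \<in> cell G 2; y \<in> cell G 2; tgt0 G 2 x = src0 G 2 y\<rbrakk> \<Longrightarrow>
      tgt G 2 (ich G x y) = hor G 2 (wh G 1 2 (src G 1 x) y) (wh G 2 1 x (tgt G 1 y))"
    and ich_inverse: "\<lbrakk>x \<in> cell G 2; y \<in> cell G 2; tgt0 G 2 x = src0 G 2 y\<rbrakk> \<Longrightarrow>
      \<exists>k. k \<in> cell G 3 \<and> src G 2 k = tgt G 2 (ich G x y) \<and> tgt G 2 k = src G 2 (ich G x y) \<and>
        ver G (ich G x y) k = idt G 2 (src G 2 (ich G x y)) \<and>
        ver G k (ich G x y) = idt G 2 (tgt G 2 (ich G x y))"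
    and ich_nat_left: "\<lbrakk>x \<in> cell G 3; y \<in> cell G 2; tgt0 G 3 x = src0 G 2 y\<rbrakk> \<Longrightarrow>
      ver G (hor G 3 (wh G 3 1 x (src G 1 y)) (idt G 2 (wh G 1 2 (tgt G 1 (tgt G 2 x)) y))) (ich G (tgt G 2 x) y) =
      ver G (ich G (src G 2 x) y) (hor G 3 (idt G 2 (wh G 1 2 (src G 1 (src G 2 x)) y)) (wh G 3 1 x (tgt G 1 y)))"
    and ich_nat_right: "\<lbrakk>x \<in> cell G 2; y \<in> cell G 3; tgt0 G 2 x = src0 G 3 y\<rbrakk> \<Longrightarrow>
      ver G (hor G 3 (idt G 2 (wh G 2 1 x (src G 1 (src G 2 y)))) (wh G 1 3 (tgt G 1 x) y)) (ich G x (tgt G 2 y)) =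
      ver G (ich G x (src G 2 y)) (hor G 3 (wh G 1 3 (src G 1 x) y) (idt G 2 (wh G 2 1 x (tgt G 1 (tgt G 2 y)))))"
    and ich_idt_left: "\<lbrakk>f \<in> cell G 1; y \<in> cell G 2; tgt G 0 f = src0 G 2 y\<rbrakk> \<Longrightarrow>
      ich G (idt G 1 f) y = idt G 2 (wh G 1 2 f y)"
    and ich_idt_right: "\<lbrakk>x \<in> cell G 2; g \<in> cell G 1; tgt0 G 2 x = src G 0 g\<rbrakk> \<Longrightarrow>
      ich G x (idt G 1 g) = idt G 2 (wh G 2 1 x g)"
    and ich_hor_left: "\<lbrakk>x \<in> cell G 2; x' \<in> cell G 2; y \<in> cell G 2; tgt G 1 x = src G 1 x'; tgt0 G 2 x = src0 G 2 y\<rbrakk>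
        \<Longrightarrow>
      ich G (hor G 2 x x') y =
      ver G (hor G 3 (idt G 2 (wh G 2 1 x (src G 1 y))) (ich G x' y))
            (hor G 3 (ich G x y) (idt G 2 (wh G 2 1 x' (tgt G 1 y))))"
    and ich_hor_right: "\<lbrakk>x \<in> cell G 2; y \<in> cell G 2; y' \<in> cell G 2; tgt G 1 y = src G 1 y'; tgt0 G 2 x = src0 G 2 y\<rbrakk>
        \<Longrightarrow>
      ich G x (hor G 2 y y') =
      ver G (hor G 3 (ich G x y) (idt G 2 (wh G 1 2 (tgt G 1 x) y')))
            (hor G 3 (idt G 2 (wh G 1 2 (src G 1 x) y)) (ich G x y'))"
    and ich_wh_left: "\<lbrakk>f \<in> cell G 1; x \<in> cell G 2; y \<in> cell G 2; tgt G 0 f = src0 G 2 x; tgt0 G 2 x = src0 G 2 y\<rbrakk> \<Longrightarrow>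
      ich G (wh G 1 2 f x) y = wh G 1 3 f (ich G x y)"
    and ich_wh_mid: "\<lbrakk>x \<in> cell G 2; f \<in> cell G 1; y \<in> cell G 2; tgt0 G 2 x = src G 0 f; tgt G 0 f = src0 G 2 y\<rbrakk> \<Longrightarrow>
      ich G (wh G 2 1 x f) y = ich G x (wh G 1 2 f y)"
    and ich_wh_right: "\<lbrakk>x \<in> cell G 2; y \<in> cell G 2; f \<in> cell G 1; tgt0 G 2 x = src0 G 2 y; tgt0 G 2 y = src G 0 f\<rbrakk> \<Longrightarrow>
      ich G x (wh G 2 1 y f) = wh G 3 1 (ich G x y) f"

section \<open>Consequences of the axioms, and the passage to and from hom 2-categories\<close>

context gray_cat
begin

lemma cell_pos_cases: "x \<in> cell G n \<Longrightarrow> n \<ge> 1 \<Longrightarrow> n = 1 \<or> n = 2 \<or> n = 3"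
  using cell_le[of x n] by auto

lemma boundary_cells [simp]:
  "x \<in> cell G 1 \<Longrightarrow> src G 0 x \<in> cell G 0" "x \<in> cell G 1 \<Longrightarrow> tgt G 0 x \<in> cell G 0"
  "x \<in> cell G 2 \<Longrightarrow> src G 1 x \<in> cell G 1" "x \<in> cell G 2 \<Longrightarrow> tgt G 1 x \<in> cell G 1"
  "x \<in> cell G 3 \<Longrightarrow> src G 2 x \<in> cell G 2" "x \<in> cell G 3 \<Longrightarrow> tgt G 2 x \<in> cell G 2"
  using src_cell[of x 0] tgt_cell[of x 0] src_cell[of x 1] tgt_cell[of x 1]
    src_cell[of x 2] tgt_cell[of x 2] by auto

text \<open>The orientation turns mixed boundaries into iterated sources or iterated targets, the
  form that \<open>bd\<close> unfolds to.\<close>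

lemma globular [simp]:
  "x \<in> cell G 2 \<Longrightarrow> src G 0 (tgt G 1 x) = src G 0 (src G 1 x)"
  "x \<in> cell G 2 \<Longrightarrow> tgt G 0 (src G 1 x) = tgt G 0 (tgt G 1 x)"
  "x \<in> cell G 3 \<Longrightarrow> src G 1 (tgt G 2 x) = src G 1 (src G 2 x)"
  "x \<in> cell G 3 \<Longrightarrow> tgt G 1 (src G 2 x) = tgt G 1 (tgt G 2 x)"
  using src_tgt[of x 0] tgt_src[of x 0] src_tgt[of x 1] tgt_src[of x 1] by auto

lemma globular_03 [simp]:
  "x \<in> cell G 3 \<Longrightarrow> src G 0 (tgt G 1 (tgt G 2 x)) = src G 0 (src G 1 (src G 2 x))"
  "x \<in> cell G 3 \<Longrightarrow> tgt G 0 (src G 1 (src G 2 x)) = tgt G 0 (tgt G 1 (tgt G 2 x))"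
  by (simp_all del: globular add: globular(1,2)[of "tgt G 2 x"] globular(1,2)[of "src G 2 x"] globular(3,4)[of x])

lemma idt_simps [simp]:
  "x \<in> cell G 0 \<Longrightarrow> idt G 0 x \<in> cell G 1" "x \<in> cell G 1 \<Longrightarrow> idt G 1 x \<in> cell G 2"
  "x \<in> cell G 2 \<Longrightarrow> idt G 2 x \<in> cell G 3"
  "x \<in> cell G 0 \<Longrightarrow> src G 0 (idt G 0 x) = x" "x \<in> cell G 0 \<Longrightarrow> tgt G 0 (idt G 0 x) = x"
  "x \<in> cell G 1 \<Longrightarrow> src G 1 (idt G 1 x) = x" "x \<in> cell G 1 \<Longrightarrow> tgt G 1 (idt G 1 x) = x"
  "x \<in> cell G 2 \<Longrightarrow> src G 2 (idt G 2 x) = x" "x \<in> cell G 2 \<Longrightarrow> tgt G 2 (idt G 2 x) = x"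
  using idt_cell[of x 0] idt_cell[of x 1] idt_cell[of x 2] src_idt[of x 0] src_idt[of x 1] src_idt[of x 2]
    tgt_idt[of x 0] tgt_idt[of x 1] tgt_idt[of x 2] by auto

lemmas hor_simps [simp] = hor2_cell src_hor2 tgt_hor2 hor3_cell src_hor3 tgt_hor3 ver_cell src_ver tgt_ver

lemma wh_simps [simp]:
  "\<lbrakk>x \<in> cell G 1; y \<in> cell G 1; tgt G 0 x = src G 0 y\<rbrakk> \<Longrightarrow> wh G 1 1 x y \<in> cell G 1"
  "\<lbrakk>x \<in> cell G 1; y \<in> cell G 2; tgt G 0 x = src G 0 (src G 1 y)\<rbrakk> \<Longrightarrow> wh G 1 2 x y \<in> cell G 2"
  "\<lbrakk>x \<in> cell G 1; y \<in> cell G 3; tgt G 0 x = src G 0 (src G 1 (src G 2 y))\<rbrakk> \<Longrightarrow> wh G 1 3 x y \<in> cell G 3"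
  "\<lbrakk>x \<in> cell G 2; y \<in> cell G 1; tgt G 0 (tgt G 1 x) = src G 0 y\<rbrakk> \<Longrightarrow> wh G 2 1 x y \<in> cell G 2"
  "\<lbrakk>x \<in> cell G 3; y \<in> cell G 1; tgt G 0 (tgt G 1 (tgt G 2 x)) = src G 0 y\<rbrakk> \<Longrightarrow> wh G 3 1 x y \<in> cell G 3"
  using wh_cell[of x 1 y 1] wh_cell[of x 1 y 2] wh_cell[of x 1 y 3] wh_cell[of x 2 y 1] wh_cell[of x 3 y 1]
  by auto

lemma src_wh_simps [simp]:
  "\<lbrakk>x \<in> cell G 1; y \<in> cell G 1; tgt G 0 x = src G 0 y\<rbrakk> \<Longrightarrow> src G 0 (wh G 1 1 x y) = src G 0 x"
  "\<lbrakk>x \<in> cell G 1; y \<in> cell G 2; tgt G 0 x = src G 0 (src G 1 y)\<rbrakk> \<Longrightarrow>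
    src G 1 (wh G 1 2 x y) = wh G 1 1 x (src G 1 y)"
  "\<lbrakk>x \<in> cell G 1; y \<in> cell G 3; tgt G 0 x = src G 0 (src G 1 (src G 2 y))\<rbrakk> \<Longrightarrow>
    src G 2 (wh G 1 3 x y) = wh G 1 2 x (src G 2 y)"
  "\<lbrakk>x \<in> cell G 2; y \<in> cell G 1; tgt G 0 (tgt G 1 x) = src G 0 y\<rbrakk> \<Longrightarrow>
    src G 1 (wh G 2 1 x y) = wh G 1 1 (src G 1 x) y"
  "\<lbrakk>x \<in> cell G 3; y \<in> cell G 1; tgt G 0 (tgt G 1 (tgt G 2 x)) = src G 0 y\<rbrakk> \<Longrightarrow>
    src G 2 (wh G 3 1 x y) = wh G 2 1 (src G 2 x) y"
  using src_wh11[of x y] src_wh_left[of x y 1] src_wh_left[of x y 2] src_wh_right[of x 1 y]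
    src_wh_right[of x 2 y] by auto

lemma tgt_wh_simps [simp]:
  "\<lbrakk>x \<in> cell G 1; y \<in> cell G 1; tgt G 0 x = src G 0 y\<rbrakk> \<Longrightarrow> tgt G 0 (wh G 1 1 x y) = tgt G 0 y"
  "\<lbrakk>x \<in> cell G 1; y \<in> cell G 2; tgt G 0 x = src G 0 (src G 1 y)\<rbrakk> \<Longrightarrow>
    tgt G 1 (wh G 1 2 x y) = wh G 1 1 x (tgt G 1 y)"
  "\<lbrakk>x \<in> cell G 1; y \<in> cell G 3; tgt G 0 x = src G 0 (src G 1 (src G 2 y))\<rbrakk> \<Longrightarrow>
    tgt G 2 (wh G 1 3 x y) = wh G 1 2 x (tgt G 2 y)"
  "\<lbrakk>x \<in> cell G 2; y \<in> cell G 1; tgt G 0 (tgt G 1 x) = src G 0 y\<rbrakk> \<Longrightarrow>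
    tgt G 1 (wh G 2 1 x y) = wh G 1 1 (tgt G 1 x) y"
  "\<lbrakk>x \<in> cell G 3; y \<in> cell G 1; tgt G 0 (tgt G 1 (tgt G 2 x)) = src G 0 y\<rbrakk> \<Longrightarrow>
    tgt G 2 (wh G 3 1 x y) = wh G 2 1 (tgt G 2 x) y"
  using tgt_wh11[of x y] tgt_wh_left[of x y 1] tgt_wh_left[of x y 2] tgt_wh_right[of x 1 y]
    tgt_wh_right[of x 2 y] by auto

lemma wh_idt_simps [simp]:
  "\<lbrakk>f \<in> cell G 1; y \<in> cell G 1; tgt G 0 f = src G 0 y\<rbrakk> \<Longrightarrow> wh G 1 2 f (idt G 1 y) = idt G 1 (wh G 1 1 f y)"
  "\<lbrakk>f \<in> cell G 1; y \<in> cell G 2; tgt G 0 f = src G 0 (src G 1 y)\<rbrakk> \<Longrightarrow>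
    wh G 1 3 f (idt G 2 y) = idt G 2 (wh G 1 2 f y)"
  "\<lbrakk>f \<in> cell G 1; y \<in> cell G 1; tgt G 0 y = src G 0 f\<rbrakk> \<Longrightarrow> wh G 2 1 (idt G 1 y) f = idt G 1 (wh G 1 1 y f)"
  "\<lbrakk>f \<in> cell G 1; y \<in> cell G 2; tgt G 0 (tgt G 1 y) = src G 0 f\<rbrakk> \<Longrightarrow>
    wh G 3 1 (idt G 2 y) f = idt G 2 (wh G 2 1 y f)"
  using wh_idt_left[of f y 1] wh_idt_left[of f y 2] wh_idt_right[of y 1 f] wh_idt_right[of y 2 f] by auto

lemma wh_unit_simps [simp]:
  "x \<in> cell G 1 \<Longrightarrow> wh G 1 1 (idt G 0 (src G 0 x)) x = x"
  "x \<in> cell G 2 \<Longrightarrow> wh G 1 2 (idt G 0 (src G 0 (src G 1 x))) x = x"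
  "x \<in> cell G 3 \<Longrightarrow> wh G 1 3 (idt G 0 (src G 0 (src G 1 (src G 2 x)))) x = x"
  "x \<in> cell G 1 \<Longrightarrow> wh G 1 1 x (idt G 0 (tgt G 0 x)) = x"
  "x \<in> cell G 2 \<Longrightarrow> wh G 2 1 x (idt G 0 (tgt G 0 (tgt G 1 x))) = x"
  "x \<in> cell G 3 \<Longrightarrow> wh G 3 1 x (idt G 0 (tgt G 0 (tgt G 1 (tgt G 2 x)))) = x"
  using wh_unit_left[of x 1] wh_unit_left[of x 2] wh_unit_left[of x 3]
    wh_unit_right[of x 1] wh_unit_right[of x 2] wh_unit_right[of x 3] by auto

text \<open>The side condition of \<open>wh_assoc\<close> lets at most one of the three dimensions
  exceed 1, which leaves these seven triples. Literal dimensions remove the subtractions that would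
  obstruct rewriting.\<close>

lemma wh_assoc_simps:
  "\<lbrakk>x \<in> cell G 1; y \<in> cell G 1; z \<in> cell G 1; tgt G 0 x = src G 0 y; tgt G 0 y = src G 0 z\<rbrakk> \<Longrightarrow>
    wh G 1 1 (wh G 1 1 x y) z = wh G 1 1 x (wh G 1 1 y z)"
  "\<lbrakk>x \<in> cell G 2; y \<in> cell G 1; z \<in> cell G 1; tgt0 G 2 x = src G 0 y; tgt G 0 y = src G 0 z\<rbrakk> \<Longrightarrow>
    wh G 2 1 (wh G 2 1 x y) z = wh G 2 1 x (wh G 1 1 y z)"
  "\<lbrakk>x \<in> cell G 1; y \<in> cell G 2; z \<in> cell G 1; tgt G 0 x = src0 G 2 y; tgt0 G 2 y = src G 0 z\<rbrakk> \<Longrightarrow>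
    wh G 2 1 (wh G 1 2 x y) z = wh G 1 2 x (wh G 2 1 y z)"
  "\<lbrakk>x \<in> cell G 1; y \<in> cell G 1; z \<in> cell G 2; tgt G 0 x = src G 0 y; tgt G 0 y = src0 G 2 z\<rbrakk> \<Longrightarrow>
    wh G 1 2 (wh G 1 1 x y) z = wh G 1 2 x (wh G 1 2 y z)"
  "\<lbrakk>x \<in> cell G 3; y \<in> cell G 1; z \<in> cell G 1; tgt0 G 3 x = src G 0 y; tgt G 0 y = src G 0 z\<rbrakk> \<Longrightarrow>
    wh G 3 1 (wh G 3 1 x y) z = wh G 3 1 x (wh G 1 1 y z)"
  "\<lbrakk>x \<in> cell G 1; y \<in> cell G 3; z \<in> cell G 1; tgt G 0 x = src0 G 3 y; tgt0 G 3 y = src G 0 z\<rbrakk> \<Longrightarrow>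
    wh G 3 1 (wh G 1 3 x y) z = wh G 1 3 x (wh G 3 1 y z)"
  "\<lbrakk>x \<in> cell G 1; y \<in> cell G 1; z \<in> cell G 3; tgt G 0 x = src G 0 y; tgt G 0 y = src0 G 3 z\<rbrakk> \<Longrightarrow>
    wh G 1 3 (wh G 1 1 x y) z = wh G 1 3 x (wh G 1 3 y z)"
  using wh_assoc[of x 1 y 1 z 1] wh_assoc[of x 2 y 1 z 1] wh_assoc[of x 1 y 2 z 1] wh_assoc[of x 1 y 1 z 2]
    wh_assoc[of x 3 y 1 z 1] wh_assoc[of x 1 y 3 z 1] wh_assoc[of x 1 y 1 z 3]
  by simp_all

lemma ich_simps [simp]:
  "\<lbrakk>x \<in> cell G 2; y \<in> cell G 2; tgt G 0 (tgt G 1 x) = src G 0 (src G 1 y)\<rbrakk> \<Longrightarrow> ich G x y \<in> cell G 3"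
  "\<lbrakk>x \<in> cell G 2; y \<in> cell G 2; tgt G 0 (tgt G 1 x) = src G 0 (src G 1 y)\<rbrakk> \<Longrightarrow>
      src G 2 (ich G x y) = hor G 2 (wh G 2 1 x (src G 1 y)) (wh G 1 2 (tgt G 1 x) y)"
  "\<lbrakk>x \<in> cell G 2; y \<in> cell G 2; tgt G 0 (tgt G 1 x) = src G 0 (src G 1 y)\<rbrakk> \<Longrightarrow>
      tgt G 2 (ich G x y) = hor G 2 (wh G 1 2 (src G 1 x) y) (wh G 2 1 x (tgt G 1 y))"
  by (simp_all add: ich_cell src_ich tgt_ich)

text \<open>For \<open>n = 0\<close> the left side would be the target 0-cell itself, whence
  \<open>n \<ge> 1\<close>.\<close>

lemma src0_tgt: "x \<in> cell G (Suc n) \<Longrightarrow> n \<ge> 1 \<Longrightarrow> src0 G n (tgt G n x) = src0 G (Suc n) x"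
  by (cases n) (simp_all add: src_tgt)

lemma tgt0_src: "x \<in> cell G (Suc n) \<Longrightarrow> n \<ge> 1 \<Longrightarrow> tgt0 G n (src G n x) = tgt0 G (Suc n) x"
  by (cases n) (simp_all add: tgt_src)

lemma src0_cell: "x \<in> cell G n \<Longrightarrow> src0 G n x \<in> cell G 0"
  by (induction n arbitrary: x) (simp_all add: src_cell)

lemma tgt0_cell: "x \<in> cell G n \<Longrightarrow> tgt0 G n x \<in> cell G 0"
  by (induction n arbitrary: x) (simp_all add: tgt_cell)

lemma src0_wh:
  assumes "x \<in> cell G m" "y \<in> cell G n" "m \<ge> 1" "n \<ge> 1" "m = 1 \<or> n = 1" "tgt0 G m x = src0 G n y"
  shows "src0 G (m + n - 1) (wh G m n x y) = src0 G m x"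
  using assms cell_pos_cases[of x m] cell_pos_cases[of y n] by auto

lemma tgt0_wh:
  assumes "x \<in> cell G m" "y \<in> cell G n" "m \<ge> 1" "n \<ge> 1" "m = 1 \<or> n = 1" "tgt0 G m x = src0 G n y"
  shows "tgt0 G (m + n - 1) (wh G m n x y) = tgt0 G n y"
  using assms cell_pos_cases[of x m] cell_pos_cases[of y n] by auto

lemma wh_left_cell:
  assumes "x \<in> cell G 1" "y \<in> cell G (Suc n)" "tgt G 0 x = src0 G (Suc n) y"
  shows "wh G 1 (Suc n) x y \<in> cell G (Suc n)" "src0 G (Suc n) (wh G 1 (Suc n) x y) = src G 0 x"
    "tgt0 G (Suc n) (wh G 1 (Suc n) x y) = tgt0 G (Suc n) y"
proof -
  have *: "1 + Suc n - 1 = Suc n" by simp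
  show "wh G 1 (Suc n) x y \<in> cell G (Suc n)" "src0 G (Suc n) (wh G 1 (Suc n) x y) = src G 0 x"
    "tgt0 G (Suc n) (wh G 1 (Suc n) x y) = tgt0 G (Suc n) y"
    using wh_cell[of x 1 y "Suc n", unfolded *] src0_wh[of x 1 y "Suc n", unfolded *]
      tgt0_wh[of x 1 y "Suc n", unfolded *] assms by (simp_all del: bd.simps)
qed

lemma wh_right_cell:
  assumes "x \<in> cell G (Suc n)" "y \<in> cell G 1" "tgt0 G (Suc n) x = src G 0 y"
  shows "wh G (Suc n) 1 x y \<in> cell G (Suc n)" "src0 G (Suc n) (wh G (Suc n) 1 x y) = src0 G (Suc n) x"
    "tgt0 G (Suc n) (wh G (Suc n) 1 x y) = tgt G 0 y"
proof -
  have *: "Suc n + 1 - 1 = Suc n" by simp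
  show "wh G (Suc n) 1 x y \<in> cell G (Suc n)" "src0 G (Suc n) (wh G (Suc n) 1 x y) = src0 G (Suc n) x"
    "tgt0 G (Suc n) (wh G (Suc n) 1 x y) = tgt G 0 y"
    using wh_cell[of x "Suc n" y 1, unfolded *] src0_wh[of x "Suc n" y 1, unfolded *]
      tgt0_wh[of x "Suc n" y 1, unfolded *] assms by (simp_all del: bd.simps)
qed

text \<open>Composability along a 1-cell is an equation of 1-cells, while whiskering and interchange
  ask for equal 0-cells. This lemma and its analogues \<open>comp3\<close> and \<open>vcomp3\<close>
  pass from the former to the latter and are instantiated wherever a composite gets
  whiskered.\<close>

lemma comp2: "\<lbrakk>x \<in> cell G 2; y \<in> cell G 2; tgt G 1 x = src G 1 y\<rbrakk> \<Longrightarrow>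
    src G 0 (src G 1 y) = src G 0 (src G 1 x) \<and> tgt G 0 (tgt G 1 x) = tgt G 0 (tgt G 1 y)"
  by (metis globular(1,2))

lemma comp3: "\<lbrakk>x \<in> cell G 3; y \<in> cell G 3; tgt G 1 (tgt G 2 x) = src G 1 (src G 2 y)\<rbrakk> \<Longrightarrow>
    src G 0 (src G 1 (src G 2 y)) = src G 0 (src G 1 (src G 2 x)) \<and>
    tgt G 0 (tgt G 1 (tgt G 2 x)) = tgt G 0 (tgt G 1 (tgt G 2 y))"
  by (metis globular_03)

lemma vcomp3: "\<lbrakk>x \<in> cell G 3; y \<in> cell G 3; tgt G 2 x = src G 2 y\<rbrakk> \<Longrightarrow>
    src G 1 (src G 2 y) = src G 1 (src G 2 x) \<and> tgt G 1 (tgt G 2 x) = tgt G 1 (tgt G 2 y) \<and>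
    src G 0 (src G 1 (src G 2 y)) = src G 0 (src G 1 (src G 2 x)) \<and>
    tgt G 0 (tgt G 1 (tgt G 2 x)) = tgt G 0 (tgt G 1 (tgt G 2 y))"
  by (metis globular(3,4))

text \<open>An n-cell of a hom 2-category is an (n+1)-cell of \<open>G\<close> with prescribed ends.
  Once this shift of dimension is made, each clause of the enriched definition is an unpacked axiom
  restricted to fixed ends.\<close>

lemma gray_category: "gray_category G"
proof -
  have two: "two_category (hom2 G X Y)" if "X \<in> cell G 0" "Y \<in> cell G 0" for X Y
  proof -
    have *: "x \<in> cell G (Suc n) \<Longrightarrow> n = 0 \<or> n = 1 \<or> n = 2" for n x
      using cell_le[of x "Suc n"] by auto
    show ?thesis
      unfolding two_category_def
      apply (intro conjI)
      subgoal by (auto dest: *)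
      subgoal by (auto simp: src_cell tgt_cell src_tgt tgt_src)
      subgoal by auto
      subgoal by (auto simp: less_2_cases_iff)
      subgoal by auto
      subgoal by auto
      subgoal by auto
      subgoal by (auto simp: hor2_assoc hor3_assoc)
      subgoal by (auto simp: hor2_idt_left hor2_idt_right hor3_idt_left hor3_idt_right)
      subgoal by auto
      subgoal by (auto simp: ver_assoc)
      subgoal by (auto simp: ver_idt_left ver_idt_right)
      subgoal by (auto simp: hor_idt)
      subgoal
        apply (intro ballI impI)
        subgoal for x x' y y' using hor_ver[of x x' y y'] vcomp3[of x x'] vcomp3[of y y'] by (simp, elim conjE,
            simp)
        done
      done
  qed
  show ?thesis
    unfolding gray_category_def
    apply (intro conjI)
    subgoal using cell_le by force
    subgoal using src_cell tgt_cell by blast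
    subgoal using two by blast
    subgoal by (simp add: hom2_def)
    subgoal
      apply (intro ballI)
      subgoal for X Y Z
      unfolding cubical_functor_def two_functor_def tinverse_def
      apply (intro conjI)
      subgoal
        apply (intro ballI conjI)
        subgoal for a using wh_left_cell[of a] by simp
        subgoal for a using src_wh_left[of a _ "Suc _"] tgt_wh_left[of a _ "Suc _"] by auto
        subgoal by (auto simp: less_2_cases_iff)
        subgoal for c n y y' using comp2[of y y'] comp3[of y y']
          by (cases "n = 1") (simp_all add: wh_hor2_left wh_hor3_left)
        subgoal for c y y' using vcomp3[of y y'] by (simp add: wh_ver_left)
        done
      subgoal
        apply (intro ballI conjI)
        subgoal for b using wh_right_cell[of _ _ b] by simp
        subgoal for b using src_wh_right[of _ "Suc _" b] tgt_wh_right[of _ "Suc _" b] by auto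
        subgoal by (auto simp: less_2_cases_iff)
        subgoal for c n y y' using comp2[of y y'] comp3[of y y']
          by (cases "n = 1") (simp_all add: wh_hor2_right wh_hor3_right)
        subgoal for c y y' using vcomp3[of y y'] by (simp add: wh_ver_right)
        done
      subgoal 
       apply (intro ballI conjI)
       subgoal by simp
       subgoal by simp
       subgoal by simp
       subgoal for p q using ich_inverse[of p q] by auto
       done
      subgoal by (simp add: ich_nat_left)
      subgoal by (simp add: ich_nat_right)
      subgoal by (simp add: ich_idt_left)
      subgoal by (simp add: ich_idt_right)
      subgoal
        apply (intro ballI impI)
        subgoal for x x' y using comp2[of x x'] by (simp add: ich_hor_left)
        done
      subgoal
        apply (intro ballI impI)
        subgoal for x y y' using comp2[of y y'] by (simp add: ich_hor_right)
        done
      done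
    done
    subgoal using wh_unit_left wh_unit_right by simp
    subgoal using wh_assoc by blast
    subgoal by (simp add: ich_wh_left)
    subgoal by (simp add: ich_wh_mid)
    subgoal by (simp add: ich_wh_right)
    done
qed

end

lemma two_categoryD:
  assumes "two_category T"
  shows "n > 2 \<Longrightarrow> tcell T n = {}"
    "x \<in> tcell T (Suc n) \<Longrightarrow> tsrc T n x \<in> tcell T n"
    "x \<in> tcell T (Suc n) \<Longrightarrow> ttgt T n x \<in> tcell T n"
    "x \<in> tcell T 2 \<Longrightarrow> tsrc T 0 (ttgt T 1 x) = tsrc T 0 (tsrc T 1 x)"
    "x \<in> tcell T 2 \<Longrightarrow> ttgt T 0 (tsrc T 1 x) = ttgt T 0 (ttgt T 1 x)"
    "n < 2 \<Longrightarrow> x \<in> tcell T n \<Longrightarrow> tidt T n x \<in> tcell T (Suc n)"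
    "n < 2 \<Longrightarrow> x \<in> tcell T n \<Longrightarrow> tsrc T n (tidt T n x) = x"
    "n < 2 \<Longrightarrow> x \<in> tcell T n \<Longrightarrow> ttgt T n (tidt T n x) = x"
    "\<lbrakk>x \<in> tcell T 1; y \<in> tcell T 1; ttgt T 0 x = tsrc T 0 y\<rbrakk> \<Longrightarrow> thor T 1 x y \<in> tcell T 1"
    "\<lbrakk>x \<in> tcell T 2; y \<in> tcell T 2; ttgt T 0 (ttgt T 1 x) = tsrc T 0 (tsrc T 1 y)\<rbrakk> \<Longrightarrow> thor T 2 x y \<in> tcell T 2"
    "\<lbrakk>x \<in> tcell T 1; y \<in> tcell T 1; ttgt T 0 x = tsrc T 0 y\<rbrakk> \<Longrightarrow>
       tsrc T 0 (thor T 1 x y) = tsrc T 0 x \<and> ttgt T 0 (thor T 1 x y) = ttgt T 0 y"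
    "\<lbrakk>x \<in> tcell T 2; y \<in> tcell T 2; ttgt T 0 (ttgt T 1 x) = tsrc T 0 (tsrc T 1 y)\<rbrakk> \<Longrightarrow>
       tsrc T 1 (thor T 2 x y) = thor T 1 (tsrc T 1 x) (tsrc T 1 y) \<and>
       ttgt T 1 (thor T 2 x y) = thor T 1 (ttgt T 1 x) (ttgt T 1 y)"
    "\<lbrakk>x \<in> tcell T 1; y \<in> tcell T 1; z \<in> tcell T 1; ttgt T 0 x = tsrc T 0 y; ttgt T 0 y = tsrc T 0 z\<rbrakk> \<Longrightarrow> thor T 1
        (thor T 1 x y) z = thor T 1 x (thor T 1 y z)"
    "\<lbrakk>x \<in> tcell T 2; y \<in> tcell T 2; z \<in> tcell T 2; ttgt T 0 (ttgt T 1 x) = tsrc T 0 (tsrc T 1 y); ttgt T 0 (ttgt T 1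
        y) = tsrc T 0 (tsrc T 1 z)\<rbrakk> \<Longrightarrow>
       thor T 2 (thor T 2 x y) z = thor T 2 x (thor T 2 y z)"
    "x \<in> tcell T 1 \<Longrightarrow> thor T 1 (tidt T 0 (tsrc T 0 x)) x = x \<and> thor T 1 x (tidt T 0 (ttgt T 0 x)) = x"
    "\<lbrakk>x \<in> tcell T 2; y \<in> tcell T 2; ttgt T 1 x = tsrc T 1 y\<rbrakk> \<Longrightarrow>
       tver T x y \<in> tcell T 2 \<and> tsrc T 1 (tver T x y) = tsrc T 1 x \<and> ttgt T 1 (tver T x y) = ttgt T 1 y"
    "\<lbrakk>x \<in> tcell T 2; y \<in> tcell T 2; z \<in> tcell T 2; ttgt T 1 x = tsrc T 1 y; ttgt T 1 y = tsrc T 1 z\<rbrakk> \<Longrightarrow> tver T (tver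
        T x y) z = tver T x (tver T y z)"
    "x \<in> tcell T 2 \<Longrightarrow> tver T (tidt T 1 (tsrc T 1 x)) x = x \<and> tver T x (tidt T 1 (ttgt T 1 x)) = x"
    "\<lbrakk>x \<in> tcell T 1; y \<in> tcell T 1; ttgt T 0 x = tsrc T 0 y\<rbrakk> \<Longrightarrow>
       thor T 2 (tidt T 1 x) (tidt T 1 y) = tidt T 1 (thor T 1 x y)"
    "\<lbrakk>x \<in> tcell T 2; x' \<in> tcell T 2; y \<in> tcell T 2; y' \<in> tcell T 2; ttgt T 1 x = tsrc T 1 x'; ttgt T 1 y = tsrc T 1
        y'; ttgt T 0 (ttgt T 1 x) = tsrc T 0 (tsrc T 1 y)\<rbrakk> \<Longrightarrow>
       thor T 2 (tver T x x') (tver T y y') = tver T (thor T 2 x y) (thor T 2 x' y')"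
  using assms unfolding two_category_def by simp_all

lemma two_category_hor_unit:
  assumes "two_category T" "x \<in> tcell T 2"
  shows "thor T 2 (tidt T 1 (tidt T 0 (tsrc T 0 (tsrc T 1 x)))) x = x \<and>
    thor T 2 x (tidt T 1 (tidt T 0 (ttgt T 0 (ttgt T 1 x)))) = x"
proof -
  have "\<forall>n\<in>{1,2}. \<forall>x\<in>tcell T n. thor T n (iid (tidt T) n (bd (tsrc T) n x)) x = x \<and>
       thor T n x (iid (tidt T) n (bd (ttgt T) n x)) = x"
    using assms(1) unfolding two_category_def by (elim conjE)
  then show ?thesis using assms(2) by simp
qed

lemma two_functorD:
  assumes "two_functor S T F"
  shows "x \<in> tcell S n \<Longrightarrow> F n x \<in> tcell T n"
    "x \<in> tcell S (Suc n) \<Longrightarrow> tsrc T n (F (Suc n) x) = F n (tsrc S n x)"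
    "x \<in> tcell S (Suc n) \<Longrightarrow> ttgt T n (F (Suc n) x) = F n (ttgt S n x)"
    "n < 2 \<Longrightarrow> x \<in> tcell S n \<Longrightarrow> F (Suc n) (tidt S n x) = tidt T n (F n x)"
    "\<lbrakk>x \<in> tcell S 1; y \<in> tcell S 1; ttgt S 0 x = tsrc S 0 y\<rbrakk> \<Longrightarrow> F 1 (thor S 1 x y) = thor T 1 (F 1 x) (F 1 y)"
    "\<lbrakk>x \<in> tcell S 2; y \<in> tcell S 2; ttgt S 0 (ttgt S 1 x) = tsrc S 0 (tsrc S 1 y)\<rbrakk> \<Longrightarrow>
       F 2 (thor S 2 x y) = thor T 2 (F 2 x) (F 2 y)"
    "\<lbrakk>x \<in> tcell S 2; y \<in> tcell S 2; ttgt S 1 x = tsrc S 1 y\<rbrakk> \<Longrightarrow> F 2 (tver S x y) = tver T (F 2 x) (F 2 y)"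
  using assms unfolding two_functor_def by simp_all

text \<open>Conversely, each unpacked axiom is read off in the hom 2-category, or in the cubical
  functor, at the end 0-cells of the cells it speaks of. Those ends are 0-cells by iterating the
  boundary axiom (\<open>s0\<close>, \<open>t0\<close>).\<close>

lemma gray_catI:
  assumes "gray_category G"
  shows "gray_cat G"
proof -
  note A = assms[unfolded gray_category_def]
  note A2 = A[THEN conjunct2] note A3 = A2[THEN conjunct2] note A4 = A3[THEN conjunct2]
  note A5 = A4[THEN conjunct2] note A6 = A5[THEN conjunct2] note A7 = A6[THEN conjunct2]
  note A8 = A7[THEN conjunct2] note A9 = A8[THEN conjunct2] note A10 = A9[THEN conjunct2]
  have le: "n \<le> 3" if "x \<in> cell G n" for x n
    using A[THEN conjunct1] that by (metis empty_iff not_le)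
  have bnd: "src G n x \<in> cell G n" "tgt G n x \<in> cell G n" if "x \<in> cell G (Suc n)" for x n
    using A2[THEN conjunct1] that by blast+
  have two: "two_category (hom2 G X Y)" if "X \<in> cell G 0" "Y \<in> cell G 0" for X Y
    using A3[THEN conjunct1] that by blast
  have id0: "idt G 0 X \<in> cell G 1" "src G 0 (idt G 0 X) = X" "tgt G 0 (idt G 0 X) = X" if "X \<in> cell G 0" for X
    using A4[THEN conjunct1] that by auto
  have cub: "cubical_functor (hom2 G X Y) (hom2 G Y Z) (hom2 G X Z) (\<lambda>m n. wh G (Suc m) (Suc n)) (ich G)"
    if "X \<in> cell G 0" "Y \<in> cell G 0" "Z \<in> cell G 0" for X Y Z
    using A5[THEN conjunct1] that by blast
  have s0: "src0 G n x \<in> cell G 0" and t0: "tgt0 G n x \<in> cell G 0" if "x \<in> cell G n" for x n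
    using that by (induction n arbitrary: x) (simp_all add: bnd)
  have two': "two_category (hom2 G (src0 G n x) (tgt0 G n x))" if "x \<in> cell G n" for x n
    using two s0 t0 that by blast
  note D = two_categoryD[OF two']
  \<comment> \<open>For 2-cells globularity is hidden in the enriched definition: it says that
    source and target of a cell lie in the same hom 2-category as the cell. For 3-cells it is the
    globularity of that 2-category.\<close>
  have st: "src G n (tgt G (Suc n) x) = src G n (src G (Suc n) x) \<and>
    tgt G n (src G (Suc n) x) = tgt G n (tgt G (Suc n) x)" if x: "x \<in> cell G (Suc (Suc n))" for x n
  proof -
    have "n = 0 \<or> n = 1" using le[OF x] by auto
    then show ?thesis
      using D(2)[OF x, of x 0] D(3)[OF x, of x 0] D(4,5)[OF x, of x] x by auto
  qed
  have b [simp]: "x \<in> cell G 1 \<Longrightarrow> src G 0 x \<in> cell G 0" "x \<in> cell G 1 \<Longrightarrow> tgt G 0 x \<in> cell G 0"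
    "x \<in> cell G 2 \<Longrightarrow> src G 1 x \<in> cell G 1" "x \<in> cell G 2 \<Longrightarrow> tgt G 1 x \<in> cell G 1"
    "x \<in> cell G 3 \<Longrightarrow> src G 2 x \<in> cell G 2" "x \<in> cell G 3 \<Longrightarrow> tgt G 2 x \<in> cell G 2" for x
    using bnd[of x 0] bnd[of x 1] bnd[of x 2] by auto
  have g [simp]: "x \<in> cell G 2 \<Longrightarrow> src G 0 (tgt G 1 x) = src G 0 (src G 1 x)"
    "x \<in> cell G 2 \<Longrightarrow> tgt G 0 (src G 1 x) = tgt G 0 (tgt G 1 x)"
    "x \<in> cell G 3 \<Longrightarrow> src G 1 (tgt G 2 x) = src G 1 (src G 2 x)"
    "x \<in> cell G 3 \<Longrightarrow> tgt G 1 (src G 2 x) = tgt G 1 (tgt G 2 x)" for x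
    using st[of x 0] st[of x 1] by auto
  have g3 [simp]: "x \<in> cell G 3 \<Longrightarrow> src G 0 (tgt G 1 (tgt G 2 x)) = src G 0 (src G 1 (src G 2 x))"
    "x \<in> cell G 3 \<Longrightarrow> tgt G 0 (src G 1 (src G 2 x)) = tgt G 0 (tgt G 1 (tgt G 2 x))" for x
    by (simp_all del: g add: g(1,2)[of "tgt G 2 x"] g(1,2)[of "src G 2 x"] g(3,4)[of x])
  \<comment> \<open>A 1-cell \<open>a\<close> of \<open>G\<close> is an object of a hom 2-category.
    Fixing it in the cubical functor leaves whiskering by \<open>a\<close> as a 2-functor.\<close>
  have wl: "two_functor (hom2 G (tgt G 0 a) Z) (hom2 G (src G 0 a) Z) (\<lambda>n. wh G 1 (Suc n) a)"
    if "a \<in> cell G 1" "Z \<in> cell G 0" for a Z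
    using cub[of "src G 0 a" "tgt G 0 a" Z] that unfolding cubical_functor_def by simp
  have wr: "two_functor (hom2 G X (src G 0 b)) (hom2 G X (tgt G 0 b)) (\<lambda>m x. wh G (Suc m) 1 x b)"
    if "b \<in> cell G 1" "X \<in> cell G 0" for b X
    using cub[of X "src G 0 b" "tgt G 0 b"] that unfolding cubical_functor_def by simp
  have wl': "two_functor (hom2 G (tgt G 0 a) (tgt0 G n x)) (hom2 G (src G 0 a) (tgt0 G n x)) (\<lambda>n. wh G 1 (Suc n) a)"
    if "a \<in> cell G 1" "x \<in> cell G n" for a n x
    using wl t0 that by blast
  have wr': "two_functor (hom2 G (src0 G n x) (src G 0 b)) (hom2 G (src0 G n x) (tgt G 0 b)) (\<lambda>m x. wh G (Suc m) 1 x
      b)"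
    if "b \<in> cell G 1" "x \<in> cell G n" for b n x
    using wr s0 that by blast
  note L = two_functorD[OF wl'] and R = two_functorD[OF wr']
  have wh_l: "wh G 1 n x y \<in> cell G n" if "x \<in> cell G 1" "y \<in> cell G n" "n \<ge> 1" "tgt G 0 x = src0 G n y" for x y n
    using L(1)[of x y n y "n - 1"] that by (cases n) auto
  have wh_r: "wh G n 1 y x \<in> cell G n" if "x \<in> cell G 1" "y \<in> cell G n" "n \<ge> 1" "tgt0 G n y = src G 0 x" for x y n
    using R(1)[of x y n y "n - 1"] that by (cases n) auto
  have C: "cubical_functor (hom2 G (src0 G m x) (tgt0 G m x)) (hom2 G (tgt0 G m x) (tgt0 G n y))
      (hom2 G (src0 G m x) (tgt0 G n y)) (\<lambda>m n. wh G (Suc m) (Suc n)) (ich G)"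
    if "x \<in> cell G m" "y \<in> cell G n" for x m y n
    using cub s0 t0 that by blast
  have h2: "src G 0 (src G 1 y) = src G 0 (src G 1 x) \<and> tgt G 0 (tgt G 1 x) = tgt G 0 (tgt G 1 y)"
    if "x \<in> cell G 2" "y \<in> cell G 2" "tgt G 1 x = src G 1 y" for x y
    using that by (metis g(1,2))
  have h3: "src G 0 (src G 1 (src G 2 y)) = src G 0 (src G 1 (src G 2 x)) \<and>
      tgt G 0 (tgt G 1 (tgt G 2 x)) = tgt G 0 (tgt G 1 (tgt G 2 y))"
    if "x \<in> cell G 3" "y \<in> cell G 3" "tgt G 1 (tgt G 2 x) = src G 1 (src G 2 y)" for x y
    using that by (metis g3)
  have v3: "src G 1 (src G 2 y) = src G 1 (src G 2 x) \<and> tgt G 1 (tgt G 2 x) = tgt G 1 (tgt G 2 y) \<and>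
      src G 0 (src G 1 (src G 2 y)) = src G 0 (src G 1 (src G 2 x)) \<and>
      tgt G 0 (tgt G 1 (tgt G 2 x)) = tgt G 0 (tgt G 1 (tgt G 2 y))"
    if "x \<in> cell G 3" "y \<in> cell G 3" "tgt G 2 x = src G 2 y" for x y
    using that by (metis g(3,4))
  have inv: "\<exists>k. tinverse (hom2 G (src0 G 2 x) (tgt0 G 2 y)) (ich G x y) k"
    if "x \<in> cell G 2" "y \<in> cell G 2" "tgt0 G 2 x = src0 G 2 y" for x y
    using C[of x 2 y 2] that by (simp add: cubical_functor_def)
  show ?thesis
    apply (rule gray_cat.intro)
    subgoal by (rule le)
    subgoal by (rule bnd)
    subgoal by (rule bnd)
    subgoal by (simp add: st)
    subgoal by (simp add: st)
    subgoal for x n using id0[of x] D(6)[of x n "n-1" x] by (cases n) auto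
    subgoal for x n using id0[of x] D(7)[of x n "n-1" x] by (cases n) auto
    subgoal for x n using id0[of x] D(8)[of x n "n-1" x] by (cases n) auto
    subgoal for x y using D(9)[of x 2 x y] h2[of x y] by simp
    subgoal for x y using D(11)[of x 2 x y] h2[of x y] by simp
    subgoal for x y using D(11)[of x 2 x y] h2[of x y] by simp
    subgoal for x y using D(10)[of x 3 x y] h3[of x y] by simp
    subgoal for x y using D(12)[of x 3 x y] h3[of x y] by simp
    subgoal for x y using D(12)[of x 3 x y] h3[of x y] by simp
    subgoal for x y z using D(13)[of x 2 x y z] h2[of x y] h2[of y z] by simp
    subgoal for x y z using D(14)[of x 3 x y z] h3[of x y] h3[of y z] by simp
    subgoal for x using D(15)[of x 2 x] by auto
    subgoal for x using D(15)[of x 2 x] by auto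
    subgoal for x using two_category_hor_unit[OF two', of x 3 x] by auto
    subgoal for x using two_category_hor_unit[OF two', of x 3 x] by auto
    subgoal for x y using D(16)[of x 3 x y] v3[of x y] by simp
    subgoal for x y using D(16)[of x 3 x y] v3[of x y] by simp
    subgoal for x y using D(16)[of x 3 x y] v3[of x y] by simp
    subgoal for x y z using D(17)[of x 3 x y z] v3[of x y] v3[of y z] by simp
    subgoal for x using D(18)[of x 3 x] by auto
    subgoal for x using D(18)[of x 3 x] by auto
    subgoal for x y using D(19)[of x 2 x y] h2[of x y] by simp
    subgoal for x x' y y' using D(20)[of x 3 x x' y y'] h3[of x y] v3[of x x'] v3[of y y'] by simp
    subgoal for x m y n using wh_l[of x y n] wh_r[of y x m] by auto
    subgoal for x y using L(1)[of x y 1 y 0] by auto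
    subgoal for x y using L(1)[of x y 1 y 0] by auto
    subgoal for x y n using L(2)[of x y "Suc n" y "n-1"] by (cases n) auto
    subgoal for x y n using L(3)[of x y "Suc n" y "n-1"] by (cases n) auto
    subgoal for x n y using R(2)[of y x "Suc n" x "n-1"] by (cases n) auto
    subgoal for x n y using R(3)[of y x "Suc n" x "n-1"] by (cases n) auto
    subgoal for f y n using L(4)[of f y n "n-1" y] by auto
    subgoal for x n f using R(4)[of f x n "n-1" x] by auto
    subgoal for f y y' using L(5)[of f y 2 y y'] h2[of y y'] by simp
    subgoal for f y y' using R(5)[of f y 2 y y'] h2[of y y'] by simp
    subgoal for f y y' using L(6)[of f y 3 y y'] h3[of y y'] by simp
    subgoal for f y y' using R(6)[of f y 3 y y'] h3[of y y'] by simp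
    subgoal for f y y' using L(7)[of f y 3 y y'] v3[of y y'] by simp
    subgoal for f y y' using R(7)[of f y 3 y y'] v3[of y y'] by simp
    subgoal using A6[THEN conjunct1] by blast
    subgoal using A6[THEN conjunct1] by blast
    subgoal using A7[THEN conjunct1] by blast
    subgoal for x y using C[of x 2 y 2] by (simp add: cubical_functor_def)
    subgoal for x y using C[of x 2 y 2] by (simp add: cubical_functor_def)
    subgoal for x y using C[of x 2 y 2] by (simp add: cubical_functor_def)
    subgoal for x y using inv[of x y] by (auto simp: tinverse_def)
    subgoal for x y using C[of x 3 y 2] by (simp add: cubical_functor_def)
    subgoal for x y using C[of x 2 y 3] by (simp add: cubical_functor_def)
    subgoal for x y using C[of x 1 y 2] by (simp add: cubical_functor_def)
    subgoal for x y using C[of x 2 y 1] by (simp add: cubical_functor_def)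
    subgoal for x x' y using C[of x 2 y 2] h2[of x x'] by (simp add: cubical_functor_def)
    subgoal for x y y' using C[of x 2 y 2] h2[of y y'] by (simp add: cubical_functor_def)
    subgoal using A8[THEN conjunct1] by blast
    subgoal using A9[THEN conjunct1] by blast
    subgoal using A10 by blast
    done
qed

section \<open>Strict functors in unpacked form, and their composition\<close>

locale gray_functor = A: gray_cat A + B: gray_cat B
  for A :: "'a gray" and B :: "'b gray" +
  fixes F :: "nat \<Rightarrow> 'a \<Rightarrow> 'b"
  assumes undef: "x \<notin> cell A n \<Longrightarrow> F n x = undefined"
    and map_cell [simp]: "x \<in> cell A n \<Longrightarrow> F n x \<in> cell B n"
    and map_src: "x \<in> cell A (Suc n) \<Longrightarrow> src B n (F (Suc n) x) = F n (src A n x)"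
    and map_tgt: "x \<in> cell A (Suc n) \<Longrightarrow> tgt B n (F (Suc n) x) = F n (tgt A n x)"
    and map_idt: "x \<in> cell A n \<Longrightarrow> n < 3 \<Longrightarrow> F (Suc n) (idt A n x) = idt B n (F n x)"
    and map_wh: "\<lbrakk>x \<in> cell A m; y \<in> cell A n; m \<ge> 1; n \<ge> 1; m = 1 \<or> n = 1; tgt0 A m x = src0 A n y\<rbrakk> \<Longrightarrow> F (m + n - 1)
        (wh A m n x y) = wh B m n (F m x) (F n y)"
    and map_hor2: "\<lbrakk>x \<in> cell A 2; y \<in> cell A 2; tgt A 1 x = src A 1 y\<rbrakk> \<Longrightarrow>
      F 2 (hor A 2 x y) = hor B 2 (F 2 x) (F 2 y)"
    and map_hor3: "\<lbrakk>x \<in> cell A 3; y \<in> cell A 3; tgt A 1 (tgt A 2 x) = src A 1 (src A 2 y)\<rbrakk> \<Longrightarrow>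
      F 3 (hor A 3 x y) = hor B 3 (F 3 x) (F 3 y)"
    and map_ver: "\<lbrakk>x \<in> cell A 3; y \<in> cell A 3; tgt A 2 x = src A 2 y\<rbrakk> \<Longrightarrow>
      F 3 (ver A x y) = ver B (F 3 x) (F 3 y)"
    and map_ich: "\<lbrakk>x \<in> cell A 2; y \<in> cell A 2; tgt0 A 2 x = src0 A 2 y\<rbrakk> \<Longrightarrow>
      F 3 (ich A x y) = ich B (F 2 x) (F 2 y)"
begin

lemma map_boundary [simp]:
  "x \<in> cell A 1 \<Longrightarrow> src B 0 (F 1 x) = F 0 (src A 0 x)" "x \<in> cell A 1 \<Longrightarrow> tgt B 0 (F 1 x) = F 0 (tgt A 0 x)"
  "x \<in> cell A 2 \<Longrightarrow> src B 1 (F 2 x) = F 1 (src A 1 x)" "x \<in> cell A 2 \<Longrightarrow> tgt B 1 (F 2 x) = F 1 (tgt A 1 x)"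
  "x \<in> cell A 3 \<Longrightarrow> src B 2 (F 3 x) = F 2 (src A 2 x)" "x \<in> cell A 3 \<Longrightarrow> tgt B 2 (F 3 x) = F 2 (tgt A 2 x)"
  using map_src[of x 0] map_tgt[of x 0] map_src[of x 1] map_tgt[of x 1] map_src[of x 2] map_tgt[of x 2] by auto

lemma map_src0 [simp]: "x \<in> cell A n \<Longrightarrow> src0 B n (F n x) = F 0 (src0 A n x)"
  by (induction n arbitrary: x) (simp_all add: map_src A.src_cell)

lemma map_tgt0 [simp]: "x \<in> cell A n \<Longrightarrow> tgt0 B n (F n x) = F 0 (tgt0 A n x)"
  by (induction n arbitrary: x) (simp_all add: map_tgt A.tgt_cell)

lemma map_idt_simps [simp]:
  "x \<in> cell A 0 \<Longrightarrow> F 1 (idt A 0 x) = idt B 0 (F 0 x)" "x \<in> cell A 1 \<Longrightarrow> F 2 (idt A 1 x) = idt B 1 (F 1 x)"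
  "x \<in> cell A 2 \<Longrightarrow> F 3 (idt A 2 x) = idt B 2 (F 2 x)"
  using map_idt[of x 0] map_idt[of x 1] map_idt[of x 2] by auto

lemma map_ich' [simp]: "\<lbrakk>x \<in> cell A 2; y \<in> cell A 2; tgt A 0 (tgt A 1 x) = src A 0 (src A 1 y)\<rbrakk> \<Longrightarrow>
      F 3 (ich A x y) = ich B (F 2 x) (F 2 y)"
  using map_ich by simp

declare map_hor2 [simp] map_hor3 [simp] map_ver [simp]

lemma strict: "strict_gray_functor A B F"
  unfolding strict_gray_functor_def
  apply (intro conjI)
  subgoal by (rule A.gray_category)
  subgoal by (rule B.gray_category)
  subgoal using undef by blast
  subgoal by simp
  subgoal
    unfolding two_functor_def
    apply (intro ballI conjI)
    subgoal using map_src0[of _ "Suc _", unfolded bd.simps] map_tgt0[of _ "Suc _", unfolded bd.simps] by simp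
    subgoal using map_src map_tgt A.src_cell A.tgt_cell by simp
    subgoal by (auto simp: less_2_cases_iff)
    subgoal for X Y n x y using A.comp2[of x y] A.comp3[of x y] by (cases "n = 1") simp_all
    subgoal for X Y x y using A.vcomp3[of x y] by simp
    done
  subgoal by simp
  subgoal using map_wh by blast
  subgoal using map_ich by blast
  done

end

text \<open>The enriched definition gives a 2-functor for each pair of 0-cells; a higher cell is fed
  to the one at its own ends. From here on functors are handled only through the locale.\<close>

lemma gray_functor_iff: "strict_gray_functor A B F \<longleftrightarrow> gray_functor A B F"
proof
  assume F: "strict_gray_functor A B F"
  interpret A: gray_cat A using F by (simp add: gray_catI strict_gray_functor_def)
  interpret B: gray_cat B using F by (simp add: gray_catI strict_gray_functor_def)
  have F1: "\<forall>n x. x \<notin> cell A n \<longrightarrow> F n x = undefined" "\<forall>X\<in>cell A 0. F 0 X \<in> cell B 0"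
    "\<forall>X\<in>cell A 0. F 1 (idt A 0 X) = idt B 0 (F 0 X)"
    and F2: "\<forall>X\<in>cell A 0. \<forall>Y\<in>cell A 0.
       two_functor (hom2 A X Y) (hom2 B (F 0 X) (F 0 Y)) (\<lambda>n. F (Suc n))"
    and F3: "\<forall>m\<ge>1. \<forall>n\<ge>1. m = 1 \<or> n = 1 \<longrightarrow>
       (\<forall>x\<in>cell A m. \<forall>y\<in>cell A n. tgt0 A m x = src0 A n y \<longrightarrow>
          F (m + n - 1) (wh A m n x y) = wh B m n (F m x) (F n y))"
    and F4: "\<forall>x\<in>cell A 2. \<forall>y\<in>cell A 2. tgt0 A 2 x = src0 A 2 y \<longrightarrow>
       F 3 (ich A x y) = ich B (F 2 x) (F 2 y)"
    using F unfolding strict_gray_functor_def by - (elim conjE, assumption)+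
  have T: "two_functor (hom2 A (src0 A n x) (tgt0 A n x)) (hom2 B (F 0 (src0 A n x)) (F 0 (tgt0 A n x))) (\<lambda>n. F (Suc
      n))"
    if "x \<in> cell A n" for n x
    using F2[rule_format, OF A.src0_cell[OF that] A.tgt0_cell[OF that]] .
  have c0: "F 0 x \<in> cell B 0" if "x \<in> cell A 0" for x
    using F1 that by blast
  have i0: "F 1 (idt A 0 x) = idt B 0 (F 0 x)" if "x \<in> cell A 0" for x
    using F1 that by blast
  have c: "F (Suc n) x \<in> cell B (Suc n) \<and> src0 B (Suc n) (F (Suc n) x) = F 0 (src0 A (Suc n) x) \<and>
     tgt0 B (Suc n) (F (Suc n) x) = F 0 (tgt0 A (Suc n) x)" if "x \<in> cell A (Suc n)" for n x
    using two_functorD(1)[OF T[OF that], of x n] that by auto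
  note D = two_functorD[OF T]
  show "gray_functor A B F"
    apply unfold_locales
    subgoal using F1(1) by blast
    subgoal for x n using c0[of x] c[of x "n-1"] by (cases n) auto
    subgoal for x n using c[of x n] D(2)[of x "Suc n" x "n-1"] by (cases n) auto
    subgoal for x n using c[of x n] D(3)[of x "Suc n" x "n-1"] by (cases n) auto
    subgoal for x n using i0[of x] D(4)[of x n "n-1" x] by (cases n) auto
    subgoal using F3 by blast
    subgoal for x y using D(5)[of x 2 x y] A.comp2[of x y] by simp
    subgoal for x y using D(6)[of x 3 x y] A.comp3[of x y] by simp
    subgoal for x y using D(7)[of x 3 x y] A.vcomp3[of x y] by simp
    subgoal using F4 by blast
    done
qed (rule gray_functor.strict)

lemma gray_category_iff: "gray_category G \<longleftrightarrow> gray_cat G"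
  using gray_catI gray_cat.gray_category by blast

lemma gray_functor_id: "gray_cat A \<Longrightarrow> gray_functor A A (gray_id A)"
proof -
  assume "gray_cat A"
  then interpret A: gray_cat A .
  show ?thesis
    apply unfold_locales
    apply (simp_all add: gray_id_def A.src_cell A.tgt_cell A.idt_cell)
    subgoal using A.wh_cell by simp
    done
qed

lemma gray_functor_comp:
  assumes "gray_functor A B F" "gray_functor B C G"
  shows "gray_functor A C (gray_comp A F G)"
proof -
  interpret F: gray_functor A B F by fact
  interpret G: gray_functor B C G by fact
  show ?thesis
    apply unfold_locales
    apply (simp_all add: gray_comp_def F.A.src_cell F.A.tgt_cell F.A.idt_cell F.map_src F.map_tgt
      G.map_src G.map_tgt F.map_idt G.map_idt)
    subgoal for x m y n using F.A.wh_cell[of x m y n] F.map_wh[of x m y n] G.map_wh[of "F m x" m "F n y" n] by simp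
    done
qed

lemma gray_comp_id:
  assumes "gray_functor A B F"
  shows "gray_comp A (gray_id A) F = F" "gray_comp A F (gray_id B) = F"
proof -
  interpret gray_functor A B F by fact
  show "gray_comp A (gray_id A) F = F" "gray_comp A F (gray_id B) = F"
    by (auto simp: gray_comp_def gray_id_def fun_eq_iff restrict_def undef)
qed

lemma gray_comp_assoc:
  assumes "gray_functor A B F"
  shows "gray_comp A (gray_comp A F G) H = gray_comp A F (gray_comp B G H)"
proof -
  interpret gray_functor A B F by fact
  show ?thesis
    by (auto simp: gray_comp_def fun_eq_iff restrict_def)
qed

text \<open>Off the cells both functions are \<open>undefined\<close>. This is why a functor
  specified by its values can be described uniquely, as the \<open>THE\<close> in the structure
  functors requires.\<close>

lemma gray_functor_eqI:
  assumes "gray_functor A B F" "gray_functor A B G" "\<And>n x. x \<in> cell A n \<Longrightarrow> F n x = G n x"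
  shows "F = G"
proof (intro ext)
  fix n x show "F n x = G n x"
    using assms(3)[of x n] gray_functor.undef[OF assms(1), of x n] gray_functor.undef[OF assms(2), of x n]
    by (cases "x \<in> cell A n") auto
qed

lemma gray_comp_apply [simp]: "x \<in> cell A n \<Longrightarrow> gray_comp A F G n x = G n (F n x)"
  by (simp add: gray_comp_def)

lemma gray_id_apply [simp]: "x \<in> cell A n \<Longrightarrow> gray_id A n x = x"
  by (simp add: gray_id_def)

section \<open>The inner hom\<close>

text \<open>The part of being an n-cell of the inner hom that mentions only the end functors,
  uniformly in n: naturality in cells of every dimension for transformations (\<open>n = 1\<close>),
  naturality in 1-cells for modifications and perturbations, and the interchange condition at
  \<open>n = 2\<close>. The intermediate boundaries of the cell are kept out; they enter through
  \<open>hcells_Suc\<close>.\<close>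

definition nat_family ::
  "'b gray \<Rightarrow> 'c gray \<Rightarrow> nat \<Rightarrow> (nat \<Rightarrow> 'b \<Rightarrow> 'c) \<Rightarrow> (nat \<Rightarrow> 'b \<Rightarrow> 'c) \<Rightarrow> ('b \<Rightarrow> 'c) \<Rightarrow> bool" where
  "nat_family B C n F G k \<longleftrightarrow>
    (\<forall>X\<in>cell B 0. k X \<in> cell C n \<and> src0 C n (k X) = F 0 X \<and> tgt0 C n (k X) = G 0 X) \<and>
    (\<forall>m\<ge>1. n = 1 \<or> m = 1 \<longrightarrow> (\<forall>y\<in>cell B m.
       wh C n m (k (src0 B m y)) (G m y) = wh C m n (F m y) (k (tgt0 B m y)))) \<and>
    (n = 2 \<longrightarrow> (\<forall>a\<in>cell B 2.
       tinverse (hom2 C (F 0 (src0 B 2 a)) (G 0 (tgt0 B 2 a)))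
         (ich C (k (src0 B 2 a)) (G 2 a)) (ich C (F 2 a) (k (tgt0 B 2 a)))))"

lemma nat_familyD:
  assumes "nat_family B C n F G k"
  shows "X \<in> cell B 0 \<Longrightarrow> k X \<in> cell C n" "X \<in> cell B 0 \<Longrightarrow> src0 C n (k X) = F 0 X"
    "X \<in> cell B 0 \<Longrightarrow> tgt0 C n (k X) = G 0 X"
    "\<lbrakk>y \<in> cell B m; m \<ge> 1; n = 1 \<or> m = 1\<rbrakk> \<Longrightarrow>
      wh C n m (k (src0 B m y)) (G m y) = wh C m n (F m y) (k (tgt0 B m y))"
    "n = 2 \<Longrightarrow> a \<in> cell B 2 \<Longrightarrow> tinverse (hom2 C (F 0 (src0 B 2 a)) (G 0 (tgt0 B 2 a)))
         (ich C (k (src0 B 2 a)) (G 2 a)) (ich C (F 2 a) (k (tgt0 B 2 a)))"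
  using assms unfolding nat_family_def by blast+

text \<open>Families are stored restricted to 0-cells, while they are computed with as unrestricted
  functions; this mediates between the two.\<close>

lemma nat_family_cong:
  assumes "nat_family B C n F G k" "\<And>X. X \<in> cell B 0 \<Longrightarrow> k X = l X" "gray_cat B"
  shows "nat_family B C n F G l"
proof -
  interpret B: gray_cat B by fact
  have [simp]: "y \<in> cell B m \<Longrightarrow> l (src0 B m y) = k (src0 B m y)" "y \<in> cell B m \<Longrightarrow> l (tgt0 B m y) = k (tgt0 B m y)" for
      m y
    using assms(2) B.src0_cell B.tgt0_cell by auto
  have [simp]: "y \<in> cell B 2 \<Longrightarrow> l (src B 0 (src B 1 y)) = k (src B 0 (src B 1 y))"
     "y \<in> cell B 2 \<Longrightarrow> l (tgt B 0 (tgt B 1 y)) = k (tgt B 0 (tgt B 1 y))" for y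
    using assms(2) by auto
  show ?thesis
    using assms(1) unfolding nat_family_def by (simp add: assms(2)[symmetric])
qed

primrec hfun :: "('b, 'c) hcell \<Rightarrow> nat \<Rightarrow> 'b \<Rightarrow> 'c" where
  "hfun (HFun F) = F"
| "hfun (HCell s t k) = undefined"

abbreviation hsrc0 :: "nat \<Rightarrow> ('b, 'c) hcell \<Rightarrow> ('b, 'c) hcell" where "hsrc0 \<equiv> bd (\<lambda>_. hsrc)"
abbreviation htgt0 :: "nat \<Rightarrow> ('b, 'c) hcell \<Rightarrow> ('b, 'c) hcell" where "htgt0 \<equiv> bd (\<lambda>_. htgt)"

lemma hcells_0: "x \<in> hcells B C 0 \<longleftrightarrow> (\<exists>F. x = HFun F \<and> strict_gray_functor B C F)"
  by (auto simp: hcells_def)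

lemma strict_transformation_iff:
  "strict_transformation B C F G k \<longleftrightarrow> strict_gray_functor B C F \<and> strict_gray_functor B C G \<and>
    k \<in> extensional (cell B 0) \<and> nat_family B C 1 F G k"
  by (auto simp: strict_transformation_def nat_family_def)

text \<open>The end conditions inside \<open>nat_family\<close> are the ones that
  \<open>\<alpha>\<close> and \<open>\<beta>\<close> satisfy as transformations.\<close>

lemma strict_modification_iff:
  assumes "gray_cat C"
  shows "strict_modification B C F G \<alpha> \<beta> k \<longleftrightarrow>
    strict_transformation B C F G \<alpha> \<and> strict_transformation B C F G \<beta> \<and> k \<in> extensional (cell B 0) \<and>
    (\<forall>X\<in>cell B 0. src C 1 (k X) = \<alpha> X \<and> tgt C 1 (k X) = \<beta> X) \<and> nat_family B C 2 F G k"
proof -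
  interpret C: gray_cat C by fact
  show ?thesis
    by (auto simp: strict_modification_def nat_family_def strict_transformation_def)
qed

lemma perturbation_iff:
  assumes "gray_cat C"
  shows "perturbation B C F G \<alpha> \<beta> \<Gamma> \<Lambda> k \<longleftrightarrow>
    strict_modification B C F G \<alpha> \<beta> \<Gamma> \<and> strict_modification B C F G \<alpha> \<beta> \<Lambda> \<and> k \<in> extensional (cell B 0) \<and>
    (\<forall>X\<in>cell B 0. src C 2 (k X) = \<Gamma> X \<and> tgt C 2 (k X) = \<Lambda> X) \<and> nat_family B C 3 F G k"
proof -
  interpret C: gray_cat C by fact
  show ?thesis
    by (auto simp: perturbation_def strict_modification_iff[OF assms] nat_family_def strict_transformation_def)
qed

text \<open>One description of the cells in all positive dimensions, replacing the three separate
  definitions. Parallelism of \<open>s\<close> and \<open>t\<close> is asked only for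
  \<open>n \<ge> 1\<close>, because 0-cells have no boundary.\<close>

lemma hcells_Suc:
  assumes "gray_cat C"
  shows "HCell s t k \<in> hcells B C (Suc n) \<longleftrightarrow> n < 3 \<and> s \<in> hcells B C n \<and> t \<in> hcells B C n \<and>
    (n \<ge> 1 \<longrightarrow> hsrc s = hsrc t \<and> htgt s = htgt t) \<and> k \<in> extensional (cell B 0) \<and>
    (\<forall>X\<in>cell B 0. src C n (k X) = hat s X \<and> tgt C n (k X) = hat t X) \<and>
    nat_family B C (Suc n) (hfun (hsrc0 n s)) (hfun (htgt0 n t)) k"
proof -
  consider "n = 0" | "n = 1" | "n = 2" | "n \<ge> 3" by linarith
  then show ?thesis
  proof cases
    case 1
    then show ?thesis
      by (auto simp: hcells_def strict_transformation_iff nat_family_def)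
  next
    case 2
    then show ?thesis
      by (auto simp: hcells_def strict_modification_iff[OF assms] strict_transformation_iff)
  next
    case 3
    then show ?thesis
      by (auto simp: hcells_def perturbation_iff[OF assms] strict_modification_iff[OF assms])
  next
    case 4
    then show ?thesis by (auto simp: hcells_def)
  qed
qed

lemma hcells_Suc_cases:
  assumes "x \<in> hcells B C (Suc n)"
  obtains s t k where "x = HCell s t k"
  using assms by (cases x) (auto simp: hcells_def split: if_splits)

section \<open>Inverse pairs of 3-cells\<close>

definition inverse3 :: "'a gray \<Rightarrow> 'a \<Rightarrow> 'a \<Rightarrow> bool" where
  "inverse3 G x y \<longleftrightarrow> x \<in> cell G 3 \<and> y \<in> cell G 3 \<and> src G 2 x = tgt G 2 y \<and> tgt G 2 x = src G 2 y \<and>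
     ver G x y = idt G 2 (src G 2 x) \<and> ver G y x = idt G 2 (src G 2 y)"

context gray_cat
begin

lemma inverse3_boundary:
  assumes "inverse3 G x y"
  shows "src0 G 3 y = src0 G 3 x \<and> tgt0 G 3 y = tgt0 G 3 x"
proof -
  have c: "x \<in> cell G 3" "y \<in> cell G 3" "tgt G 2 y = src G 2 x" "tgt G 2 x = src G 2 y"
    using assms unfolding inverse3_def by auto
  show ?thesis using vcomp3[OF c(1,2,4)] vcomp3[OF c(2,1,3)] bd_simps(3) by metis
qed

text \<open>Whiskering changes the ends of a 3-cell and so the hom 2-category in which its inverse
  is taken. With \<open>inverse3\<close> that 2-category need not be named; the ends become a
  separate condition on one of the two cells.\<close>

lemma tinverse_iff: "tinverse (hom2 G X Y) x y \<longleftrightarrow> inverse3 G x y \<and> src0 G 3 x = X \<and> tgt0 G 3 x = Y"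
proof -
  show ?thesis
  proof
    assume "tinverse (hom2 G X Y) x y"
    then show "inverse3 G x y \<and> src0 G 3 x = X \<and> tgt0 G 3 x = Y"
      unfolding tinverse_def inverse3_def by simp
  next
    assume a: "inverse3 G x y \<and> src0 G 3 x = X \<and> tgt0 G 3 x = Y"
    then have b: "src0 G 3 y = X" "tgt0 G 3 y = Y" using inverse3_boundary by auto
    show "tinverse (hom2 G X Y) x y"
      using a b unfolding tinverse_def inverse3_def hom2_simps mem_Collect_eq One_nat_def[symmetric] Suc_1 Suc_2_nat
      by blast
  qed
qed

lemma inverse3_sym: "inverse3 G x y \<Longrightarrow> inverse3 G y x"
  by (simp add: inverse3_def)

text \<open>The monoid argument y = y(xz) = (yx)z = z. It allows a chosen inverse to be replaced by
  any known one, and makes functors that agree on a cell agree on its inverse.\<close>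

lemma inverse3_unique:
  assumes "inverse3 G x y" "inverse3 G x z"
  shows "y = z"
proof -
  have "y = ver G y (ver G x z)" using assms ver_idt_right[of y] by (simp add: inverse3_def)
  also have "\<dots> = ver G (ver G y x) z" using assms by (intro ver_assoc[symmetric]) (simp_all add: inverse3_def)
  also have "\<dots> = z" using assms ver_idt_left[of z] by (simp add: inverse3_def)
  finally show ?thesis .
qed

lemma inverse3_idt: "x \<in> cell G 2 \<Longrightarrow> inverse3 G (idt G 2 x) (idt G 2 x)"
  using ver_idt_left[of "idt G 2 x"] by (simp add: inverse3_def)

lemma inverse3_wh_left:
  "\<lbrakk>inverse3 G x y; f \<in> cell G 1; tgt G 0 f = src0 G 3 x\<rbrakk> \<Longrightarrow> inverse3 G (wh G 1 3 f x) (wh G 1 3 f y)"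
  by (simp add: inverse3_def wh_ver_left[symmetric])

lemma inverse3_wh_right:
  "\<lbrakk>inverse3 G x y; f \<in> cell G 1; tgt0 G 3 x = src G 0 f\<rbrakk> \<Longrightarrow> inverse3 G (wh G 3 1 x f) (wh G 3 1 y f)"
  by (simp add: inverse3_def wh_ver_right[symmetric])

text \<open>Inverting a composite along 2-cells reverses the order of the factors, whereas
  composition along 1-cells in \<open>inverse3_hor\<close> keeps it.\<close>

lemma inverse3_ver:
  assumes "inverse3 G x x'" "inverse3 G y y'" "tgt G 2 x = src G 2 y"
  shows "inverse3 G (ver G x y) (ver G y' x')"
proof -
  have c: "x \<in> cell G 3" "x' \<in> cell G 3" "y \<in> cell G 3" "y' \<in> cell G 3"
    "src G 2 x' = src G 2 y" "tgt G 2 x' = src G 2 x" "src G 2 y' = tgt G 2 y" "tgt G 2 y' = src G 2 y" "tgt G 2 x =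
        src G 2 y"
    and v: "ver G x x' = idt G 2 (src G 2 x)" "ver G x' x = idt G 2 (src G 2 y)"
    "ver G y y' = idt G 2 (src G 2 y)" "ver G y' y = idt G 2 (tgt G 2 y)"
    using assms by (simp_all add: inverse3_def)
  have "ver G (ver G x y) (ver G y' x') = ver G x (ver G y (ver G y' x'))"
    using c by (intro ver_assoc) simp_all
  also have "ver G y (ver G y' x') = ver G (ver G y y') x'"
    using c by (intro ver_assoc[symmetric]) simp_all
  also have "\<dots> = x'" using c v ver_idt_left[of x'] by simp
  finally have 1: "ver G (ver G x y) (ver G y' x') = idt G 2 (src G 2 x)" using v by simp
  have "ver G (ver G y' x') (ver G x y) = ver G y' (ver G x' (ver G x y))"
    using c by (intro ver_assoc) simp_all
  also have "ver G x' (ver G x y) = ver G (ver G x' x) y"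
    using c by (intro ver_assoc[symmetric]) simp_all
  also have "\<dots> = y" using c v ver_idt_left[of y] by simp
  finally show ?thesis using 1 c v by (simp add: inverse3_def)
qed

text \<open>Composition along 1-cells is functorial for \<open>ver\<close> (\<open>hor_ver\<close>)
  and preserves identities (\<open>hor_idt\<close>).\<close>

lemma inverse3_hor:
  assumes "inverse3 G x x'" "inverse3 G y y'" "tgt G 1 (tgt G 2 x) = src G 1 (src G 2 y)"
  shows "inverse3 G (hor G 3 x y) (hor G 3 x' y')"
proof -
  have c: "x \<in> cell G 3" "x' \<in> cell G 3" "y \<in> cell G 3" "y' \<in> cell G 3"
    "src G 2 x' = tgt G 2 x" "tgt G 2 x' = src G 2 x" "src G 2 y' = tgt G 2 y" "tgt G 2 y' = src G 2 y"
    "ver G x x' = idt G 2 (src G 2 x)" "ver G x' x = idt G 2 (tgt G 2 x)"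
    "ver G y y' = idt G 2 (src G 2 y)" "ver G y' y = idt G 2 (tgt G 2 y)"
    using assms by (simp_all add: inverse3_def)
  show ?thesis
    unfolding inverse3_def
    using hor_ver[of x x' y y'] hor_ver[of x' x y' y] c assms(3) by (simp add: hor_idt)
qed

lemma ich_inverse3: "\<lbrakk>x \<in> cell G 2; y \<in> cell G 2; tgt0 G 2 x = src0 G 2 y\<rbrakk> \<Longrightarrow> \<exists>k. inverse3 G (ich G x y) k"
  using ich_inverse[of x y] unfolding inverse3_def by (metis ich_cell)

end

lemma (in gray_functor) map_inverse3: "inverse3 A x y \<Longrightarrow> inverse3 B (F 3 x) (F 3 y)"
  by (simp add: inverse3_def map_ver[symmetric])

section \<open>Closure of natural families under the componentwise operations\<close>

locale gray_pair = B: gray_cat B + C: gray_cat C for B :: "'b gray" and C :: "'c gray"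
begin

text \<open>Between strict functors the interchange cells have the right ends automatically, so the
  invertibility clause can drop the hom 2-category.\<close>

lemma nat_family_iff:
  "nat_family B C n F G k \<longleftrightarrow>
    (\<forall>X\<in>cell B 0. k X \<in> cell C n \<and> src0 C n (k X) = F 0 X \<and> tgt0 C n (k X) = G 0 X) \<and>
    (\<forall>m\<ge>1. n = 1 \<or> m = 1 \<longrightarrow> (\<forall>y\<in>cell B m.
       wh C n m (k (src0 B m y)) (G m y) = wh C m n (F m y) (k (tgt0 B m y)))) \<and>
    (n = 2 \<longrightarrow> (\<forall>a\<in>cell B 2. inverse3 C (ich C (k (src0 B 2 a)) (G 2 a)) (ich C (F 2 a) (k (tgt0 B 2 a)))))"
  if "gray_functor B C F" "gray_functor B C G"
proof -
  interpret F: gray_functor B C F by fact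
  interpret G: gray_functor B C G by fact
  have "src0 C 3 (ich C (k (src0 B 2 a)) (G 2 a)) = F 0 (src0 B 2 a) \<and>
    tgt0 C 3 (ich C (k (src0 B 2 a)) (G 2 a)) = G 0 (tgt0 B 2 a)"
    if "n = 2" "a \<in> cell B 2" "\<forall>X\<in>cell B 0. k X \<in> cell C n \<and> src0 C n (k X) = F 0 X \<and> tgt0 C n (k X) = G 0 X" for a
    using that by simp
  then show ?thesis unfolding nat_family_def C.tinverse_iff by blast
qed

text \<open>A cell of \<open>B\<close> is moved first past \<open>l\<close> and then past
  \<open>k\<close>, with associativity of whiskering in between. In the interchange condition one
  factor is a transformation, and its naturality in 2-cells reduces the claim to a whiskering of the
  inverse pair of the other factor.\<close>

lemma nat_family_wh:
  assumes F: "gray_functor B C F" "gray_functor B C G" "gray_functor B C H"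
    and k: "nat_family B C m F G k" and l: "nat_family B C n G H l"
    and mn: "m \<ge> 1" "n \<ge> 1" "m = 1 \<or> n = 1"
  shows "nat_family B C (m + n - 1) F H (\<lambda>X. wh C m n (k X) (l X))"
proof -
  interpret F: gray_functor B C F by fact
  interpret G: gray_functor B C G by fact
  interpret H: gray_functor B C H by fact
  note K = nat_familyD[OF k] and L = nat_familyD[OF l]
  have 1: "wh C m n (k X) (l X) \<in> cell C (m + n - 1) \<and> src0 C (m + n - 1) (wh C m n (k X) (l X)) = F 0 X \<and>
      tgt0 C (m + n - 1) (wh C m n (k X) (l X)) = H 0 X" if "X \<in> cell B 0" for X
    using C.wh_cell C.src0_wh C.tgt0_wh K(1-3) L(1-3) that mn by simp
  have 2: "wh C (m + n - 1) p (wh C m n (k (src0 B p y)) (l (src0 B p y))) (H p y) =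
      wh C p (m + n - 1) (F p y) (wh C m n (k (tgt0 B p y)) (l (tgt0 B p y)))"
    if y: "y \<in> cell B p" and p: "p \<ge> 1" "m + n - 1 = 1 \<or> p = 1" for p y
  proof -
    let ?s = "src0 B p y" and ?t = "tgt0 B p y"
    have c: "?s \<in> cell B 0" "?t \<in> cell B 0" using y B.src0_cell B.tgt0_cell by auto
    have "wh C (m + n - 1) p (wh C m n (k ?s) (l ?s)) (H p y) = wh C m (n + p - 1) (k ?s) (wh C n p (l ?s) (H p y))"
      using c y mn p by (intro C.wh_assoc) (auto simp: K L)
    also have "\<dots> = wh C m (p + n - 1) (k ?s) (wh C p n (G p y) (l ?t))"
      using L(4)[OF y p(1)] mn p by (auto simp: add.commute)
    also have "\<dots> = wh C (m + p - 1) n (wh C m p (k ?s) (G p y)) (l ?t)"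
      using c y mn p by (intro C.wh_assoc[symmetric]) (auto simp: K L)
    also have "\<dots> = wh C (p + m - 1) n (wh C p m (F p y) (k ?t)) (l ?t)"
      using K(4)[OF y p(1)] mn p by (auto simp: add.commute)
    also have "\<dots> = wh C p (m + n - 1) (F p y) (wh C m n (k ?t) (l ?t))"
      using c y mn p by (intro C.wh_assoc) (auto simp: K L)
    finally show ?thesis .
  qed
  have 3: "inverse3 C (ich C (wh C m n (k (src0 B 2 a)) (l (src0 B 2 a))) (H 2 a))
     (ich C (F 2 a) (wh C m n (k (tgt0 B 2 a)) (l (tgt0 B 2 a))))" if a: "a \<in> cell B 2" and "m + n - 1 = 2" for a
  proof -
    let ?s = "src0 B 2 a" and ?t = "tgt0 B 2 a"
    have c: "?s \<in> cell B 0" "?t \<in> cell B 0" using a by auto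
    from that mn consider "m = 1" "n = 2" | "m = 2" "n = 1" by auto
    then show ?thesis
    proof cases
      \<comment> \<open>Naturality of the transformation \<open>k\<close> in the 2-cell
        \<open>a\<close> exhibits both interchange cells as whiskerings by \<open>k ?s\<close> of
        the inverse pair belonging to \<open>l\<close>.\<close>
      case 1
      have "ich C (wh C 1 2 (k ?s) (l ?s)) (H 2 a) = wh C 1 3 (k ?s) (ich C (l ?s) (H 2 a))"
        using c a 1 K(1-3) L(1-3) by (intro C.ich_wh_left) auto
      moreover have "ich C (F 2 a) (wh C 1 2 (k ?t) (l ?t)) = ich C (wh C 2 1 (F 2 a) (k ?t)) (l ?t)"
        using c a 1 K(1-3) L(1-3) by (intro C.ich_wh_mid[symmetric]) auto
      moreover have "wh C 2 1 (F 2 a) (k ?t) = wh C 1 2 (k ?s) (G 2 a)"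
        using K(4)[OF a] 1 by simp
      moreover have "ich C (wh C 1 2 (k ?s) (G 2 a)) (l ?t) = wh C 1 3 (k ?s) (ich C (G 2 a) (l ?t))"
        using c a 1 K(1-3) L(1-3) by (intro C.ich_wh_left) auto
      moreover have "inverse3 C (ich C (l ?s) (H 2 a)) (ich C (G 2 a) (l ?t))"
        using L(5)[OF 1(2) a] by (simp add: C.tinverse_iff)
      ultimately show ?thesis
        using 1 c a K(1-3) L(1-3) by (auto intro!: C.inverse3_wh_left)
    next
      \<comment> \<open>Dually, naturality of \<open>l\<close> in \<open>a\<close> exhibits both as
        whiskerings by \<open>l ?t\<close> of the inverse pair belonging to
        \<open>k\<close>.\<close>
      case 2
      have "ich C (wh C 2 1 (k ?s) (l ?s)) (H 2 a) = ich C (k ?s) (wh C 1 2 (l ?s) (H 2 a))"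
        using c a 2 K(1-3) L(1-3) by (intro C.ich_wh_mid) auto
      moreover have "wh C 1 2 (l ?s) (H 2 a) = wh C 2 1 (G 2 a) (l ?t)"
        using L(4)[OF a] 2 by simp
      moreover have "ich C (k ?s) (wh C 2 1 (G 2 a) (l ?t)) = wh C 3 1 (ich C (k ?s) (G 2 a)) (l ?t)"
        using c a 2 K(1-3) L(1-3) by (intro C.ich_wh_right) auto
      moreover have "ich C (F 2 a) (wh C 2 1 (k ?t) (l ?t)) = wh C 3 1 (ich C (F 2 a) (k ?t)) (l ?t)"
        using c a 2 K(1-3) L(1-3) by (intro C.ich_wh_right) auto
      moreover have "inverse3 C (ich C (k ?s) (G 2 a)) (ich C (F 2 a) (k ?t))"
        using K(5)[OF 2(1) a] by (simp add: C.tinverse_iff)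
      ultimately show ?thesis
        using 2 c a K(1-3) L(1-3) by (auto intro!: C.inverse3_wh_right)
    qed
  qed
  show ?thesis
    unfolding nat_family_iff[OF F(1,3)]
    using 1 2 3 by blast
qed

lemma nat_family_idt0:
  assumes F: "gray_functor B C F"
  shows "nat_family B C 1 F F (\<lambda>X. idt C 0 (F 0 X))"
proof -
  interpret F: gray_functor B C F by fact
  have "wh C 1 m (idt C 0 (F 0 (src0 B m y))) (F m y) = wh C m 1 (F m y) (idt C 0 (F 0 (tgt0 B m y)))"
    if "y \<in> cell B m" "m \<ge> 1" for m y
    using C.wh_unit_left[of "F m y" m] C.wh_unit_right[of "F m y" m] that by simp
  then show ?thesis unfolding nat_family_iff[OF F F] by simp
qed

text \<open>For \<open>n = 1\<close> both interchange cells involve an identity 2-cell and are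
  therefore identity 3-cells. They are identities on the same 2-cell because \<open>k\<close> is
  natural in 2-cells, and an identity is its own inverse.\<close>

lemma nat_family_idt:
  assumes F: "gray_functor B C F" "gray_functor B C G" and k: "nat_family B C n F G k" and n: "n \<in> {1,2}"
  shows "nat_family B C (Suc n) F G (\<lambda>X. idt C n (k X))"
proof -
  interpret F: gray_functor B C F by fact
  interpret G: gray_functor B C G by fact
  note K = nat_familyD[OF k]
  show ?thesis
  proof (cases "n = 1")
    case True
    show ?thesis
      unfolding nat_family_iff[OF F] using True K(1-3) K(4)[of _ 2] K(4)[of _ 1]
      by (auto simp: C.ich_idt_left C.ich_idt_right intro!: C.inverse3_idt)
  next
    case False
    then show ?thesis
      unfolding nat_family_iff[OF F] using n K(1-3) K(4)[of _ 1] by auto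
  qed
qed

text \<open>Expanding the interchange cell of a composite on the left and on the right yields two
  vertical composites with the roles of \<open>k\<close> and \<open>l\<close> in opposite orders.
  This is the order reversal of \<open>inverse3_ver\<close>, so factors invert each other
  pairwise.\<close>

lemma nat_family_hor2:
  assumes F: "gray_functor B C F" "gray_functor B C G" and k: "nat_family B C 2 F G k" and l: "nat_family B C 2 F G
      l"
    and kl: "\<And>X. X \<in> cell B 0 \<Longrightarrow> tgt C 1 (k X) = src C 1 (l X)"
  shows "nat_family B C 2 F G (\<lambda>X. hor C 2 (k X) (l X))"
proof -
  interpret F: gray_functor B C F by fact
  interpret G: gray_functor B C G by fact
  note K = nat_familyD[OF k] and L = nat_familyD[OF l]
  have 1: "wh C 2 1 (hor C 2 (k (src0 B 1 y)) (l (src0 B 1 y))) (G 1 y) =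
      wh C 1 2 (F 1 y) (hor C 2 (k (tgt0 B 1 y)) (l (tgt0 B 1 y)))" if "y \<in> cell B 1" for y
    using that K(1-3) L(1-3) K(4)[of y 1] L(4)[of y 1] kl by (simp add: C.wh_hor2_left C.wh_hor2_right)
  have 2: "inverse3 C (ich C (hor C 2 (k (src0 B 2 a)) (l (src0 B 2 a))) (G 2 a))
     (ich C (F 2 a) (hor C 2 (k (tgt0 B 2 a)) (l (tgt0 B 2 a))))" if a: "a \<in> cell B 2" for a
  proof -
    let ?s = "src0 B 2 a" and ?t = "tgt0 B 2 a"
    have c: "?s \<in> cell B 0" "?t \<in> cell B 0" using a by auto
    note kt = K(1-3)[OF c(1)] K(1-3)[OF c(2)] L(1-3)[OF c(1)] L(1-3)[OF c(2)] kl[OF c(1)] kl[OF c(2)]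
    \<comment> \<open>Naturality in the two boundary 1-cells of \<open>a\<close> identifies the
      identity factors of the two expansions.\<close>
    have e: "wh C 2 1 (l ?s) (G 1 (tgt B 1 a)) = wh C 1 2 (F 1 (tgt B 1 a)) (l ?t)"
      using L(4)[of "tgt B 1 a" 1] a by simp
    have e': "wh C 2 1 (k ?s) (G 1 (src B 1 a)) = wh C 1 2 (F 1 (src B 1 a)) (k ?t)"
      using K(4)[of "src B 1 a" 1] a by simp
    have i: "inverse3 C (ich C (k ?s) (G 2 a)) (ich C (F 2 a) (k ?t))"
      "inverse3 C (ich C (l ?s) (G 2 a)) (ich C (F 2 a) (l ?t))"
      using K(5)[OF _ a] L(5)[OF _ a] by (simp_all add: C.tinverse_iff)
    have p: "ich C (hor C 2 (k ?s) (l ?s)) (G 2 a) =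
        ver C (hor C 3 (idt C 2 (wh C 2 1 (k ?s) (G 1 (src B 1 a)))) (ich C (l ?s) (G 2 a)))
            (hor C 3 (ich C (k ?s) (G 2 a)) (idt C 2 (wh C 2 1 (l ?s) (G 1 (tgt B 1 a)))))"
      using C.ich_hor_left[of "k ?s" "l ?s" "G 2 a"] kt a by simp
    have q: "ich C (F 2 a) (hor C 2 (k ?t) (l ?t)) =
        ver C (hor C 3 (ich C (F 2 a) (k ?t)) (idt C 2 (wh C 1 2 (F 1 (tgt B 1 a)) (l ?t))))
            (hor C 3 (idt C 2 (wh C 1 2 (F 1 (src B 1 a)) (k ?t))) (ich C (F 2 a) (l ?t)))"
      using C.ich_hor_right[of "F 2 a" "k ?t" "l ?t"] kt a by simp
    have r: "wh C 2 1 (k ?s) (G 1 (src B 1 a)) \<in> cell C 2" "wh C 2 1 (l ?s) (G 1 (tgt B 1 a)) \<in> cell C 2"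
      using kt a by auto
    show ?thesis
      unfolding p q e[symmetric] e'[symmetric]
      using kt a i C.inverse3_idt[OF r(1)] C.inverse3_idt[OF r(2)]
      by (intro C.inverse3_ver C.inverse3_hor) (auto simp: C.hor2_assoc)
  qed
  have 3: "hor C 2 (k X) (l X) \<in> cell C 2 \<and> src0 C 2 (hor C 2 (k X) (l X)) = F 0 X \<and>
      tgt0 C 2 (hor C 2 (k X) (l X)) = G 0 X" if "X \<in> cell B 0" for X
    using K(1-3) L(1-3) kl that by simp
  show ?thesis unfolding nat_family_iff[OF F] using 1 2 3 by simp
qed

lemma nat_family_hor3:
  assumes F: "gray_functor B C F" "gray_functor B C G" and k: "nat_family B C 3 F G k" and l: "nat_family B C 3 F G
      l"
    and kl: "\<And>X. X \<in> cell B 0 \<Longrightarrow> tgt C 1 (tgt C 2 (k X)) = src C 1 (src C 2 (l X))"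
  shows "nat_family B C 3 F G (\<lambda>X. hor C 3 (k X) (l X))"
proof -
  interpret F: gray_functor B C F by fact
  interpret G: gray_functor B C G by fact
  note K = nat_familyD[OF k] and L = nat_familyD[OF l]
  show ?thesis unfolding nat_family_iff[OF F]
    using K(1-3) L(1-3) K(4)[of _ 1] L(4)[of _ 1] kl by (auto simp add: C.wh_hor3_left C.wh_hor3_right)
qed

lemma nat_family_ver:
  assumes F: "gray_functor B C F" "gray_functor B C G" and k: "nat_family B C 3 F G k" and l: "nat_family B C 3 F G
      l"
    and kl: "\<And>X. X \<in> cell B 0 \<Longrightarrow> tgt C 2 (k X) = src C 2 (l X)"
  shows "nat_family B C 3 F G (\<lambda>X. ver C (k X) (l X))"
proof -
  interpret F: gray_functor B C F by fact
  interpret G: gray_functor B C G by fact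
  note K = nat_familyD[OF k] and L = nat_familyD[OF l]
  show ?thesis unfolding nat_family_iff[OF F]
    using K(1-3) L(1-3) K(4)[of _ 1] L(4)[of _ 1] kl by (auto simp add: C.wh_ver_left C.wh_ver_right)
qed

text \<open>The 1-cell passes \<open>l\<close>, moves from the right argument to the left one by
  \<open>ich_wh_mid\<close>, and then passes \<open>k\<close>.\<close>

lemma nat_family_ich:
  assumes F: "gray_functor B C F" "gray_functor B C G" "gray_functor B C H"
    and k: "nat_family B C 2 F G k" and l: "nat_family B C 2 G H l"
  shows "nat_family B C 3 F H (\<lambda>X. ich C (k X) (l X))"
proof -
  interpret F: gray_functor B C F by fact
  interpret G: gray_functor B C G by fact
  interpret H: gray_functor B C H by fact
  note K = nat_familyD[OF k] and L = nat_familyD[OF l]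
  have "wh C 3 1 (ich C (k (src B 0 f)) (l (src B 0 f))) (H 1 f) = wh C 1 3 (F 1 f) (ich C (k (tgt B 0 f)) (l (tgt B
      0 f)))"
    if f: "f \<in> cell B 1" for f
  proof -
    let ?s = "src B 0 f" and ?t = "tgt B 0 f"
    have c: "?s \<in> cell B 0" "?t \<in> cell B 0" using f by auto
    note kt = K(1-3)[OF c(1)] K(1-3)[OF c(2)] L(1-3)[OF c(1)] L(1-3)[OF c(2)]
    have "wh C 3 1 (ich C (k ?s) (l ?s)) (H 1 f) = ich C (k ?s) (wh C 2 1 (l ?s) (H 1 f))"
      using kt f by (intro C.ich_wh_right[symmetric]) auto
    also have "\<dots> = ich C (k ?s) (wh C 1 2 (G 1 f) (l ?t))" using L(4)[OF f] by simp
    also have "\<dots> = ich C (wh C 2 1 (k ?s) (G 1 f)) (l ?t)"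
      using kt f by (intro C.ich_wh_mid[symmetric]) auto
    also have "\<dots> = ich C (wh C 1 2 (F 1 f) (k ?t)) (l ?t)" using K(4)[OF f] by simp
    also have "\<dots> = wh C 1 3 (F 1 f) (ich C (k ?t) (l ?t))"
      using kt f by (intro C.ich_wh_left) auto
    finally show ?thesis .
  qed
  then show ?thesis unfolding nat_family_iff[OF F(1,3)] using K(1-3) L(1-3) by auto
qed

text \<open>Whiskering by a 1-cell preserves inverse pairs, so both sides of the naturality equation
  for \<open>l\<close> are inverse to the same 3-cell and hence equal. This makes interchange cells
  in the inner hom invertible.\<close>

lemma nat_family_inverse3:
  assumes F: "gray_functor B C F" "gray_functor B C G" and k: "nat_family B C 3 F G k"
    and kl: "\<And>X. X \<in> cell B 0 \<Longrightarrow> inverse3 C (k X) (l X)"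
  shows "nat_family B C 3 F G l"
proof -
  interpret F: gray_functor B C F by fact
  interpret G: gray_functor B C G by fact
  note K = nat_familyD[OF k]
  have l: "l X \<in> cell C 3 \<and> src0 C 3 (l X) = F 0 X \<and> tgt0 C 3 (l X) = G 0 X" if "X \<in> cell B 0" for X
    using kl[OF that] K(2,3)[OF that] C.tinverse_iff[of "F 0 X" "G 0 X" "k X" "l X"] by (simp add: tinverse_def)
  have "wh C 3 1 (l (src B 0 f)) (G 1 f) = wh C 1 3 (F 1 f) (l (tgt B 0 f))" if f: "f \<in> cell B 1" for f
  proof -
    let ?s = "src B 0 f" and ?t = "tgt B 0 f"
    have c: "?s \<in> cell B 0" "?t \<in> cell B 0" using f by auto
    have "inverse3 C (wh C 3 1 (k ?s) (G 1 f)) (wh C 3 1 (l ?s) (G 1 f))"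
      using f c kl[OF c(1)] K(1-3)[OF c(1)] by (intro C.inverse3_wh_right) auto
    moreover have "inverse3 C (wh C 1 3 (F 1 f) (k ?t)) (wh C 1 3 (F 1 f) (l ?t))"
      using f c kl[OF c(2)] K(1-3)[OF c(2)] by (intro C.inverse3_wh_left) auto
    moreover have "wh C 3 1 (k ?s) (G 1 f) = wh C 1 3 (F 1 f) (k ?t)" using K(4)[OF f] by simp
    ultimately show ?thesis using C.inverse3_unique by metis
  qed
  then show ?thesis unfolding nat_family_iff[OF F] using l by auto
qed

end

section \<open>The Gray-category of functors, transformations, modifications and
  perturbations\<close>

lemma gray_hom_simps [simp]:
  "cell (gray_hom B C) = hcells B C" "src (gray_hom B C) n = hsrc" "tgt (gray_hom B C) n = htgt"
  "idt (gray_hom B C) = hidt B C" "wh (gray_hom B C) = hwh B C" "hor (gray_hom B C) = hhor B C"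
  "ver (gray_hom B C) = hver B C" "ich (gray_hom B C) = hich B C"
  by (simp_all add: gray_hom_def)

lemma bd_gray_hom [simp]: "src0 (gray_hom B C) n x = hsrc0 n x" "tgt0 (gray_hom B C) n x = htgt0 n x"
  by (induction n arbitrary: x) simp_all

context gray_pair
begin

lemma hcells_0D: "x \<in> hcells B C 0 \<Longrightarrow> gray_functor B C (hfun x)"
  by (auto simp: hcells_0 gray_functor_iff)

lemma hcells_0_eq: "x \<in> hcells B C 0 \<Longrightarrow> HFun (hfun x) = x"
  by (auto simp: hcells_0)

lemma hat_0: "x \<in> hcells B C 0 \<Longrightarrow> hat x X = hfun x 0 X"
  by (auto simp: hcells_0)

lemma hcells_SucD:
  assumes "x \<in> hcells B C (Suc n)"
  shows "hsrc x \<in> hcells B C n" "htgt x \<in> hcells B C n"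
    "n \<ge> 1 \<Longrightarrow> hsrc (htgt x) = hsrc (hsrc x)" "n \<ge> 1 \<Longrightarrow> htgt (hsrc x) = htgt (htgt x)"
    "hat x \<in> extensional (cell B 0)"
    "X \<in> cell B 0 \<Longrightarrow> hat x X \<in> cell C (Suc n)"
    "X \<in> cell B 0 \<Longrightarrow> src C n (hat x X) = hat (hsrc x) X"
    "X \<in> cell B 0 \<Longrightarrow> tgt C n (hat x X) = hat (htgt x) X"
    "nat_family B C (Suc n) (hfun (hsrc0 (Suc n) x)) (hfun (htgt0 (Suc n) x)) (hat x)"
    "HCell (hsrc x) (htgt x) (hat x) = x" "n < 3"
proof -
  obtain s t k where x: "x = HCell s t k" using assms by (rule hcells_Suc_cases)
  have eta: "hat (HCell s t k) = k" by auto
  show "hsrc x \<in> hcells B C n" "htgt x \<in> hcells B C n"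
    "n \<ge> 1 \<Longrightarrow> hsrc (htgt x) = hsrc (hsrc x)" "n \<ge> 1 \<Longrightarrow> htgt (hsrc x) = htgt (htgt x)"
    "hat x \<in> extensional (cell B 0)"
    "X \<in> cell B 0 \<Longrightarrow> hat x X \<in> cell C (Suc n)"
    "X \<in> cell B 0 \<Longrightarrow> src C n (hat x X) = hat (hsrc x) X"
    "X \<in> cell B 0 \<Longrightarrow> tgt C n (hat x X) = hat (htgt x) X"
    "nat_family B C (Suc n) (hfun (hsrc0 (Suc n) x)) (hfun (htgt0 (Suc n) x)) (hat x)"
    "HCell (hsrc x) (htgt x) (hat x) = x" "n < 3"
    using assms unfolding x hcells_Suc[OF C.gray_cat_axioms] eta
    by (auto dest: nat_familyD)
qed

lemma hcell_boundary [simp]: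
  "x \<in> hcells B C 1 \<Longrightarrow> hsrc x \<in> hcells B C 0" "x \<in> hcells B C 1 \<Longrightarrow> htgt x \<in> hcells B C 0"
  "x \<in> hcells B C 2 \<Longrightarrow> hsrc x \<in> hcells B C 1" "x \<in> hcells B C 2 \<Longrightarrow> htgt x \<in> hcells B C 1"
  "x \<in> hcells B C 3 \<Longrightarrow> hsrc x \<in> hcells B C 2" "x \<in> hcells B C 3 \<Longrightarrow> htgt x \<in> hcells B C 2"
  using hcells_SucD(1,2)[of x 0] hcells_SucD(1,2)[of x 1] hcells_SucD(1,2)[of x 2] by auto

lemma hcell_globular [simp]:
  "x \<in> hcells B C 2 \<Longrightarrow> hsrc (htgt x) = hsrc (hsrc x)" "x \<in> hcells B C 2 \<Longrightarrow> htgt (hsrc x) = htgt (htgt x)"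
  "x \<in> hcells B C 3 \<Longrightarrow> hsrc (htgt x) = hsrc (hsrc x)" "x \<in> hcells B C 3 \<Longrightarrow> htgt (hsrc x) = htgt (htgt x)"
  using hcells_SucD(3,4)[of x 1] hcells_SucD(3,4)[of x 2] by auto

lemma hat_cell [simp]:
  assumes "X \<in> cell B 0"
  shows "x \<in> hcells B C 0 \<Longrightarrow> hat x X \<in> cell C 0" "x \<in> hcells B C 1 \<Longrightarrow> hat x X \<in> cell C 1"
  "x \<in> hcells B C 2 \<Longrightarrow> hat x X \<in> cell C 2" "x \<in> hcells B C 3 \<Longrightarrow> hat x X \<in> cell C 3"
  using assms hcells_SucD(6)[of x 0 X] hcells_SucD(6)[of x 1 X] hcells_SucD(6)[of x 2 X]
    hat_0[of x X] gray_functor.map_cell[OF hcells_0D, of x X 0] by auto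

lemma hat_boundary [simp]:
  assumes "X \<in> cell B 0"
  shows "x \<in> hcells B C 1 \<Longrightarrow> src C 0 (hat x X) = hat (hsrc x) X" "x \<in> hcells B C 1 \<Longrightarrow> tgt C 0 (hat x X) = hat (htgt x)
      X"
  "x \<in> hcells B C 2 \<Longrightarrow> src C 1 (hat x X) = hat (hsrc x) X" "x \<in> hcells B C 2 \<Longrightarrow> tgt C 1 (hat x X) = hat (htgt x) X"
  "x \<in> hcells B C 3 \<Longrightarrow> src C 2 (hat x X) = hat (hsrc x) X" "x \<in> hcells B C 3 \<Longrightarrow> tgt C 2 (hat x X) = hat (htgt x) X"
  using assms hcells_SucD(7,8)[of x 0 X] hcells_SucD(7,8)[of x 1 X] hcells_SucD(7,8)[of x 2 X] by auto

text \<open>The intermediate boundaries of a higher cell need not be compared: their components are the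
  boundaries of its components.\<close>

lemma hcell_eqI:
  assumes "x \<in> hcells B C n" "y \<in> hcells B C n" "hsrc0 n x = hsrc0 n y" "htgt0 n x = htgt0 n y"
    and "\<And>X. X \<in> cell B 0 \<Longrightarrow> n \<ge> 1 \<Longrightarrow> hat x X = hat y X"
  shows "x = y"
  using assms
proof (induction n arbitrary: x y)
  case 0
  then show ?case by simp
next
  case (Suc n)
  note x = hcells_SucD[OF Suc.prems(1)] and y = hcells_SucD[OF Suc.prems(2)]
  have h: "hat x = hat y"
    using x(5) y(5) Suc.prems(5) by (intro extensionalityI) auto
  have "htgt0 n (hsrc x) = htgt0 n (htgt x)" "htgt0 n (hsrc y) = htgt0 n (htgt y)"
    "hsrc0 n (htgt x) = hsrc0 n (hsrc x)" "hsrc0 n (htgt y) = hsrc0 n (hsrc y)"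
    if "n \<noteq> 0"
    using x(3,4) y(3,4) that by (cases n; simp)+
  note n = this
  have "hsrc x = hsrc y"
    using Suc.prems(3,4) h x(7) y(7) n by (cases "n = 0"; intro Suc.IH[OF x(1) y(1)]; force)
  moreover have "htgt x = htgt y"
    using Suc.prems(3,4) h x(8) y(8) n by (cases "n = 0"; intro Suc.IH[OF x(2) y(2)]; force)
  ultimately show ?case using x(10) y(10) h by metis
qed

lemma hcells_SucI:
  assumes "n < 3" "s \<in> hcells B C n" "t \<in> hcells B C n" "n \<ge> 1 \<Longrightarrow> hsrc s = hsrc t \<and> htgt s = htgt t"
    "\<And>X. X \<in> cell B 0 \<Longrightarrow> src C n (k X) = hat s X \<and> tgt C n (k X) = hat t X"
    "nat_family B C (Suc n) (hfun (hsrc0 n s)) (hfun (htgt0 n t)) k"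
  shows "HCell s t (restrict k (cell B 0)) \<in> hcells B C (Suc n)"
  unfolding hcells_Suc[OF C.gray_cat_axioms]
  using assms nat_family_cong[OF assms(6), of "restrict k (cell B 0)"] B.gray_cat_axioms by auto

lemma nat_family_hat:
  "x \<in> hcells B C 1 \<Longrightarrow> nat_family B C 1 (hfun (hsrc x)) (hfun (htgt x)) (hat x)"
  "x \<in> hcells B C 2 \<Longrightarrow> nat_family B C 2 (hfun (hsrc (hsrc x))) (hfun (htgt (htgt x))) (hat x)"
  "x \<in> hcells B C 3 \<Longrightarrow> nat_family B C 3 (hfun (hsrc (hsrc (hsrc x)))) (hfun (htgt (htgt (htgt x)))) (hat x)"
  using hcells_SucD(9)[of x 0] hcells_SucD(9)[of x 1] hcells_SucD(9)[of x 2] by auto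

lemma functor_hat [simp]:
  "x \<in> hcells B C 0 \<Longrightarrow> gray_functor B C (hfun x)"
  by (rule hcells_0D)

lemma hop_simps [simp]:
  "hsrc (hidt B C n x) = x" "htgt (hidt B C n x) = x"
  "X \<in> cell B 0 \<Longrightarrow> hat (hidt B C n x) X = idt C n (hat x X)"
  "hsrc (hwh B C 1 1 x y) = hsrc x" "htgt (hwh B C 1 1 x y) = htgt y"
  "hsrc (hwh B C 1 2 x y) = hwh B C 1 1 x (hsrc y)" "htgt (hwh B C 1 2 x y) = hwh B C 1 1 x (htgt y)"
  "hsrc (hwh B C 2 1 x y) = hwh B C 1 1 (hsrc x) y" "htgt (hwh B C 2 1 x y) = hwh B C 1 1 (htgt x) y"
  "hsrc (hwh B C 1 3 x y) = hwh B C 1 2 x (hsrc y)" "htgt (hwh B C 1 3 x y) = hwh B C 1 2 x (htgt y)"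
  "hsrc (hwh B C 3 1 x y) = hwh B C 2 1 (hsrc x) y" "htgt (hwh B C 3 1 x y) = hwh B C 2 1 (htgt x) y"
  "X \<in> cell B 0 \<Longrightarrow> hat (hwh B C m n x y) X = wh C m n (hat x X) (hat y X)"
  "hsrc (hhor B C 2 x y) = hsrc x" "htgt (hhor B C 2 x y) = htgt y"
  "hsrc (hhor B C 3 x y) = hhor B C 2 (hsrc x) (hsrc y)" "htgt (hhor B C 3 x y) = hhor B C 2 (htgt x) (htgt y)"
  "X \<in> cell B 0 \<Longrightarrow> hat (hhor B C n x y) X = hor C n (hat x X) (hat y X)"
  "hsrc (hver B C x y) = hsrc x" "htgt (hver B C x y) = htgt y"
  "X \<in> cell B 0 \<Longrightarrow> hat (hver B C x y) X = ver C (hat x X) (hat y X)"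
  "hsrc (hich B C x y) = hhor B C 2 (hwh B C 2 1 x (hsrc y)) (hwh B C 1 2 (htgt x) y)"
  "htgt (hich B C x y) = hhor B C 2 (hwh B C 1 2 (hsrc x) y) (hwh B C 2 1 x (htgt y))"
  "X \<in> cell B 0 \<Longrightarrow> hat (hich B C x y) X = ich C (hat x X) (hat y X)"
  by (simp_all add: hidt_def hwh.simps[of B C 1 1] hwh.simps[of B C 1 2] hwh.simps[of B C 2 1]
      hwh.simps[of B C 1 3] hwh.simps[of B C 3 1] hwh.simps[of B C m n] hhor_def hver_def hich_def Let_def)

lemma hidt_cell [simp]:
  "x \<in> hcells B C 0 \<Longrightarrow> hidt B C 0 x \<in> hcells B C 1"
  "x \<in> hcells B C 1 \<Longrightarrow> hidt B C 1 x \<in> hcells B C 2"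
  "x \<in> hcells B C 2 \<Longrightarrow> hidt B C 2 x \<in> hcells B C 3"
proof -
  have "nat_family B C 1 (hfun x) (hfun x) (\<lambda>X. idt C 0 (hat x X))" if "x \<in> hcells B C 0"
    using nat_family_idt0[OF hcells_0D[OF that]] by (simp add: hat_0[OF that])
  then show "x \<in> hcells B C 0 \<Longrightarrow> hidt B C 0 x \<in> hcells B C 1"
    using hcells_SucI[of 0 x x "\<lambda>X. idt C 0 (hat x X)"] by (simp add: hidt_def)
  show "x \<in> hcells B C 1 \<Longrightarrow> hidt B C 1 x \<in> hcells B C 2" "x \<in> hcells B C 2 \<Longrightarrow> hidt B C 2 x \<in> hcells B C 3"
    using hcells_SucI[of 1 x x "\<lambda>X. idt C 1 (hat x X)"] hcells_SucI[of 2 x x "\<lambda>X. idt C 2 (hat x X)"]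
      nat_family_idt[OF _ _ nat_family_hat(1), of x] nat_family_idt[OF _ _ nat_family_hat(2), of x]
    by (simp_all add: hidt_def)
qed

lemma nat_family_hat': "x \<in> hcells B C m \<Longrightarrow> m \<ge> 1 \<Longrightarrow>
    nat_family B C m (hfun (hsrc0 m x)) (hfun (htgt0 m x)) (hat x)"
  using hcells_SucD(9)[of x "m - 1"] by (cases m) auto

lemma hsrc0_cell: "x \<in> hcells B C m \<Longrightarrow> hsrc0 m x \<in> hcells B C 0"
  by (induction m arbitrary: x) (auto dest: hcells_SucD(1))

lemma htgt0_cell: "x \<in> hcells B C m \<Longrightarrow> htgt0 m x \<in> hcells B C 0"
  by (induction m arbitrary: x) (auto dest: hcells_SucD(2))

lemma nat_family_hwh:
  assumes "x \<in> hcells B C m" "y \<in> hcells B C n" "m \<ge> 1" "n \<ge> 1" "m = 1 \<or> n = 1" "htgt0 m x = hsrc0 n y"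
  shows "nat_family B C (m + n - 1) (hfun (hsrc0 m x)) (hfun (htgt0 n y)) (\<lambda>X. wh C m n (hat x X) (hat y X))"
  using assms hsrc0_cell htgt0_cell hcells_0D nat_family_hat'[of x m] nat_family_hat'[of y n]
  by (intro nat_family_wh[where G = "hfun (hsrc0 n y)"]) auto

lemma hwh_cell_11 [simp]:
  "\<lbrakk>x \<in> hcells B C 1; y \<in> hcells B C 1; htgt x = hsrc y\<rbrakk> \<Longrightarrow> hwh B C 1 1 x y \<in> hcells B C 1"
  using hcells_SucI[of 0 "hsrc x" "htgt y" "\<lambda>X. wh C 1 1 (hat x X) (hat y X)"]
    nat_family_hwh[of x 1 y 1] by (simp add: hwh.simps[of B C 1 1])

lemma hwh_cell_12 [simp]:
  "\<lbrakk>x \<in> hcells B C 1; y \<in> hcells B C 2; htgt x = hsrc (hsrc y)\<rbrakk> \<Longrightarrow> hwh B C 1 2 x y \<in> hcells B C 2"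
  using hcells_SucI[of 1 "hwh B C 1 1 x (hsrc y)" "hwh B C 1 1 x (htgt y)" "\<lambda>X. wh C 1 2 (hat x X) (hat y X)"]
    nat_family_hwh[of x 1 y 2] by (simp add: hwh.simps[of B C 1 2])

lemma hwh_cell_21 [simp]:
  "\<lbrakk>x \<in> hcells B C 2; y \<in> hcells B C 1; htgt (htgt x) = hsrc y\<rbrakk> \<Longrightarrow> hwh B C 2 1 x y \<in> hcells B C 2"
  using hcells_SucI[of 1 "hwh B C 1 1 (hsrc x) y" "hwh B C 1 1 (htgt x) y" "\<lambda>X. wh C 2 1 (hat x X) (hat y X)"]
    nat_family_hwh[of x 2 y 1] by (simp add: hwh.simps[of B C 2 1])

lemma hwh_cell_13 [simp]:
  "\<lbrakk>x \<in> hcells B C 1; y \<in> hcells B C 3; htgt x = hsrc (hsrc (hsrc y))\<rbrakk> \<Longrightarrow> hwh B C 1 3 x y \<in> hcells B C 3"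
  using hcells_SucI[of 2 "hwh B C 1 2 x (hsrc y)" "hwh B C 1 2 x (htgt y)" "\<lambda>X. wh C 1 3 (hat x X) (hat y X)"]
    nat_family_hwh[of x 1 y 3] by (simp add: hwh.simps[of B C 1 3])

lemma hwh_cell_31 [simp]:
  "\<lbrakk>x \<in> hcells B C 3; y \<in> hcells B C 1; htgt (htgt (htgt x)) = hsrc y\<rbrakk> \<Longrightarrow> hwh B C 3 1 x y \<in> hcells B C 3"
  using hcells_SucI[of 2 "hwh B C 2 1 (hsrc x) y" "hwh B C 2 1 (htgt x) y" "\<lambda>X. wh C 3 1 (hat x X) (hat y X)"]
    nat_family_hwh[of x 3 y 1] by (simp add: hwh.simps[of B C 3 1])

lemma hcomp2: "\<lbrakk>x \<in> hcells B C 2; y \<in> hcells B C 2; htgt x = hsrc y\<rbrakk> \<Longrightarrow>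
    hsrc (hsrc y) = hsrc (hsrc x) \<and> htgt (htgt x) = htgt (htgt y)"
  by (metis hcell_globular(1,2))

lemma hcomp3: "\<lbrakk>x \<in> hcells B C 3; y \<in> hcells B C 3; htgt (htgt x) = hsrc (hsrc y)\<rbrakk> \<Longrightarrow>
    hsrc (hsrc (hsrc y)) = hsrc (hsrc (hsrc x)) \<and> htgt (htgt (htgt x)) = htgt (htgt (htgt y))"
  by (metis hcell_globular hcell_boundary(5,6))

lemma hvcomp3: "\<lbrakk>x \<in> hcells B C 3; y \<in> hcells B C 3; htgt x = hsrc y\<rbrakk> \<Longrightarrow>
    hsrc (hsrc y) = hsrc (hsrc x) \<and> htgt (htgt x) = htgt (htgt y) \<and>
    hsrc (hsrc (hsrc y)) = hsrc (hsrc (hsrc x)) \<and> htgt (htgt (htgt x)) = htgt (htgt (htgt y))"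
  by (metis hcell_globular(3,4))

lemma hhor2_cell [simp]:
  "\<lbrakk>x \<in> hcells B C 2; y \<in> hcells B C 2; htgt x = hsrc y\<rbrakk> \<Longrightarrow> hhor B C 2 x y \<in> hcells B C 2"
  using hcells_SucI[of 1 "hsrc x" "htgt y" "\<lambda>X. hor C 2 (hat x X) (hat y X)"] hcomp2[of x y]
    nat_family_hor2[OF _ _ nat_family_hat(2)[of x], of "hat y"] nat_family_hat(2)[of y]
  by (simp add: hhor_def)

lemma hhor3_cell [simp]:
  assumes "x \<in> hcells B C 3" "y \<in> hcells B C 3" "htgt (htgt x) = hsrc (hsrc y)"
  shows "hhor B C 3 x y \<in> hcells B C 3"
proof -
  have "hhor B C 3 x y = HCell (hhor B C 2 (hsrc x) (hsrc y)) (hhor B C 2 (htgt x) (htgt y))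
      (restrict (\<lambda>X. hor C 3 (hat x X) (hat y X)) (cell B 0))"
    by (simp add: hhor_def Let_def)
  then show ?thesis
    using assms hcells_SucI[of 2 "hhor B C 2 (hsrc x) (hsrc y)" "hhor B C 2 (htgt x) (htgt y)" "\<lambda>X. hor C 3 (hat x
        X) (hat y X)"]
      hcomp3[of x y] nat_family_hor3[OF _ _ nat_family_hat(3)[of x], of "hat y"] nat_family_hat(3)[of y]
    by simp
qed

lemma hver_cell [simp]:
  "\<lbrakk>x \<in> hcells B C 3; y \<in> hcells B C 3; htgt x = hsrc y\<rbrakk> \<Longrightarrow> hver B C x y \<in> hcells B C 3"
  using hcells_SucI[of 2 "hsrc x" "htgt y" "\<lambda>X. ver C (hat x X) (hat y X)"]
    hvcomp3[of x y] nat_family_ver[OF _ _ nat_family_hat(3)[of x], of "hat y"] nat_family_hat(3)[of y]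
  by (simp add: hver_def)

lemma hich_cell [simp]:
  "\<lbrakk>x \<in> hcells B C 2; y \<in> hcells B C 2; htgt (htgt x) = hsrc (hsrc y)\<rbrakk> \<Longrightarrow> hich B C x y \<in> hcells B C 3"
  using hcells_SucI[of 2 "hhor B C 2 (hwh B C 2 1 x (hsrc y)) (hwh B C 1 2 (htgt x) y)"
      "hhor B C 2 (hwh B C 1 2 (hsrc x) y) (hwh B C 2 1 x (htgt y))" "\<lambda>X. ich C (hat x X) (hat y X)"]
    nat_family_ich[OF _ _ _ nat_family_hat(2)[of x], of "hfun (htgt (htgt y))" "hat y"] nat_family_hat(2)[of y]
  by (simp add: hich_def)

text \<open>Inverses are chosen component by component, and \<open>nat_family_inverse3\<close> shows
  that the resulting family is a perturbation between the exchanged boundaries.\<close>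

lemma hich_inverse:
  assumes "x \<in> hcells B C 2" "y \<in> hcells B C 2" "htgt (htgt x) = hsrc (hsrc y)"
  shows "\<exists>k. inverse3 (gray_hom B C) (hich B C x y) k"
proof -
  let ?i = "hich B C x y"
  have i: "?i \<in> hcells B C 3" using assms by simp
  have "\<forall>X\<in>cell B 0. \<exists>k. inverse3 C (hat ?i X) k"
    using assms by (auto intro!: C.ich_inverse3)
  then obtain k where k: "inverse3 C (hat ?i X) (k X)" if "X \<in> cell B 0" for X
    by metis
  let ?k = "HCell (htgt ?i) (hsrc ?i) (restrict k (cell B 0))"
  have "nat_family B C 3 (hfun (hsrc (hsrc (hsrc ?i)))) (hfun (htgt (htgt (htgt ?i)))) k"
    using i k assms by (intro nat_family_inverse3[OF _ _ nat_family_hat(3)[OF i]]) simp_all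
  moreover have "src C 2 (k X) = hat (htgt ?i) X \<and> tgt C 2 (k X) = hat (hsrc ?i) X" if "X \<in> cell B 0" for X
    using k[OF that] hat_boundary(5,6)[OF that i] by (simp add: inverse3_def)
  ultimately have kc: "?k \<in> hcells B C 3"
    using hcells_SucI[of 2 "htgt ?i" "hsrc ?i" k] i hcell_globular(3,4)[OF i] hcell_boundary(5,6)[OF i] by (simp
        del: hop_simps)
  \<comment> \<open>The rules unfolding \<open>hich\<close> are switched off, since \<open>k\<close>
    is known only as the inverse of the component of \<open>?i\<close> as a whole.\<close>
  have "hver B C ?i ?k = hidt B C 2 (hsrc ?i)"
    by (rule hcell_eqI[where n = 3]) (use i kc k hcell_globular(3,4)[OF i] hcell_boundary(5,6)[OF i]
        hat_boundary(5,6)[OF _ i] in \<open>simp_all del: hop_simps(23-25) add: inverse3_def\<close>)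
  moreover have "hver B C ?k ?i = hidt B C 2 (hsrc ?k)"
    by (rule hcell_eqI[where n = 3]) (use i kc k hcell_globular(3,4)[OF i] hcell_boundary(5,6)[OF i]
        hat_boundary(5,6)[OF _ i] in \<open>simp_all del: hop_simps(23-25) add: inverse3_def\<close>)
  ultimately show ?thesis using i kc unfolding inverse3_def by (intro exI[of _ ?k]) simp
qed

lemma hwh_assoc_simps:
  "\<lbrakk>x \<in> hcells B C 1; y \<in> hcells B C 1; z \<in> hcells B C 1; htgt x = hsrc y; htgt y = hsrc z\<rbrakk> \<Longrightarrow>
    hwh B C 1 1 (hwh B C 1 1 x y) z = hwh B C 1 1 x (hwh B C 1 1 y z)"
  "\<lbrakk>x \<in> hcells B C 2; y \<in> hcells B C 1; z \<in> hcells B C 1; htgt (htgt x) = hsrc y; htgt y = hsrc z\<rbrakk> \<Longrightarrow>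
    hwh B C 2 1 (hwh B C 2 1 x y) z = hwh B C 2 1 x (hwh B C 1 1 y z)"
  "\<lbrakk>x \<in> hcells B C 1; y \<in> hcells B C 2; z \<in> hcells B C 1; htgt x = hsrc (hsrc y); htgt (htgt y) = hsrc z\<rbrakk> \<Longrightarrow>
    hwh B C 2 1 (hwh B C 1 2 x y) z = hwh B C 1 2 x (hwh B C 2 1 y z)"
  "\<lbrakk>x \<in> hcells B C 1; y \<in> hcells B C 1; z \<in> hcells B C 2; htgt x = hsrc y; htgt y = hsrc (hsrc z)\<rbrakk> \<Longrightarrow>
    hwh B C 1 2 (hwh B C 1 1 x y) z = hwh B C 1 2 x (hwh B C 1 2 y z)"
  "\<lbrakk>x \<in> hcells B C 3; y \<in> hcells B C 1; z \<in> hcells B C 1; htgt (htgt (htgt x)) = hsrc y; htgt y = hsrc z\<rbrakk> \<Longrightarrow>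
    hwh B C 3 1 (hwh B C 3 1 x y) z = hwh B C 3 1 x (hwh B C 1 1 y z)"
  "\<lbrakk>x \<in> hcells B C 1; y \<in> hcells B C 3; z \<in> hcells B C 1; htgt x = hsrc (hsrc (hsrc y)); htgt (htgt (htgt y)) = hsrc
      z\<rbrakk> \<Longrightarrow>
    hwh B C 3 1 (hwh B C 1 3 x y) z = hwh B C 1 3 x (hwh B C 3 1 y z)"
  "\<lbrakk>x \<in> hcells B C 1; y \<in> hcells B C 1; z \<in> hcells B C 3; htgt x = hsrc y; htgt y = hsrc (hsrc (hsrc z))\<rbrakk> \<Longrightarrow>
    hwh B C 1 3 (hwh B C 1 1 x y) z = hwh B C 1 3 x (hwh B C 1 3 y z)"
  subgoal by (rule hcell_eqI[where n = 1]) (simp_all add: C.wh_assoc_simps)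
  subgoal by (rule hcell_eqI[where n = 2]) (simp_all add: C.wh_assoc_simps)
  subgoal by (rule hcell_eqI[where n = 2]) (simp_all add: C.wh_assoc_simps)
  subgoal by (rule hcell_eqI[where n = 2]) (simp_all add: C.wh_assoc_simps)
  subgoal by (rule hcell_eqI[where n = 3]) (simp_all add: C.wh_assoc_simps)
  subgoal by (rule hcell_eqI[where n = 3]) (simp_all add: C.wh_assoc_simps)
  subgoal by (rule hcell_eqI[where n = 3]) (simp_all add: C.wh_assoc_simps)
  done

text \<open>The unit laws of \<open>C\<close> in the shape in which \<open>hat_boundary\<close>
  leaves them, where the boundary of a component has already become a component of the boundary. The
  lemma \<open>hat_ich_nat\<close> does the same for the naturality of interchange.\<close>

lemma hat_units:
  assumes X: "X \<in> cell B 0"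
  shows "x \<in> hcells B C 2 \<Longrightarrow> hor C 2 (idt C 1 (hat (hsrc x) X)) (hat x X) = hat x X"
    "x \<in> hcells B C 2 \<Longrightarrow> hor C 2 (hat x X) (idt C 1 (hat (htgt x) X)) = hat x X"
    "x \<in> hcells B C 3 \<Longrightarrow> hor C 3 (idt C 2 (idt C 1 (hat (hsrc (hsrc x)) X))) (hat x X) = hat x X"
    "x \<in> hcells B C 3 \<Longrightarrow> hor C 3 (hat x X) (idt C 2 (idt C 1 (hat (htgt (htgt x)) X))) = hat x X"
    "x \<in> hcells B C 3 \<Longrightarrow> ver C (idt C 2 (hat (hsrc x) X)) (hat x X) = hat x X"
    "x \<in> hcells B C 3 \<Longrightarrow> ver C (hat x X) (idt C 2 (hat (htgt x) X)) = hat x X"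
    "x \<in> hcells B C 1 \<Longrightarrow> wh C 1 1 (idt C 0 (hat (hsrc x) X)) (hat x X) = hat x X"
    "x \<in> hcells B C 2 \<Longrightarrow> wh C 1 2 (idt C 0 (hat (hsrc (hsrc x)) X)) (hat x X) = hat x X"
    "x \<in> hcells B C 3 \<Longrightarrow> wh C 1 3 (idt C 0 (hat (hsrc (hsrc (hsrc x))) X)) (hat x X) = hat x X"
    "x \<in> hcells B C 1 \<Longrightarrow> wh C 1 1 (hat x X) (idt C 0 (hat (htgt x) X)) = hat x X"
    "x \<in> hcells B C 2 \<Longrightarrow> wh C 2 1 (hat x X) (idt C 0 (hat (htgt (htgt x)) X)) = hat x X"
    "x \<in> hcells B C 3 \<Longrightarrow> wh C 3 1 (hat x X) (idt C 0 (hat (htgt (htgt (htgt x))) X)) = hat x X"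
  using C.hor2_idt_left[of "hat x X"] C.hor2_idt_right[of "hat x X"] C.hor3_idt_left[of "hat x X"]
    C.hor3_idt_right[of "hat x X"] C.ver_idt_left[of "hat x X"] C.ver_idt_right[of "hat x X"]
    C.wh_unit_left[of "hat x X" 1] C.wh_unit_left[of "hat x X" 2] C.wh_unit_left[of "hat x X" 3]
    C.wh_unit_right[of "hat x X" 1] C.wh_unit_right[of "hat x X" 2] C.wh_unit_right[of "hat x X" 3] X
  by (simp_all del: C.wh_unit_simps)

lemma hat_ich_nat:
  assumes X: "X \<in> cell B 0"
  shows "\<lbrakk>x \<in> hcells B C 3; y \<in> hcells B C 2; htgt (htgt (htgt x)) = hsrc (hsrc y)\<rbrakk> \<Longrightarrow>
    ver C (hor C 3 (wh C 3 1 (hat x X) (hat (hsrc y) X)) (idt C 2 (wh C 1 2 (hat (htgt (htgt x)) X) (hat y X))))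
      (ich C (hat (htgt x) X) (hat y X)) =
    ver C (ich C (hat (hsrc x) X) (hat y X))
      (hor C 3 (idt C 2 (wh C 1 2 (hat (hsrc (hsrc x)) X) (hat y X))) (wh C 3 1 (hat x X) (hat (htgt y) X)))"
    "\<lbrakk>x \<in> hcells B C 2; y \<in> hcells B C 3; htgt (htgt x) = hsrc (hsrc (hsrc y))\<rbrakk> \<Longrightarrow>
    ver C (hor C 3 (idt C 2 (wh C 2 1 (hat x X) (hat (hsrc (hsrc y)) X))) (wh C 1 3 (hat (htgt x) X) (hat y X)))
      (ich C (hat x X) (hat (htgt y) X)) =
    ver C (ich C (hat x X) (hat (hsrc y) X))
      (hor C 3 (wh C 1 3 (hat (hsrc x) X) (hat y X)) (idt C 2 (wh C 2 1 (hat x X) (hat (htgt (htgt y)) X))))"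
  using C.ich_nat_left[of "hat x X" "hat y X"] C.ich_nat_right[of "hat x X" "hat y X"] X
  by simp_all

lemma hhor2_assoc:
  "\<lbrakk>x \<in> hcells B C 2; y \<in> hcells B C 2; z \<in> hcells B C 2; htgt x = hsrc y; htgt y = hsrc z\<rbrakk> \<Longrightarrow>
    hhor B C 2 (hhor B C 2 x y) z = hhor B C 2 x (hhor B C 2 y z)"
  by (insert hcomp2[of x y] hcomp2[of y z], rule hcell_eqI[where n = 2]) (simp_all add: C.hor2_assoc)

text \<open>Closure under the operations is closure of natural families. Every equation is reduced
  by \<open>hcell_eqI\<close> to equal end functors and to the same law for the components in
  \<open>C\<close>.\<close>

theorem gray_hom_cat: "gray_cat (gray_hom B C)"
proof -
  have cases3: "n = 0 \<or> n = 1 \<or> n = 2 \<or> n = 3" if "x \<in> hcells B C n" for x n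
    using that by (cases "n \<le> 3") (auto simp: hcells_def)
  show ?thesis
    apply (rule gray_cat.intro; (unfold gray_hom_simps bd_gray_hom)?)
    subgoal for x n by (cases "n \<le> 3") (simp_all add: hcells_def)
    subgoal for x n using hcells_SucD(1) by simp
    subgoal for x n using hcells_SucD(2) by simp
    subgoal for x n using hcells_SucD(1)[of x "Suc n"] hcells_SucD(3)[of x "Suc n"] by simp
    subgoal for x n using hcells_SucD(1)[of x "Suc n"] hcells_SucD(4)[of x "Suc n"] by simp
    subgoal for x n using less_3_cases[of n] by auto
    subgoal by simp
    subgoal by simp
    subgoal by simp
    subgoal by simp
    subgoal by simp
    subgoal by simp
    subgoal by simp
    subgoal by simp
    subgoal by (rule hhor2_assoc)
    subgoal for x y z by (insert hcomp3[of x y] hcomp3[of y z], rule hcell_eqI[where n = 3]) (simp_all add: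
        C.hor3_assoc)
    subgoal by (rule hcell_eqI[where n = 2]) (simp_all add: hat_units)
    subgoal by (rule hcell_eqI[where n = 2]) (simp_all add: hat_units)
    subgoal by (rule hcell_eqI[where n = 3]) (simp_all add: hat_units)
    subgoal by (rule hcell_eqI[where n = 3]) (simp_all add: hat_units)
    subgoal by simp
    subgoal by simp
    subgoal by simp
    subgoal for x y z by (insert hvcomp3[of x y] hvcomp3[of y z], rule hcell_eqI[where n = 3]) (simp_all add:
        C.ver_assoc)
    subgoal by (rule hcell_eqI[where n = 3]) (simp_all add: hat_units)
    subgoal by (rule hcell_eqI[where n = 3]) (simp_all add: hat_units)
    subgoal for x y by (insert hcomp2[of x y], rule hcell_eqI[where n = 3]) (simp_all add: C.hor_idt)
    subgoal for x x' y y' by (insert hcomp3[of x y] hvcomp3[of x x'] hvcomp3[of y y'], rule hcell_eqI[where n = 3])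
        (simp_all add: C.hor_ver)
    subgoal for x m y n using cases3[of x m] cases3[of y n] by auto
    subgoal by simp
    subgoal by simp
    subgoal for x y n using cases3[of y "Suc n"] by auto
    subgoal for x y n using cases3[of y "Suc n"] by auto
    subgoal for x n y using cases3[of x "Suc n"] by auto
    subgoal for x n y using cases3[of x "Suc n"] by auto
    subgoal for f y n by (rule hcell_eqI[where n = "Suc n"]; force)
    subgoal for x n f by (rule hcell_eqI[where n = "Suc n"]; force)
    subgoal for f y y' by (insert hcomp2[of y y'], rule hcell_eqI[where n = 2]) (simp_all add: C.wh_hor2_left)
    subgoal for f x x' by (insert hcomp2[of x x'], rule hcell_eqI[where n = 2]) (simp_all add: C.wh_hor2_right)
    subgoal for f y y' by (insert hcomp3[of y y'], rule hcell_eqI[where n = 3]) (simp_all add: C.wh_hor3_left)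
    subgoal for f x x' by (insert hcomp3[of x x'], rule hcell_eqI[where n = 3]) (simp_all add: C.wh_hor3_right)
    subgoal for f y y' by (insert hvcomp3[of y y'], rule hcell_eqI[where n = 3]) (simp_all add: C.wh_ver_left)
    subgoal for f x x' by (insert hvcomp3[of x x'], rule hcell_eqI[where n = 3]) (simp_all add: C.wh_ver_right)
    subgoal for x n by (insert cases3[of x n], rule hcell_eqI[where n = n]; auto simp: hat_units)
    subgoal for x n by (insert cases3[of x n], rule hcell_eqI[where n = n]; auto simp: hat_units)
    subgoal for x l y m z n
      using cases3[of x l] cases3[of y m] cases3[of z n]
      by (auto simp: hwh_assoc_simps)
    subgoal by simp
    subgoal by simp
    subgoal by simp
    subgoal for x y using hich_inverse[of x y] unfolding inverse3_def by auto
    subgoal for x y by (rule hcell_eqI[where n = 3]) (simp_all add: hat_ich_nat)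
    subgoal for x y by (rule hcell_eqI[where n = 3]) (simp_all add: hat_ich_nat)
    subgoal for f y by (rule hcell_eqI[where n = 3]) (simp_all add: C.ich_idt_left)
    subgoal for x g by (rule hcell_eqI[where n = 3]) (simp_all add: C.ich_idt_right)
    subgoal for x x' y by (insert hcomp2[of x x'], rule hcell_eqI[where n = 3]) (simp_all add: C.ich_hor_left
        hhor2_assoc)
    subgoal for x y y' by (insert hcomp2[of y y'], rule hcell_eqI[where n = 3]) (simp_all add: C.ich_hor_right
        hhor2_assoc)
    subgoal for f x y by (rule hcell_eqI[where n = 3]) (simp_all add: C.ich_wh_left)
    subgoal for x f y by (rule hcell_eqI[where n = 3]) (simp_all add: C.ich_wh_mid)
    subgoal for x y f by (rule hcell_eqI[where n = 3]) (simp_all add: C.ich_wh_right)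
    done
qed

end

section \<open>Quasi-functors\<close>

lemma gray_pairI: "gray_cat B \<Longrightarrow> gray_cat C \<Longrightarrow> gray_pair B C"
  by (simp add: gray_pair_def)

lemma gray_cat_hom: "gray_cat B \<Longrightarrow> gray_cat C \<Longrightarrow> gray_cat (gray_hom B C)"
  by (rule gray_pair.gray_hom_cat[OF gray_pairI])

text \<open>Quasi-functors unpacked in \<open>C\<close>. The last two conditions say that cells of
  \<open>A\<close> act as transformations, modifications and perturbations, in a form that treats
  the two variables alike and mirrors the relations \<open>Gen_nat\<close> and
  \<open>Gen_ich\<close>.\<close>

locale gray_quasi = A: gray_cat A + B: gray_cat B + C: gray_cat C
  for A :: "'a gray" and B :: "'b gray" and C :: "'c gray" +
  fixes H :: "nat \<Rightarrow> nat \<Rightarrow> 'a \<Rightarrow> 'b \<Rightarrow> 'c"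
  assumes right: "X \<in> cell A 0 \<Longrightarrow> gray_functor B C (\<lambda>n. restrict (H 0 n X) (cell B n))"
    and left: "Y \<in> cell B 0 \<Longrightarrow> gray_functor A C (\<lambda>m. restrict (\<lambda>x. H m 0 x Y) (cell A m))"
    and quasi_wh: "\<lbrakk>x \<in> cell A m; y \<in> cell B n; m \<ge> 1; n \<ge> 1; m = 1 \<or> n = 1\<rbrakk> \<Longrightarrow>
      wh C m n (H m 0 x (src0 B n y)) (H 0 n (tgt0 A m x) y) =
      wh C n m (H 0 n (src0 A m x) y) (H m 0 x (tgt0 B n y))"
    and quasi_ich: "a \<in> cell A 2 \<Longrightarrow> b \<in> cell B 2 \<Longrightarrow>
      inverse3 C (ich C (H 2 0 a (src0 B 2 b)) (H 0 2 (tgt0 A 2 a) b))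
        (ich C (H 0 2 (src0 A 2 a) b) (H 2 0 a (tgt0 B 2 b)))"
begin

text \<open>One condition is an equation read backwards, and being inverse is a symmetric relation.
  Here it matters that the type of strict cells is its own opposite.\<close>

lemma swap: "gray_quasi B A C (\<lambda>m n x y. H n m y x)"
  apply (intro gray_quasi.intro gray_quasi_axioms.intro)
  subgoal by (rule B.gray_cat_axioms)
  subgoal by (rule A.gray_cat_axioms)
  subgoal by (rule C.gray_cat_axioms)
  subgoal by (rule left)
  subgoal by (rule right)
  subgoal for x m y n by (rule quasi_wh[symmetric]) auto
  subgoal by (rule C.inverse3_sym[OF quasi_ich])
  done

text \<open>A strict functor preserves whiskering, interchange and inverse pairs, hence both mixed
  conditions. Currying a functor on a tensor product is the case where \<open>H\<close> is the
  universal quasi-functor.\<close>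

lemma post:
  assumes "gray_functor C D K"
  shows "gray_quasi A B D (\<lambda>m n x y. K (m + n) (H m n x y))"
proof -
  interpret K: gray_functor C D K by fact
  have 1: "gray_functor B D (\<lambda>n. restrict (\<lambda>y. K (0 + n) (H 0 n X y)) (cell B n))" if "X \<in> cell A 0" for X
  proof -
    have "gray_comp B (\<lambda>n. restrict (H 0 n X) (cell B n)) K = (\<lambda>n. restrict (\<lambda>y. K (0 + n) (H 0 n X y)) (cell B n))"
      by (simp add: gray_comp_def fun_eq_iff restrict_def)
    then show ?thesis using gray_functor_comp[OF right[OF that] assms] by simp
  qed
  have 2: "gray_functor A D (\<lambda>m. restrict (\<lambda>x. K (m + 0) (H m 0 x Y)) (cell A m))" if "Y \<in> cell B 0" for Y
  proof -
    have "gray_comp A (\<lambda>m. restrict (\<lambda>x. H m 0 x Y) (cell A m)) K = (\<lambda>m. restrict (\<lambda>x. K (m + 0) (H m 0 x Y)) (cell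
        A m))"
      by (simp add: gray_comp_def fun_eq_iff restrict_def)
    then show ?thesis using gray_functor_comp[OF left[OF that] assms] by simp
  qed
  have c: "H 0 n X y \<in> cell C n" "src0 C n (H 0 n X y) = H 0 0 X (src0 B n y)" "tgt0 C n (H 0 n X y) = H 0 0 X (tgt0
      B n y)"
    if "X \<in> cell A 0" "y \<in> cell B n" for X n y
    using gray_functor.map_cell[OF right, of X y n] gray_functor.map_src0[OF right, of X y n]
      gray_functor.map_tgt0[OF right, of X y n] that B.src0_cell B.tgt0_cell by auto
  have d: "H m 0 x Y \<in> cell C m" "src0 C m (H m 0 x Y) = H 0 0 (src0 A m x) Y" "tgt0 C m (H m 0 x Y) = H 0 0 (tgt0 A
      m x) Y"
    if "Y \<in> cell B 0" "x \<in> cell A m" for x m Y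
    using gray_functor.map_cell[OF left, of Y x m] gray_functor.map_src0[OF left, of Y x m]
      gray_functor.map_tgt0[OF left, of Y x m] that A.src0_cell A.tgt0_cell by auto
  have 3: "wh D m n (K m (H m 0 x (src0 B n y))) (K n (H 0 n (tgt0 A m x) y)) =
      wh D n m (K n (H 0 n (src0 A m x) y)) (K m (H m 0 x (tgt0 B n y)))"
    if "x \<in> cell A m" "y \<in> cell B n" "m \<ge> 1" "n \<ge> 1" "m = 1 \<or> n = 1" for x y m n
  proof -
    have "K (m + n - 1) (wh C m n (H m 0 x (src0 B n y)) (H 0 n (tgt0 A m x) y)) =
      K (n + m - 1) (wh C n m (H 0 n (src0 A m x) y) (H m 0 x (tgt0 B n y)))"
      using quasi_wh[OF that] by (simp add: add.commute)
    moreover have "K (m + n - 1) (wh C m n (H m 0 x (src0 B n y)) (H 0 n (tgt0 A m x) y)) =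
       wh D m n (K m (H m 0 x (src0 B n y))) (K n (H 0 n (tgt0 A m x) y))"
      using that c d A.src0_cell A.tgt0_cell B.src0_cell B.tgt0_cell by (intro K.map_wh) auto
    moreover have "K (n + m - 1) (wh C n m (H 0 n (src0 A m x) y) (H m 0 x (tgt0 B n y))) =
       wh D n m (K n (H 0 n (src0 A m x) y)) (K m (H m 0 x (tgt0 B n y)))"
      using that c d A.src0_cell A.tgt0_cell B.src0_cell B.tgt0_cell by (intro K.map_wh) auto
    ultimately show ?thesis by simp
  qed
  have 4: "inverse3 D (ich D (K 2 (H 2 0 a (src0 B 2 b))) (K 2 (H 0 2 (tgt0 A 2 a) b)))
        (ich D (K 2 (H 0 2 (src0 A 2 a) b)) (K 2 (H 2 0 a (tgt0 B 2 b))))"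
    if "a \<in> cell A 2" "b \<in> cell B 2" for a b
    using K.map_inverse3[OF quasi_ich[OF that]] that c[of _ b 2] d[of _ a 2]
    by simp
  show ?thesis
    apply (intro gray_quasi.intro gray_quasi_axioms.intro)
    subgoal by (rule A.gray_cat_axioms)
    subgoal by (rule B.gray_cat_axioms)
    subgoal by (rule K.B.gray_cat_axioms)
    subgoal by (rule 1)
    subgoal by (rule 2)
    subgoal for x m y n unfolding add_0_left add_0_right by (rule 3)
    subgoal unfolding add_0_left add_0_right by (rule 4)
    done
qed

lemma cells:
  "X \<in> cell A 0 \<Longrightarrow> y \<in> cell B n \<Longrightarrow> H 0 n X y \<in> cell C n"
  "Y \<in> cell B 0 \<Longrightarrow> x \<in> cell A m \<Longrightarrow> H m 0 x Y \<in> cell C m"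
  using gray_functor.map_cell[OF right, of X y n] gray_functor.map_cell[OF left, of Y x m] by auto

end

lemma gray_functor_cong:
  assumes "gray_functor A B F" "\<And>n x. x \<in> cell A n \<Longrightarrow> F n x = G n x" "\<And>n x. x \<notin> cell A n \<Longrightarrow> G n x = undefined"
  shows "gray_functor A B G"
proof -
  have "F = G"
    using assms gray_functor.undef[OF assms(1)] by (intro ext) metis
  then show ?thesis using assms(1) by simp
qed

lemma gray_quasi_cong:
  assumes "gray_quasi A B C H"
    "\<And>n X y. X \<in> cell A 0 \<Longrightarrow> y \<in> cell B n \<Longrightarrow> H 0 n X y = H' 0 n X y"
    "\<And>m x Y. x \<in> cell A m \<Longrightarrow> Y \<in> cell B 0 \<Longrightarrow> H m 0 x Y = H' m 0 x Y"
  shows "gray_quasi A B C H'"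
proof -
  interpret gray_quasi A B C H by fact
  show ?thesis
    apply (intro gray_quasi.intro gray_quasi_axioms.intro)
    subgoal by (rule A.gray_cat_axioms)
    subgoal by (rule B.gray_cat_axioms)
    subgoal by (rule C.gray_cat_axioms)
    subgoal for X by (rule gray_functor_cong[OF right]) (use assms(2)[of X] in auto)
    subgoal for Y by (rule gray_functor_cong[OF left]) (use assms(3)[of _ _ Y] in auto)
    subgoal for x m y n using quasi_wh[of x m y n]
      by (simp add: assms A.src0_cell A.tgt0_cell B.src0_cell B.tgt0_cell)
    subgoal for a b using quasi_ich[of a b] by (simp add: assms)
    done
qed

lemma gray_quasi_pre:
  assumes "gray_quasi A B C H" "gray_functor A' A P" "gray_functor B' B Q"
  shows "gray_quasi A' B' C (\<lambda>m n x y. H m n (P m x) (Q n y))"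
proof -
  interpret gray_quasi A B C H by fact
  interpret P: gray_functor A' A P by fact
  interpret Q: gray_functor B' B Q by fact
  show ?thesis
    apply (intro gray_quasi.intro gray_quasi_axioms.intro)
    subgoal by (rule P.A.gray_cat_axioms)
    subgoal by (rule Q.A.gray_cat_axioms)
    subgoal by (rule C.gray_cat_axioms)
    subgoal for X by (rule gray_functor_cong[OF gray_functor_comp[OF assms(3) right[of "P 0 X"]]])
        (simp_all add: gray_comp_def)
    subgoal for Y by (rule gray_functor_cong[OF gray_functor_comp[OF assms(2) left[of "Q 0 Y"]]])
        (simp_all add: gray_comp_def)
    subgoal for x m y n using quasi_wh[of "P m x" m "Q n y" n] by simp
    subgoal for a b using quasi_ich[of "P 2 a" "Q 2 b"] by simp
    done
qed

section \<open>Transposition between quasi-functors and functors into the inner hom\<close>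

context gray_quasi
begin

abbreviation T where "T \<equiv> transp A B H"

lemma hat_T: "Y \<in> cell B 0 \<Longrightarrow> hat (T m x) Y = H m 0 x Y"
  by (cases m) simp_all

lemma hsrc0_T: "hsrc0 m (T m x) = T 0 (src0 A m x)"
  by (induction m arbitrary: x) simp_all

lemma htgt0_T: "htgt0 m (T m x) = T 0 (tgt0 A m x)"
  by (induction m arbitrary: x) simp_all

text \<open>By induction on the dimension. With \<open>x\<close> fixed, \<open>quasi_wh\<close> and
  \<open>quasi_ich\<close> are the conditions of \<open>nat_family\<close> on the components of the
  transpose, and the functor in the first variable supplies their boundaries.\<close>

lemma T_cell: "x \<in> cell A m \<Longrightarrow> T m x \<in> hcells B C m"
proof (induction m arbitrary: x)
  case 0
  then show ?case using right by (auto simp: hcells_0 gray_functor_iff)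
next
  case (Suc m)
  interpret P: gray_pair B C by unfold_locales
  have F: "gray_functor B C (hfun (hsrc0 m (T m (src A m x))))" "gray_functor B C (hfun (htgt0 m (T m (tgt A m
      x))))"
    using Suc.prems right A.src0_cell A.tgt0_cell A.src_cell A.tgt_cell by (simp_all only: hsrc0_T htgt0_T
        transp.simps hfun.simps)
  have b: "src C m (H (Suc m) 0 x Y) = H m 0 (src A m x) Y \<and> tgt C m (H (Suc m) 0 x Y) = H m 0 (tgt A m x) Y"
    if "Y \<in> cell B 0" for Y
    using gray_functor.map_src[OF left[OF that], of x m] gray_functor.map_tgt[OF left[OF that], of x m] Suc.prems
      A.src_cell A.tgt_cell by simp
  have 0: "hfun (hsrc0 m (T m (src A m x))) n = restrict (H 0 n (src0 A (Suc m) x)) (cell B n)"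
    "hfun (htgt0 m (T m (tgt A m x))) n = restrict (H 0 n (tgt0 A (Suc m) x)) (cell B n)" for n
    by (simp_all add: hsrc0_T htgt0_T)
  have 1: "H (Suc m) 0 x Y \<in> cell C (Suc m) \<and> src0 C (Suc m) (H (Suc m) 0 x Y) = H 0 0 (src0 A (Suc m) x) Y \<and>
     tgt0 C (Suc m) (H (Suc m) 0 x Y) = H 0 0 (tgt0 A (Suc m) x) Y" if "Y \<in> cell B 0" for Y
    using gray_functor.map_src0[OF left[OF that], of x "Suc m"] gray_functor.map_tgt0[OF left[OF that], of x "Suc
        m"]
      gray_functor.map_cell[OF left[OF that], of x "Suc m"]
      Suc.prems A.src0_cell[of x "Suc m"] A.tgt0_cell[of x "Suc m"] by simp
  have "nat_family B C (Suc m) (hfun (hsrc0 m (T m (src A m x)))) (hfun (htgt0 m (T m (tgt A m x)))) (H (Suc m) 0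
      x)"
    unfolding P.nat_family_iff[OF F] 0
    using 1 quasi_wh[OF Suc.prems] quasi_ich[of x] Suc.prems by (auto simp del: bd.simps bd_simps)
  then show ?case
    using Suc A.cell_le[OF Suc.prems] b A.src_cell A.tgt_cell
    by (auto intro!: P.hcells_SucI simp: hat_T) (cases m; simp add: A.src_tgt A.tgt_src)+
qed

lemma T_boundary:
  "hsrc (T 1 x) = T 0 (src A 0 x)" "htgt (T 1 x) = T 0 (tgt A 0 x)"
  "hsrc (T 2 x) = T 1 (src A 1 x)" "htgt (T 2 x) = T 1 (tgt A 1 x)"
  "hsrc (T 3 x) = T 2 (src A 2 x)" "htgt (T 3 x) = T 2 (tgt A 2 x)"
  using transp.simps(2)[of A B H 0 x] transp.simps(2)[of A B H 1 x] transp.simps(2)[of A B H 2 x]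
  by (simp_all del: transp.simps)

lemma T_cells: "x \<in> cell A 0 \<Longrightarrow> T 0 x \<in> hcells B C 0" "x \<in> cell A 1 \<Longrightarrow> T 1 x \<in> hcells B C 1"
  "x \<in> cell A 2 \<Longrightarrow> T 2 x \<in> hcells B C 2" "x \<in> cell A 3 \<Longrightarrow> T 3 x \<in> hcells B C 3"
  by (simp_all only: T_cell)

text \<open>The laws of the functor in \<open>left\<close>, freed from its restriction to cells. The
  laws in the other variable follow by applying this to the quasi-functor with exchanged
  variables.\<close>

lemma left_simps:
  assumes Y: "Y \<in> cell B 0"
  shows "x \<in> cell A n \<Longrightarrow> n < 3 \<Longrightarrow> H (Suc n) 0 (idt A n x) Y = idt C n (H n 0 x Y)"
    "\<lbrakk>x \<in> cell A m; y \<in> cell A n; m \<ge> 1; n \<ge> 1; m = 1 \<or> n = 1; tgt0 A m x = src0 A n y\<rbrakk> \<Longrightarrow> H (m + n - 1) 0 (wh A m n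
        x y) Y = wh C m n (H m 0 x Y) (H n 0 y Y)"
    "\<lbrakk>x \<in> cell A 2; y \<in> cell A 2; tgt A 1 x = src A 1 y\<rbrakk> \<Longrightarrow>
      H 2 0 (hor A 2 x y) Y = hor C 2 (H 2 0 x Y) (H 2 0 y Y)"
    "\<lbrakk>x \<in> cell A 3; y \<in> cell A 3; tgt A 1 (tgt A 2 x) = src A 1 (src A 2 y)\<rbrakk> \<Longrightarrow>
      H 3 0 (hor A 3 x y) Y = hor C 3 (H 3 0 x Y) (H 3 0 y Y)"
    "\<lbrakk>x \<in> cell A 3; y \<in> cell A 3; tgt A 2 x = src A 2 y\<rbrakk> \<Longrightarrow>
      H 3 0 (ver A x y) Y = ver C (H 3 0 x Y) (H 3 0 y Y)"
    "\<lbrakk>x \<in> cell A 2; y \<in> cell A 2; tgt0 A 2 x = src0 A 2 y\<rbrakk> \<Longrightarrow>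
      H 3 0 (ich A x y) Y = ich C (H 2 0 x Y) (H 2 0 y Y)"
proof -
  interpret L: gray_functor A C "\<lambda>m. restrict (\<lambda>x. H m 0 x Y) (cell A m)" by (rule left[OF Y])
  show "x \<in> cell A n \<Longrightarrow> n < 3 \<Longrightarrow> H (Suc n) 0 (idt A n x) Y = idt C n (H n 0 x Y)"
    using L.map_idt[of x n] A.idt_cell[of x n] by simp
  show "\<lbrakk>x \<in> cell A m; y \<in> cell A n; m \<ge> 1; n \<ge> 1; m = 1 \<or> n = 1; tgt0 A m x = src0 A n y\<rbrakk> \<Longrightarrow> H (m + n - 1) 0 (wh A m
      n x y) Y = wh C m n (H m 0 x Y) (H n 0 y Y)"
    using L.map_wh[of x m y n] A.wh_cell[of x m y n] by simp
  show "\<lbrakk>x \<in> cell A 2; y \<in> cell A 2; tgt A 1 x = src A 1 y\<rbrakk> \<Longrightarrow>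
      H 2 0 (hor A 2 x y) Y = hor C 2 (H 2 0 x Y) (H 2 0 y Y)"
    using L.map_hor2[of x y] by simp
  show "\<lbrakk>x \<in> cell A 3; y \<in> cell A 3; tgt A 1 (tgt A 2 x) = src A 1 (src A 2 y)\<rbrakk> \<Longrightarrow>
      H 3 0 (hor A 3 x y) Y = hor C 3 (H 3 0 x Y) (H 3 0 y Y)"
    using L.map_hor3[of x y] by simp
  show "\<lbrakk>x \<in> cell A 3; y \<in> cell A 3; tgt A 2 x = src A 2 y\<rbrakk> \<Longrightarrow>
      H 3 0 (ver A x y) Y = ver C (H 3 0 x Y) (H 3 0 y Y)"
    using L.map_ver[of x y] by simp
  show "\<lbrakk>x \<in> cell A 2; y \<in> cell A 2; tgt0 A 2 x = src0 A 2 y\<rbrakk> \<Longrightarrow>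
      H 3 0 (ich A x y) Y = ich C (H 2 0 x Y) (H 2 0 y Y)"
    using L.map_ich[of x y] by simp
qed

text \<open>Both sides of each law are cells of the inner hom with the same end functors, so
  \<open>hcell_eqI\<close> leaves only the component at an object \<open>Y\<close>, where the law is
  that of the functor in the first variable.\<close>

theorem transpose_functor: "gray_functor A (gray_hom B C) (transpose A B H)"
proof -
  interpret P: gray_pair B C by unfold_locales
  interpret HC: gray_cat "gray_hom B C" by (rule P.gray_hom_cat)
  have 0: "T (Suc n) (idt A n x) = hidt B C n (T n x)" if "x \<in> cell A n" "n < 3" for x n
  proof (rule P.hcell_eqI[where n = "Suc n"])
    show "T (Suc n) (idt A n x) \<in> hcells B C (Suc n)" using that by (intro T_cell A.idt_cell)
    show "hidt B C n (T n x) \<in> hcells B C (Suc n)" using HC.idt_cell[of "T n x" n] that T_cell by simp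
  qed (use that A.idt_cell left_simps(1) in \<open>simp_all add: A.src_idt A.tgt_idt hat_T\<close>)
  have 1: "T (m + n - 1) (wh A m n x y) = hwh B C m n (T m x) (T n y)"
    if "x \<in> cell A m" "y \<in> cell A n" "m \<ge> 1" "n \<ge> 1" "m = 1 \<or> n = 1" "tgt0 A m x = src0 A n y" for x y m n
  proof (rule P.hcell_eqI[where n = "m + n - 1"])
    show "T (m + n - 1) (wh A m n x y) \<in> hcells B C (m + n - 1)" using that by (intro T_cell A.wh_cell)
    show "hwh B C m n (T m x) (T n y) \<in> hcells B C (m + n - 1)"
      using HC.wh_cell[of "T m x" m "T n y" n] that T_cell by (simp add: hsrc0_T htgt0_T del: transp.simps)
    show "hsrc0 (m + n - 1) (T (m + n - 1) (wh A m n x y)) = hsrc0 (m + n - 1) (hwh B C m n (T m x) (T n y))"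
      using HC.src0_wh[of "T m x" m "T n y" n] A.src0_wh that T_cell by (simp add: hsrc0_T htgt0_T del:
          transp.simps)
    show "htgt0 (m + n - 1) (T (m + n - 1) (wh A m n x y)) = htgt0 (m + n - 1) (hwh B C m n (T m x) (T n y))"
      using HC.tgt0_wh[of "T m x" m "T n y" n] A.tgt0_wh that T_cell by (simp add: hsrc0_T htgt0_T del:
          transp.simps)
  qed (use that left_simps(2) in \<open>simp_all add: hat_T\<close>)
  show ?thesis
    apply (unfold_locales; (unfold gray_hom_simps bd_gray_hom)?)
    subgoal by (simp add: transpose_def)
    subgoal by (simp add: transpose_def T_cell)
    subgoal by (simp add: transpose_def A.src_cell)
    subgoal by (simp add: transpose_def A.tgt_cell)
    subgoal using 0 A.idt_cell by (simp add: transpose_def del: transp.simps)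
    subgoal for x m y n using 1[of x m y n] A.wh_cell[of x m y n] by (simp add: transpose_def)
    subgoal for x y
      by (insert A.comp2[of x y], simp add: transpose_def, rule P.hcell_eqI[where n = 2])
        (simp_all add: T_boundary T_cells hat_T left_simps)
    subgoal for x y
      by (insert A.comp3[of x y], simp add: transpose_def, rule P.hcell_eqI[where n = 3])
        (simp_all add: T_boundary T_cells hat_T left_simps)
    subgoal for x y
      by (insert A.vcomp3[of x y], simp add: transpose_def, rule P.hcell_eqI[where n = 3])
        (simp_all add: T_boundary T_cells hat_T left_simps)
    subgoal for x y
      by (simp add: transpose_def, rule P.hcell_eqI[where n = 3])
        (simp_all add: T_boundary T_cells hat_T left_simps)
    done
qed

end

text \<open>For \<open>m = 0\<close> the functor \<open>L 0 x\<close> acts on cells of all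
  dimensions; for positive \<open>m\<close> there are only components at 0-cells. Where both
  readings make sense, at \<open>m = n = 0\<close>, they agree by \<open>hat_0\<close>.\<close>

definition untranspose :: "(nat \<Rightarrow> 'a \<Rightarrow> ('b, 'c) hcell) \<Rightarrow> nat \<Rightarrow> nat \<Rightarrow> 'a \<Rightarrow> 'b \<Rightarrow> 'c" where
  "untranspose L m n x y = (if m = 0 then hfun (L 0 x) n y else hat (L m x) y)"

context gray_pair
begin

text \<open>All operations of the inner hom are computed componentwise, so taking the component at
  \<open>Y\<close> preserves them on the nose.\<close>

theorem eval_functor:
  assumes Y: "Y \<in> cell B 0"
  shows "gray_functor (gray_hom B C) C (\<lambda>n. restrict (\<lambda>x. hat x Y) (hcells B C n))"
proof -
  interpret HC: gray_cat "gray_hom B C" by (rule gray_hom_cat)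
  show ?thesis
    apply (intro gray_functor.intro gray_functor_axioms.intro; (unfold gray_hom_simps bd_gray_hom)?)
    subgoal by (rule HC.gray_cat_axioms)
    subgoal by (rule C.gray_cat_axioms)
    subgoal by simp
    subgoal for x n using Y hcells_SucD(6)[of x "n-1" Y] by (cases n) simp_all
    subgoal for x n using Y hcells_SucD(1,7)[of x n] by simp
    subgoal for x n using Y hcells_SucD(2,8)[of x n] by simp
    subgoal for x n using Y HC.idt_cell[of x n] by simp
    subgoal for x m y n using Y HC.wh_cell[of x m y n] by simp
    subgoal for x y using Y by simp
    subgoal for x y using Y by simp
    subgoal for x y using Y by simp
    subgoal for x y using Y by simp
    done
qed

end

text \<open>The mixed conditions are the naturality of the cells \<open>L n x\<close>. In the first
  variable the functor is \<open>L\<close> followed by evaluation at an object, in the second it is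
  the 0-cell \<open>L 0 X\<close> itself.\<close>

theorem untranspose_quasi:
  assumes L: "gray_functor A (gray_hom B C) L" and BC: "gray_cat B" "gray_cat C"
  shows "gray_quasi A B C (untranspose L)"
proof -
  interpret gray_pair B C using BC by (rule gray_pairI)
  interpret L: gray_functor A "gray_hom B C" L by fact
  have Lc: "L n x \<in> hcells B C n" if "x \<in> cell A n" for n x using L.map_cell[OF that] by simp
  have s: "hsrc0 n (L n x) = L 0 (src0 A n x)" "htgt0 n (L n x) = L 0 (tgt0 A n x)" if "x \<in> cell A n" for n x
    using L.map_src0[OF that] L.map_tgt0[OF that] by simp_all
  have N: "nat_family B C n (hfun (L 0 (src0 A n x))) (hfun (L 0 (tgt0 A n x))) (hat (L n x))"
    if "x \<in> cell A n" "n \<ge> 1" for n x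
    using nat_family_hat'[OF Lc[OF that(1)] that(2)] s[OF that(1)] by simp
  show ?thesis
    apply (intro gray_quasi.intro gray_quasi_axioms.intro)
    subgoal by (rule L.A.gray_cat_axioms)
    subgoal by (rule B.gray_cat_axioms)
    subgoal by (rule C.gray_cat_axioms)
    subgoal for X by (rule gray_functor_cong[OF hcells_0D[OF Lc[of X 0]]]) (simp_all add: untranspose_def)
    subgoal for Y
      by (rule gray_functor_cong[OF gray_functor_comp[OF L eval_functor[of Y]]])
        (auto simp: untranspose_def Lc hat_0[OF Lc])
    subgoal for x m y n using nat_familyD(4)[OF N[of x m], of y n] by (simp add: untranspose_def)
    subgoal for a b using nat_familyD(5)[OF N[of a 2], of b] by (simp add: untranspose_def C.tinverse_iff)
    done
qed

theorem transpose_untranspose: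
  assumes L: "gray_functor A (gray_hom B C) L" and BC: "gray_cat B" "gray_cat C"
  shows "transpose A B (untranspose L) = L"
proof -
  interpret gray_pair B C using BC by (rule gray_pairI)
  interpret L: gray_functor A "gray_hom B C" L by fact
  have Lc: "L n x \<in> hcells B C n" if "x \<in> cell A n" for n x using L.map_cell[OF that] by simp
  have "transp A B (untranspose L) n x = L n x" if "x \<in> cell A n" for n x
    using that
  proof (induction n arbitrary: x)
    case 0
    \<comment> \<open>A strict functor is already \<open>undefined\<close> off the cells, so the
      restriction made by \<open>transp\<close> changes nothing.\<close>
    have "(\<lambda>n. restrict (hfun (L 0 x) n) (cell B n)) = hfun (L 0 x)"
      using gray_functor.undef[OF hcells_0D[OF Lc[OF 0]]] by (auto simp: fun_eq_iff restrict_def)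
    then show ?case using hcells_0_eq[OF Lc[OF 0]] by (simp add: untranspose_def)
  next
    case (Suc n)
    have "restrict (hat (L (Suc n) x)) (cell B 0) = hat (L (Suc n) x)"
      using hcells_SucD(5)[OF Lc[OF Suc.prems]] by (rule extensional_restrict)
    then show ?case
      using Suc hcells_SucD(10)[OF Lc[OF Suc.prems]] L.map_src[of x n] L.map_tgt[of x n] L.A.src_cell L.A.tgt_cell
      by (simp add: untranspose_def)
  qed
  then show ?thesis using L.undef by (auto simp: transpose_def fun_eq_iff restrict_def)
qed

text \<open>The values at 0-cells are compared whole, because \<open>hat\<close> sees only the
  action of a functor on objects.\<close>

lemma hom_functor_eqI:
  assumes L: "gray_functor A (gray_hom B C) L" "gray_functor A (gray_hom B C) L'" and BC: "gray_cat B" "gray_cat C"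
    and 0: "\<And>X. X \<in> cell A 0 \<Longrightarrow> L 0 X = L' 0 X"
    and 1: "\<And>n x Y. \<lbrakk>x \<in> cell A n; n \<ge> 1; Y \<in> cell B 0\<rbrakk> \<Longrightarrow> hat (L n x) Y = hat (L' n x) Y"
  shows "L = L'"
proof (rule gray_functor_eqI[OF L])
  interpret gray_pair B C using BC by (rule gray_pairI)
  interpret L: gray_functor A "gray_hom B C" L by fact
  interpret L': gray_functor A "gray_hom B C" L' by fact
  fix n x assume x: "x \<in> cell A n"
  show "L n x = L' n x"
    by (rule hcell_eqI[where n = n])
      (use x L.map_cell[OF x] L'.map_cell[OF x] L.map_src0[OF x] L'.map_src0[OF x] L.map_tgt0[OF x] L'.map_tgt0[OF
          x]
        0 1 L.A.src0_cell L.A.tgt0_cell in simp_all)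
qed

text \<open>The untransposed identity is the evaluation quasi-functor, and postcomposition with
  \<open>K\<close> is the transpose of \<open>K\<close> applied to it. Functoriality of the inner
  hom thus follows from \<open>post\<close> and \<open>transpose_functor\<close> without a new
  calculation.\<close>

lemma hom_map_eq_transpose:
  assumes BC: "gray_cat B" "gray_cat C"
  shows "gray_hom_map B C K = transpose (gray_hom B C) B (\<lambda>m n x y. K (m + n) (untranspose (gray_id (gray_hom B C))
      m n x y))"
proof -
  interpret gray_pair B C using BC by (rule gray_pairI)
  have "hpost B K x n = transp (gray_hom B C) B (\<lambda>m n x y. K (m + n) (untranspose (gray_id (gray_hom B C)) m n x y))
      n x"
    if "x \<in> hcells B C n" for x n
    using that
  proof (induction n arbitrary: x)
    case 0
    then obtain F where "x = HFun F" by (auto simp: hcells_0)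
    then show ?case using 0 by (simp add: untranspose_def gray_id_def gray_comp_def restrict_def fun_eq_iff)
  next
    case (Suc n)
    obtain s t k where x: "x = HCell s t k" using Suc.prems by (rule hcells_Suc_cases)
    show ?case using Suc hcells_SucD(1,2)[OF Suc.prems] by (simp add: x untranspose_def gray_id_def)
  qed
  then show ?thesis by (simp add: gray_hom_map_def transpose_def fun_eq_iff restrict_def)
qed

theorem hom_map_functor:
  assumes B: "gray_cat B" and K: "gray_functor C D K"
  shows "gray_functor (gray_hom B C) (gray_hom B D) (gray_hom_map B C K)"
proof -
  interpret K: gray_functor C D K by fact
  note C = K.A.gray_cat_axioms
  note hom = gray_cat_hom[OF B C]
  have "gray_quasi (gray_hom B C) B C (untranspose (gray_id (gray_hom B C)))"
    by (rule untranspose_quasi[OF gray_functor_id[OF hom] B C])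
  from gray_quasi.transpose_functor[OF gray_quasi.post[OF this K]]
  show ?thesis unfolding hom_map_eq_transpose[OF B C] .
qed

lemma hat_hom_map:
  "\<lbrakk>x \<in> hcells B C n; n \<ge> 1; Y \<in> cell B 0\<rbrakk> \<Longrightarrow> hat (gray_hom_map B C K n x) Y = K n (hat x Y)"
  by (cases n) (auto simp: gray_hom_map_def elim!: hcells_Suc_cases)

lemma hom_map_HFun: "HFun F \<in> hcells B C 0 \<Longrightarrow> gray_hom_map B C K 0 (HFun F) = HFun (gray_comp B F K)"
  by (simp add: gray_hom_map_def)

section \<open>The tensor product\<close>

lemma funpow_simps [simp]: "(f ^^ 1) x = f x" "(f ^^ 2) x = f (f x)" "(f ^^ 3) x = f (f (f x))"
  by (simp_all only: numeral_2_eq_2 numeral_3_eq_3 One_nat_def funpow.simps comp_apply id_apply)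

text \<open>Peels off the innermost application, as the recursion of \<open>bd\<close> does.\<close>

lemma funpow_Suc_simp: "(f ^^ Suc n) x = (f ^^ n) (f x)"
  by (simp add: funpow_swap1)

section \<open>Formal cells modulo the relations\<close>

locale gray_tensor = A: gray_cat A + B: gray_cat B for A :: "'a gray" and B :: "'b gray"
begin

definition wt :: "nat \<Rightarrow> ('a, 'b) trm \<Rightarrow> bool" where
  "wt n t \<longleftrightarrow> teq A B n t t"

abbreviation "AB \<equiv> A \<otimes>\<^sub>G B"
abbreviation "c \<equiv> cls A B"
abbreviation "d \<equiv> dm A B"
abbreviation "e \<equiv> cd A B"

lemma teq_wt [simp]: "teq A B n t t \<longleftrightarrow> wt n t"
  by (simp add: wt_def)

lemma teqD: "teq A B n t u \<Longrightarrow> wt n t \<and> wt n u"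
  unfolding wt_def by (blast intro: teq.sym teq.trans)

lemma cls_eqI: "teq A B n t u \<Longrightarrow> c n t = c n u"
  unfolding cls_def by (blast intro: teq.sym teq.trans)

text \<open>Together with \<open>teq_wt\<close> this turns the premises of the \<open>teq\<close>
  rules into well-formedness and equations of classes, the form in which the boundary rules below
  can simplify them.\<close>

lemma teq_iff [simp]: "wt n t \<Longrightarrow> teq A B n t u \<longleftrightarrow> c n t = c n u"
  unfolding wt_def cls_def by (blast intro: teq.sym teq.trans)

lemma teq_rep: "wt n t \<Longrightarrow> teq A B n t (rep (c n t))"
  unfolding wt_def cls_def rep_def by (rule someI2[of _ t]) auto

lemma cell_tensor: "cell AB n = {c n t |t. wt n t}"
  by (simp add: tensor_def)

lemma wt_cell [simp]: "wt n t \<Longrightarrow> c n t \<in> cell AB n"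
  by (auto simp: cell_tensor)

lemma teq_le: "teq A B n t u \<Longrightarrow> n \<le> 3"
  by (induction rule: teq.induct) (auto dest: A.cell_le B.cell_le)

lemma wt_le: "wt n t \<Longrightarrow> n \<le> 3"
  unfolding wt_def by (rule teq_le)

lemma wt_dm: "wt (Suc n) t \<Longrightarrow> wt n (d t)" and wt_cd: "wt (Suc n) t \<Longrightarrow> wt n (e t)"
  unfolding wt_def by (rule teq.dm teq.cd, assumption)+

lemma wt_boundary [simp]:
  "wt 1 t \<Longrightarrow> wt 0 (d t)" "wt 1 t \<Longrightarrow> wt 0 (e t)" "wt 2 t \<Longrightarrow> wt 1 (d t)" "wt 2 t \<Longrightarrow> wt 1 (e t)"
  "wt 3 t \<Longrightarrow> wt 2 (d t)" "wt 3 t \<Longrightarrow> wt 2 (e t)"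
  using wt_dm[of 0 t] wt_dm[of 1 t] wt_dm[of 2 t] wt_cd[of 0 t] wt_cd[of 1 t] wt_cd[of 2 t] by auto

lemma wt_dms: "wt n t \<Longrightarrow> wt 0 ((d ^^ n) t)" and wt_cds: "wt n t \<Longrightarrow> wt 0 ((e ^^ n) t)"
  by (induction n arbitrary: t) (simp_all add: funpow_Suc_simp wt_dm wt_cd del: funpow.simps(2))

text \<open>Formal boundaries are computed syntactically, so globularity fails for terms, for
  instance for \<open>Ver x y\<close>, and holds only for classes, by the relations
  \<open>dm_glob\<close> and \<open>cd_glob\<close>.\<close>

lemma cls_glob:
  "wt (Suc (Suc n)) t \<Longrightarrow> c n (d (e t)) = c n (d (d t))" "wt (Suc (Suc n)) t \<Longrightarrow> c n (e (d t)) = c n (e (e t))"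
  using cls_eqI[OF teq.dm_glob] cls_eqI[OF teq.cd_glob] unfolding wt_def by metis+

lemma cls_glob_simps [simp]:
  "wt 2 t \<Longrightarrow> c 0 (d (e t)) = c 0 (d (d t))" "wt 2 t \<Longrightarrow> c 0 (e (d t)) = c 0 (e (e t))"
  "wt 3 t \<Longrightarrow> c 1 (d (e t)) = c 1 (d (d t))" "wt 3 t \<Longrightarrow> c 1 (e (d t)) = c 1 (e (e t))"
  using cls_glob[of 0 t] cls_glob[of 1 t] by simp_all

lemma cls_dm: "wt (Suc n) t \<Longrightarrow> c (Suc n) t = c (Suc n) u \<Longrightarrow> c n (d t) = c n (d u)"
  and cls_cd: "wt (Suc n) t \<Longrightarrow> c (Suc n) t = c (Suc n) u \<Longrightarrow> c n (e t) = c n (e u)"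
  using teq.dm[of A B n t u] teq.cd[of A B n t u] by (simp_all add: wt_dm wt_cd)

lemma cls_glob_03 [simp]:
  "wt 3 t \<Longrightarrow> c 0 (d (e (e t))) = c 0 (d (d (d t)))" "wt 3 t \<Longrightarrow> c 0 (e (d (d t))) = c 0 (e (e (e t)))"
  "wt 3 t \<Longrightarrow> c 0 (d (d (e t))) = c 0 (d (d (d t)))" "wt 3 t \<Longrightarrow> c 0 (e (e (d t))) = c 0 (e (e (e t)))"
  using cls_dm[of 0 "d (e t)" "d (d t)"] cls_cd[of 0 "e (d t)" "e (e t)"]
    cls_glob_simps(1,2)[of "e t"] cls_glob_simps(1,2)[of "d t"] by simp_all

lemma wt_simps [simp]:
  "wt 0 x \<Longrightarrow> wt 1 (Idt 0 x)" "wt 1 x \<Longrightarrow> wt 2 (Idt 1 x)" "wt 2 x \<Longrightarrow> wt 3 (Idt 2 x)"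
  "\<lbrakk>wt 2 x; wt 2 y; c 1 (e x) = c 1 (d y)\<rbrakk> \<Longrightarrow> wt 2 (Hor 2 x y)"
  "\<lbrakk>wt 3 x; wt 3 y; c 1 (e (e x)) = c 1 (d (d y))\<rbrakk> \<Longrightarrow> wt 3 (Hor 3 x y)"
  "\<lbrakk>wt 3 x; wt 3 y; c 2 (e x) = c 2 (d y)\<rbrakk> \<Longrightarrow> wt 3 (Ver x y)"
  "\<lbrakk>wt 1 x; wt 1 y; c 0 (e x) = c 0 (d y)\<rbrakk> \<Longrightarrow> wt 1 (Wh 1 1 x y)"
  "\<lbrakk>wt 1 x; wt 2 y; c 0 (e x) = c 0 (d (d y))\<rbrakk> \<Longrightarrow> wt 2 (Wh 1 2 x y)"
  "\<lbrakk>wt 1 x; wt 3 y; c 0 (e x) = c 0 (d (d (d y)))\<rbrakk> \<Longrightarrow> wt 3 (Wh 1 3 x y)"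
  "\<lbrakk>wt 2 x; wt 1 y; c 0 (e (e x)) = c 0 (d y)\<rbrakk> \<Longrightarrow> wt 2 (Wh 2 1 x y)"
  "\<lbrakk>wt 3 x; wt 1 y; c 0 (e (e (e x))) = c 0 (d y)\<rbrakk> \<Longrightarrow> wt 3 (Wh 3 1 x y)"
  "\<lbrakk>wt 2 x; wt 2 y; c 0 (e (e x)) = c 0 (d (d y))\<rbrakk> \<Longrightarrow> wt 3 (Ich x y)"
  "\<lbrakk>wt 2 x; wt 2 y; c 0 (e (e x)) = c 0 (d (d y))\<rbrakk> \<Longrightarrow> wt 3 (IchI x y)"
  using teq.Idt[of A B 0 x x] teq.Idt[of A B 1 x x] teq.Idt[of A B 2 x x] teq.Hor[of A B 2 x x y y]
    teq.Hor[of A B 3 x x y y] teq.Ver[of A B x x y y] teq.Wh[of A B 1 x x 1 y y] teq.Wh[of A B 1 x x 2 y y]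
    teq.Wh[of A B 1 x x 3 y y] teq.Wh[of A B 2 x x 1 y y] teq.Wh[of A B 3 x x 1 y y]
    teq.Ich[of A B x x y y] teq.IchI[of A B x x y y]
  by simp_all

lemma wt_Gen: "\<lbrakk>x \<in> cell A m; y \<in> cell B n; m = 0 \<or> n = 0\<rbrakk> \<Longrightarrow> wt (m + n) (Gen m n x y)"
  unfolding wt_def by (rule teq.Gen)

lemma wt_Wh: "\<lbrakk>wt m x; wt n y; m \<ge> 1; n \<ge> 1; m = 1 \<or> n = 1; c 0 ((e ^^ m) x) = c 0 ((d ^^ n) y)\<rbrakk> \<Longrightarrow> wt (m + n - 1)
    (Wh m n x y)"
  using teq.Wh[of A B m x x n y y] by (simp add: wt_cds)

text \<open>The operations of the tensor product act on chosen representatives. The congruence rules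
  of \<open>teq\<close> make them computable on any representative, here and in the following
  rules.\<close>

lemma op_src: "wt (Suc n) t \<Longrightarrow> src AB n (c (Suc n) t) = c n (d t)"
  using cls_eqI[OF teq.dm[OF teq_rep]] by (simp add: tensor_def)

lemma op_tgt: "wt (Suc n) t \<Longrightarrow> tgt AB n (c (Suc n) t) = c n (e t)"
  using cls_eqI[OF teq.cd[OF teq_rep]] by (simp add: tensor_def)

lemma op_idt: "wt n t \<Longrightarrow> n < 3 \<Longrightarrow> idt AB n (c n t) = c (Suc n) (Idt n t)"
  using cls_eqI[OF teq.Idt[OF teq_rep]] by (simp add: tensor_def)

lemma op_wh: "\<lbrakk>wt m x; wt n y; m \<ge> 1; n \<ge> 1; m = 1 \<or> n = 1; c 0 ((e ^^ m) x) = c 0 ((d ^^ n) y)\<rbrakk> \<Longrightarrow> wh AB m n (c m x)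
    (c n y) = c (m + n - 1) (Wh m n x y)"
  using cls_eqI[OF teq.Wh[OF teq_rep teq_rep, of m x n y]] by (simp add: tensor_def wt_cds)

lemma op_hor: "\<lbrakk>wt n x; wt n y; n \<in> {2,3}; teq A B 1 ((e ^^ (n - 1)) x) ((d ^^ (n - 1)) y)\<rbrakk> \<Longrightarrow>
    hor AB n (c n x) (c n y) = c n (Hor n x y)"
  using cls_eqI[OF teq.Hor[OF teq_rep teq_rep, of n x y]] by (simp add: tensor_def)

lemma op_ver: "\<lbrakk>wt 3 x; wt 3 y; c 2 (e x) = c 2 (d y)\<rbrakk> \<Longrightarrow>
    ver AB (c 3 x) (c 3 y) = c 3 (Ver x y)"
  using cls_eqI[OF teq.Ver[OF teq_rep teq_rep, of x y]] by (simp add: tensor_def)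

lemma op_ich: "\<lbrakk>wt 2 x; wt 2 y; c 0 (e (e x)) = c 0 (d (d y))\<rbrakk> \<Longrightarrow>
    ich AB (c 2 x) (c 2 y) = c 3 (Ich x y)"
  using cls_eqI[OF teq.Ich[OF teq_rep teq_rep, of x y]] by (simp add: tensor_def)

lemma op_simps [simp]:
  "wt 1 t \<Longrightarrow> src AB 0 (c 1 t) = c 0 (d t)" "wt 1 t \<Longrightarrow> tgt AB 0 (c 1 t) = c 0 (e t)"
  "wt 2 t \<Longrightarrow> src AB 1 (c 2 t) = c 1 (d t)" "wt 2 t \<Longrightarrow> tgt AB 1 (c 2 t) = c 1 (e t)"
  "wt 3 t \<Longrightarrow> src AB 2 (c 3 t) = c 2 (d t)" "wt 3 t \<Longrightarrow> tgt AB 2 (c 3 t) = c 2 (e t)"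
  "wt 0 t \<Longrightarrow> idt AB 0 (c 0 t) = c 1 (Idt 0 t)" "wt 1 t \<Longrightarrow> idt AB 1 (c 1 t) = c 2 (Idt 1 t)"
  "wt 2 t \<Longrightarrow> idt AB 2 (c 2 t) = c 3 (Idt 2 t)"
  "\<lbrakk>wt 2 x; wt 2 y; c 1 (e x) = c 1 (d y)\<rbrakk> \<Longrightarrow> hor AB 2 (c 2 x) (c 2 y) = c 2 (Hor 2 x y)"
  "\<lbrakk>wt 3 x; wt 3 y; c 1 (e (e x)) = c 1 (d (d y))\<rbrakk> \<Longrightarrow> hor AB 3 (c 3 x) (c 3 y) = c 3 (Hor 3 x y)"
  "\<lbrakk>wt 1 x; wt 1 y; c 0 (e x) = c 0 (d y)\<rbrakk> \<Longrightarrow> wh AB 1 1 (c 1 x) (c 1 y) = c 1 (Wh 1 1 x y)"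
  "\<lbrakk>wt 1 x; wt 2 y; c 0 (e x) = c 0 (d (d y))\<rbrakk> \<Longrightarrow> wh AB 1 2 (c 1 x) (c 2 y) = c 2 (Wh 1 2 x y)"
  "\<lbrakk>wt 1 x; wt 3 y; c 0 (e x) = c 0 (d (d (d y)))\<rbrakk> \<Longrightarrow> wh AB 1 3 (c 1 x) (c 3 y) = c 3 (Wh 1 3 x y)"
  "\<lbrakk>wt 2 x; wt 1 y; c 0 (e (e x)) = c 0 (d y)\<rbrakk> \<Longrightarrow> wh AB 2 1 (c 2 x) (c 1 y) = c 2 (Wh 2 1 x y)"
  "\<lbrakk>wt 3 x; wt 1 y; c 0 (e (e (e x))) = c 0 (d y)\<rbrakk> \<Longrightarrow> wh AB 3 1 (c 3 x) (c 1 y) = c 3 (Wh 3 1 x y)"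
  using op_src[of 0 t] op_src[of 1 t] op_src[of 2 t] op_tgt[of 0 t] op_tgt[of 1 t] op_tgt[of 2 t]
    op_idt[of 0 t] op_idt[of 1 t] op_idt[of 2 t] op_hor[of 2 x y] op_hor[of 3 x y]
    op_wh[of 1 x 1 y] op_wh[of 1 x 2 y] op_wh[of 1 x 3 y] op_wh[of 2 x 1 y] op_wh[of 3 x 1 y]
  by simp_all

declare op_ver [simp] op_ich [simp]

lemma cls_comp2: "\<lbrakk>wt 2 x; wt 2 y; c 1 (e x) = c 1 (d y)\<rbrakk> \<Longrightarrow>
    c 0 (d (d y)) = c 0 (d (d x)) \<and> c 0 (e (e x)) = c 0 (e (e y))"
  using cls_dm[of 0 "e x" "d y"] cls_cd[of 0 "e x" "d y"] by simp

lemma cls_comp3: "\<lbrakk>wt 3 x; wt 3 y; c 1 (e (e x)) = c 1 (d (d y))\<rbrakk> \<Longrightarrow>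
    c 0 (d (d (d y))) = c 0 (d (d (d x))) \<and> c 0 (e (e (e x))) = c 0 (e (e (e y)))"
  using cls_dm[of 0 "e (e x)" "d (d y)"] cls_cd[of 0 "e (e x)" "d (d y)"] by simp

lemma cls_vcomp3: "\<lbrakk>wt 3 x; wt 3 y; c 2 (e x) = c 2 (d y)\<rbrakk> \<Longrightarrow>
    c 1 (d (d y)) = c 1 (d (d x)) \<and> c 1 (e (e x)) = c 1 (e (e y)) \<and>
    c 0 (d (d (d y))) = c 0 (d (d (d x))) \<and> c 0 (e (e (e x))) = c 0 (e (e (e y)))"
  using cls_dm[of 1 "e x" "d y"] cls_cd[of 1 "e x" "d y"] cls_dm[of 0 "e (e x)" "e (d y)"] cls_dm[of 0 "d (d y)" "d
      (d x)"]
    cls_cd[of 0 "e (e x)" "e (e y)"] by simp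

lemma tensor_cellE:
  assumes "x \<in> cell AB n"
  obtains t where "x = c n t" "wt n t"
  using assms by (auto simp: cell_tensor)

end

section \<open>The Gray-category axioms for classes of formal cells\<close>

context gray_tensor
begin

lemma bd_tensor [simp]:
  "wt n t \<Longrightarrow> src0 AB n (c n t) = c 0 ((d ^^ n) t)" "wt n t \<Longrightarrow> tgt0 AB n (c n t) = c 0 ((e ^^ n) t)"
  by (induction n arbitrary: t) (simp_all add: op_src op_tgt wt_dm wt_cd funpow_Suc_simp del: funpow.simps(2))

lemma tensor_cell_pos_cases: "x \<in> cell AB n \<Longrightarrow> n \<ge> 1 \<Longrightarrow> n = 1 \<or> n = 2 \<or> n = 3"
  by (auto elim!: tensor_cellE dest!: wt_le)

lemma tensor_cell_Suc_cases: "x \<in> cell AB (Suc n) \<Longrightarrow> n \<ge> 1 \<Longrightarrow> n = 1 \<or> n = 2"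
  using tensor_cell_pos_cases[of x "Suc n"] by auto

lemma wt_pos_cases: "wt n x \<Longrightarrow> n \<ge> 1 \<Longrightarrow> n = 1 \<or> n = 2 \<or> n = 3"
  using wt_le[of n x] by auto

lemma tensor_wh_unit:
  assumes x: "wt n x" and n: "n \<ge> 1"
  shows "wh AB 1 n (idt AB 0 (src0 AB n (c n x))) (c n x) = c n x"
    "wh AB n 1 (c n x) (idt AB 0 (tgt0 AB n (c n x))) = c n x"
proof -
  have "(wh AB 1 n (idt AB 0 (src0 AB n (c n x))) (c n x) = c n x) \<and>
    (wh AB n 1 (c n x) (idt AB 0 (tgt0 AB n (c n x))) = c n x)"
    using wt_pos_cases[OF x n]
  proof (elim disjE)
    assume "n = 1"
    then show ?thesis
      using x teq.Wh_unit_left[where x = x and n = 1, THEN cls_eqI] teq.Wh_unit_right[where x = x and n = 1, THEN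
          cls_eqI] by simp
  next
    assume "n = 2"
    then show ?thesis
      using x teq.Wh_unit_left[where x = x and n = 2, THEN cls_eqI] teq.Wh_unit_right[where x = x and n = 2, THEN
          cls_eqI] by simp
  next
    assume "n = 3"
    then show ?thesis
      using x teq.Wh_unit_left[where x = x and n = 3, THEN cls_eqI] teq.Wh_unit_right[where x = x and n = 3, THEN
          cls_eqI] by simp
  qed
  then show "wh AB 1 n (idt AB 0 (src0 AB n (c n x))) (c n x) = c n x"
    "wh AB n 1 (c n x) (idt AB 0 (tgt0 AB n (c n x))) = c n x"
    by blast+
qed

lemma tensor_wh_assoc_simps:
  "\<lbrakk>wt 1 x; wt 1 y; wt 1 z; c 0 (e x) = c 0 (d y); c 0 (e y) = c 0 (d z)\<rbrakk> \<Longrightarrow>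
    wh AB 1 1 (wh AB 1 1 (c 1 x) (c 1 y)) (c 1 z) = wh AB 1 1 (c 1 x) (wh AB 1 1 (c 1 y) (c 1 z))"
  "\<lbrakk>wt 2 x; wt 1 y; wt 1 z; c 0 (e (e x)) = c 0 (d y); c 0 (e y) = c 0 (d z)\<rbrakk> \<Longrightarrow>
    wh AB 2 1 (wh AB 2 1 (c 2 x) (c 1 y)) (c 1 z) = wh AB 2 1 (c 2 x) (wh AB 1 1 (c 1 y) (c 1 z))"
  "\<lbrakk>wt 1 x; wt 2 y; wt 1 z; c 0 (e x) = c 0 (d (d y)); c 0 (e (e y)) = c 0 (d z)\<rbrakk> \<Longrightarrow>
    wh AB 2 1 (wh AB 1 2 (c 1 x) (c 2 y)) (c 1 z) = wh AB 1 2 (c 1 x) (wh AB 2 1 (c 2 y) (c 1 z))"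
  "\<lbrakk>wt 1 x; wt 1 y; wt 2 z; c 0 (e x) = c 0 (d y); c 0 (e y) = c 0 (d (d z))\<rbrakk> \<Longrightarrow>
    wh AB 1 2 (wh AB 1 1 (c 1 x) (c 1 y)) (c 2 z) = wh AB 1 2 (c 1 x) (wh AB 1 2 (c 1 y) (c 2 z))"
  "\<lbrakk>wt 3 x; wt 1 y; wt 1 z; c 0 (e (e (e x))) = c 0 (d y); c 0 (e y) = c 0 (d z)\<rbrakk> \<Longrightarrow>
    wh AB 3 1 (wh AB 3 1 (c 3 x) (c 1 y)) (c 1 z) = wh AB 3 1 (c 3 x) (wh AB 1 1 (c 1 y) (c 1 z))"
  "\<lbrakk>wt 1 x; wt 3 y; wt 1 z; c 0 (e x) = c 0 (d (d (d y))); c 0 (e (e (e y))) = c 0 (d z)\<rbrakk> \<Longrightarrow>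
    wh AB 3 1 (wh AB 1 3 (c 1 x) (c 3 y)) (c 1 z) = wh AB 1 3 (c 1 x) (wh AB 3 1 (c 3 y) (c 1 z))"
  "\<lbrakk>wt 1 x; wt 1 y; wt 3 z; c 0 (e x) = c 0 (d y); c 0 (e y) = c 0 (d (d (d z)))\<rbrakk> \<Longrightarrow>
    wh AB 1 3 (wh AB 1 1 (c 1 x) (c 1 y)) (c 3 z) = wh AB 1 3 (c 1 x) (wh AB 1 3 (c 1 y) (c 3 z))"
  subgoal using teq.Wh_assoc[where x = x and y = y and z = z and l = 1 and m = 1 and n = 1, THEN cls_eqI] by simp
  subgoal using teq.Wh_assoc[where x = x and y = y and z = z and l = 2 and m = 1 and n = 1, THEN cls_eqI] by simp
  subgoal using teq.Wh_assoc[where x = x and y = y and z = z and l = 1 and m = 2 and n = 1, THEN cls_eqI] by simp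
  subgoal using teq.Wh_assoc[where x = x and y = y and z = z and l = 1 and m = 1 and n = 2, THEN cls_eqI] by simp
  subgoal using teq.Wh_assoc[where x = x and y = y and z = z and l = 3 and m = 1 and n = 1, THEN cls_eqI] by simp
  subgoal using teq.Wh_assoc[where x = x and y = y and z = z and l = 1 and m = 3 and n = 1, THEN cls_eqI] by simp
  subgoal using teq.Wh_assoc[where x = x and y = y and z = z and l = 1 and m = 1 and n = 3, THEN cls_eqI] by simp
  done

lemma tensor_wh_assoc:
  assumes x: "wt l x" "wt m y" "wt n z" "l \<ge> 1" "m \<ge> 1" "n \<ge> 1"
    and lmn: "l = 1 \<and> m = 1 \<or> l = 1 \<and> n = 1 \<or> m = 1 \<and> n = 1"
    and b: "c 0 ((e ^^ l) x) = c 0 ((d ^^ m) y)" "c 0 ((e ^^ m) y) = c 0 ((d ^^ n) z)"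
  shows "wh AB (l + m - 1) n (wh AB l m (c l x) (c m y)) (c n z) =
    wh AB l (m + n - 1) (c l x) (wh AB m n (c m y) (c n z))"
proof -
  have "n = 1 \<or> n = 2 \<or> n = 3" "m = 1 \<or> m = 2 \<or> m = 3" "l = 1 \<or> l = 2 \<or> l = 3"
    by (rule wt_pos_cases[OF x(3,6)] wt_pos_cases[OF x(2,5)] wt_pos_cases[OF x(1,4)])+
  then show ?thesis
    using lmn x b by (elim disjE conjE) (simp_all add: tensor_wh_assoc_simps del: op_simps)
qed

text \<open>The boundaries of composable formal cells often agree only up to the relations. These
  congruences identify boundaries built from such cells, so that the composites occurring in a law
  are seen to be well formed.\<close>

lemma cls_Hor2:
  "\<lbrakk>wt 2 x; wt 2 y; c 2 x = c 2 x'; c 2 y = c 2 y'; c 1 (e x) = c 1 (d y)\<rbrakk> \<Longrightarrow>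
    c 2 (Hor 2 x y) = c 2 (Hor 2 x' y')"
  using teq.Hor[where n = 2 and x = x and y = y and x' = x' and y' = y', THEN cls_eqI] by simp

lemma cls_Wh11:
  "\<lbrakk>wt 1 x; wt 1 y; c 1 x = c 1 x'; c 1 y = c 1 y'; c 0 (e x) = c 0 (d y)\<rbrakk> \<Longrightarrow>
    c 1 (Wh 1 1 x y) = c 1 (Wh 1 1 x' y')"
  using teq.Wh[where m = 1 and n = 1 and x = x and y = y and x' = x' and y' = y', THEN cls_eqI] by simp

lemma cls_Wh12:
  "\<lbrakk>wt 1 x; wt 2 y; c 1 x = c 1 x'; c 2 y = c 2 y'; c 0 (e x) = c 0 (d (d y))\<rbrakk> \<Longrightarrow>
    c 2 (Wh 1 2 x y) = c 2 (Wh 1 2 x' y')"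
  using teq.Wh[where m = 1 and n = 2 and x = x and y = y and x' = x' and y' = y', THEN cls_eqI] by simp

lemma cls_Wh21:
  "\<lbrakk>wt 2 x; wt 1 y; c 2 x = c 2 x'; c 1 y = c 1 y'; c 0 (e (e x)) = c 0 (d y)\<rbrakk> \<Longrightarrow>
    c 2 (Wh 2 1 x y) = c 2 (Wh 2 1 x' y')"
  using teq.Wh[where m = 2 and n = 1 and x = x and y = y and x' = x' and y' = y', THEN cls_eqI] by simp

text \<open>Each axiom is a relation of \<open>teq\<close> transported to classes by
  \<open>cls_eqI\<close>. What remains is that all composites in it are well formed; the inverse of
  an interchange cell is the class of \<open>IchI\<close>.\<close>

theorem tensor_cat: "gray_cat AB"
  apply (rule gray_cat.intro)
  subgoal using tensor_cellE wt_le by metis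
  subgoal by (elim tensor_cellE) (simp add: op_src wt_dm)
  subgoal by (elim tensor_cellE) (simp add: op_tgt wt_cd)
  subgoal by (elim tensor_cellE) (simp add: op_src op_tgt wt_dm wt_cd cls_glob)
  subgoal by (elim tensor_cellE) (simp add: op_src op_tgt wt_dm wt_cd cls_glob)
  subgoal for x n using less_3_cases[of n] by (elim tensor_cellE) auto
  subgoal for x n using less_3_cases[of n] by (elim tensor_cellE) auto
  subgoal for x n using less_3_cases[of n] by (elim tensor_cellE) auto
  subgoal by (elim tensor_cellE) simp
  subgoal by (elim tensor_cellE) simp
  subgoal by (elim tensor_cellE) simp
  subgoal by (elim tensor_cellE) simp
  subgoal by (elim tensor_cellE) simp
  subgoal by (elim tensor_cellE) simp
  subgoal for X Y Z
    apply (elim tensor_cellE)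
    subgoal for x y z using teq.Hor_assoc[where n = 2 and x = x and y = y and z = z, THEN cls_eqI] cls_comp2[of x y]
        cls_comp2[of y z] by simp
    done
  subgoal for X Y Z
    apply (elim tensor_cellE)
    subgoal for x y z using teq.Hor_assoc[where n = 3 and x = x and y = y and z = z, THEN cls_eqI] cls_comp3[of x y]
        cls_comp3[of y z] by simp
    done
  subgoal for X
    apply (elim tensor_cellE)
    subgoal for x using teq.Hor2_unit_left[where x = x, THEN cls_eqI]  by simp
    done
  subgoal for X
    apply (elim tensor_cellE)
    subgoal for x using teq.Hor2_unit_right[where x = x, THEN cls_eqI]  by simp
    done
  subgoal for X
    apply (elim tensor_cellE)
    subgoal for x using teq.Hor3_unit_left[where x = x, THEN cls_eqI]  by simp
    done
  subgoal for X
    apply (elim tensor_cellE)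
    subgoal for x using teq.Hor3_unit_right[where x = x, THEN cls_eqI]  by simp
    done
  subgoal by (elim tensor_cellE) simp
  subgoal by (elim tensor_cellE) simp
  subgoal by (elim tensor_cellE) simp
  subgoal for X Y Z
    apply (elim tensor_cellE)
    subgoal for x y z using teq.Ver_assoc[where x = x and y = y and z = z, THEN cls_eqI] cls_vcomp3[of x y]
        cls_vcomp3[of y z] by simp
    done
  subgoal for X
    apply (elim tensor_cellE)
    subgoal for x using teq.Ver_unit_left[where x = x, THEN cls_eqI]  by simp
    done
  subgoal for X
    apply (elim tensor_cellE)
    subgoal for x using teq.Ver_unit_right[where x = x, THEN cls_eqI]  by simp
    done
  subgoal for X Y
    apply (elim tensor_cellE)
    subgoal for x y using teq.Hor_Idt[where x = x and y = y, THEN cls_eqI]  by simp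
    done
  subgoal for X X' Y Y'
    apply (elim tensor_cellE)
    subgoal for x x' y y' using teq.Hor_Ver[where x = x and x' = x' and y = y and y' = y', THEN cls_eqI]
        cls_vcomp3[of x x'] cls_vcomp3[of y y'] cls_comp3[of x y] cls_Hor2[of "e x" "e y" "d x'" "d y'"] by simp
    done
  subgoal for x m y n by (elim tensor_cellE) (simp add: op_wh wt_Wh)
  subgoal by (elim tensor_cellE) simp
  subgoal by (elim tensor_cellE) simp
  subgoal for x y n using tensor_cell_Suc_cases[of y n] by (elim tensor_cellE) auto
  subgoal for x y n using tensor_cell_Suc_cases[of y n] by (elim tensor_cellE) auto
  subgoal for x n y using tensor_cell_Suc_cases[of x n] by (elim tensor_cellE) auto
  subgoal for x n y using tensor_cell_Suc_cases[of x n] by (elim tensor_cellE) auto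
  subgoal for F Y n
    apply (elim tensor_cellE)
    subgoal for f y using teq.Wh_Idt_left[where f = f and y = y and n = n, THEN cls_eqI] by auto
    done
  subgoal for X n F
    apply (elim tensor_cellE)
    subgoal for x f using teq.Wh_Idt_right[where f = f and x = x and n = n, THEN cls_eqI] by auto
    done
  subgoal for F Y Y'
    apply (elim tensor_cellE)
    subgoal for f y y' using teq.Wh_Hor_left[where f = f and y = y and y' = y' and n = 2, THEN cls_eqI] cls_comp2[of
        y y'] cls_Wh11[of f "e y" f "d y'"] by simp
    done
  subgoal for F X X'
    apply (elim tensor_cellE)
    subgoal for f x x' using teq.Wh_Hor_right[where f = f and x = x and x' = x' and n = 2, THEN cls_eqI]
        cls_comp2[of x x'] cls_Wh11[of "e x" f "d x'" f] by simp
    done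
  subgoal for F Y Y'
    apply (elim tensor_cellE)
    subgoal for f y y' using teq.Wh_Hor_left[where f = f and y = y and y' = y' and n = 3, THEN cls_eqI] cls_comp3[of
        y y'] cls_Wh11[of f "e (e y)" f "d (d y')"] by simp
    done
  subgoal for F X X'
    apply (elim tensor_cellE)
    subgoal for f x x' using teq.Wh_Hor_right[where f = f and x = x and x' = x' and n = 3, THEN cls_eqI]
        cls_comp3[of x x'] cls_Wh11[of "e (e x)" f "d (d x')" f] by simp
    done
  subgoal for F Y Y'
    apply (elim tensor_cellE)
    subgoal for f y y' using teq.Wh_Ver_left[where f = f and y = y and y' = y', THEN cls_eqI] cls_vcomp3[of y y']
        cls_Wh12[of f "e y" f "d y'"] by simp
    done
  subgoal for F X X'
    apply (elim tensor_cellE)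
    subgoal for f x x' using teq.Wh_Ver_right[where f = f and x = x and x' = x', THEN cls_eqI] cls_vcomp3[of x x']
        cls_Wh21[of "e x" f "d x'" f] by simp
    done
  subgoal using tensor_wh_unit(1) by (elim tensor_cellE) simp
  subgoal using tensor_wh_unit(2) by (elim tensor_cellE) simp
  subgoal for x l y m z n by (elim tensor_cellE, hypsubst, rule tensor_wh_assoc) (simp_all add: wt_dms wt_cds)
  subgoal by (elim tensor_cellE) simp
  subgoal by (elim tensor_cellE) simp
  subgoal by (elim tensor_cellE) simp
  subgoal for X Y
    apply (elim tensor_cellE)
    subgoal for x y
      using teq.Ich_IchI[where x = x and y = y, THEN cls_eqI] teq.IchI_Ich[where x = x and y = y, THEN cls_eqI]
      by (intro exI[of _ "c 3 (IchI x y)"]) simp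
    done
  subgoal for X Y
    apply (elim tensor_cellE)
    subgoal for x y using teq.Ich_nat_left[where x = x and y = y, THEN cls_eqI]  by simp
    done
  subgoal for X Y
    apply (elim tensor_cellE)
    subgoal for x y using teq.Ich_nat_right[where x = x and y = y, THEN cls_eqI] cls_Wh21[of x "d (e y)" x "d (d
        y)"] cls_Wh11[of "e x" "d (e y)" "e x" "d (d y)"] cls_Wh21[of x "e (d y)" x "e (e y)"]
        cls_Hor2[of "Wh 2 1 x (d (e y))" "Wh 1 2 (e x) (e y)" "Wh 2 1 x (d (d y))" "Wh 1 2 (e x) (e y)"]
        cls_Hor2[of "Wh 1 2 (d x) (d y)" "Wh 2 1 x (e (d y))" "Wh 1 2 (d x) (d y)" "Wh 2 1 x (e (e y))"]
        by simp
    done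
  subgoal for F Y
    apply (elim tensor_cellE)
    subgoal for f y using teq.Ich_Idt_left[where f = f and y = y, THEN cls_eqI]  by simp
    done
  subgoal for X G
    apply (elim tensor_cellE)
    subgoal for x g using teq.Ich_Idt_right[where x = x and g = g, THEN cls_eqI]  by simp
    done
  subgoal for X X' Y
    apply (elim tensor_cellE)
    \<comment> \<open>The two vertical factors meet only after reassociating the threefold composite
      in the middle and replacing \<open>e x\<close> by the equivalent \<open>d x'\<close> inside
      it. The other variable below is analogous.\<close>
    subgoal for x x' y using teq.Ich_Hor_left[where x = x and x' = x' and y = y, THEN cls_eqI] cls_comp2[of x x']
        cls_Wh11[of "e x" "d y" "d x'" "d y"] cls_Wh11[of "e x" "e y" "d x'" "e y"]
        cls_Wh12[of "e x" y "d x'" y]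
        teq.Hor_assoc[where n = 2 and x = "Wh 2 1 x (d y)" and y = "Wh 1 2 (e x) y" and z = "Wh 2 1 x' (e y)", THEN
            cls_eqI]
        cls_Hor2[of "Wh 1 2 (e x) y" "Wh 2 1 x' (e y)" "Wh 1 2 (d x') y" "Wh 2 1 x' (e y)"]
        cls_Hor2[of "Wh 2 1 x (d y)" "Hor 2 (Wh 1 2 (e x) y) (Wh 2 1 x' (e y))"
          "Wh 2 1 x (d y)" "Hor 2 (Wh 1 2 (d x') y) (Wh 2 1 x' (e y))"]
        by simp
    done
  subgoal for X Y Y'
    apply (elim tensor_cellE)
    subgoal for x y y' using teq.Ich_Hor_right[where x = x and y' = y' and y = y, THEN cls_eqI] cls_comp2[of y y']
        cls_Wh11[of "e x" "e y" "e x" "d y'"] cls_Wh11[of "d x" "e y" "d x" "d y'"]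
        cls_Wh21[of x "e y" x "d y'"]
        teq.Hor_assoc[where n = 2 and x = "Wh 1 2 (d x) y" and y = "Wh 2 1 x (e y)" and z = "Wh 1 2 (e x) y'", THEN
            cls_eqI]
        cls_Hor2[of "Wh 2 1 x (e y)" "Wh 1 2 (e x) y'" "Wh 2 1 x (d y')" "Wh 1 2 (e x) y'"]
        cls_Hor2[of "Wh 1 2 (d x) y" "Hor 2 (Wh 2 1 x (e y)) (Wh 1 2 (e x) y')"
          "Wh 1 2 (d x) y" "Hor 2 (Wh 2 1 x (d y')) (Wh 1 2 (e x) y')"]
        by simp
    done
  subgoal for F X Y
    apply (elim tensor_cellE)
    subgoal for f x y using teq.Ich_Wh_left[where f = f and x = x and y = y, THEN cls_eqI]  by simp
    done
  subgoal for X F Y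
    apply (elim tensor_cellE)
    subgoal for x f y using teq.Ich_Wh_mid[where f = f and x = x and y = y, THEN cls_eqI]  by simp
    done
  subgoal for X Y F
    apply (elim tensor_cellE)
    subgoal for x y f using teq.Ich_Wh_right[where f = f and x = x and y = y, THEN cls_eqI]  by simp
    done
  done

end

section \<open>Generation of the tensor product\<close>

context gray_tensor
begin

lemma inverse3_IchI: "\<lbrakk>wt 2 x; wt 2 y; c 0 (e (e x)) = c 0 (d (d y))\<rbrakk> \<Longrightarrow>
    inverse3 AB (c 3 (Ich x y)) (c 3 (IchI x y))"
  using teq.Ich_IchI[where x = x and y = y, THEN cls_eqI] teq.IchI_Ich[where x = x and y = y, THEN cls_eqI]
  by (simp add: inverse3_def)

lemma cds_Gen: "(e ^^ m) (Gen m 0 x Y) = Gen 0 0 (tgt0 A m x) Y" "(e ^^ n) (Gen 0 n X y) = Gen 0 0 X (tgt0 B n y)"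
  subgoal by (induction m arbitrary: x) (simp_all add: funpow_Suc_simp del: funpow.simps(2))
  subgoal by (induction n arbitrary: y) (simp_all add: funpow_Suc_simp del: funpow.simps(2))
  done

lemma dms_Gen: "(d ^^ m) (Gen m 0 x Y) = Gen 0 0 (src0 A m x) Y" "(d ^^ n) (Gen 0 n X y) = Gen 0 0 X (src0 B n y)"
  subgoal by (induction m arbitrary: x) (simp_all add: funpow_Suc_simp del: funpow.simps(2))
  subgoal by (induction n arbitrary: y) (simp_all add: funpow_Suc_simp del: funpow.simps(2))
  done

text \<open>Inverses of interchange 3-cells are not values of an operation, whence the last closure condition.\<close>

theorem tensor_cell_induct [consumes 1, case_names gen src tgt idt wh hor2 hor3 ver ich inv]:
  assumes x: "x \<in> cell AB n"
    and gen: "\<And>m n x y. \<lbrakk>x \<in> cell A m; y \<in> cell B n; m = 0 \<or> n = 0\<rbrakk> \<Longrightarrow> P (m + n) (ten A B m n x y)"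
    and src: "\<And>n x. x \<in> cell AB (Suc n) \<Longrightarrow> P (Suc n) x \<Longrightarrow> P n (src AB n x)"
    and tgt: "\<And>n x. x \<in> cell AB (Suc n) \<Longrightarrow> P (Suc n) x \<Longrightarrow> P n (tgt AB n x)"
    and idt: "\<And>n x. \<lbrakk>x \<in> cell AB n; n < 3; P n x\<rbrakk> \<Longrightarrow> P (Suc n) (idt AB n x)"
    and wh: "\<And>m n x y. \<lbrakk>x \<in> cell AB m; y \<in> cell AB n; m \<ge> 1; n \<ge> 1; m = 1 \<or> n = 1; tgt0 AB m x = src0 AB n y; P m x;
        P n y\<rbrakk> \<Longrightarrow> P (m + n - 1) (wh AB m n x y)"
    and hor2: "\<And>x y. \<lbrakk>x \<in> cell AB 2; y \<in> cell AB 2; tgt AB 1 x = src AB 1 y; P 2 x; P 2 y\<rbrakk> \<Longrightarrow> P 2 (hor AB 2 x y)"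
    and hor3: "\<And>x y. \<lbrakk>x \<in> cell AB 3; y \<in> cell AB 3; tgt AB 1 (tgt AB 2 x) = src AB 1 (src AB 2 y); P 3 x; P 3 y\<rbrakk> \<Longrightarrow>
      P 3 (hor AB 3 x y)"
    and ver: "\<And>x y. \<lbrakk>x \<in> cell AB 3; y \<in> cell AB 3; tgt AB 2 x = src AB 2 y; P 3 x; P 3 y\<rbrakk> \<Longrightarrow> P 3 (ver AB x y)"
    and ich: "\<And>x y. \<lbrakk>x \<in> cell AB 2; y \<in> cell AB 2; tgt0 AB 2 x = src0 AB 2 y; P 2 x; P 2 y\<rbrakk> \<Longrightarrow> P 3 (ich AB x y)"
    and inv: "\<And>x y. inverse3 AB x y \<Longrightarrow> P 3 x \<Longrightarrow> P 3 y"
  shows "P n x"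
proof -
  have PG: "P (m + n) (c (m + n) (Gen m n x y))" if "x \<in> cell A m" "y \<in> cell B n" "m = 0 \<or> n = 0" for m n x y
    using gen[OF that] by (simp add: ten_def)
  have Pd: "P n (c n (d t))" "P n (c n (e t))" if "wt (Suc n) t" "P (Suc n) (c (Suc n) t)" for n t
    using src[OF wt_cell that(2)] tgt[OF wt_cell that(2)] that(1) by (simp_all add: op_src op_tgt)
  have Pd' [simp]: "wt 1 t \<Longrightarrow> P 1 (c 1 t) \<Longrightarrow> P 0 (c 0 (d t))" "wt 1 t \<Longrightarrow> P 1 (c 1 t) \<Longrightarrow> P 0 (c 0 (e t))"
    "wt 2 t \<Longrightarrow> P 2 (c 2 t) \<Longrightarrow> P 1 (c 1 (d t))" "wt 2 t \<Longrightarrow> P 2 (c 2 t) \<Longrightarrow> P 1 (c 1 (e t))"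
    "wt 3 t \<Longrightarrow> P 3 (c 3 t) \<Longrightarrow> P 2 (c 2 (d t))" "wt 3 t \<Longrightarrow> P 3 (c 3 t) \<Longrightarrow> P 2 (c 2 (e t))" for t
    using Pd[of 0 t] Pd[of 1 t] Pd[of 2 t] by simp_all
  have PIdt: "P (Suc n) (c (Suc n) (Idt n t))" if "wt n t" "n < 3" "P n (c n t)" for n t
    using idt[OF wt_cell that(2,3)] that by (simp add: op_idt)
  have PIdt' [simp]: "wt 0 t \<Longrightarrow> P 0 (c 0 t) \<Longrightarrow> P 1 (c 1 (Idt 0 t))" "wt 1 t \<Longrightarrow> P 1 (c 1 t) \<Longrightarrow> P 2 (c 2 (Idt 1 t))"
    "wt 2 t \<Longrightarrow> P 2 (c 2 t) \<Longrightarrow> P 3 (c 3 (Idt 2 t))" for t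
    using PIdt[of 0 t] PIdt[of 1 t] PIdt[of 2 t] by simp_all
  have PWh: "P (m + n - 1) (c (m + n - 1) (Wh m n x y))" if "wt m x" "wt n y" "m \<ge> 1" "n \<ge> 1" "m = 1 \<or> n = 1"
    "c 0 ((e ^^ m) x) = c 0 ((d ^^ n) y)" "P m (c m x)" "P n (c n y)" for m n x y
    using wh[of "c m x" m "c n y" n] that by (simp add: op_wh)
  have PWh' [simp]:
    "\<lbrakk>wt 1 x; wt 1 y; c 0 (e x) = c 0 (d y); P 1 (c 1 x); P 1 (c 1 y)\<rbrakk> \<Longrightarrow> P 1 (c 1 (Wh 1 1 x y))"
    "\<lbrakk>wt 1 x; wt 2 y; c 0 (e x) = c 0 (d (d y)); P 1 (c 1 x); P 2 (c 2 y)\<rbrakk> \<Longrightarrow> P 2 (c 2 (Wh 1 2 x y))"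
    "\<lbrakk>wt 1 x; wt 3 y; c 0 (e x) = c 0 (d (d (d y))); P 1 (c 1 x); P 3 (c 3 y)\<rbrakk> \<Longrightarrow> P 3 (c 3 (Wh 1 3 x y))"
    "\<lbrakk>wt 2 x; wt 1 y; c 0 (e (e x)) = c 0 (d y); P 2 (c 2 x); P 1 (c 1 y)\<rbrakk> \<Longrightarrow> P 2 (c 2 (Wh 2 1 x y))"
    "\<lbrakk>wt 3 x; wt 1 y; c 0 (e (e (e x))) = c 0 (d y); P 3 (c 3 x); P 1 (c 1 y)\<rbrakk> \<Longrightarrow> P 3 (c 3 (Wh 3 1 x y))"
    for x y
    using PWh[of 1 x 1 y] PWh[of 1 x 2 y] PWh[of 1 x 3 y] PWh[of 2 x 1 y] PWh[of 3 x 1 y] by simp_all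
  have PH [simp]:
    "\<lbrakk>wt 2 x; wt 2 y; c 1 (e x) = c 1 (d y); P 2 (c 2 x); P 2 (c 2 y)\<rbrakk> \<Longrightarrow> P 2 (c 2 (Hor 2 x y))"
    "\<lbrakk>wt 3 x; wt 3 y; c 1 (e (e x)) = c 1 (d (d y)); P 3 (c 3 x); P 3 (c 3 y)\<rbrakk> \<Longrightarrow> P 3 (c 3 (Hor 3 x y))"
    "\<lbrakk>wt 3 x; wt 3 y; c 2 (e x) = c 2 (d y); P 3 (c 3 x); P 3 (c 3 y)\<rbrakk> \<Longrightarrow> P 3 (c 3 (Ver x y))"
    for x y
    using hor2[of "c 2 x" "c 2 y"] hor3[of "c 3 x" "c 3 y"] ver[of "c 3 x" "c 3 y"] by simp_all
  have PI [simp]: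
    "\<lbrakk>wt 2 x; wt 2 y; c 0 (e (e x)) = c 0 (d (d y)); P 2 (c 2 x); P 2 (c 2 y)\<rbrakk> \<Longrightarrow> P 3 (c 3 (Ich x y))"
    for x y
    using ich[of "c 2 x" "c 2 y"] by simp
  have PII [simp]:
    "\<lbrakk>wt 2 x; wt 2 y; c 0 (e (e x)) = c 0 (d (d y)); P 2 (c 2 x); P 2 (c 2 y)\<rbrakk> \<Longrightarrow> P 3 (c 3 (IchI x y))"
    for x y
    using inv[OF inverse3_IchI[of x y]] by simp
  \<comment> \<open>Well-formedness is itself a derivation of \<open>teq\<close> and may pass
    through any relation, so the induction runs over all rules. Both terms of a derivation have the
    same class, and therefore only the left one is treated.\<close>
  have main: "teq A B n t u \<Longrightarrow> P n (c n t)" for n t u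
  proof (induction rule: teq.induct)
    case (sym n x y)
    then show ?case using cls_eqI[of n x y] by simp
  next
    case (dm n x y)
    then show ?case using Pd teqD by blast
  next
    case (cd n x y)
    then show ?case using Pd teqD by blast
  next
    case (dm_glob n x)
    then show ?case using Pd wt_dm by simp
  next
    case (cd_glob n x)
    then show ?case using Pd wt_dm by simp
  next
    case (Gen x m y n)
    then show ?case using PG by blast
  next
    case (Idt n x x')
    then show ?case using PIdt teqD by blast
  next
    case (Wh m x x' n y y')
    note teqD[OF Wh.hyps(1)] teqD[OF Wh.hyps(2)] cls_eqI[OF Wh.hyps(6)]
    then show ?case using PWh[of m x n y] Wh.hyps(3-5) Wh.IH by simp
  next
    case (Hor n x x' y y')
    note teqD[OF Hor.hyps(1)] teqD[OF Hor.hyps(2)] cls_eqI[OF Hor.hyps(4)]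
    then show ?case using Hor.hyps(3) Hor.IH by auto
  next
    case (Ver x x' y y')
    note teqD[OF Ver.hyps(1)] teqD[OF Ver.hyps(2)] cls_eqI[OF Ver.hyps(3)]
    then show ?case using Ver.IH by simp
  next
    case (Ich x x' y y')
    note teqD[OF Ich.hyps(1)] teqD[OF Ich.hyps(2)] cls_eqI[OF Ich.hyps(3)]
    then show ?case using Ich.IH by simp
  next
    case (IchI x x' y y')
    note teqD[OF IchI.hyps(1)] teqD[OF IchI.hyps(2)] cls_eqI[OF IchI.hyps(3)]
    then show ?case using IchI.IH by simp
  next
    case (Hor_Ver x x' y y')
    then show ?case using cls_vcomp3[of x x'] cls_vcomp3[of y y'] by simp
  next
    case (Wh_Hor_right f n x x')
    then show ?case using cls_comp2[of x x'] cls_comp3[of x x'] by (cases "n = 2") simp_all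
  next
    case (Wh_Ver_right f x x')
    then show ?case using cls_vcomp3[of x x'] by simp
  next
    case (Wh_assoc l x m y n z)
    have w: "wt l x" "wt m y" "wt n z" using Wh_assoc by simp_all
    have "n = 1 \<or> n = 2 \<or> n = 3" "m = 1 \<or> m = 2 \<or> m = 3" "l = 1 \<or> l = 2 \<or> l = 3"
      by (rule wt_pos_cases[OF w(3)] wt_pos_cases[OF w(2)] wt_pos_cases[OF w(1)], use Wh_assoc in simp)+
    then show ?case using Wh_assoc w by (elim disjE conjE) (simp_all add: wt_cds)
  next
    case (Wh_unit_left n x)
    then show ?case using cls_eqI[OF teq.Wh_unit_left[of A B n x]] by simp
  next
    case (Wh_unit_right n x)
    then show ?case using cls_eqI[OF teq.Wh_unit_right[of A B n x]] by simp
  next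
    case (Hor_assoc n x y z)
    then show ?case by (cases "n = 2") simp_all
  next
    case (Ich_Hor_left x x' y)
    then show ?case using cls_comp2[of x x'] by simp
  next
    case (Ich_Hor_right x y y')
    then show ?case using cls_comp2[of y y'] by simp
  next
    case (Ich_nat_right x y)
    then show ?case
      using cls_Wh21[of x "d (e y)" x "d (d y)"] cls_Wh11[of "e x" "d (e y)" "e x" "d (d y)"]
        cls_Hor2[of "Wh 2 1 x (d (e y))" "Wh 1 2 (e x) (e y)" "Wh 2 1 x (d (d y))" "Wh 1 2 (e x) (e y)"]
      by simp
  next
    case (Gen_right_idt X y n)
    then show ?case using PG[of X 0 "idt B n y" "Suc n"] B.idt_cell by simp
  next
    case (Gen_left_idt x n Y)
    then show ?case using PG[of "idt A n x" "Suc n" Y 0] A.idt_cell by simp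
  next
    case (Gen_right_wh X y m y' n)
    then show ?case using PG[of X 0 "wh B m n y y'" "m + n - 1"] B.wh_cell[of y m y' n] by simp
  next
    case (Gen_left_wh x m x' n Y)
    then show ?case using PG[of "wh A m n x x'" "m + n - 1" Y 0] A.wh_cell[of x m x' n] by simp
  next
    case (Gen_right_hor2 X y y')
    then show ?case using PG[of X 0 "hor B 2 y y'" 2] by simp
  next
    case (Gen_left_hor2 x x' Y)
    then show ?case using PG[of "hor A 2 x x'" 2 Y 0] by simp
  next
    case (Gen_right_hor3 X y y')
    then show ?case using PG[of X 0 "hor B 3 y y'" 3] by simp
  next
    case (Gen_left_hor3 x x' Y)
    then show ?case using PG[of "hor A 3 x x'" 3 Y 0] by simp
  next
    case (Gen_right_ver X y y')
    then show ?case using PG[of X 0 "ver B y y'" 3] by simp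
  next
    case (Gen_left_ver x x' Y)
    then show ?case using PG[of "ver A x x'" 3 Y 0] by simp
  next
    case (Gen_right_ich X y y')
    then show ?case using PG[of X 0 "ich B y y'" 3] by simp
  next
    case (Gen_left_ich x x' Y)
    then show ?case using PG[of "ich A x x'" 3 Y 0] by simp
  next
    case (Gen_nat x m y n)
    have "c 0 ((e ^^ m) (Gen m 0 x (src0 B n y))) = c 0 ((d ^^ n) (Gen 0 n (tgt0 A m x) y))"
      by (simp add: cds_Gen dms_Gen)
    then show ?case using PWh[of m "Gen m 0 x (src0 B n y)" n "Gen 0 n (tgt0 A m x) y"]
        Gen_nat PG[of x m "src0 B n y" 0] PG[of "tgt0 A m x" 0 y n] wt_Gen[of x m "src0 B n y" 0] wt_Gen[of "tgt0 A
            m x" 0 y n]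
        B.src0_cell A.tgt0_cell by simp
  next
    case (Gen_ich a b)
    then show ?case using PI[of "Gen 2 0 a (src0 B 2 b)" "Gen 0 2 (tgt0 A 2 a) b"]
       PG[of a 2 "src0 B 2 b" 0] PG[of "tgt0 A 2 a" 0 b 2] wt_Gen[of a 2 "src0 B 2 b" 0] wt_Gen[of "tgt0 A 2 a" 0 b
           2] by simp
  qed (auto simp: wt_cds)
  show ?thesis using x by (elim tensor_cellE) (metis main wt_def)
qed

end

section \<open>The universal property of the tensor product\<close>

locale gray_eval = Q: gray_quasi A B D H + gray_tensor A B
  for A :: "'a gray" and B :: "'b gray" and D :: "'c gray" and H
begin

text \<open>The interpretation forced by the values \<open>H\<close> on generators, extended to all
  formal cells whether or not they are well formed. The value at \<open>IchI\<close> is a chosen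
  inverse, determined by \<open>inverse3_unique\<close> as soon as one exists.\<close>

primrec ev :: "('a, 'b) trm \<Rightarrow> 'c" where
  "ev (Gen m n x y) = H m n x y"
| "ev (Idt n x) = idt D n (ev x)"
| "ev (Wh m n x y) = wh D m n (ev x) (ev y)"
| "ev (Hor n x y) = hor D n (ev x) (ev y)"
| "ev (Ver x y) = ver D (ev x) (ev y)"
| "ev (Ich x y) = ich D (ev x) (ev y)"
| "ev (IchI x y) = (SOME k. inverse3 D (ich D (ev x) (ev y)) k)"

text \<open>Evaluation commutes with the formal boundaries hereditarily, down to dimension 0. The
  full depth is needed because the rules of \<open>teq\<close> put conditions on iterated
  boundaries.\<close>

primrec good :: "nat \<Rightarrow> ('a, 'b) trm \<Rightarrow> bool" where
  "good 0 t \<longleftrightarrow> ev t \<in> cell D 0"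
| "good (Suc n) t \<longleftrightarrow> ev t \<in> cell D (Suc n) \<and> ev (d t) = src D n (ev t) \<and> ev (e t) = tgt D n (ev t) \<and>
    good n (d t) \<and> good n (e t)"

lemma good_iff:
  "good 1 t \<longleftrightarrow> ev t \<in> cell D 1 \<and> ev (d t) = src D 0 (ev t) \<and> ev (e t) = tgt D 0 (ev t) \<and> good 0 (d t) \<and> good 0 (e t)"
  "good 2 t \<longleftrightarrow> ev t \<in> cell D 2 \<and> ev (d t) = src D 1 (ev t) \<and> ev (e t) = tgt D 1 (ev t) \<and> good 1 (d t) \<and> good 1 (e t)"
  "good 3 t \<longleftrightarrow> ev t \<in> cell D 3 \<and> ev (d t) = src D 2 (ev t) \<and> ev (e t) = tgt D 2 (ev t) \<and> good 2 (d t) \<and> good 2 (e t)"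
  using good.simps(2)[of 0 t] good.simps(2)[of 1 t] good.simps(2)[of 2 t] by (simp_all del: good.simps(2))

lemma good_cell [simp]:
  "good 0 t \<Longrightarrow> ev t \<in> cell D 0" "good 1 t \<Longrightarrow> ev t \<in> cell D 1" "good 2 t \<Longrightarrow> ev t \<in> cell D 2" "good 3 t \<Longrightarrow> ev t \<in> cell D
      3"
  by (simp_all add: good_iff)

lemma good_cell': "good n t \<Longrightarrow> ev t \<in> cell D n"
  by (cases n) simp_all

lemma good_boundary [simp]:
  "good 1 t \<Longrightarrow> good 0 (d t)" "good 1 t \<Longrightarrow> good 0 (e t)" "good 2 t \<Longrightarrow> good 1 (d t)" "good 2 t \<Longrightarrow> good 1 (e t)"
  "good 3 t \<Longrightarrow> good 2 (d t)" "good 3 t \<Longrightarrow> good 2 (e t)"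
  using good_iff[of t] by blast+

lemma ev_boundary [simp]:
  "good 1 t \<Longrightarrow> ev (d t) = src D 0 (ev t)" "good 1 t \<Longrightarrow> ev (e t) = tgt D 0 (ev t)"
  "good 2 t \<Longrightarrow> ev (d t) = src D 1 (ev t)" "good 2 t \<Longrightarrow> ev (e t) = tgt D 1 (ev t)"
  "good 3 t \<Longrightarrow> ev (d t) = src D 2 (ev t)" "good 3 t \<Longrightarrow> ev (e t) = tgt D 2 (ev t)"
  using good_iff[of t] by blast+

lemma ev_bd: "good n t \<Longrightarrow> ev ((d ^^ n) t) = src0 D n (ev t)" "good n t \<Longrightarrow> ev ((e ^^ n) t) = tgt0 D n (ev t)"
  by (induction n arbitrary: t) (simp_all add: funpow_Suc_simp del: funpow.simps(2))

declare good.simps(2) [simp del]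

lemma good_Idt [simp]:
  "good 0 x \<Longrightarrow> good 1 (Idt 0 x)" "good 1 x \<Longrightarrow> good 2 (Idt 1 x)" "good 2 x \<Longrightarrow> good 3 (Idt 2 x)"
  by (simp_all add: good_iff(1)[of "Idt 0 x"] good_iff(2)[of "Idt 1 x"] good_iff(3)[of "Idt 2 x"])

lemma good_Hor2 [simp]:
  "\<lbrakk>good 2 x; good 2 y; tgt D 1 (ev x) = src D 1 (ev y)\<rbrakk> \<Longrightarrow> good 2 (Hor 2 x y)"
  using Q.C.comp2[of "ev x" "ev y"] by (simp add: good_iff(2)[of "Hor 2 x y"])

lemma good_Hor3 [simp]:
  "\<lbrakk>good 3 x; good 3 y; tgt D 1 (tgt D 2 (ev x)) = src D 1 (src D 2 (ev y))\<rbrakk> \<Longrightarrow> good 3 (Hor 3 x y)"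
  using Q.C.comp3[of "ev x" "ev y"] by (simp add: good_iff(3)[of "Hor 3 x y"])

lemma good_Ver [simp]:
  "\<lbrakk>good 3 x; good 3 y; tgt D 2 (ev x) = src D 2 (ev y)\<rbrakk> \<Longrightarrow> good 3 (Ver x y)"
  using Q.C.vcomp3[of "ev x" "ev y"] by (simp add: good_iff(3)[of "Ver x y"])

lemma good_Wh11 [simp]:
  "\<lbrakk>good 1 x; good 1 y; tgt D 0 (ev x) = src D 0 (ev y)\<rbrakk> \<Longrightarrow> good 1 (Wh 1 1 x y)"
  by (simp add: good_iff(1)[of "Wh 1 1 x y"])

lemma good_Wh12 [simp]:
  "\<lbrakk>good 1 x; good 2 y; tgt D 0 (ev x) = src D 0 (src D 1 (ev y))\<rbrakk> \<Longrightarrow> good 2 (Wh 1 2 x y)"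
  by (simp add: good_iff(2)[of "Wh 1 2 x y"])

lemma good_Wh21 [simp]:
  "\<lbrakk>good 2 x; good 1 y; tgt D 0 (tgt D 1 (ev x)) = src D 0 (ev y)\<rbrakk> \<Longrightarrow> good 2 (Wh 2 1 x y)"
  by (simp add: good_iff(2)[of "Wh 2 1 x y"])

lemma good_Wh13 [simp]:
  "\<lbrakk>good 1 x; good 3 y; tgt D 0 (ev x) = src D 0 (src D 1 (src D 2 (ev y)))\<rbrakk> \<Longrightarrow> good 3 (Wh 1 3 x y)"
  by (simp add: good_iff(3)[of "Wh 1 3 x y"])

lemma good_Wh31 [simp]:
  "\<lbrakk>good 3 x; good 1 y; tgt D 0 (tgt D 1 (tgt D 2 (ev x))) = src D 0 (ev y)\<rbrakk> \<Longrightarrow> good 3 (Wh 3 1 x y)"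
  by (simp add: good_iff(3)[of "Wh 3 1 x y"])

lemma good_Ich [simp]:
  "\<lbrakk>good 2 x; good 2 y; tgt D 0 (tgt D 1 (ev x)) = src D 0 (src D 1 (ev y))\<rbrakk> \<Longrightarrow> good 3 (Ich x y)"
  by (simp add: good_iff(3)[of "Ich x y"])

lemma ev_IchI:
  "\<lbrakk>good 2 x; good 2 y; tgt D 0 (tgt D 1 (ev x)) = src D 0 (src D 1 (ev y))\<rbrakk> \<Longrightarrow>
    inverse3 D (ich D (ev x) (ev y)) (ev (IchI x y))"
  using someI_ex[OF Q.C.ich_inverse3[of "ev x" "ev y"]] by simp

lemma ev_IchI_eqI:
  "inverse3 D (ich D (ev x) (ev y)) k \<Longrightarrow> ev (IchI x y) = k"
  by (simp add: some_equality Q.C.inverse3_unique)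

lemma good_IchI [simp]:
  "\<lbrakk>good 2 x; good 2 y; tgt D 0 (tgt D 1 (ev x)) = src D 0 (src D 1 (ev y))\<rbrakk> \<Longrightarrow> good 3 (IchI x y)"
  using ev_IchI[of x y] by (simp add: good_iff(3)[of "IchI x y"] inverse3_def del: ev.simps(7))

text \<open>By induction on the total dimension, since the formal boundary of a generator is a
  generator of one dimension less.\<close>

lemma good_Gen: "\<lbrakk>x \<in> cell A m; y \<in> cell B n; m = 0 \<or> n = 0\<rbrakk> \<Longrightarrow> good (m + n) (Gen m n x y)"
proof (induction "m + n" arbitrary: m n x y)
  case 0
  then show ?case using Q.cells(1)[of x y 0] by simp
next
  case (Suc k)
  note R = gray_functor.map_src[OF Q.right] gray_functor.map_tgt[OF Q.right]
    and L = gray_functor.map_src[OF Q.left] gray_functor.map_tgt[OF Q.left]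
  show ?case
  proof (cases m)
    case 0
    then have n: "n = Suc k" using Suc by simp
    then show ?thesis
      using Suc.hyps(1)[of 0 k x "src B k y"] Suc.hyps(1)[of 0 k x "tgt B k y"] Suc.prems 0 Q.cells(1)[of x y n]
        R(1)[of x y k] R(2)[of x y k] Q.B.src_cell Q.B.tgt_cell
      by (simp add: good.simps(2))
  next
    case (Suc j)
    then have n: "n = 0" "j = k" using Suc.hyps Suc.prems by auto
    then show ?thesis
      using Suc.hyps(1)[of k 0 "src A k x" y] Suc.hyps(1)[of k 0 "tgt A k x" y] Suc.prems Suc Q.cells(2)[of y x m]
        L(1)[of y x k] L(2)[of y x k] Q.A.src_cell Q.A.tgt_cell
      by (simp add: good.simps(2))
  qed
qed

lemma good_Gens: "x \<in> cell A m \<Longrightarrow> Y \<in> cell B 0 \<Longrightarrow> good m (Gen m 0 x Y)" "X \<in> cell A 0 \<Longrightarrow> y \<in> cell B n \<Longrightarrow> good n (Gen 0 n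
    X y)"
  using good_Gen[of x m Y 0] good_Gen[of X 0 y n] by simp_all

lemma good_Wh: "\<lbrakk>good m x; good n y; m \<ge> 1; n \<ge> 1; m = 1 \<or> n = 1; tgt0 D m (ev x) = src0 D n (ev y)\<rbrakk> \<Longrightarrow> good (m + n -
    1) (Wh m n x y)"
  using Q.C.cell_pos_cases[OF good_cell'[of m x]] Q.C.cell_pos_cases[OF good_cell'[of n y]] by auto

lemmas right_simps = gray_quasi.left_simps[OF Q.swap]

text \<open>Carrying \<open>good\<close> for both terms makes the induction work: composability
  premises become equations between boundaries in \<open>D\<close>, and each relation turns into an
  axiom of \<open>D\<close>, a functor law for \<open>H\<close> in one variable, or one of the mixed
  conditions.\<close>

theorem sound: "teq A B n t u \<Longrightarrow> good n t \<and> good n u \<and> ev t = ev u"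
proof (induction rule: teq.induct)
  case (sym n x y)
  then show ?case by (simp)
next
  case (trans n x y z)
  then show ?case by (simp)
next
  case (dm n x y)
  then show ?case by (simp add: good.simps(2))
next
  case (cd n x y)
  then show ?case by (simp add: good.simps(2))
next
  case (dm_glob n x)
  then show ?case by (auto simp: good.simps(2) Q.C.src_tgt)
next
  case (cd_glob n x)
  then show ?case by (auto simp: good.simps(2) Q.C.tgt_src)
next
  case (Gen x m y n)
  then show ?case using good_Gen by simp
next
  case (Idt n x x')
  then show ?case using less_3_cases[of n] by auto
next
  case (Wh m x x' n y y')
  then show ?case using good_Wh[of m x n y] good_Wh[of m x' n y'] by (simp add: ev_bd)
next
  case (Hor n x x' y y')
  then show ?case by (cases "n = 2") simp_all
next
  case (Ver x x' y y')
  then show ?case by simp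
next
  case (Ich x x' y y')
  then show ?case by simp
next
  case (IchI x x' y y')
  then show ?case by simp
next
  case (Hor_assoc n x y z)
  then show ?case
    using Q.C.comp2[of "ev x" "ev y"] Q.C.comp2[of "ev y" "ev z"] Q.C.comp3[of "ev x" "ev y"] Q.C.comp3[of "ev y"
        "ev z"]
    by (cases "n = 2") (simp_all add: Q.C.hor2_assoc Q.C.hor3_assoc)
next
  case (Hor2_unit_left x)
  then show ?case by (simp add: Q.C.hor2_idt_left)
next
  case (Hor2_unit_right x)
  then show ?case by (simp add: Q.C.hor2_idt_right)
next
  case (Hor3_unit_left x)
  then show ?case by (simp add: Q.C.hor3_idt_left)
next
  case (Hor3_unit_right x)
  then show ?case by (simp add: Q.C.hor3_idt_right)
next
  case (Ver_assoc x y z)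
  then show ?case using Q.C.vcomp3[of "ev x" "ev y"] Q.C.vcomp3[of "ev y" "ev z"] by (simp add: Q.C.ver_assoc)
next
  case (Ver_unit_left x)
  then show ?case by (simp add: Q.C.ver_idt_left)
next
  case (Ver_unit_right x)
  then show ?case by (simp add: Q.C.ver_idt_right)
next
  case (Hor_Idt x y)
  then show ?case by (simp add: Q.C.hor_idt)
next
  case (Hor_Ver x x' y y')
  then show ?case using Q.C.vcomp3[of "ev x" "ev x'"] Q.C.vcomp3[of "ev y" "ev y'"] Q.C.comp3[of "ev x" "ev y"]
      Q.C.hor_ver[of "ev x" "ev x'" "ev y" "ev y'"] by (simp)
next
  case (Wh_Idt_left f n y)
  then show ?case by (cases "n = 1") simp_all
next
  case (Wh_Idt_right f n x)
  then show ?case by (cases "n = 1") simp_all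
next
  case (Wh_Hor_left f n y y')
  then show ?case using Q.C.comp2[of "ev y" "ev y'"] Q.C.comp3[of "ev y" "ev y'"]
    by (cases "n = 2") (simp_all add: Q.C.wh_hor2_left Q.C.wh_hor3_left)
next
  case (Wh_Hor_right f n y y')
  then show ?case using Q.C.comp2[of "ev y" "ev y'"] Q.C.comp3[of "ev y" "ev y'"]
    by (cases "n = 2") (simp_all add: Q.C.wh_hor2_right Q.C.wh_hor3_right)
next
  case (Wh_Ver_left f y y')
  then show ?case using Q.C.vcomp3[of "ev y" "ev y'"] by (simp add: Q.C.wh_ver_left)
next
  case (Wh_Ver_right f y y')
  then show ?case using Q.C.vcomp3[of "ev y" "ev y'"] by (simp add: Q.C.wh_ver_right)
next
  case (Ich_IchI x y)
  then show ?case using ev_IchI[of x y] by (simp add: inverse3_def del: ev.simps(7))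
next
  case (IchI_Ich x y)
  then show ?case using ev_IchI[of x y] by (simp add: inverse3_def del: ev.simps(7))
next
  case (Ich_nat_left x y)
  then show ?case by (simp add: Q.C.ich_nat_left)
next
  case (Ich_nat_right x y)
  then show ?case by (simp add: Q.C.ich_nat_right)
next
  case (Ich_Idt_left f y)
  then show ?case by (simp add: Q.C.ich_idt_left)
next
  case (Ich_Idt_right x g)
  then show ?case by (simp add: Q.C.ich_idt_right)
next
  case (Ich_Hor_left x x' y)
  then show ?case using Q.C.comp2[of "ev x" "ev x'"] by (simp add: Q.C.ich_hor_left Q.C.hor2_assoc)
next
  case (Ich_Hor_right x y y')
  then show ?case using Q.C.comp2[of "ev y" "ev y'"] by (simp add: Q.C.ich_hor_right Q.C.hor2_assoc)
next
  case (Wh_unit_left n x)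
  then have "n = 1 \<or> n = 2 \<or> n = 3" using Q.C.cell_pos_cases[OF good_cell'[of n x]] by simp
  then show ?case using Wh_unit_left by (elim disjE) simp_all
next
  case (Wh_unit_right n x)
  then have "n = 1 \<or> n = 2 \<or> n = 3" using Q.C.cell_pos_cases[OF good_cell'[of n x]] by simp
  then show ?case using Wh_unit_right by (elim disjE) simp_all
next
  case (Wh_assoc l x m y n z)
  then have "n = 1 \<or> n = 2 \<or> n = 3" "m = 1 \<or> m = 2 \<or> m = 3" "l = 1 \<or> l = 2 \<or> l = 3"
    using Q.C.cell_pos_cases[OF good_cell'[of n z]] Q.C.cell_pos_cases[OF good_cell'[of m y]]
      Q.C.cell_pos_cases[OF good_cell'[of l x]] by simp_all
  then show ?case using Wh_assoc by (elim disjE conjE) (simp_all add: Q.C.wh_assoc_simps)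
next
  case (Ich_Wh_left f x y)
  then show ?case by (simp add: Q.C.ich_wh_left)
next
  case (Ich_Wh_mid x f y)
  then show ?case by (simp add: Q.C.ich_wh_mid)
next
  case (Ich_Wh_right x y f)
  then show ?case by (simp add: Q.C.ich_wh_right)
next
  case (Gen_right_idt X y n)
  then show ?case
    using right_simps(1)[of X y n] good_Gens(2)[of X "idt B n y" "Suc n"] good_Gens(2)[of X y n] less_3_cases[of n]
        Q.B.idt_cell by auto
next
  case (Gen_left_idt x n Y)
  then show ?case
    using Q.left_simps(1)[of Y x n] good_Gens(1)[of "idt A n x" "Suc n" Y] good_Gens(1)[of x n Y] less_3_cases[of n]
        Q.A.idt_cell by auto
next
  case (Gen_right_wh X y m y' n)
  have "X \<in> cell A 0" "y \<in> cell B m" "y' \<in> cell B n" "m \<ge> 1" "n \<ge> 1" "m = 1 \<or> n = 1" "tgt0 B m y = src0 B n y'"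
    by fact+
  then show ?case
    using right_simps(2)[of X y m y' n] good_Gens(2)[of X "wh B m n y y'" "m + n - 1"] good_Gens(2)[of X y m]
        good_Gens(2)[of X y' n]
      Q.B.wh_cell[of y m y' n] good_Wh[of m "Gen 0 m X y" n "Gen 0 n X y'"]
      gray_functor.map_tgt0[OF Q.right, of X y m] gray_functor.map_src0[OF Q.right, of X y' n] Q.B.src0_cell[of y'
          n] by simp
next
  case (Gen_left_wh y m y' n Y)
  have "Y \<in> cell B 0" "y \<in> cell A m" "y' \<in> cell A n" "m \<ge> 1" "n \<ge> 1" "m = 1 \<or> n = 1" "tgt0 A m y = src0 A n y'"
    by fact+
  then show ?case
    using Q.left_simps(2)[of Y y m y' n] good_Gens(1)[of "wh A m n y y'" "m + n - 1" Y] good_Gens(1)[of y m Y]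
        good_Gens(1)[of y' n Y]
      Q.A.wh_cell[of y m y' n] good_Wh[of m "Gen m 0 y Y" n "Gen n 0 y' Y"]
      gray_functor.map_tgt0[OF Q.left, of Y y m] gray_functor.map_src0[OF Q.left, of Y y' n] Q.A.src0_cell[of y' n]
          by simp
next
  case (Gen_right_hor2 X y y')
  then show ?case
    using right_simps(3)[of X y y'] good_Gens(2)[of X "hor B 2 y y'" 2] good_Gens(2)[of X y 2] good_Gens(2)[of X y'
        2]
      gray_functor.map_boundary(4)[OF Q.right, of X y] gray_functor.map_boundary(3)[OF Q.right, of X y'] by simp
next
  case (Gen_left_hor2 y y' X)
  then show ?case
    using Q.left_simps(3)[of X y y'] good_Gens(1)[of "hor A 2 y y'" 2 X] good_Gens(1)[of y 2 X] good_Gens(1)[of y' 2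
        X]
      gray_functor.map_boundary(4)[OF Q.left, of X y] gray_functor.map_boundary(3)[OF Q.left, of X y'] by simp
next
  case (Gen_right_hor3 X y y')
  then show ?case
    using right_simps(4)[of X y y'] good_Gens(2)[of X "hor B 3 y y'" 3] good_Gens(2)[of X y 3] good_Gens(2)[of X y'
        3]
      gray_functor.map_boundary(6)[OF Q.right, of X y] gray_functor.map_boundary(5)[OF Q.right, of X y']
          gray_functor.map_boundary(4)[OF Q.right, of X "tgt B 2 y"] gray_functor.map_boundary(3)[OF Q.right, of X
          "src B 2 y'"] by simp
next
  case (Gen_left_hor3 y y' X)
  then show ?case
    using Q.left_simps(4)[of X y y'] good_Gens(1)[of "hor A 3 y y'" 3 X] good_Gens(1)[of y 3 X] good_Gens(1)[of y' 3
        X]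
      gray_functor.map_boundary(6)[OF Q.left, of X y] gray_functor.map_boundary(5)[OF Q.left, of X y']
          gray_functor.map_boundary(4)[OF Q.left, of X "tgt A 2 y"] gray_functor.map_boundary(3)[OF Q.left, of X
          "src A 2 y'"] by simp
next
  case (Gen_right_ver X y y')
  then show ?case
    using right_simps(5)[of X y y'] good_Gens(2)[of X "ver B y y'" 3] good_Gens(2)[of X y 3] good_Gens(2)[of X y' 3]
      gray_functor.map_boundary(6)[OF Q.right, of X y] gray_functor.map_boundary(5)[OF Q.right, of X y'] by simp
next
  case (Gen_left_ver y y' X)
  then show ?case
    using Q.left_simps(5)[of X y y'] good_Gens(1)[of "ver A y y'" 3 X] good_Gens(1)[of y 3 X] good_Gens(1)[of y' 3
        X]
      gray_functor.map_boundary(6)[OF Q.left, of X y] gray_functor.map_boundary(5)[OF Q.left, of X y'] by simp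
next
  case (Gen_right_ich X y y')
  then show ?case
    using right_simps(6)[of X y y'] good_Gens(2)[of X "ich B y y'" 3] good_Gens(2)[of X y 2] good_Gens(2)[of X y' 2]
      gray_functor.map_boundary(4)[OF Q.right, of X y] gray_functor.map_boundary(3)[OF Q.right, of X y']
          gray_functor.map_boundary(2)[OF Q.right, of X "tgt B 1 y"] gray_functor.map_boundary(1)[OF Q.right, of X
          "src B 1 y'"] by simp
next
  case (Gen_left_ich y y' X)
  then show ?case
    using Q.left_simps(6)[of X y y'] good_Gens(1)[of "ich A y y'" 3 X] good_Gens(1)[of y 2 X] good_Gens(1)[of y' 2
        X]
      gray_functor.map_boundary(4)[OF Q.left, of X y] gray_functor.map_boundary(3)[OF Q.left, of X y']
          gray_functor.map_boundary(2)[OF Q.left, of X "tgt A 1 y"] gray_functor.map_boundary(1)[OF Q.left, of X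
          "src A 1 y'"] by simp
next
  case (Gen_nat x m y n)
  have a: "x \<in> cell A m" "y \<in> cell B n" "m \<ge> 1" "n \<ge> 1" "m = 1 \<or> n = 1" by fact+
  have b: "src0 A m x \<in> cell A 0" "tgt0 A m x \<in> cell A 0" "src0 B n y \<in> cell B 0" "tgt0 B n y \<in> cell B 0"
    using a Q.A.src0_cell Q.A.tgt0_cell Q.B.src0_cell Q.B.tgt0_cell by auto
  show ?case
    using Q.quasi_wh[OF a] good_Gens(1)[OF a(1) b(3)] good_Gens(1)[OF a(1) b(4)] good_Gens(2)[OF b(1) a(2)]
        good_Gens(2)[OF b(2) a(2)]
      good_Wh[of m "Gen m 0 x (src0 B n y)" n "Gen 0 n (tgt0 A m x) y"] good_Wh[of n "Gen 0 n (src0 A m x) y" m "Gen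
          m 0 x (tgt0 B n y)"]
      gray_functor.map_tgt0[OF Q.left[OF b(3)] a(1)] gray_functor.map_src0[OF Q.right[OF b(2)] a(2)]
      gray_functor.map_src0[OF Q.left[OF b(4)] a(1)] gray_functor.map_tgt0[OF Q.right[OF b(1)] a(2)] a b
    by (auto simp: add.commute)
next
  case (Gen_ich a b)
  have b: "src0 A 2 a \<in> cell A 0" "tgt0 A 2 a \<in> cell A 0" "src0 B 2 b \<in> cell B 0" "tgt0 B 2 b \<in> cell B 0"
    using Gen_ich by simp_all
  have i: "inverse3 D (ich D (H 2 0 a (src0 B 2 b)) (H 0 2 (tgt0 A 2 a) b)) (ich D (H 0 2 (src0 A 2 a) b) (H 2 0 a
      (tgt0 B 2 b)))"
    by (rule Q.quasi_ich) fact+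
  have "good 3 (Ich (Gen 2 0 a (src0 B 2 b)) (Gen 0 2 (tgt0 A 2 a) b))" "good 3 (IchI (Gen 0 2 (src0 A 2 a) b) (Gen
      2 0 a (tgt0 B 2 b)))"
    using good_Gens(1)[OF Gen_ich(1) b(3)] good_Gens(1)[OF Gen_ich(1) b(4)] good_Gens(2)[OF b(1) Gen_ich(2)]
        good_Gens(2)[OF b(2) Gen_ich(2)]
      gray_functor.map_tgt0[OF Q.left[OF b(3)] Gen_ich(1)] gray_functor.map_src0[OF Q.right[OF b(2)] Gen_ich(2)]
      gray_functor.map_src0[OF Q.left[OF b(4)] Gen_ich(1)] gray_functor.map_tgt0[OF Q.right[OF b(1)] Gen_ich(2)] b
          Gen_ich
    by simp_all
  \<comment> \<open>By \<open>quasi_ich\<close> the interchange cell on the right is an inverse of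
    the one that \<open>IchI\<close> refers to, so it is the chosen inverse.\<close>
  moreover have "ev (IchI (Gen 0 2 (src0 A 2 a) b) (Gen 2 0 a (tgt0 B 2 b))) = ich D (H 2 0 a (src0 B 2 b)) (H 0 2
      (tgt0 A 2 a) b)"
    using Q.C.inverse3_sym[OF i] by (intro ev_IchI_eqI) simp
  ultimately show ?case by (simp del: ev.simps(7))
qed

lemma wt_good: "wt n t \<Longrightarrow> good n t"
  using sound unfolding wt_def by blast

definition lift :: "nat \<Rightarrow> ('a, 'b) trm set \<Rightarrow> 'c" where
  "lift n = restrict (\<lambda>X. ev (rep X)) (cell AB n)"

lemma lift_cls: "wt n t \<Longrightarrow> lift n (c n t) = ev t"
  using sound[OF teq_rep[of n t]] by (simp add: lift_def)

lemma lift_gen: "\<lbrakk>x \<in> cell A m; y \<in> cell B n; m = 0 \<or> n = 0\<rbrakk> \<Longrightarrow> lift (m + n) (ten A B m n x y) = H m n x y"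
  by (simp add: ten_def lift_cls wt_Gen)

theorem lift_functor: "gray_functor AB D lift"
  apply (intro gray_functor.intro gray_functor_axioms.intro)
  subgoal by (rule tensor_cat)
  subgoal by (rule Q.C.gray_cat_axioms)
  subgoal by (simp add: lift_def)
  subgoal by (elim tensor_cellE) (simp add: lift_cls wt_good good_cell')
  subgoal for x n
    apply (elim tensor_cellE)
    subgoal for t using wt_good[of "Suc n" t] by (simp add: lift_cls op_src wt_dm good.simps(2))
    done
  subgoal for x n
    apply (elim tensor_cellE)
    subgoal for t using wt_good[of "Suc n" t] by (simp add: lift_cls op_tgt wt_cd good.simps(2))
    done
  subgoal for x n
    apply (elim tensor_cellE)
    subgoal for t using less_3_cases[of n] by (auto simp: lift_cls)
    done
  subgoal for x m y n by (elim tensor_cellE) (simp add: lift_cls op_wh wt_Wh)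
  subgoal by (elim tensor_cellE) (simp add: lift_cls)
  subgoal by (elim tensor_cellE) (simp add: lift_cls)
  subgoal by (elim tensor_cellE) (simp add: lift_cls)
  subgoal by (elim tensor_cellE) (simp add: lift_cls)
  done

end

section \<open>Uniqueness of functors on the tensor product, and the universal quasi-functor\<close>

context gray_tensor
begin

theorem tensor_functor_eqI:
  assumes K: "gray_functor AB D K" and L: "gray_functor AB D L"
    and gens: "\<And>m n x y. \<lbrakk>x \<in> cell A m; y \<in> cell B n; m = 0 \<or> n = 0\<rbrakk> \<Longrightarrow>
      K (m + n) (ten A B m n x y) = L (m + n) (ten A B m n x y)"
  shows "K = L"
proof (rule gray_functor_eqI[OF K L])
  interpret K: gray_functor "AB" D K by fact
  interpret L: gray_functor "AB" D L by fact
  fix n x assume "x \<in> cell AB n"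
  then show "K n x = L n x"
  proof (induction rule: tensor_cell_induct)
    case (src n x)
    then show ?case using K.map_src[of x n] L.map_src[of x n] by simp
  next
    case (tgt n x)
    then show ?case using K.map_tgt[of x n] L.map_tgt[of x n] by simp
  next
    case (inv x y)
    \<comment> \<open>Both functors send \<open>y\<close> to an inverse of the common value at
      \<open>x\<close>.\<close>
    have "inverse3 D (K 3 x) (K 3 y)" "inverse3 D (K 3 x) (L 3 y)"
      using K.map_inverse3[OF inv(1)] L.map_inverse3[OF inv(1)] inv(2) by simp_all
    then show ?case by (rule K.B.inverse3_unique)
  qed (simp_all add: gens K.map_idt L.map_idt K.map_wh L.map_wh)
qed

text \<open>The induction principle produces 0-cells also as boundaries of 1-cells, so the claim is
  strengthened to the ends of cells of all dimensions. For a 0-cell both ends are the cell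
  itself.\<close>

lemma tensor_objects:
  assumes "x \<in> cell AB 0"
  obtains a b where "a \<in> cell A 0" "b \<in> cell B 0" "x = ten A B 0 0 a b"
proof -
  interpret T: gray_cat "AB" by (rule tensor_cat)
  define S where "S = {ten A B 0 0 a b |a b. a \<in> cell A 0 \<and> b \<in> cell B 0}"
  have "src0 AB n x \<in> S \<and> tgt0 AB n x \<in> S" if "x \<in> cell AB n" for n x
    using that
  proof (induction rule: tensor_cell_induct)
    case (gen m n x y)
    then consider "m = 0" | "n = 0" by blast
    then show ?case
    proof cases
      case m: 1
      then show ?thesis using gen wt_Gen[of x 0 y n] B.src0_cell[of y n] B.tgt0_cell[of y n]
        by (auto simp: ten_def S_def cds_Gen dms_Gen)
    next
      case n: 2
      then show ?thesis using gen wt_Gen[of x m y 0] A.src0_cell[of x m] A.tgt0_cell[of x m]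
        by (auto simp: ten_def S_def cds_Gen dms_Gen)
    qed
  next
    case (src n x)
    then show ?case using T.tgt0_src[of x n] by (cases "n = 0") auto
  next
    case (tgt n x)
    then show ?case using T.src0_tgt[of x n] by (cases "n = 0") auto
  next
    case (idt n x)
    then show ?case using T.src_idt T.tgt_idt by simp
  next
    case (wh m n x y)
    then show ?case using T.src0_wh T.tgt0_wh by simp
  next
    case (hor2 x y)
    then show ?case using T.comp2[of x y] by simp
  next
    case (hor3 x y)
    then show ?case using T.comp3[of x y] by simp
  next
    case (ver x y)
    then show ?case using T.vcomp3[of x y] by simp
  next
    case (ich x y)
    then show ?case by simp
  next
    case (inv x y)
    then show ?case using T.inverse3_boundary[OF inv(1)] by (simp del: bd_simps)
  qed
  from this[OF assms] show ?thesis using that by (auto simp: S_def)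
qed

lemma ten_right: "X \<in> cell A 0 \<Longrightarrow> gray_functor B AB (\<lambda>n. restrict (ten A B 0 n X) (cell B n))"
  apply (intro gray_functor.intro gray_functor_axioms.intro)
  subgoal by (rule B.gray_cat_axioms)
  subgoal by (rule tensor_cat)
  subgoal by simp
  subgoal for y n using wt_Gen[of X 0 y n] by (simp add: ten_def)
  subgoal for y n using wt_Gen[of X 0 y "Suc n"] B.src_cell[of y n] by (simp add: ten_def op_src)
  subgoal for y n using wt_Gen[of X 0 y "Suc n"] B.tgt_cell[of y n] by (simp add: ten_def op_tgt)
  subgoal for y n using wt_Gen[of X 0 y n] B.idt_cell[of y n] cls_eqI[OF teq.Gen_right_idt[of X A y B n]]
    by (simp add: ten_def op_idt)
  subgoal for y m y' n using wt_Gen[of X 0 y m] wt_Gen[of X 0 y' n] B.wh_cell[of y m y' n] cls_eqI[OF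
      teq.Gen_right_wh[of X A y B m y' n]]
    by (simp add: ten_def op_wh cds_Gen dms_Gen)
  subgoal for y y' using wt_Gen[of X 0 y 2] wt_Gen[of X 0 y' 2] cls_eqI[OF teq.Gen_right_hor2[of X A y B y']]
    by (simp add: ten_def)
  subgoal for y y' using wt_Gen[of X 0 y 3] wt_Gen[of X 0 y' 3] cls_eqI[OF teq.Gen_right_hor3[of X A y B y']]
    by (simp add: ten_def)
  subgoal for y y' using wt_Gen[of X 0 y 3] wt_Gen[of X 0 y' 3] cls_eqI[OF teq.Gen_right_ver[of X A y B y']]
    by (simp add: ten_def)
  subgoal for y y' using wt_Gen[of X 0 y 2] wt_Gen[of X 0 y' 2] cls_eqI[OF teq.Gen_right_ich[of X A y B y']]
    by (simp add: ten_def)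
  done

lemma ten_left: "Y \<in> cell B 0 \<Longrightarrow> gray_functor A AB (\<lambda>m. restrict (\<lambda>x. ten A B m 0 x Y) (cell A m))"
  apply (intro gray_functor.intro gray_functor_axioms.intro)
  subgoal by (rule A.gray_cat_axioms)
  subgoal by (rule tensor_cat)
  subgoal by simp
  subgoal for x m using wt_Gen[of x m Y 0] by (simp add: ten_def)
  subgoal for x m using wt_Gen[of x "Suc m" Y 0] A.src_cell[of x m] by (simp add: ten_def op_src)
  subgoal for x m using wt_Gen[of x "Suc m" Y 0] A.tgt_cell[of x m] by (simp add: ten_def op_tgt)
  subgoal for x m using wt_Gen[of x m Y 0] A.idt_cell[of x m] cls_eqI[OF teq.Gen_left_idt[of x A m Y B]]
    by (simp add: ten_def op_idt)
  subgoal for x m x' n using wt_Gen[of x m Y 0] wt_Gen[of x' n Y 0] A.wh_cell[of x m x' n] cls_eqI[OF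
      teq.Gen_left_wh[of x A m x' n Y B]]
    by (simp add: ten_def op_wh cds_Gen dms_Gen)
  subgoal for x x' using wt_Gen[of x 2 Y 0] wt_Gen[of x' 2 Y 0] cls_eqI[OF teq.Gen_left_hor2[of x A x' Y B]]
    by (simp add: ten_def)
  subgoal for x x' using wt_Gen[of x 3 Y 0] wt_Gen[of x' 3 Y 0] cls_eqI[OF teq.Gen_left_hor3[of x A x' Y B]]
    by (simp add: ten_def)
  subgoal for x x' using wt_Gen[of x 3 Y 0] wt_Gen[of x' 3 Y 0] cls_eqI[OF teq.Gen_left_ver[of x A x' Y B]]
    by (simp add: ten_def)
  subgoal for x x' using wt_Gen[of x 2 Y 0] wt_Gen[of x' 2 Y 0] cls_eqI[OF teq.Gen_left_ich[of x A x' Y B]]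
    by (simp add: ten_def)
  done

text \<open>The mixed conditions are the relations \<open>Gen_nat\<close> and
  \<open>Gen_ich\<close>; the latter equates an interchange cell with the formal inverse of the
  other one, which is an actual inverse by \<open>inverse3_IchI\<close>.\<close>

theorem ten_quasi: "gray_quasi A B AB (ten A B)"
proof (intro gray_quasi.intro gray_quasi_axioms.intro)
  fix x m y n assume a: "x \<in> cell A m" "y \<in> cell B n" "1 \<le> m" "1 \<le> n" "m = 1 \<or> n = 1"
  have b: "src0 A m x \<in> cell A 0" "tgt0 A m x \<in> cell A 0" "src0 B n y \<in> cell B 0" "tgt0 B n y \<in> cell B 0"
    using a A.src0_cell A.tgt0_cell B.src0_cell B.tgt0_cell by auto
  have w: "wt m (Gen m 0 x (src0 B n y))" "wt m (Gen m 0 x (tgt0 B n y))" "wt n (Gen 0 n (src0 A m x) y)" "wt n (Gen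
      0 n (tgt0 A m x) y)"
    using wt_Gen[OF a(1) b(3)] wt_Gen[OF a(1) b(4)] wt_Gen[OF b(1) a(2)] wt_Gen[OF b(2) a(2)] by simp_all
  show "wh AB m n (ten A B m 0 x (src0 B n y)) (ten A B 0 n (tgt0 A m x) y) =
     wh AB n m (ten A B 0 n (src0 A m x) y) (ten A B m 0 x (tgt0 B n y))"
    using op_wh[OF w(1,4) a(3-5)] op_wh[OF w(3,2) a(4,3)] a(5) cls_eqI[OF teq.Gen_nat[OF a]]
    by (auto simp: ten_def cds_Gen dms_Gen add.commute)
next
  fix x y assume a: "x \<in> cell A 2" "y \<in> cell B 2"
  have b: "src0 A 2 x \<in> cell A 0" "tgt0 A 2 x \<in> cell A 0" "src0 B 2 y \<in> cell B 0" "tgt0 B 2 y \<in> cell B 0"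
    using a A.src0_cell A.tgt0_cell B.src0_cell B.tgt0_cell by auto
  have w: "wt 2 (Gen 2 0 x (src0 B 2 y))" "wt 2 (Gen 2 0 x (tgt0 B 2 y))" "wt 2 (Gen 0 2 (src0 A 2 x) y)" "wt 2 (Gen
      0 2 (tgt0 A 2 x) y)"
    using wt_Gen[OF a(1) b(3)] wt_Gen[OF a(1) b(4)] wt_Gen[OF b(1) a(2)] wt_Gen[OF b(2) a(2)] by simp_all
  interpret T: gray_cat "AB" by (rule tensor_cat)
  show "inverse3 AB (ich AB (ten A B 2 0 x (src0 B 2 y)) (ten A B 0 2 (tgt0 A 2 x) y))
        (ich AB (ten A B 0 2 (src0 A 2 x) y) (ten A B 2 0 x (tgt0 B 2 y)))"
    using T.inverse3_sym[OF inverse3_IchI[OF w(3,2)]] cls_eqI[OF teq.Gen_ich[OF a]] w a by (simp add: ten_def)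
qed (rule A.gray_cat_axioms B.gray_cat_axioms tensor_cat ten_right ten_left; assumption?)+

end

section \<open>Comparing functors on iterated tensor products by their values on generators\<close>

abbreviation (input) two_zero :: "nat \<Rightarrow> nat \<Rightarrow> nat \<Rightarrow> bool" where
  "two_zero l m n \<equiv> l = 0 \<and> m = 0 \<or> l = 0 \<and> n = 0 \<or> m = 0 \<and> n = 0"

lemma gray_tensorI: "gray_cat A \<Longrightarrow> gray_cat B \<Longrightarrow> gray_tensor A B"
  by (simp add: gray_tensor_def)

lemma gray_functorD: "gray_functor A B F \<Longrightarrow> gray_cat A" "gray_functor A B F \<Longrightarrow> gray_cat B"
  by (auto simp: gray_functor_def)

lemma tensor_gray_cat: "gray_cat A \<Longrightarrow> gray_cat B \<Longrightarrow> gray_cat (A \<otimes>\<^sub>G B)"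
  by (rule gray_tensor.tensor_cat[OF gray_tensorI])

lemma ten_gray_quasi: "gray_cat A \<Longrightarrow> gray_cat B \<Longrightarrow> gray_quasi A B (A \<otimes>\<^sub>G B) (ten A B)"
  by (rule gray_tensor.ten_quasi[OF gray_tensorI])

text \<open>The dimension is a separate variable \<open>k\<close>, as sums in different association
  or order have to match. The same device is used in the rules for lifts and structure functors
  below.\<close>

lemma ten_cell:
  assumes "gray_cat A" "gray_cat B" "x \<in> cell A m" "y \<in> cell B n" "m = 0 \<or> n = 0" "k = m + n"
  shows "ten A B m n x y \<in> cell (A \<otimes>\<^sub>G B) k"
  using gray_quasi.cells[OF ten_gray_quasi[OF assms(1,2)]] assms by auto

lemma tensor_lift_exists:
  assumes "gray_quasi A B D H"
  obtains K where "gray_functor (A \<otimes>\<^sub>G B) D K"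
    "\<And>m n k x y. \<lbrakk>x \<in> cell A m; y \<in> cell B n; m = 0 \<or> n = 0; k = m + n\<rbrakk> \<Longrightarrow> K k (ten A B m n x y) = H m n x y"
proof -
  interpret gray_quasi A B D H by fact
  interpret gray_eval A B D H by (simp add: gray_eval_def gray_tensorI assms A.gray_cat_axioms B.gray_cat_axioms)
  show ?thesis using that[of lift] lift_functor lift_gen by blast
qed

lemma tensor_eqI:
  assumes A: "gray_cat A" "gray_cat B" and K: "gray_functor (A \<otimes>\<^sub>G B) D K" "gray_functor (A \<otimes>\<^sub>G B) D L"
    and gen: "\<And>m n x y. \<lbrakk>x \<in> cell A m; y \<in> cell B n; m = 0 \<or> n = 0\<rbrakk> \<Longrightarrow>
      K (m + n) (ten A B m n x y) = L (m + n) (ten A B m n x y)"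
  shows "K = L"
  using gray_tensor.tensor_functor_eqI[OF gray_tensorI[OF A] K gen] .

lemma tensor_left_functor:
  assumes A: "gray_cat A" "gray_cat B" and K: "gray_functor (A \<otimes>\<^sub>G B) D K" and Y: "Y \<in> cell B 0"
  shows "gray_functor A D (\<lambda>m. restrict (\<lambda>x. K m (ten A B m 0 x Y)) (cell A m))"
  using gray_quasi.left[OF gray_quasi.post[OF ten_gray_quasi[OF A] K] Y] by simp

lemma tensor_right_functor:
  assumes A: "gray_cat A" "gray_cat B" and K: "gray_functor (A \<otimes>\<^sub>G B) D K" and X: "X \<in> cell A 0"
  shows "gray_functor B D (\<lambda>n. restrict (\<lambda>y. K n (ten A B 0 n X y)) (cell B n))"
  using gray_quasi.right[OF gray_quasi.post[OF ten_gray_quasi[OF A] K] X] by simp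

text \<open>The second condition is an equation of strict functors on \<open>A\<close>. If
  \<open>A\<close> is itself a tensor product, it can again be checked on generators.\<close>

lemma tensor_eqI_left:
  assumes A: "gray_cat A" "gray_cat B" and K: "gray_functor (A \<otimes>\<^sub>G B) D K" "gray_functor (A \<otimes>\<^sub>G B) D L"
    and 1: "\<And>X n y. X \<in> cell A 0 \<Longrightarrow> y \<in> cell B n \<Longrightarrow> K n (ten A B 0 n X y) = L n (ten A B 0 n X y)"
    and 2: "\<And>Y. Y \<in> cell B 0 \<Longrightarrow> (\<lambda>m. restrict (\<lambda>x. K m (ten A B m 0 x Y)) (cell A m)) =
      (\<lambda>m. restrict (\<lambda>x. L m (ten A B m 0 x Y)) (cell A m))"
  shows "K = L"
proof (rule tensor_eqI[OF A K])
  fix m n x y assume x: "x \<in> cell A m" "y \<in> cell B n" "m = 0 \<or> n = 0"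
  have "K m (ten A B m 0 x Y) = L m (ten A B m 0 x Y)" if "Y \<in> cell B 0" for Y
    using fun_cong[OF fun_cong[OF 2[OF that], of m], of x] x by simp
  then show "K (m + n) (ten A B m n x y) = L (m + n) (ten A B m n x y)"
    using x 1 by auto
qed

lemma tensor_eqI_right:
  assumes A: "gray_cat A" "gray_cat B" and K: "gray_functor (A \<otimes>\<^sub>G B) D K" "gray_functor (A \<otimes>\<^sub>G B) D L"
    and 1: "\<And>X. X \<in> cell A 0 \<Longrightarrow> (\<lambda>n. restrict (\<lambda>y. K n (ten A B 0 n X y)) (cell B n)) =
      (\<lambda>n. restrict (\<lambda>y. L n (ten A B 0 n X y)) (cell B n))"
    and 2: "\<And>m x Y. x \<in> cell A m \<Longrightarrow> Y \<in> cell B 0 \<Longrightarrow> K m (ten A B m 0 x Y) = L m (ten A B m 0 x Y)"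
  shows "K = L"
proof (rule tensor_eqI[OF A K])
  fix m n x y assume x: "x \<in> cell A m" "y \<in> cell B n" "m = 0 \<or> n = 0"
  have "K n (ten A B 0 n X y) = L n (ten A B 0 n X y)" if "X \<in> cell A 0" for X
    using fun_cong[OF fun_cong[OF 1[OF that], of n], of y] x by simp
  then show "K (m + n) (ten A B m n x y) = L (m + n) (ten A B m n x y)"
    using x 2 by auto
qed

text \<open>A generator of the outer product pairs an object of \<open>A \<otimes>\<^sub>G B\<close>
  with a cell of \<open>C\<close>, or the other way round. In the first case the object is a pair by
  \<open>tensor_objects\<close>; in the second the two functors on
  \<open>A \<otimes>\<^sub>G B\<close> are compared on its generators.\<close>

lemma tensor3_eqI:
  assumes A: "gray_cat A" "gray_cat B" "gray_cat C"
    and K: "gray_functor ((A \<otimes>\<^sub>G B) \<otimes>\<^sub>G C) D K" "gray_functor ((A \<otimes>\<^sub>G B) \<otimes>\<^sub>G C) D L"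
    and gen: "\<And>l m n x y z. \<lbrakk>x \<in> cell A l; y \<in> cell B m; z \<in> cell C n; two_zero l m n\<rbrakk> \<Longrightarrow>
      K (l + m + n) (ten (A \<otimes>\<^sub>G B) C (l + m) n (ten A B l m x y) z) =
      L (l + m + n) (ten (A \<otimes>\<^sub>G B) C (l + m) n (ten A B l m x y) z)"
  shows "K = L"
proof (rule tensor_eqI_left[OF tensor_gray_cat[OF A(1,2)] A(3) K])
  fix X n z assume "X \<in> cell (A \<otimes>\<^sub>G B) 0" and z: "z \<in> cell C n"
  then obtain a b where "a \<in> cell A 0" "b \<in> cell B 0" "X = ten A B 0 0 a b"
    using gray_tensor.tensor_objects[OF gray_tensorI[OF A(1,2)]] by metis
  then show "K n (ten (A \<otimes>\<^sub>G B) C 0 n X z) = L n (ten (A \<otimes>\<^sub>G B) C 0 n X z)"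
    using gen[of a 0 b 0 z n] z by simp
next
  fix Z assume Z: "Z \<in> cell C 0"
  note T = tensor_gray_cat[OF A(1,2)]
  show "(\<lambda>m. \<lambda>x\<in>cell (A \<otimes>\<^sub>G B) m. K m (ten (A \<otimes>\<^sub>G B) C m 0 x Z)) =
      (\<lambda>m. \<lambda>x\<in>cell (A \<otimes>\<^sub>G B) m. L m (ten (A \<otimes>\<^sub>G B) C m 0 x Z))"
    by (rule tensor_eqI[OF A(1,2) tensor_left_functor[OF T A(3) K(1) Z] tensor_left_functor[OF T A(3) K(2) Z]])
      (use gen[of _ _ _ _ Z 0] Z A in \<open>auto simp: ten_cell\<close>)
qed

lemma tensor3_eqI':
  assumes A: "gray_cat A" "gray_cat B" "gray_cat C"
    and K: "gray_functor (A \<otimes>\<^sub>G (B \<otimes>\<^sub>G C)) D K" "gray_functor (A \<otimes>\<^sub>G (B \<otimes>\<^sub>G C)) D L"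
    and gen: "\<And>l m n x y z. \<lbrakk>x \<in> cell A l; y \<in> cell B m; z \<in> cell C n; two_zero l m n\<rbrakk> \<Longrightarrow>
      K (l + m + n) (ten A (B \<otimes>\<^sub>G C) l (m + n) x (ten B C m n y z)) =
      L (l + m + n) (ten A (B \<otimes>\<^sub>G C) l (m + n) x (ten B C m n y z))"
  shows "K = L"
proof (rule tensor_eqI_right[OF A(1) tensor_gray_cat[OF A(2,3)] K])
  fix X n x assume "X \<in> cell (B \<otimes>\<^sub>G C) 0" and x: "x \<in> cell A n"
  then obtain a b where "a \<in> cell B 0" "b \<in> cell C 0" "X = ten B C 0 0 a b"
    using gray_tensor.tensor_objects[OF gray_tensorI[OF A(2,3)]] by metis
  then show "K n (ten A (B \<otimes>\<^sub>G C) n 0 x X) = L n (ten A (B \<otimes>\<^sub>G C) n 0 x X)"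
    using gen[of x n a 0 b 0] x by simp
next
  fix X assume X: "X \<in> cell A 0"
  note T = tensor_gray_cat[OF A(2,3)]
  show "(\<lambda>n. \<lambda>y\<in>cell (B \<otimes>\<^sub>G C) n. K n (ten A (B \<otimes>\<^sub>G C) 0 n X y)) =
      (\<lambda>n. \<lambda>y\<in>cell (B \<otimes>\<^sub>G C) n. L n (ten A (B \<otimes>\<^sub>G C) 0 n X y))"
    by (rule tensor_eqI[OF A(2,3) tensor_right_functor[OF A(1) T K(1) X] tensor_right_functor[OF A(1) T K(2) X]])
      (use gen[of X 0] X A in \<open>auto simp: ten_cell\<close>)
qed

lemma tensor4_eqI:
  assumes A: "gray_cat A" "gray_cat B" "gray_cat C" "gray_cat D"
    and K: "gray_functor (((A \<otimes>\<^sub>G B) \<otimes>\<^sub>G C) \<otimes>\<^sub>G D) E K" "gray_functor (((A \<otimes>\<^sub>G B) \<otimes>\<^sub>G C) \<otimes>\<^sub>G D) E L"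
    and gen: "\<And>l m n p x y z w. \<lbrakk>x \<in> cell A l; y \<in> cell B m; z \<in> cell C n; w \<in> cell D p; l = 0 \<and> m = 0 \<and> n = 0 \<or> l =
        0 \<and> m = 0 \<and> p = 0 \<or> l = 0 \<and> n = 0 \<and> p = 0 \<or> m = 0 \<and> n = 0 \<and> p = 0\<rbrakk> \<Longrightarrow>
      K (l + m + n + p) (ten ((A \<otimes>\<^sub>G B) \<otimes>\<^sub>G C) D (l + m + n) p (ten (A \<otimes>\<^sub>G B) C (l + m) n (ten A B l m x y) z) w) =
      L (l + m + n + p) (ten ((A \<otimes>\<^sub>G B) \<otimes>\<^sub>G C) D (l + m + n) p (ten (A \<otimes>\<^sub>G B) C (l + m) n (ten A B l m x y) z) w)"
  shows "K = L"
proof -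
  note T = tensor_gray_cat[OF A(1,2)]
  note TT = tensor_gray_cat[OF T A(3)]
  show ?thesis
  proof (rule tensor_eqI_left[OF TT A(4) K])
    fix X p w assume "X \<in> cell ((A \<otimes>\<^sub>G B) \<otimes>\<^sub>G C) 0" and w: "w \<in> cell D p"
    then obtain Y c where c: "Y \<in> cell (A \<otimes>\<^sub>G B) 0" "c \<in> cell C 0" "X = ten (A \<otimes>\<^sub>G B) C 0 0 Y c"
      using gray_tensor.tensor_objects[OF gray_tensorI[OF T A(3)]] by metis
    moreover obtain a b where "a \<in> cell A 0" "b \<in> cell B 0" "Y = ten A B 0 0 a b"
      using c(1) gray_tensor.tensor_objects[OF gray_tensorI[OF A(1,2)]] by metis
    ultimately show "K p (ten ((A \<otimes>\<^sub>G B) \<otimes>\<^sub>G C) D 0 p X w) = L p (ten ((A \<otimes>\<^sub>G B) \<otimes>\<^sub>G C) D 0 p X w)"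
      using gen[of a 0 b 0 c 0 w p] w by simp
  next
    fix W assume W: "W \<in> cell D 0"
    show "(\<lambda>m. \<lambda>x\<in>cell ((A \<otimes>\<^sub>G B) \<otimes>\<^sub>G C) m. K m (ten ((A \<otimes>\<^sub>G B) \<otimes>\<^sub>G C) D m 0 x W)) =
        (\<lambda>m. \<lambda>x\<in>cell ((A \<otimes>\<^sub>G B) \<otimes>\<^sub>G C) m. L m (ten ((A \<otimes>\<^sub>G B) \<otimes>\<^sub>G C) D m 0 x W))"
      by (rule tensor3_eqI[OF A(1-3) tensor_left_functor[OF TT A(4) K(1) W] tensor_left_functor[OF TT A(4) K(2) W]])
        (use gen[of _ _ _ _ _ _ W 0] W A T in \<open>auto simp: ten_cell\<close>)
  qed
qed

section \<open>The structure functors\<close>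

text \<open>Existence comes from lifting the universal quasi-functor precomposed with
  \<open>F\<close> and \<open>G\<close>, uniqueness from \<open>tensor_eqI\<close>; together they
  give the \<open>THE\<close> its meaning. The other structure functors follow the same
  pattern.\<close>

lemma tensor_map_spec:
  assumes F: "gray_functor A A' F" "gray_functor B B' G"
  shows "gray_functor (A \<otimes>\<^sub>G B) (A' \<otimes>\<^sub>G B') (tensor_map A B A' B' F G) \<and>
     (\<forall>m n. m = 0 \<or> n = 0 \<longrightarrow> (\<forall>x\<in>cell A m. \<forall>y\<in>cell B n.
        tensor_map A B A' B' F G (m + n) (ten A B m n x y) = ten A' B' m n (F m x) (G n y)))"
proof -
  note c = gray_functorD[OF F(1)] gray_functorD[OF F(2)]
  obtain K where K: "gray_functor (A \<otimes>\<^sub>G B) (A' \<otimes>\<^sub>G B') K"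
    "\<And>m n k x y. \<lbrakk>x \<in> cell A m; y \<in> cell B n; m = 0 \<or> n = 0; k = m + n\<rbrakk> \<Longrightarrow>
      K k (ten A B m n x y) = ten A' B' m n (F m x) (G n y)"
    using tensor_lift_exists[OF gray_quasi_pre[OF ten_gray_quasi[OF c(2,4)] F]] by metis
  show ?thesis
    unfolding tensor_map_def gray_functor_iff
  proof (rule theI[of _ K])
    show "gray_functor (A \<otimes>\<^sub>G B) (A' \<otimes>\<^sub>G B') K \<and> (\<forall>m n. m = 0 \<or> n = 0 \<longrightarrow> (\<forall>x\<in>cell A m. \<forall>y\<in>cell B n.
        K (m + n) (ten A B m n x y) = ten A' B' m n (F m x) (G n y)))"
      using K by blast
  next
    fix L assume L: "gray_functor (A \<otimes>\<^sub>G B) (A' \<otimes>\<^sub>G B') L \<and> (\<forall>m n. m = 0 \<or> n = 0 \<longrightarrow> (\<forall>x\<in>cell A m. \<forall>y\<in>cell B n.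
        L (m + n) (ten A B m n x y) = ten A' B' m n (F m x) (G n y)))"
    show "L = K"
      by (rule tensor_eqI[OF c(1,3) conjunct1[OF L] K(1)], subst K(2)) (use L in blast)+
  qed
qed

lemma tensor_map_functor:
  "gray_functor A A' F \<Longrightarrow> gray_functor B B' G \<Longrightarrow> gray_functor (A \<otimes>\<^sub>G B) (A' \<otimes>\<^sub>G B') (tensor_map A B A' B' F G)"
  using tensor_map_spec by blast

lemma tensor_map_ten:
  "\<lbrakk>gray_functor A A' F; gray_functor B B' G; x \<in> cell A m; y \<in> cell B n; m = 0 \<or> n = 0; k = m + n\<rbrakk> \<Longrightarrow>
    tensor_map A B A' B' F G k (ten A B m n x y) = ten A' B' m n (F m x) (G n y)"
  using tensor_map_spec by blast

lemma tensor_map_id: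
  assumes "gray_cat A" "gray_cat B"
  shows "tensor_map A B A B (gray_id A) (gray_id B) = gray_id (A \<otimes>\<^sub>G B)"
  by (rule tensor_eqI[OF assms tensor_map_functor gray_functor_id])
    (use assms in \<open>auto simp: gray_functor_id tensor_gray_cat tensor_map_ten ten_cell\<close>)

lemma tensor_map_comp:
  assumes F: "gray_functor A A' F" "gray_functor A' A'' F'" and G: "gray_functor B B' G" "gray_functor B' B'' G'"
  shows "tensor_map A B A'' B'' (gray_comp A F F') (gray_comp B G G') =
        gray_comp (A \<otimes>\<^sub>G B) (tensor_map A B A' B' F G) (tensor_map A' B' A'' B'' F' G')"
proof -
  note c = gray_functorD[OF F(1)] gray_functorD[OF F(2)] gray_functorD[OF G(1)] gray_functorD[OF G(2)]
  note FF = gray_functor_comp[OF F] gray_functor_comp[OF G]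
  show ?thesis
    by (rule tensor_eqI[OF c(1,5) tensor_map_functor[OF FF] gray_functor_comp[OF tensor_map_functor[OF F(1) G(1)]
        tensor_map_functor[OF F(2) G(2)]]])
      (use c in \<open>auto simp: tensor_map_ten[OF FF] tensor_map_ten[OF F(1) G(1)] tensor_map_ten[OF F(2) G(2)] ten_cell
        gray_functor.map_cell[OF F(1)] gray_functor.map_cell[OF G(1)]\<close>)
qed

section \<open>The symmetry and the associativity functor\<close>

definition swap :: "'a gray \<Rightarrow> 'b gray \<Rightarrow> nat \<Rightarrow> ('a, 'b) trm set \<Rightarrow> ('b, 'a) trm set" where
  "swap A B = (SOME K. gray_functor (A \<otimes>\<^sub>G B) (B \<otimes>\<^sub>G A) K \<and>
     (\<forall>m n. m = 0 \<or> n = 0 \<longrightarrow> (\<forall>x\<in>cell A m. \<forall>y\<in>cell B n. K (m + n) (ten A B m n x y) = ten B A n m y x)))"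

text \<open>The universal quasi-functor on \<open>B\<close> and \<open>A\<close>, read with its
  variables exchanged, is one on \<open>A\<close> and \<open>B\<close> and lifts. The symmetry
  supplies the inverse of \<open>assoc\<close> and the right unit.\<close>

lemma swap_spec:
  assumes "gray_cat A" "gray_cat B"
  shows "gray_functor (A \<otimes>\<^sub>G B) (B \<otimes>\<^sub>G A) (swap A B) \<and>
     (\<forall>m n. m = 0 \<or> n = 0 \<longrightarrow> (\<forall>x\<in>cell A m. \<forall>y\<in>cell B n. swap A B (m + n) (ten A B m n x y) = ten B A n m y x))"
proof -
  obtain K where K: "gray_functor (A \<otimes>\<^sub>G B) (B \<otimes>\<^sub>G A) K"
    "\<And>m n k x y. \<lbrakk>x \<in> cell A m; y \<in> cell B n; m = 0 \<or> n = 0; k = m + n\<rbrakk> \<Longrightarrow>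
      K k (ten A B m n x y) = ten B A n m y x"
    using tensor_lift_exists[OF gray_quasi.swap[OF ten_gray_quasi[OF assms(2,1)]]] by metis
  show ?thesis
    unfolding swap_def by (rule someI[of _ K]) (use K in auto)
qed

lemma swap_functor: "gray_cat A \<Longrightarrow> gray_cat B \<Longrightarrow> gray_functor (A \<otimes>\<^sub>G B) (B \<otimes>\<^sub>G A) (swap A B)"
  using swap_spec by blast

lemma swap_ten: "\<lbrakk>gray_cat A; gray_cat B; x \<in> cell A m; y \<in> cell B n; m = 0 \<or> n = 0; k = m + n\<rbrakk> \<Longrightarrow>
    swap A B k (ten A B m n x y) = ten B A n m y x"
  using swap_spec by blast

text \<open>That the boundaries of \<open>x\<close> and \<open>y\<close> are exchanged follows from
  the components: each is determined by its end functors and its components, which the inverse pairs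
  match up.\<close>

lemma (in gray_pair) hom_inverse3I:
  assumes "x \<in> hcells B C 3" "y \<in> hcells B C 3" "hsrc0 3 x = hsrc0 3 y" "htgt0 3 x = htgt0 3 y"
    and i: "\<And>X. X \<in> cell B 0 \<Longrightarrow> inverse3 C (hat x X) (hat y X)"
  shows "inverse3 (gray_hom B C) x y"
proof -
  have i': "hat (hsrc x) X = hat (htgt y) X" "hat (htgt x) X = hat (hsrc y) X"
     "ver C (hat x X) (hat y X) = idt C 2 (hat (hsrc x) X)" "ver C (hat y X) (hat x X) = idt C 2 (hat (hsrc y) X)"
    if "X \<in> cell B 0" for X
    using i[OF that] assms(1,2) that by (simp_all add: inverse3_def)
  have 1: "hsrc x = htgt y"
    by (rule hcell_eqI[where n = 2]) (use assms(1-4) i' in auto)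
  have 2: "htgt x = hsrc y"
    by (rule hcell_eqI[where n = 2]) (use assms(1-4) i' in auto)
  have "hver B C x y = hidt B C 2 (hsrc x)"
    by (rule hcell_eqI[where n = 3]) (use assms(1-4) i' 1 2 in auto)
  moreover have "hver B C y x = hidt B C 2 (hsrc y)"
    by (rule hcell_eqI[where n = 3]) (use assms(1-4) i' 1 2 in auto)
  ultimately show ?thesis using assms(1,2) 1 2 by (simp add: inverse3_def)
qed


text \<open>The data \<open>(x, y, z) \<mapsto> H x (y \<otimes> z)\<close> on \<open>A \<otimes> B\<close> and C are obtained by giving a quasi-functor from A and B
  to the inner hom of C and D.\<close>

lemma assoc_lift_exists:
  assumes A: "gray_cat A" "gray_cat B" "gray_cat C" and H: "gray_quasi A (B \<otimes>\<^sub>G C) D H"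
  obtains K where "gray_functor ((A \<otimes>\<^sub>G B) \<otimes>\<^sub>G C) D K"
    "\<And>l m n x y z. \<lbrakk>x \<in> cell A l; y \<in> cell B m; z \<in> cell C n; two_zero l m n\<rbrakk> \<Longrightarrow>
      K (l + m + n) (ten (A \<otimes>\<^sub>G B) C (l + m) n (ten A B l m x y) z) = H l (m + n) x (ten B C m n y z)"
proof -
  interpret H: gray_quasi A "B \<otimes>\<^sub>G C" D H by fact
  interpret BC: gray_quasi B C "B \<otimes>\<^sub>G C" "ten B C" by (rule ten_gray_quasi[OF A(2,3)])
  interpret P: gray_pair C D by (rule gray_pairI[OF A(3) H.C.gray_cat_axioms])
  interpret HC: gray_cat "gray_hom C D" by (rule P.gray_hom_cat)
  note tc = ten_cell[OF A(2,3)]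
  \<comment> \<open>With \<open>b\<close> fixed, precomposing the second variable of
    \<open>H\<close> with tensoring by \<open>b\<close> gives a quasi-functor on \<open>A\<close>
    and \<open>C\<close>. With \<open>a\<close> fixed, \<open>H(a,-)\<close> is a strict functor on
    \<open>B \<otimes>\<^sub>G C\<close> and gives one on \<open>B\<close> and
    \<open>C\<close>.\<close>
  define HL where "HL b = (\<lambda>m n a c. H m n a (ten B C 0 n b c))" for b
  define HR where "HR a = (\<lambda>m n b c. H 0 (m + n) a (ten B C m n b c))" for a
  have L: "gray_quasi A C D (HL b)" if b: "b \<in> cell B 0" for b
    by (rule gray_quasi_cong[OF gray_quasi_pre[OF H gray_functor_id[OF A(1)] BC.right[OF b]]])
      (simp_all add: HL_def)
  have R: "gray_quasi B C D (HR a)" if a: "a \<in> cell A 0" for a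
    by (rule gray_quasi_cong[OF BC.post[OF H.right[OF a]]]) (simp_all add: HR_def tc)
  \<comment> \<open>At \<open>m = n = 0\<close> the two transposes are the same functor on
    \<open>C\<close>, as \<open>M0\<close> records, so they form the two halves of data on
    \<open>A\<close> and \<open>B\<close>.\<close>
  define M where "M m n a b = (if n = 0 then transp A C (HL b) m a else transp B C (HR a) n b)" for m n a b
  have M0: "M m 0 a b = transp A C (HL b) m a" "M 0 n a b = transp B C (HR a) n b" for m n a b
    by (simp_all add: M_def HL_def HR_def)
  have hat_M: "hat (M m 0 a b) Z = H m 0 a (ten B C 0 0 b Z)" "hat (M 0 n a b) Z = H 0 n a (ten B C n 0 b Z)"
    if "Z \<in> cell C 0" for m n a b Z
    using that by (cases m; cases n; simp add: M0 HL_def HR_def)+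
  have M_cell: "a \<in> cell A m \<Longrightarrow> b \<in> cell B 0 \<Longrightarrow> M m 0 a b \<in> hcells C D m"
      "a \<in> cell A 0 \<Longrightarrow> b \<in> cell B n \<Longrightarrow> M 0 n a b \<in> hcells C D n" for a b m n
    unfolding M0 using gray_quasi.T_cell[OF L] gray_quasi.T_cell[OF R] by blast+
  have M_bd: "hsrc0 m (M m 0 a b) = M 0 0 (src0 A m a) b" "htgt0 m (M m 0 a b) = M 0 0 (tgt0 A m a) b"
    if "b \<in> cell B 0" for a b m
    using gray_quasi.hsrc0_T[OF L[OF that]] gray_quasi.htgt0_T[OF L[OF that]] unfolding M0 by simp_all
  have M_bd': "hsrc0 n (M 0 n a b) = M 0 0 a (src0 B n b)" "htgt0 n (M 0 n a b) = M 0 0 a (tgt0 B n b)"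
    if "a \<in> cell A 0" for a b n
    using gray_quasi.hsrc0_T[OF R[OF that]] gray_quasi.htgt0_T[OF R[OF that]] unfolding M0(2) by simp_all
  have s0: "src0 (B \<otimes>\<^sub>G C) n (ten B C n 0 b Z) = ten B C 0 0 (src0 B n b) Z"
    "tgt0 (B \<otimes>\<^sub>G C) n (ten B C n 0 b Z) = ten B C 0 0 (tgt0 B n b) Z" if "b \<in> cell B n" "Z \<in> cell C 0" for n b Z
    using gray_functor.map_src0[OF BC.left[OF that(2)] that(1)] gray_functor.map_tgt0[OF BC.left[OF that(2)]
        that(1)]
      BC.A.src0_cell[OF that(1)] BC.A.tgt0_cell[OF that(1)] that by simp_all
  have M: "gray_quasi A B (gray_hom C D) M"
  proof (intro gray_quasi.intro gray_quasi_axioms.intro)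
    fix X assume "X \<in> cell A 0"
    from gray_quasi.transpose_functor[OF R[OF this]]
    show "gray_functor B (gray_hom C D) (\<lambda>n. restrict (M 0 n X) (cell B n))"
      by (rule gray_functor_cong) (simp_all add: transpose_def M0)
  next
    fix Y assume "Y \<in> cell B 0"
    from gray_quasi.transpose_functor[OF L[OF this]]
    show "gray_functor A (gray_hom C D) (\<lambda>m. \<lambda>x\<in>cell A m. M m 0 x Y)"
      by (rule gray_functor_cong) (simp_all add: transpose_def M0)
  next
    fix x m y n assume a: "x \<in> cell A m" "y \<in> cell B n" "1 \<le> m" "1 \<le> n" "m = 1 \<or> n = 1"
    have b: "src0 A m x \<in> cell A 0" "tgt0 A m x \<in> cell A 0" "src0 B n y \<in> cell B 0" "tgt0 B n y \<in> cell B 0"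
      using a H.A.src0_cell H.A.tgt0_cell BC.A.src0_cell BC.A.tgt0_cell by auto
    note mc = M_cell(1)[OF a(1) b(3)] M_cell(1)[OF a(1) b(4)] M_cell(2)[OF b(1) a(2)] M_cell(2)[OF b(2) a(2)]
    note mb = M_bd[OF b(3)] M_bd[OF b(4)] M_bd'[OF b(1)] M_bd'[OF b(2)]
    note W = HC.wh_cell HC.src0_wh HC.tgt0_wh
    note W1 = W[of "M m 0 x (src0 B n y)" m "M 0 n (tgt0 A m x) y" n, unfolded gray_hom_simps bd_gray_hom mb, OF
        mc(1,4) a(3,4,5) refl]
    note W2 = W[of "M 0 n (src0 A m x) y" n "M m 0 x (tgt0 B n y)" m, unfolded gray_hom_simps bd_gray_hom mb, OF
        mc(3,2) a(4,3) _ refl]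
    show "wh (gray_hom C D) m n (M m 0 x (src0 B n y)) (M 0 n (tgt0 A m x) y) =
       wh (gray_hom C D) n m (M 0 n (src0 A m x) y) (M m 0 x (tgt0 B n y))"
      unfolding gray_hom_simps
    proof (rule P.hcell_eqI[where n = "m + n - 1"])
      fix Z assume Z: "Z \<in> cell C 0"
      \<comment> \<open>The component at \<open>Z\<close> of the required equation is the mixed
        condition of \<open>H\<close> at \<open>x\<close> and the generator formed from
        \<open>y\<close> and \<open>Z\<close>.\<close>
      show "hat (hwh C D m n (M m 0 x (src0 B n y)) (M 0 n (tgt0 A m x) y)) Z =
          hat (hwh C D n m (M 0 n (src0 A m x) y) (M m 0 x (tgt0 B n y))) Z"
        using H.quasi_wh[OF a(1) tc[OF a(2) Z _ refl, simplified] a(3-5)] s0[OF a(2) Z] Z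
        by (simp add: hat_M)
    qed (use W1 W2 a(5) in \<open>auto simp: add.commute\<close>)
  next
    fix x y assume a: "x \<in> cell A 2" "y \<in> cell B 2"
    have b: "src0 A 2 x \<in> cell A 0" "tgt0 A 2 x \<in> cell A 0" "src0 B 2 y \<in> cell B 0" "tgt0 B 2 y \<in> cell B 0"
      using a H.A.src0_cell H.A.tgt0_cell BC.A.src0_cell BC.A.tgt0_cell by auto
    note mc = M_cell(1)[OF a(1) b(3)] M_cell(1)[OF a(1) b(4)] M_cell(2)[OF b(1) a(2)] M_cell(2)[OF b(2) a(2)]
    note mb = M_bd[OF b(3), of 2 x] M_bd[OF b(4), of 2 x] M_bd'[OF b(1), of 2 y] M_bd'[OF b(2), of 2 y]
    show "inverse3 (gray_hom C D) (ich (gray_hom C D) (M 2 0 x (src0 B 2 y)) (M 0 2 (tgt0 A 2 x) y))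
            (ich (gray_hom C D) (M 0 2 (src0 A 2 x) y) (M 2 0 x (tgt0 B 2 y)))"
      unfolding gray_hom_simps
    proof (rule P.hom_inverse3I)
      fix Z assume Z: "Z \<in> cell C 0"
      show "inverse3 D (hat (hich C D (M 2 0 x (src0 B 2 y)) (M 0 2 (tgt0 A 2 x) y)) Z)
          (hat (hich C D (M 0 2 (src0 A 2 x) y) (M 2 0 x (tgt0 B 2 y))) Z)"
        using H.quasi_ich[OF a(1), of "ten B C 2 0 y Z"] tc[OF a(2) Z] s0[OF a(2) Z] Z hat_M(1)[OF Z, of 2]
            hat_M(2)[OF Z, of 2]
        by simp
    qed (use mc mb in simp_all)
  qed (rule A P.gray_hom_cat)+
  \<comment> \<open>Lifting \<open>M\<close> gives a functor from
    \<open>A \<otimes>\<^sub>G B\<close> to the inner hom; untransposing that functor and lifting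
    once more gives the functor on the threefold product.\<close>
  obtain N where N: "gray_functor (A \<otimes>\<^sub>G B) (gray_hom C D) N"
    "\<And>m n k x y. \<lbrakk>x \<in> cell A m; y \<in> cell B n; m = 0 \<or> n = 0; k = m + n\<rbrakk> \<Longrightarrow> N k (ten A B m n x y) = M m n x y"
    using tensor_lift_exists[OF M] by metis
  obtain K where K: "gray_functor ((A \<otimes>\<^sub>G B) \<otimes>\<^sub>G C) D K"
    "\<And>m n k x y. \<lbrakk>x \<in> cell (A \<otimes>\<^sub>G B) m; y \<in> cell C n; m = 0 \<or> n = 0; k = m + n\<rbrakk> \<Longrightarrow>
      K k (ten (A \<otimes>\<^sub>G B) C m n x y) = untranspose N m n x y"
    using tensor_lift_exists[OF untranspose_quasi[OF N(1) A(3) H.C.gray_cat_axioms]] by metis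
  show ?thesis
  proof (rule that[OF K(1)])
    fix l m n x y z
    assume a: "x \<in> cell A l" "y \<in> cell B m" "z \<in> cell C n" and lmn: "two_zero l m n"
    have w: "ten A B l m x y \<in> cell (A \<otimes>\<^sub>G B) (l + m)" using ten_cell[OF A(1,2) a(1,2) _ refl] lmn by auto
    have "K (l + m + n) (ten (A \<otimes>\<^sub>G B) C (l + m) n (ten A B l m x y) z) = untranspose N (l + m) n (ten A B l m x y)
        z"
      by (rule K(2)[OF w a(3) _ refl]) (use lmn in auto)
    also have "\<dots> = H l (m + n) x (ten B C m n y z)"
    \<comment> \<open>At an object of \<open>A \<otimes>\<^sub>G B\<close> the value of
      \<open>N\<close> is a functor, which is applied to \<open>z\<close> in any dimension. At a
      higher cell \<open>z\<close> is an object, and a component is taken.\<close>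
    proof (cases "l + m = 0")
      case True
      then show ?thesis using N(2)[OF a(1,2) _ refl] a by (simp add: untranspose_def M0 HL_def)
    next
      case False
      then have n: "n = 0" and "l = 0 \<or> m = 0" using lmn by auto
      then show ?thesis using N(2)[OF a(1,2) _ refl] False a hat_M[of z] by (auto simp: untranspose_def)
    qed
    finally show "K (l + m + n) (ten (A \<otimes>\<^sub>G B) C (l + m) n (ten A B l m x y) z) = H l (m + n) x (ten B C m n y z)" .
  qed
qed

lemma assoc_spec:
  assumes A: "gray_cat A" "gray_cat B" "gray_cat C"
  shows "gray_functor ((A \<otimes>\<^sub>G B) \<otimes>\<^sub>G C) (A \<otimes>\<^sub>G (B \<otimes>\<^sub>G C)) (assoc A B C) \<and>
     (\<forall>l m n. two_zero l m n \<longrightarrow>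
        (\<forall>x\<in>cell A l. \<forall>y\<in>cell B m. \<forall>z\<in>cell C n.
           assoc A B C (l + m + n) (ten (A \<otimes>\<^sub>G B) C (l + m) n (ten A B l m x y) z) =
           ten A (B \<otimes>\<^sub>G C) l (m + n) x (ten B C m n y z)))"
proof -
  obtain K where K: "gray_functor ((A \<otimes>\<^sub>G B) \<otimes>\<^sub>G C) (A \<otimes>\<^sub>G (B \<otimes>\<^sub>G C)) K"
    "\<And>l m n x y z. \<lbrakk>x \<in> cell A l; y \<in> cell B m; z \<in> cell C n; two_zero l m n\<rbrakk> \<Longrightarrow>
      K (l + m + n) (ten (A \<otimes>\<^sub>G B) C (l + m) n (ten A B l m x y) z) = ten A (B \<otimes>\<^sub>G C) l (m + n) x (ten B C m n y z)"
    using assoc_lift_exists[OF A ten_gray_quasi[OF A(1) tensor_gray_cat[OF A(2,3)]]] by metis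
  show ?thesis
    unfolding assoc_def gray_functor_iff
  proof (rule theI[of _ K])
    fix L assume L: "gray_functor ((A \<otimes>\<^sub>G B) \<otimes>\<^sub>G C) (A \<otimes>\<^sub>G (B \<otimes>\<^sub>G C)) L \<and>
     (\<forall>l m n. two_zero l m n \<longrightarrow>
        (\<forall>x\<in>cell A l. \<forall>y\<in>cell B m. \<forall>z\<in>cell C n.
           L (l + m + n) (ten (A \<otimes>\<^sub>G B) C (l + m) n (ten A B l m x y) z) =
           ten A (B \<otimes>\<^sub>G C) l (m + n) x (ten B C m n y z)))"
    show "L = K"
    proof (rule tensor3_eqI[OF A conjunct1[OF L] K(1)])
      fix l m n x y z
      assume a: "x \<in> cell A l" "y \<in> cell B m" "z \<in> cell C n" and lmn: "two_zero l m n"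
      show "L (l + m + n) (ten (A \<otimes>\<^sub>G B) C (l + m) n (ten A B l m x y) z) =
        K (l + m + n) (ten (A \<otimes>\<^sub>G B) C (l + m) n (ten A B l m x y) z)"
        using conjunct2[OF L, rule_format, OF lmn a] K(2)[OF a lmn] by simp
    qed
  qed (use K in blast)
qed

lemma assoc_functor:
  "\<lbrakk>gray_cat A; gray_cat B; gray_cat C\<rbrakk> \<Longrightarrow> gray_functor ((A \<otimes>\<^sub>G B) \<otimes>\<^sub>G C) (A \<otimes>\<^sub>G (B \<otimes>\<^sub>G C)) (assoc A B C)"
  using assoc_spec by blast

lemma assoc_ten:
  assumes "gray_cat A" "gray_cat B" "gray_cat C" "x \<in> cell A l" "y \<in> cell B m" "z \<in> cell C n"
    "two_zero l m n" "k = l + m + n" "j = l + m" "i = m + n"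
  shows "assoc A B C k (ten (A \<otimes>\<^sub>G B) C j n (ten A B l m x y) z) = ten A (B \<otimes>\<^sub>G C) l i x (ten B C m n y z)"
  unfolding assms(8-10)
  by (rule conjunct2[OF assoc_spec[OF assms(1-3)], rule_format, OF assms(7,4-6)])

text \<open>The path A(BC), (BC)A, (CB)A, C(BA), (BA)C, (AB)C. Its middle step is the associativity
  functor of the reversed triple, which saves a mirror image of
  \<open>assoc_lift_exists\<close>.\<close>

definition assoc_inv ::
  "'a gray \<Rightarrow> 'b gray \<Rightarrow> 'c gray \<Rightarrow> nat \<Rightarrow> ('a, ('b, 'c) trm set) trm set \<Rightarrow> (('a, 'b) trm set, 'c) trm set" where
  "assoc_inv A B C =
    gray_comp (A \<otimes>\<^sub>G (B \<otimes>\<^sub>G C)) (swap A (B \<otimes>\<^sub>G C))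
      (gray_comp ((B \<otimes>\<^sub>G C) \<otimes>\<^sub>G A) (tensor_map (B \<otimes>\<^sub>G C) A (C \<otimes>\<^sub>G B) A (swap B C) (gray_id A))
        (gray_comp ((C \<otimes>\<^sub>G B) \<otimes>\<^sub>G A) (assoc C B A)
          (gray_comp (C \<otimes>\<^sub>G (B \<otimes>\<^sub>G A)) (swap C (B \<otimes>\<^sub>G A))
            (tensor_map (B \<otimes>\<^sub>G A) C (A \<otimes>\<^sub>G B) C (swap B A) (gray_id C)))))"

lemma assoc_inv_functor:
  assumes "gray_cat A" "gray_cat B" "gray_cat C"
  shows "gray_functor (A \<otimes>\<^sub>G (B \<otimes>\<^sub>G C)) ((A \<otimes>\<^sub>G B) \<otimes>\<^sub>G C) (assoc_inv A B C)"
proof -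
  note T = tensor_gray_cat[OF assms(2,3)] tensor_gray_cat[OF assms(2,1)]
  show ?thesis
    unfolding assoc_inv_def
    by (rule gray_functor_comp[OF swap_functor[OF assms(1) T(1)] gray_functor_comp[OF
          tensor_map_functor[OF swap_functor[OF assms(2,3)] gray_functor_id[OF assms(1)]] gray_functor_comp[OF
          assoc_functor[OF assms(3,2,1)] gray_functor_comp[OF swap_functor[OF assms(3) T(2)]
          tensor_map_functor[OF swap_functor[OF assms(2,1)] gray_functor_id[OF assms(3)]]]]]])
qed

lemma assoc_inv_ten:
  assumes A: "gray_cat A" "gray_cat B" "gray_cat C" and a: "x \<in> cell A l" "y \<in> cell B m" "z \<in> cell C n"
    "two_zero l m n" "k = l + m + n" "j = l + m" "i = m + n"
  shows "assoc_inv A B C k (ten A (B \<otimes>\<^sub>G C) l i x (ten B C m n y z)) = ten (A \<otimes>\<^sub>G B) C j n (ten A B l m x y) z"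
proof -
  note T = tensor_gray_cat[OF A(2,3)] tensor_gray_cat[OF A(3,2)] tensor_gray_cat[OF A(2,1)] tensor_gray_cat[OF
      A(1,2)]
  have d: "m = 0 \<or> n = 0" "l = 0 \<or> m = 0" "l = 0 \<or> i = 0" "n = 0 \<or> j = 0" using a(4-) by auto
  have c': "ten B C m n y z \<in> cell (B \<otimes>\<^sub>G C) i" "ten C B n m z y \<in> cell (C \<otimes>\<^sub>G B) i"
    "ten B A m l y x \<in> cell (B \<otimes>\<^sub>G A) j" "ten A B l m x y \<in> cell (A \<otimes>\<^sub>G B) j"
    by (rule ten_cell[OF A(2,3) a(2,3)] ten_cell[OF A(3,2) a(3,2)] ten_cell[OF A(2,1) a(2,1)] ten_cell[OF A(1,2)
        a(1,2)];
        use d a(5-) in auto)+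
  have e: "i = 0 \<or> l = 0" "j = 0 \<or> n = 0" "k = i + l" "k = j + n" using d a(5-) by auto
  have s: "swap B C i (ten B C m n y z) = ten C B n m z y" "swap B A j (ten B A m l y x) = ten A B l m x y"
    by (rule swap_ten[OF A(2,3) a(2,3)] swap_ten[OF A(2,1) a(2,1)]; use d a(5-) in auto)+
  have 1: "swap A (B \<otimes>\<^sub>G C) k (ten A (B \<otimes>\<^sub>G C) l i x (ten B C m n y z)) = ten (B \<otimes>\<^sub>G C) A i l (ten B C m n y z) x"
    by (rule swap_ten[OF A(1) T(1) a(1) c'(1)]) (use d a(5-) in auto)
  have 2: "tensor_map (B \<otimes>\<^sub>G C) A (C \<otimes>\<^sub>G B) A (swap B C) (gray_id A) k (ten (B \<otimes>\<^sub>G C) A i l (ten B C m n y z) x) =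
     ten (C \<otimes>\<^sub>G B) A i l (ten C B n m z y) x"
    using tensor_map_ten[OF swap_functor[OF A(2,3)] gray_functor_id[OF A(1)] c'(1) a(1) e(1,3)] a(1) by (simp add:
        s)
  have 3: "assoc C B A k (ten (C \<otimes>\<^sub>G B) A i l (ten C B n m z y) x) = ten C (B \<otimes>\<^sub>G A) n j z (ten B A m l y x)"
    by (rule assoc_ten[OF A(3,2,1) a(3,2,1)]) (use a(4-) in auto)
  have 4: "swap C (B \<otimes>\<^sub>G A) k (ten C (B \<otimes>\<^sub>G A) n j z (ten B A m l y x)) = ten (B \<otimes>\<^sub>G A) C j n (ten B A m l y x) z"
    by (rule swap_ten[OF A(3) T(3) a(3) c'(3)]) (use d a(5-) in auto)
  have 5: "tensor_map (B \<otimes>\<^sub>G A) C (A \<otimes>\<^sub>G B) C (swap B A) (gray_id C) k (ten (B \<otimes>\<^sub>G A) C j n (ten B A m l y x) z) =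
     ten (A \<otimes>\<^sub>G B) C j n (ten A B l m x y) z"
    using tensor_map_ten[OF swap_functor[OF A(2,1)] gray_functor_id[OF A(3)] c'(3) a(3) e(2,4)] a(3) by (simp add:
        s)
  have "ten A (B \<otimes>\<^sub>G C) l i x (ten B C m n y z) \<in> cell (A \<otimes>\<^sub>G (B \<otimes>\<^sub>G C)) k"
    "ten (B \<otimes>\<^sub>G C) A i l (ten B C m n y z) x \<in> cell ((B \<otimes>\<^sub>G C) \<otimes>\<^sub>G A) k"
    "ten (C \<otimes>\<^sub>G B) A i l (ten C B n m z y) x \<in> cell ((C \<otimes>\<^sub>G B) \<otimes>\<^sub>G A) k"
    "ten C (B \<otimes>\<^sub>G A) n j z (ten B A m l y x) \<in> cell (C \<otimes>\<^sub>G (B \<otimes>\<^sub>G A)) k"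
    by (rule ten_cell[OF A(1) T(1) a(1) c'(1)] ten_cell[OF T(1) A(1) c'(1) a(1)] ten_cell[OF T(2) A(1) c'(2) a(1)]
        ten_cell[OF A(3) T(3) a(3) c'(3)]; use d a(5-) in auto)+
  then show ?thesis unfolding assoc_inv_def by (simp add: 1 2 3 4 5)
qed

text \<open>On generators the two functors only move brackets back and forth, and both composites
  are determined by their values there.\<close>

theorem assoc_iso:
  assumes A: "gray_cat A" "gray_cat B" "gray_cat C"
  shows "gray_iso ((A \<otimes>\<^sub>G B) \<otimes>\<^sub>G C) (A \<otimes>\<^sub>G (B \<otimes>\<^sub>G C)) (assoc A B C)"
proof -
  note F = assoc_functor[OF A] and G = assoc_inv_functor[OF A]
  note T = tensor_gray_cat[OF A(1,2)] tensor_gray_cat[OF A(2,3)]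
  have "gray_comp ((A \<otimes>\<^sub>G B) \<otimes>\<^sub>G C) (assoc A B C) (assoc_inv A B C) = gray_id ((A \<otimes>\<^sub>G B) \<otimes>\<^sub>G C)" (is "?FG = _")
  proof (rule tensor3_eqI[OF A gray_functor_comp[OF F G] gray_functor_id[OF gray_functorD(1)[OF F]]])
    fix l m n x y z
    assume a: "x \<in> cell A l" "y \<in> cell B m" "z \<in> cell C n" and lmn: "two_zero l m n"
    have "ten (A \<otimes>\<^sub>G B) C (l + m) n (ten A B l m x y) z \<in> cell ((A \<otimes>\<^sub>G B) \<otimes>\<^sub>G C) (l + m + n)"
      by (rule ten_cell[OF T(1) A(3) ten_cell[OF A(1,2) a(1,2)] a(3)]) (use lmn in auto)
    then show "?FG (l + m + n) (ten (A \<otimes>\<^sub>G B) C (l + m) n (ten A B l m x y) z) =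
        gray_id ((A \<otimes>\<^sub>G B) \<otimes>\<^sub>G C) (l + m + n) (ten (A \<otimes>\<^sub>G B) C (l + m) n (ten A B l m x y) z)"
      by (simp add: assoc_ten[OF A a lmn refl refl refl] assoc_inv_ten[OF A a lmn refl refl refl])
  qed
  moreover have "gray_comp (A \<otimes>\<^sub>G (B \<otimes>\<^sub>G C)) (assoc_inv A B C) (assoc A B C) = gray_id (A \<otimes>\<^sub>G (B \<otimes>\<^sub>G C))" (is "?GF =
      _")
  proof (rule tensor3_eqI'[OF A gray_functor_comp[OF G F] gray_functor_id[OF gray_functorD(1)[OF G]]])
    fix l m n x y z
    assume a: "x \<in> cell A l" "y \<in> cell B m" "z \<in> cell C n" and lmn: "two_zero l m n"
    have "ten A (B \<otimes>\<^sub>G C) l (m + n) x (ten B C m n y z) \<in> cell (A \<otimes>\<^sub>G (B \<otimes>\<^sub>G C)) (l + m + n)"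
      by (rule ten_cell[OF A(1) T(2) a(1) ten_cell[OF A(2,3) a(2,3)]]) (use lmn in auto)
    then show "?GF (l + m + n)
        (ten A (B \<otimes>\<^sub>G C) l (m + n) x (ten B C m n y z)) =
       gray_id (A \<otimes>\<^sub>G (B \<otimes>\<^sub>G C)) (l + m + n) (ten A (B \<otimes>\<^sub>G C) l (m + n) x (ten B C m n y z))"
      by (simp add: assoc_ten[OF A a lmn refl refl refl] assoc_inv_ten[OF A a lmn refl refl refl])
  qed
  ultimately show ?thesis using F G unfolding gray_iso_def gray_functor_iff by blast
qed

lemma assoc_natural:
  assumes F: "gray_functor A A' F" and G: "gray_functor B B' G" and H: "gray_functor C C' H"
  shows "gray_comp ((A \<otimes>\<^sub>G B) \<otimes>\<^sub>G C)
          (tensor_map (A \<otimes>\<^sub>G B) C (A' \<otimes>\<^sub>G B') C' (tensor_map A B A' B' F G) H) (assoc A' B' C') =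
        gray_comp ((A \<otimes>\<^sub>G B) \<otimes>\<^sub>G C)
          (assoc A B C) (tensor_map A (B \<otimes>\<^sub>G C) A' (B' \<otimes>\<^sub>G C') F (tensor_map B C B' C' G H))"
    (is "?L = ?R")
proof -
  note A = gray_functorD(1)[OF F] gray_functorD(1)[OF G] gray_functorD(1)[OF H]
  note A' = gray_functorD(2)[OF F] gray_functorD(2)[OF G] gray_functorD(2)[OF H]
  note FG = tensor_map_functor[OF F G] and GH = tensor_map_functor[OF G H]
  show ?thesis
  proof (rule tensor3_eqI[OF A gray_functor_comp[OF tensor_map_functor[OF FG H] assoc_functor[OF A']]
        gray_functor_comp[OF assoc_functor[OF A] tensor_map_functor[OF F GH]]])
    fix l m n x y z
    assume a: "x \<in> cell A l" "y \<in> cell B m" "z \<in> cell C n" and lmn: "two_zero l m n"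
    have a': "F l x \<in> cell A' l" "G m y \<in> cell B' m" "H n z \<in> cell C' n"
      using a gray_functor.map_cell F G H by metis+
    have 1: "ten A B l m x y \<in> cell (A \<otimes>\<^sub>G B) (l + m)" "ten B C m n y z \<in> cell (B \<otimes>\<^sub>G C) (m + n)"
      by (rule ten_cell[OF A(1,2) a(1,2)] ten_cell[OF A(2,3) a(2,3)]; use lmn in auto)+
    have 2: "ten (A \<otimes>\<^sub>G B) C (l + m) n (ten A B l m x y) z \<in> cell ((A \<otimes>\<^sub>G B) \<otimes>\<^sub>G C) (l + m + n)"
      by (rule ten_cell[OF gray_functorD(1)[OF FG] A(3) 1(1) a(3)]) (use lmn in auto)
    have "l + m = 0 \<or> n = 0" "l = 0 \<or> m + n = 0" "l = 0 \<or> m = 0" "m = 0 \<or> n = 0" using lmn by auto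
    then show "?L (l + m + n) (ten (A \<otimes>\<^sub>G B) C (l + m) n (ten A B l m x y) z) =
        ?R (l + m + n) (ten (A \<otimes>\<^sub>G B) C (l + m) n (ten A B l m x y) z)"
      using 2 by (simp add: assoc_ten[OF A a lmn refl refl refl] assoc_ten[OF A' a' lmn refl refl refl]
          tensor_map_ten[OF FG H 1(1) a(3)] tensor_map_ten[OF F GH a(1) 1(2)] tensor_map_ten[OF F G a(1,2)]
          tensor_map_ten[OF G H a(2,3)])
  qed
qed

text \<open>Both sides rebracket a generator from fully left to fully right, and
  \<open>tensor4_eqI\<close> says that this determines them.\<close>

theorem pentagon:
  assumes A: "gray_cat A" "gray_cat B" "gray_cat C" "gray_cat D"
  shows "gray_comp (((A \<otimes>\<^sub>G B) \<otimes>\<^sub>G C) \<otimes>\<^sub>G D) (assoc (A \<otimes>\<^sub>G B) C D) (assoc A B (C \<otimes>\<^sub>G D)) =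
        gray_comp (((A \<otimes>\<^sub>G B) \<otimes>\<^sub>G C) \<otimes>\<^sub>G D)
          (tensor_map ((A \<otimes>\<^sub>G B) \<otimes>\<^sub>G C) D (A \<otimes>\<^sub>G (B \<otimes>\<^sub>G C)) D (assoc A B C) (gray_id D))
          (gray_comp ((A \<otimes>\<^sub>G (B \<otimes>\<^sub>G C)) \<otimes>\<^sub>G D) (assoc A (B \<otimes>\<^sub>G C) D)
            (tensor_map A ((B \<otimes>\<^sub>G C) \<otimes>\<^sub>G D) A (B \<otimes>\<^sub>G (C \<otimes>\<^sub>G D)) (gray_id A) (assoc B C D)))"
    (is "?L = ?R")
proof -
  note AB = tensor_gray_cat[OF A(1,2)] and BC = tensor_gray_cat[OF A(2,3)] and CD = tensor_gray_cat[OF A(3,4)]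
  note F1 = assoc_functor[OF AB A(3,4)] and F2 = assoc_functor[OF A(1,2) CD] and F3 = assoc_functor[OF A(1-3)]
    and F4 = assoc_functor[OF A(1) BC A(4)] and F5 = assoc_functor[OF A(2-4)]
  note I = gray_functor_id[OF A(1)] gray_functor_id[OF A(4)]
  note G1 = tensor_map_functor[OF F3 I(2)] and G2 = tensor_map_functor[OF I(1) F5]
  show ?thesis
  proof (rule tensor4_eqI[OF A gray_functor_comp[OF F1 F2] gray_functor_comp[OF G1 gray_functor_comp[OF F4 G2]]])
    fix l m n p x y z w
    assume a: "x \<in> cell A l" "y \<in> cell B m" "z \<in> cell C n" "w \<in> cell D p"
      and d: "l = 0 \<and> m = 0 \<and> n = 0 \<or> l = 0 \<and> m = 0 \<and> p = 0 \<or> l = 0 \<and> n = 0 \<and> p = 0 \<or> m = 0 \<and> n = 0 \<and> p = 0"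
    have 1: "ten A B l m x y \<in> cell (A \<otimes>\<^sub>G B) (l + m)" "ten B C m n y z \<in> cell (B \<otimes>\<^sub>G C) (m + n)"
      "ten C D n p z w \<in> cell (C \<otimes>\<^sub>G D) (n + p)"
      by (rule ten_cell[OF A(1,2) a(1,2)] ten_cell[OF A(2,3) a(2,3)] ten_cell[OF A(3,4) a(3,4)]; use d in auto)+
    have 2: "ten (A \<otimes>\<^sub>G B) C (l + m) n (ten A B l m x y) z \<in> cell ((A \<otimes>\<^sub>G B) \<otimes>\<^sub>G C) (l + m + n)"
      "ten A (B \<otimes>\<^sub>G C) l (m + n) x (ten B C m n y z) \<in> cell (A \<otimes>\<^sub>G (B \<otimes>\<^sub>G C)) (l + m + n)"
      "ten (B \<otimes>\<^sub>G C) D (m + n) p (ten B C m n y z) w \<in> cell ((B \<otimes>\<^sub>G C) \<otimes>\<^sub>G D) (m + n + p)"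
      by (rule ten_cell[OF AB A(3) 1(1) a(3)] ten_cell[OF A(1) BC a(1) 1(2)] ten_cell[OF BC A(4) 1(2) a(4)]; use d
          in auto)+
    have 3: "ten ((A \<otimes>\<^sub>G B) \<otimes>\<^sub>G C) D (l + m + n) p (ten (A \<otimes>\<^sub>G B) C (l + m) n (ten A B l m x y) z) w
        \<in> cell (((A \<otimes>\<^sub>G B) \<otimes>\<^sub>G C) \<otimes>\<^sub>G D) (l + m + n + p)"
      "ten (A \<otimes>\<^sub>G (B \<otimes>\<^sub>G C)) D (l + m + n) p (ten A (B \<otimes>\<^sub>G C) l (m + n) x (ten B C m n y z)) w
        \<in> cell ((A \<otimes>\<^sub>G (B \<otimes>\<^sub>G C)) \<otimes>\<^sub>G D) (l + m + n + p)"
      by (rule ten_cell[OF gray_functorD(1)[OF F3] A(4) 2(1) a(4)] ten_cell[OF gray_functorD(2)[OF F3] A(4) 2(2)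
          a(4)]; use d in auto)+
    have e1: "assoc (A \<otimes>\<^sub>G B) C D (l + m + n + p) (ten ((A \<otimes>\<^sub>G B) \<otimes>\<^sub>G C) D (l + m + n) p (ten (A \<otimes>\<^sub>G B) C (l + m) n
        (ten A B l m x y) z) w) =
        ten (A \<otimes>\<^sub>G B) (C \<otimes>\<^sub>G D) (l + m) (n + p) (ten A B l m x y) (ten C D n p z w)"
      by (rule assoc_ten[OF AB A(3,4) 1(1) a(3,4)]) (use d in auto)
    have e2: "assoc A B (C \<otimes>\<^sub>G D) (l + m + n + p) (ten (A \<otimes>\<^sub>G B) (C \<otimes>\<^sub>G D) (l + m) (n + p) (ten A B l m x y) (ten C
        D n p z w)) =
        ten A (B \<otimes>\<^sub>G (C \<otimes>\<^sub>G D)) l (m + n + p) x (ten B (C \<otimes>\<^sub>G D) m (n + p) y (ten C D n p z w))"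
      by (rule assoc_ten[OF A(1,2) CD a(1,2) 1(3)]) (use d in auto)
    have e3: "assoc A B C (l + m + n) (ten (A \<otimes>\<^sub>G B) C (l + m) n (ten A B l m x y) z) = ten A (B \<otimes>\<^sub>G C) l (m + n) x
        (ten B C m n y z)"
      by (rule assoc_ten[OF A(1-3) a(1-3)]) (use d in auto)
    have e4: "tensor_map ((A \<otimes>\<^sub>G B) \<otimes>\<^sub>G C) D (A \<otimes>\<^sub>G (B \<otimes>\<^sub>G C)) D (assoc A B C) (gray_id D) (l + m + n + p)
        (ten ((A \<otimes>\<^sub>G B) \<otimes>\<^sub>G C) D (l + m + n) p (ten (A \<otimes>\<^sub>G B) C (l + m) n (ten A B l m x y) z) w) =
        ten (A \<otimes>\<^sub>G (B \<otimes>\<^sub>G C)) D (l + m + n) p (ten A (B \<otimes>\<^sub>G C) l (m + n) x (ten B C m n y z)) w"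
      using d a(4) by (subst tensor_map_ten[OF F3 I(2) 2(1) a(4)]) (auto simp: e3)
    have e5: "assoc A (B \<otimes>\<^sub>G C) D (l + m + n + p) (ten (A \<otimes>\<^sub>G (B \<otimes>\<^sub>G C)) D (l + m + n) p (ten A (B \<otimes>\<^sub>G C) l (m + n)
        x (ten B C m n y z)) w) =
        ten A ((B \<otimes>\<^sub>G C) \<otimes>\<^sub>G D) l (m + n + p) x (ten (B \<otimes>\<^sub>G C) D (m + n) p (ten B C m n y z) w)"
      by (rule assoc_ten[OF A(1) BC A(4) a(1) 1(2) a(4)]) (use d in auto)
    have e6: "assoc B C D (m + n + p) (ten (B \<otimes>\<^sub>G C) D (m + n) p (ten B C m n y z) w) = ten B (C \<otimes>\<^sub>G D) m (n + p) y
        (ten C D n p z w)"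
      by (rule assoc_ten[OF A(2-4) a(2-4)]) (use d in auto)
    have e7: "tensor_map A ((B \<otimes>\<^sub>G C) \<otimes>\<^sub>G D) A (B \<otimes>\<^sub>G (C \<otimes>\<^sub>G D)) (gray_id A) (assoc B C D) (l + m + n + p)
        (ten A ((B \<otimes>\<^sub>G C) \<otimes>\<^sub>G D) l (m + n + p) x (ten (B \<otimes>\<^sub>G C) D (m + n) p (ten B C m n y z) w)) =
        ten A (B \<otimes>\<^sub>G (C \<otimes>\<^sub>G D)) l (m + n + p) x (ten B (C \<otimes>\<^sub>G D) m (n + p) y (ten C D n p z w))"
      using d a(1) by (subst tensor_map_ten[OF I(1) F5 a(1) 2(3)]) (auto simp: e6)
    show "?L (l + m + n + p) (ten ((A \<otimes>\<^sub>G B) \<otimes>\<^sub>G C) D (l + m + n) p (ten (A \<otimes>\<^sub>G B) C (l + m) n (ten A B l m x y) z)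
        w) =
        ?R (l + m + n + p) (ten ((A \<otimes>\<^sub>G B) \<otimes>\<^sub>G C) D (l + m + n) p (ten (A \<otimes>\<^sub>G B) C (l + m) n (ten A B l m x y) z)
            w)"
      using 3 by (simp add: e1 e2 e4 e5 e7)
  qed
qed

section \<open>The unit object\<close>

lemma gray_unit_cat: "gray_cat gray_unit"
  by (rule gray_cat.intro) (auto simp: gray_unit_def split: if_splits)

lemma gray_unit_cell [simp]: "x \<in> cell gray_unit n \<longleftrightarrow> n \<le> 3"
  by (simp add: gray_unit_def)

context gray_cat
begin

lemma iid_cell: "X \<in> cell G 0 \<Longrightarrow> n \<le> 3 \<Longrightarrow> iid (idt G) n X \<in> cell G n"
  by (induction n) (simp_all add: idt_cell)

lemma iid_wh:
  assumes "X \<in> cell G 0" "m \<ge> 1" "n \<ge> 1" "m = 1 \<or> n = 1" "m \<le> 3" "n \<le> 3"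
  shows "wh G m n (iid (idt G) m X) (iid (idt G) n X) = iid (idt G) (m + n - 1) X"
proof -
  have *: "wh G 1 1 (idt G 0 X) (idt G 0 X) = idt G 0 X"
    using wh_unit_simps(1)[of "idt G 0 X"] assms(1) by simp
  have "m = 1 \<or> m = 2 \<or> m = 3" "n = 1 \<or> n = 2 \<or> n = 3" using assms by auto
  then show ?thesis using assms(1,4) by (elim disjE) (simp_all add: *)
qed

text \<open>The iterated identities of one object are closed under all operations: each composite or
  interchange of them collapses by a unit law.\<close>

lemma constant_functor:
  assumes X: "X \<in> cell G 0"
  shows "gray_functor gray_unit G (\<lambda>m. restrict (\<lambda>_. iid (idt G) m X) (cell gray_unit m))"
proof -
  note i = iid_cell[OF X]
  have h: "hor G 2 (idt G 1 (idt G 0 X)) (idt G 1 (idt G 0 X)) = idt G 1 (idt G 0 X)"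
    using hor2_idt_left[of "idt G 1 (idt G 0 X)"] X by simp
  have h3: "hor G 3 (idt G 2 (idt G 1 (idt G 0 X))) (idt G 2 (idt G 1 (idt G 0 X))) = idt G 2 (idt G 1 (idt G 0 X))"
    using hor3_idt_left[of "idt G 2 (idt G 1 (idt G 0 X))"] X by simp
  have v: "ver G (idt G 2 (idt G 1 (idt G 0 X))) (idt G 2 (idt G 1 (idt G 0 X))) = idt G 2 (idt G 1 (idt G 0 X))"
    using ver_idt_left[of "idt G 2 (idt G 1 (idt G 0 X))"] X by simp
  have c: "ich G (idt G 1 (idt G 0 X)) (idt G 1 (idt G 0 X)) = idt G 2 (idt G 1 (idt G 0 X))"
    using ich_idt_left[of "idt G 0 X" "idt G 1 (idt G 0 X)"] wh_unit_simps(2)[of "idt G 1 (idt G 0 X)"] X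
    by (simp del: wh_idt_simps)
  show ?thesis
    apply (intro gray_functor.intro gray_functor_axioms.intro)
    subgoal by (rule gray_unit_cat)
    subgoal by (rule gray_cat_axioms)
    subgoal by simp
    subgoal using i by simp
    subgoal using i by (simp add: src_idt)
    subgoal using i by (simp add: tgt_idt)
    subgoal by simp
    subgoal for x m y n using iid_wh[OF X, of m n] by auto
    subgoal by (simp add: h)
    subgoal by (simp add: h3)
    subgoal by (simp add: v)
    subgoal by (simp add: c)
    done
qed

text \<open>The identity in the second variable and constant in the first. The mixed conditions
  reduce to unit laws, since whiskering with an iterated identity gives an iterated identity, and
  interchange with an identity 2-cell is an identity. Its lift is \<open>lunit\<close>.\<close>

lemma unit_quasi: "gray_quasi gray_unit G G (\<lambda>m n _ y. if m = 0 then y else iid (idt G) m y)"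
proof -
  have 1: "wh G m n (iid (idt G) m (src0 G n y)) y = wh G n m y (iid (idt G) m (tgt0 G n y))"
    if "m \<le> 3" "y \<in> cell G n" "m \<ge> 1" "n \<ge> 1" "m = 1 \<or> n = 1" for m n y
  proof -
    have "m = 1 \<or> m = 2 \<and> n = 1 \<or> m = 3 \<and> n = 1" using that by auto
    then show ?thesis
      using that wh_unit_left[of y n] wh_unit_right[of y n] by auto
  qed
  have 2: "inverse3 G (ich G (idt G 1 (idt G 0 (src0 G 2 b))) b) (ich G b (idt G 1 (idt G 0 (tgt0 G 2 b))))"
    if "b \<in> cell G 2" for b
    using that by (simp add: ich_idt_left ich_idt_right inverse3_idt)
  show ?thesis
    apply (intro gray_quasi.intro gray_quasi_axioms.intro)
    subgoal by (rule gray_unit_cat)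
    subgoal by (rule gray_cat_axioms)
    subgoal by (rule gray_cat_axioms)
    subgoal by (rule gray_functor_cong[OF gray_functor_id[OF gray_cat_axioms]]) simp_all
    subgoal for Y by (rule gray_functor_cong[OF constant_functor[of Y]]) simp_all
    subgoal using 1 by simp
    subgoal using 2 by simp
    done
qed

end

text \<open>Every cell of the unit is an iterated identity of its object, and tensoring with
  \<open>Y\<close> followed by \<open>K\<close> preserves identities. Generators with a unit cell of
  positive dimension therefore carry no further information.\<close>

lemma unit_functor_values:
  assumes A: "gray_cat A" and K: "gray_functor (gray_unit \<otimes>\<^sub>G A) D K" and Y: "Y \<in> cell A 0" and m: "m \<le> 3"
  shows "K m (ten gray_unit A m 0 () Y) = iid (idt D) m (K 0 (ten gray_unit A 0 0 () Y))"
proof -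
  interpret F: gray_functor gray_unit D "\<lambda>m. restrict (\<lambda>x. K m (ten gray_unit A m 0 x Y)) (cell gray_unit m)"
    by (rule tensor_left_functor[OF gray_unit_cat A K Y])
  show ?thesis using m
  proof (induction m)
    case (Suc m)
    then show ?case using F.map_idt[of "()" m] by simp
  qed simp
qed

lemma unit_functor_eqI:
  assumes A: "gray_cat A" and K: "gray_functor (gray_unit \<otimes>\<^sub>G A) D K" "gray_functor (gray_unit \<otimes>\<^sub>G A) D L"
    and eq: "\<And>n y. y \<in> cell A n \<Longrightarrow> K n (ten gray_unit A 0 n () y) = L n (ten gray_unit A 0 n () y)"
  shows "K = L"
proof (rule tensor_eqI[OF gray_unit_cat A K])
  fix m n x y assume "x \<in> cell gray_unit m" "y \<in> cell A n" "m = 0 \<or> n = 0"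
  then show "K (m + n) (ten gray_unit A m n x y) = L (m + n) (ten gray_unit A m n x y)"
    using eq[of y n] unit_functor_values[OF A K(1), of y m] unit_functor_values[OF A K(2), of y m] by auto
qed

lemma lunit_spec:
  assumes A: "gray_cat A"
  shows "gray_functor (gray_unit \<otimes>\<^sub>G A) A (lunit A) \<and> (\<forall>n. \<forall>x\<in>cell A n. lunit A n (ten gray_unit A 0 n () x) = x)"
proof -
  obtain K where K: "gray_functor (gray_unit \<otimes>\<^sub>G A) A K"
    "\<And>m n k x y. \<lbrakk>x \<in> cell gray_unit m; y \<in> cell A n; m = 0 \<or> n = 0; k = m + n\<rbrakk> \<Longrightarrow>
      K k (ten gray_unit A m n x y) = (if m = 0 then y else iid (idt A) m y)"
    using tensor_lift_exists[OF gray_cat.unit_quasi[OF A]] by metis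
  have K': "K n (ten gray_unit A 0 n () x) = x" if "x \<in> cell A n" for n x
    using K(2)[of "()" 0 x n n] that by simp
  show ?thesis
    unfolding lunit_def gray_functor_iff
  proof (rule theI[of _ K])
    fix L assume L: "gray_functor (gray_unit \<otimes>\<^sub>G A) A L \<and> (\<forall>n. \<forall>x\<in>cell A n. L n (ten gray_unit A 0 n () x) = x)"
    show "L = K"
      by (rule unit_functor_eqI[OF A conjunct1[OF L] K(1)]) (use L K' in simp)
  qed (use K(1) K' in blast)
qed

lemma lunit_functor: "gray_cat A \<Longrightarrow> gray_functor (gray_unit \<otimes>\<^sub>G A) A (lunit A)"
  and lunit_ten: "gray_cat A \<Longrightarrow> x \<in> cell A n \<Longrightarrow> lunit A n (ten gray_unit A 0 n () x) = x"
  using lunit_spec by blast+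

text \<open>The inverse tensors with the object of the unit on the left. By
  \<open>unit_functor_eqI\<close> the composite on the tensor product has to be compared only on
  generators containing that object.\<close>

theorem lunit_iso:
  assumes A: "gray_cat A"
  shows "gray_iso (gray_unit \<otimes>\<^sub>G A) A (lunit A)"
proof -
  let ?J = "\<lambda>n. restrict (ten gray_unit A 0 n ()) (cell A n)"
  have J: "gray_functor A (gray_unit \<otimes>\<^sub>G A) ?J"
    by (rule gray_quasi.right[OF ten_gray_quasi[OF gray_unit_cat A]]) simp
  note F = lunit_functor[OF A]
  have "gray_comp A ?J (lunit A) = gray_id A"
    by (rule gray_functor_eqI[OF gray_functor_comp[OF J F] gray_functor_id[OF A]]) (simp add: lunit_ten[OF A])
  moreover have "gray_comp (gray_unit \<otimes>\<^sub>G A) (lunit A) ?J = gray_id (gray_unit \<otimes>\<^sub>G A)"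
    by (rule unit_functor_eqI[OF A gray_functor_comp[OF F J] gray_functor_id[OF gray_functorD(1)[OF F]]])
      (simp add: lunit_ten[OF A] ten_cell[OF gray_unit_cat A])
  ultimately show ?thesis using F J unfolding gray_iso_def gray_functor_iff by blast
qed

lemma swap_swap:
  assumes "gray_cat A" "gray_cat B"
  shows "gray_comp (A \<otimes>\<^sub>G B) (swap A B) (swap B A) = gray_id (A \<otimes>\<^sub>G B)"
proof (rule tensor_eqI[OF assms gray_functor_comp[OF swap_functor[OF assms] swap_functor[OF assms(2,1)]]
      gray_functor_id[OF tensor_gray_cat[OF assms]]])
  fix m n x y assume a: "x \<in> cell A m" "y \<in> cell B n" "m = 0 \<or> n = 0"
  then show "gray_comp (A \<otimes>\<^sub>G B) (swap A B) (swap B A) (m + n) (ten A B m n x y) = gray_id (A \<otimes>\<^sub>G B) (m + n) (ten A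
      B m n x y)"
    using ten_cell[OF assms a refl] swap_ten[OF assms a refl] swap_ten[OF assms(2,1) a(2,1)] by auto
qed

text \<open>The symmetry carries any functor with the values prescribed for \<open>runit\<close> to
  one with those prescribed for \<open>lunit\<close>, which is unique; \<open>swap_swap\<close>
  carries the equation back.\<close>

lemma runit_eq:
  assumes A: "gray_cat A"
  shows "runit A = gray_comp (A \<otimes>\<^sub>G gray_unit) (swap A gray_unit) (lunit A)"
  unfolding runit_def gray_functor_iff
proof (rule the_equality)
  note S = swap_functor[OF A gray_unit_cat] and S' = swap_functor[OF gray_unit_cat A] and F = lunit_functor[OF A]
  show "gray_functor (A \<otimes>\<^sub>G gray_unit) A (gray_comp (A \<otimes>\<^sub>G gray_unit) (swap A gray_unit) (lunit A)) \<and>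
    (\<forall>n. \<forall>x\<in>cell A n. gray_comp (A \<otimes>\<^sub>G gray_unit) (swap A gray_unit) (lunit A) n (ten A gray_unit n 0 x ()) = x)"
    using gray_functor_comp[OF S F] by (auto simp: ten_cell[OF A gray_unit_cat] swap_ten[OF A gray_unit_cat]
        lunit_ten[OF A])
  fix K assume K: "gray_functor (A \<otimes>\<^sub>G gray_unit) A K \<and> (\<forall>n. \<forall>x\<in>cell A n. K n (ten A gray_unit n 0 x ()) = x)"
  have "gray_comp (gray_unit \<otimes>\<^sub>G A) (swap gray_unit A) K = lunit A"
    by (rule unit_functor_eqI[OF A gray_functor_comp[OF S' conjunct1[OF K]] F])
      (use K in \<open>auto simp: ten_cell[OF gray_unit_cat A] swap_ten[OF gray_unit_cat A] lunit_ten[OF A]\<close>)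
  then have "gray_comp (A \<otimes>\<^sub>G gray_unit) (swap A gray_unit) (lunit A) =
    gray_comp (A \<otimes>\<^sub>G gray_unit) (gray_comp (A \<otimes>\<^sub>G gray_unit) (swap A gray_unit) (swap gray_unit A)) K"
    using gray_comp_assoc[OF S, of "swap gray_unit A" K] by simp
  then show "K = gray_comp (A \<otimes>\<^sub>G gray_unit) (swap A gray_unit) (lunit A)"
    using swap_swap[OF A gray_unit_cat] gray_comp_id(1) K by metis
qed

lemma runit_functor: "gray_cat A \<Longrightarrow> gray_functor (A \<otimes>\<^sub>G gray_unit) A (runit A)"
  using gray_functor_comp[OF swap_functor[OF _ gray_unit_cat] lunit_functor] by (simp add: runit_eq)

lemma runit_ten: "gray_cat A \<Longrightarrow> x \<in> cell A n \<Longrightarrow> runit A n (ten A gray_unit n 0 x ()) = x"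
  by (simp add: runit_eq ten_cell gray_unit_cat swap_ten lunit_ten)

lemma gray_iso_comp:
  assumes "gray_iso A B F" "gray_iso B C G"
  shows "gray_iso A C (gray_comp A F G)"
proof -
  obtain F' G' where F: "gray_functor A B F" "gray_functor B A F'" "gray_comp A F F' = gray_id A" "gray_comp B F' F
      = gray_id B"
    and G: "gray_functor B C G" "gray_functor C B G'" "gray_comp B G G' = gray_id B" "gray_comp C G' G = gray_id C"
    using assms unfolding gray_iso_def gray_functor_iff by blast
  have "gray_comp A (gray_comp A F G) (gray_comp C G' F') = gray_id A"
    using gray_comp_assoc[OF F(1), of G "gray_comp C G' F'"] gray_comp_assoc[OF G(1), of G' F'] G(3) F(3)
        gray_comp_id(1)[OF F(2)] by simp
  moreover have "gray_comp C (gray_comp C G' F') (gray_comp A F G) = gray_id C"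
    using gray_comp_assoc[OF G(2), of F' "gray_comp A F G"] gray_comp_assoc[OF F(2), of F G] G(4) F(4)
        gray_comp_id(1)[OF G(1)] by simp
  ultimately show ?thesis
    using gray_functor_comp[OF F(1) G(1)] gray_functor_comp[OF G(2) F(2)] unfolding gray_iso_def gray_functor_iff by
        blast
qed

theorem runit_iso:
  assumes A: "gray_cat A"
  shows "gray_iso (A \<otimes>\<^sub>G gray_unit) A (runit A)"
proof -
  have "gray_iso (A \<otimes>\<^sub>G gray_unit) (gray_unit \<otimes>\<^sub>G A) (swap A gray_unit)"
    unfolding gray_iso_def gray_functor_iff
    using swap_functor[OF A gray_unit_cat] swap_functor[OF gray_unit_cat A] swap_swap[OF A gray_unit_cat]
      swap_swap[OF gray_unit_cat A] by blast
  from gray_iso_comp[OF this lunit_iso[OF A]] show ?thesis by (simp add: runit_eq[OF A])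
qed

lemma lunit_natural:
  assumes F: "gray_functor A A' F"
  shows "gray_comp (gray_unit \<otimes>\<^sub>G A) (tensor_map gray_unit A gray_unit A' (gray_id gray_unit) F) (lunit A') =
        gray_comp (gray_unit \<otimes>\<^sub>G A) (lunit A) F"
proof -
  note A = gray_functorD[OF F] and I = gray_functor_id[OF gray_unit_cat]
  show ?thesis
    by (rule unit_functor_eqI[OF A(1) gray_functor_comp[OF tensor_map_functor[OF I F] lunit_functor[OF A(2)]]
          gray_functor_comp[OF lunit_functor[OF A(1)] F]])
      (simp add: ten_cell[OF gray_unit_cat A(1)] tensor_map_ten[OF I F] lunit_ten[OF A(1)] lunit_ten[OF A(2)]
        gray_functor.map_cell[OF F])
qed

lemma runit_functor_eqI:
  assumes A: "gray_cat A" and K: "gray_functor (A \<otimes>\<^sub>G gray_unit) D K" "gray_functor (A \<otimes>\<^sub>G gray_unit) D L"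
    and eq: "\<And>n y. y \<in> cell A n \<Longrightarrow> K n (ten A gray_unit n 0 y ()) = L n (ten A gray_unit n 0 y ())"
  shows "K = L"
proof -
  note S = swap_functor[OF A gray_unit_cat] and S' = swap_functor[OF gray_unit_cat A]
  have "gray_comp (gray_unit \<otimes>\<^sub>G A) (swap gray_unit A) K = gray_comp (gray_unit \<otimes>\<^sub>G A) (swap gray_unit A) L"
    by (rule unit_functor_eqI[OF A gray_functor_comp[OF S' K(1)] gray_functor_comp[OF S' K(2)]])
      (simp add: ten_cell[OF gray_unit_cat A] swap_ten[OF gray_unit_cat A] eq)
  then have "gray_comp (A \<otimes>\<^sub>G gray_unit) (gray_comp (A \<otimes>\<^sub>G gray_unit) (swap A gray_unit) (swap gray_unit A)) K =
    gray_comp (A \<otimes>\<^sub>G gray_unit) (gray_comp (A \<otimes>\<^sub>G gray_unit) (swap A gray_unit) (swap gray_unit A)) L"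
    by (simp add: gray_comp_assoc[OF S])
  then show ?thesis using swap_swap[OF A gray_unit_cat] gray_comp_id(1)[OF K(1)] gray_comp_id(1)[OF K(2)] by simp
qed

lemma runit_natural:
  assumes F: "gray_functor A A' F"
  shows "gray_comp (A \<otimes>\<^sub>G gray_unit) (tensor_map A gray_unit A' gray_unit F (gray_id gray_unit)) (runit A') =
        gray_comp (A \<otimes>\<^sub>G gray_unit) (runit A) F"
proof -
  note A = gray_functorD[OF F] and I = gray_functor_id[OF gray_unit_cat]
  show ?thesis
    by (rule runit_functor_eqI[OF A(1) gray_functor_comp[OF tensor_map_functor[OF F I] runit_functor[OF A(2)]]
          gray_functor_comp[OF runit_functor[OF A(1)] F]])
      (simp add: ten_cell[OF A(1) gray_unit_cat] tensor_map_ten[OF F I] runit_ten[OF A(1)] runit_ten[OF A(2)]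
        gray_functor.map_cell[OF F])
qed

text \<open>The general criterion for threefold products would involve unit cells of all dimensions
  in the middle. Using \<open>runit_functor_eqI\<close> instead leaves generators whose middle entry
  is the object of the unit, where both sides simply erase it.\<close>

theorem triangle:
  assumes A: "gray_cat A" "gray_cat B"
  shows "gray_comp ((A \<otimes>\<^sub>G gray_unit) \<otimes>\<^sub>G B) (assoc A gray_unit B)
          (tensor_map A (gray_unit \<otimes>\<^sub>G B) A B (gray_id A) (lunit B)) =
        tensor_map (A \<otimes>\<^sub>G gray_unit) B A B (runit A) (gray_id B)"
    (is "?L = ?R")
proof -
  note U = gray_unit_cat and I = gray_functor_id[OF A(1)] gray_functor_id[OF A(2)]
  note AU = tensor_gray_cat[OF A(1) U] and UB = tensor_gray_cat[OF U A(2)]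
  note F = assoc_functor[OF A(1) U A(2)] and L = lunit_functor[OF A(2)] and R = runit_functor[OF A(1)]
  note TL = gray_functor_comp[OF F tensor_map_functor[OF I(1) L]] and TR = tensor_map_functor[OF R I(2)]
  have eq: "?L (l + n) (ten (A \<otimes>\<^sub>G gray_unit) B l n (ten A gray_unit l 0 x ()) z) =
      ?R (l + n) (ten (A \<otimes>\<^sub>G gray_unit) B l n (ten A gray_unit l 0 x ()) z)"
    if x: "x \<in> cell A l" "z \<in> cell B n" and ln: "l = 0 \<or> n = 0" for l n x z
  proof -
    have u: "() \<in> cell gray_unit 0" by simp
    have c: "ten A gray_unit l 0 x () \<in> cell (A \<otimes>\<^sub>G gray_unit) l" "ten gray_unit B 0 n () z \<in> cell (gray_unit \<otimes>\<^sub>G B)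
        n"
      by (rule ten_cell[OF A(1) U x(1) u] ten_cell[OF U A(2) u x(2)]; simp)+
    have 1: "assoc A gray_unit B (l + n) (ten (A \<otimes>\<^sub>G gray_unit) B l n (ten A gray_unit l 0 x ()) z) =
        ten A (gray_unit \<otimes>\<^sub>G B) l n x (ten gray_unit B 0 n () z)"
      by (rule assoc_ten[OF A(1) U A(2) x(1) u x(2)]) (use ln in auto)
    show ?thesis
      using ten_cell[OF AU A(2) c(1) x(2) ln refl] tensor_map_ten[OF R I(2) c(1) x(2) ln refl]
        tensor_map_ten[OF I(1) L x(1) c(2) ln refl] x by (simp add: 1 lunit_ten[OF A(2)] runit_ten[OF A(1)])
  qed
  show ?thesis
  proof (rule tensor_eqI_left[OF AU A(2) TL TR])
    fix X n z assume "X \<in> cell (A \<otimes>\<^sub>G gray_unit) 0" "z \<in> cell B n"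
    moreover then obtain a where "a \<in> cell A 0" "X = ten A gray_unit 0 0 a ()"
      using gray_tensor.tensor_objects[OF gray_tensorI[OF A(1) U]] by (metis old.unit.exhaust)
    ultimately show "?L n (ten (A \<otimes>\<^sub>G gray_unit) B 0 n X z) = ?R n (ten (A \<otimes>\<^sub>G gray_unit) B 0 n X z)"
      using eq[of a 0 z n] by simp
  next
    fix Z assume Z: "Z \<in> cell B 0"
    show "(\<lambda>m. \<lambda>x\<in>cell (A \<otimes>\<^sub>G gray_unit) m. ?L m (ten (A \<otimes>\<^sub>G gray_unit) B m 0 x Z)) =
      (\<lambda>m. \<lambda>x\<in>cell (A \<otimes>\<^sub>G gray_unit) m. ?R m (ten (A \<otimes>\<^sub>G gray_unit) B m 0 x Z))"
      by (rule runit_functor_eqI[OF A(1) tensor_left_functor[OF AU A(2) TL Z] tensor_left_functor[OF AU A(2) TR Z]])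
        (use eq[of _ _ Z 0] Z in \<open>simp add: ten_cell[OF A(1) U]\<close>)
  qed
qed

section \<open>The adjunctions\<close>

lemma hom_map_id:
  assumes "gray_cat B" "gray_cat C"
  shows "gray_hom_map B C (gray_id C) = gray_id (gray_hom B C)"
proof -
  interpret gray_pair B C using assms by (rule gray_pairI)
  note I = gray_functor_id[OF assms(2)] and HC = gray_functor_id[OF gray_hom_cat]
  show ?thesis
  proof (rule hom_functor_eqI[OF hom_map_functor[OF assms(1) I] HC assms])
    fix X assume X: "X \<in> cell (gray_hom B C) 0"
    then obtain F where F: "X = HFun F" "gray_functor B C F" by (auto simp: hcells_0 gray_functor_iff)
    show "gray_hom_map B C (gray_id C) 0 X = gray_id (gray_hom B C) 0 X"
      using X gray_comp_id(2)[OF F(2)] by (simp add: F(1) hom_map_HFun)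
  next
    fix n x Y assume x: "x \<in> cell (gray_hom B C) n" "n \<ge> 1" "Y \<in> cell B 0"
    then have "hat x Y \<in> cell C n" using hcells_SucD(6)[of x "n - 1" Y] by (cases n) simp_all
    then show "hat (gray_hom_map B C (gray_id C) n x) Y = hat (gray_id (gray_hom B C) n x) Y"
      using x by (simp add: hat_hom_map)
  qed
qed

lemma hom_map_comp:
  assumes B: "gray_cat B" and K: "gray_functor C C' K" and L: "gray_functor C' C'' L"
  shows "gray_hom_map B C (gray_comp C K L) = gray_comp (gray_hom B C) (gray_hom_map B C K) (gray_hom_map B C' L)"
proof -
  note KL = gray_functor_comp[OF K L] and HK = hom_map_functor[OF B K] and HL = hom_map_functor[OF B L]
  interpret gray_pair B C using B gray_functorD(1)[OF K] by (rule gray_pairI)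
  show ?thesis
  proof (rule hom_functor_eqI[OF hom_map_functor[OF B KL] gray_functor_comp[OF HK HL] B gray_functorD(2)[OF L]])
    fix X assume X: "X \<in> cell (gray_hom B C) 0"
    then obtain F where F: "X = HFun F" "gray_functor B C F" by (auto simp: hcells_0 gray_functor_iff)
    have "HFun (gray_comp B F K) \<in> hcells B C' 0"
      using gray_functor_comp[OF F(2) K] by (auto simp: hcells_0 gray_functor_iff)
    then show "gray_hom_map B C (gray_comp C K L) 0 X = gray_comp (gray_hom B C) (gray_hom_map B C K) (gray_hom_map
        B C' L) 0 X"
      using X gray_comp_assoc[OF F(2), of K L] by (simp add: F(1) hom_map_HFun)
  next
    fix n x Y assume x: "x \<in> cell (gray_hom B C) n" "n \<ge> 1" "Y \<in> cell B 0"
    then have "hat x Y \<in> cell C n" using hcells_SucD(6)[of x "n - 1" Y] by (cases n) simp_all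
    moreover have "gray_hom_map B C K n x \<in> hcells B C' n" using gray_functor.map_cell[OF HK x(1)] by simp
    ultimately show "hat (gray_hom_map B C (gray_comp C K L) n x) Y =
        hat (gray_comp (gray_hom B C) (gray_hom_map B C K) (gray_hom_map B C' L) n x) Y"
      using x by (simp add: hat_hom_map)
  qed
qed

lemma transpose_cong:
  assumes "gray_cat A" "\<And>n X y. X \<in> cell A 0 \<Longrightarrow> y \<in> cell B n \<Longrightarrow> H 0 n X y = H' 0 n X y"
    "\<And>m x Y. x \<in> cell A m \<Longrightarrow> Y \<in> cell B 0 \<Longrightarrow> H m 0 x Y = H' m 0 x Y"
  shows "transpose A B H = transpose A B H'"
proof -
  interpret A: gray_cat A by fact
  have "transp A B H n x = transp A B H' n x" if "x \<in> cell A n" for n x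
    using that
  proof (induction n arbitrary: x)
    case 0
    then show ?case using assms(2) by (auto simp: restrict_def fun_eq_iff)
  next
    case (Suc n)
    then show ?case using assms(3) A.src_cell A.tgt_cell by (auto simp: restrict_def fun_eq_iff)
  qed
  then show ?thesis by (auto simp: transpose_def restrict_def fun_eq_iff)
qed

text \<open>The values are recovered from the transpose as actions of its 0-cells
  (\<open>hfun\<close>) and as components of its cells (\<open>hat\<close>).\<close>

lemma transpose_inj:
  assumes "transpose A B H = transpose A B H'"
  shows "X \<in> cell A 0 \<Longrightarrow> y \<in> cell B n \<Longrightarrow> H 0 n X y = H' 0 n X y"
    "x \<in> cell A m \<Longrightarrow> Y \<in> cell B 0 \<Longrightarrow> H m 0 x Y = H' m 0 x Y"
proof -
  have T: "transp A B H k w = transp A B H' k w" if "w \<in> cell A k" for k w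
    using fun_cong[OF fun_cong[OF assms, of k], of w] that by (simp add: transpose_def)
  show "H 0 n X y = H' 0 n X y" if "X \<in> cell A 0" "y \<in> cell B n"
    using arg_cong[OF T[OF that(1)], of "\<lambda>h. hfun h n y"] that by simp
  show "H m 0 x Y = H' m 0 x Y" if "x \<in> cell A m" "Y \<in> cell B 0"
    using arg_cong[OF T[OF that(1)], of "\<lambda>h. hat h Y"] that by (cases m) simp_all
qed

lemma curry_right_quasi:
  "\<lbrakk>gray_cat A; gray_cat B; gray_functor (A \<otimes>\<^sub>G B) C K\<rbrakk> \<Longrightarrow> gray_quasi A B C (\<lambda>m n x y. K (m + n) (ten A B m n x y))"
  by (rule gray_quasi.post[OF ten_gray_quasi])

lemma curry_left_quasi:
  "\<lbrakk>gray_cat A; gray_cat B; gray_functor (B \<otimes>\<^sub>G A) C K\<rbrakk> \<Longrightarrow> gray_quasi A B C (\<lambda>m n x y. K (n + m) (ten B A n m y x))"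
  by (rule gray_quasi.swap[OF gray_quasi.post[OF ten_gray_quasi]])

text \<open>A transpose determines the values on generators, hence the functor on the tensor
  product. Conversely a functor into the inner hom untransposes to a quasi-functor, which
  lifts.\<close>

theorem curry_right_bij:
  assumes A: "gray_cat A" "gray_cat B" "gray_cat C"
  shows "bij_betw (curry_right A B) {K. gray_functor (A \<otimes>\<^sub>G B) C K} {L. gray_functor A (gray_hom B C) L}"
proof (intro bij_betw_imageI inj_onI set_eqI iffI; (elim imageE)?)
  fix K K' assume K: "K \<in> {K. gray_functor (A \<otimes>\<^sub>G B) C K}" "K' \<in> {K. gray_functor (A \<otimes>\<^sub>G B) C K}"
    and eq: "curry_right A B K = curry_right A B K'"
  show "K = K'"
  proof (rule tensor_eqI[OF A(1,2)])
    fix m n x y assume "x \<in> cell A m" "y \<in> cell B n" "m = 0 \<or> n = 0"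
    then show "K (m + n) (ten A B m n x y) = K' (m + n) (ten A B m n x y)"
      using transpose_inj[OF eq[unfolded curry_right_def]] by auto
  qed (use K in auto)
next
  fix L K assume "L = curry_right A B K" "K \<in> {K. gray_functor (A \<otimes>\<^sub>G B) C K}"
  then show "L \<in> {L. gray_functor A (gray_hom B C) L}"
    using gray_quasi.transpose_functor[OF curry_right_quasi[OF A(1,2)]] by (simp add: curry_right_def)
next
  fix L assume "L \<in> {L. gray_functor A (gray_hom B C) L}"
  then have L: "gray_functor A (gray_hom B C) L" by simp
  obtain K where K: "gray_functor (A \<otimes>\<^sub>G B) C K"
    "\<And>m n k x y. \<lbrakk>x \<in> cell A m; y \<in> cell B n; m = 0 \<or> n = 0; k = m + n\<rbrakk> \<Longrightarrow>
      K k (ten A B m n x y) = untranspose L m n x y"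
    using tensor_lift_exists[OF untranspose_quasi[OF L A(2,3)]] by metis
  have "curry_right A B K = transpose A B (untranspose L)"
    unfolding curry_right_def by (rule transpose_cong[OF A(1)]; rule K(2); simp)
  then show "L \<in> curry_right A B ` {K. gray_functor (A \<otimes>\<^sub>G B) C K}"
    using transpose_untranspose[OF L A(2,3)] K(1) by (intro image_eqI[of _ _ K]) simp_all
qed

text \<open>The same argument with the lift taken on \<open>B \<otimes>\<^sub>G A\<close>, after
  exchanging the variables of the untransposed quasi-functor. The inner hom is therefore the same on
  both sides.\<close>

theorem curry_left_bij:
  assumes A: "gray_cat A" "gray_cat B" "gray_cat C"
  shows "bij_betw (curry_left A B) {K. gray_functor (B \<otimes>\<^sub>G A) C K} {L. gray_functor A (gray_hom B C) L}"
proof (intro bij_betw_imageI inj_onI set_eqI iffI; (elim imageE)?)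
  fix K K' assume K: "K \<in> {K. gray_functor (B \<otimes>\<^sub>G A) C K}" "K' \<in> {K. gray_functor (B \<otimes>\<^sub>G A) C K}"
    and eq: "curry_left A B K = curry_left A B K'"
  show "K = K'"
  proof (rule tensor_eqI[OF A(2,1)])
    fix n m y x assume "y \<in> cell B n" "x \<in> cell A m" "n = 0 \<or> m = 0"
    then show "K (n + m) (ten B A n m y x) = K' (n + m) (ten B A n m y x)"
      using transpose_inj[OF eq[unfolded curry_left_def]] by auto
  qed (use K in auto)
next
  fix L K assume "L = curry_left A B K" "K \<in> {K. gray_functor (B \<otimes>\<^sub>G A) C K}"
  then show "L \<in> {L. gray_functor A (gray_hom B C) L}"
    using gray_quasi.transpose_functor[OF curry_left_quasi[OF A(1,2)]] by (simp add: curry_left_def)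
next
  fix L assume "L \<in> {L. gray_functor A (gray_hom B C) L}"
  then have L: "gray_functor A (gray_hom B C) L" by simp
  obtain K where K: "gray_functor (B \<otimes>\<^sub>G A) C K"
    "\<And>n m k y x. \<lbrakk>y \<in> cell B n; x \<in> cell A m; n = 0 \<or> m = 0; k = n + m\<rbrakk> \<Longrightarrow>
      K k (ten B A n m y x) = untranspose L m n x y"
    using tensor_lift_exists[OF gray_quasi.swap[OF untranspose_quasi[OF L A(2,3)]]] by metis
  have "curry_left A B K = transpose A B (untranspose L)"
    unfolding curry_left_def by (rule transpose_cong[OF A(1)]; rule K(2); simp)
  then show "L \<in> curry_left A B ` {K. gray_functor (B \<otimes>\<^sub>G A) C K}"
    using transpose_untranspose[OF L A(2,3)] K(1) by (intro image_eqI[of _ _ K]) simp_all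
qed

text \<open>Stated for an arbitrary quasi-functor, so that it yields the naturality of both
  bijections: for \<open>curry_left\<close> it is applied to the quasi-functor with exchanged
  variables.\<close>

lemma transpose_natural:
  assumes H: "gray_quasi A B C H" and P: "gray_functor A' A P" and Q: "gray_functor C C' Q"
  shows "transpose A' B (\<lambda>m n x y. Q (m + n) (H m n (P m x) y)) =
    gray_comp A' P (gray_comp A (transpose A B H) (gray_hom_map B C Q))"
proof -
  interpret H: gray_quasi A B C H by fact
  interpret P: gray_functor A' A P by fact
  note B = H.B.gray_cat_axioms
  have "gray_quasi A' B C (\<lambda>m n x y. H m n (P m x) (gray_id B n y))"
    by (rule gray_quasi_pre[OF H P gray_functor_id[OF B]])
  then have "gray_quasi A' B C (\<lambda>m n x y. H m n (P m x) y)"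
    by (rule gray_quasi_cong) simp_all
  note H' = gray_quasi.post[OF this Q]
  note L = gray_quasi.transpose_functor[OF H']
  note R = gray_functor_comp[OF P gray_functor_comp[OF H.transpose_functor hom_map_functor[OF B Q]]]
  show ?thesis
  proof (rule hom_functor_eqI[OF L R B gray_functorD(2)[OF Q]])
    fix X assume X: "X \<in> cell A' 0"
    then have "transp A B H 0 (P 0 X) \<in> hcells B C 0" by (intro H.T_cell) simp
    then show "transpose A' B (\<lambda>m n x y. Q (m + n) (H m n (P m x) y)) 0 X =
        gray_comp A' P (gray_comp A (transpose A B H) (gray_hom_map B C Q)) 0 X"
      using X by (simp add: transpose_def hom_map_HFun) (simp add: gray_comp_def restrict_def fun_eq_iff)
  next
    fix n x Y assume x: "x \<in> cell A' n" "n \<ge> 1" "Y \<in> cell B 0"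
    then have "transp A B H n (P n x) \<in> hcells B C n" by (intro H.T_cell) simp
    then show "hat (transpose A' B (\<lambda>m n x y. Q (m + n) (H m n (P m x) y)) n x) Y =
        hat (gray_comp A' P (gray_comp A (transpose A B H) (gray_hom_map B C Q)) n x) Y"
      using x by (simp add: transpose_def hat_hom_map H.hat_T gray_quasi.hat_T[OF H'])
  qed
qed

lemma curry_right_natural:
  assumes B: "gray_cat B" and P: "gray_functor A' A P" and Q: "gray_functor C C' Q" and K: "gray_functor (A \<otimes>\<^sub>G B) C
      K"
  shows "curry_right A' B
     (gray_comp (A' \<otimes>\<^sub>G B) (tensor_map A' B A B P (gray_id B)) (gray_comp (A \<otimes>\<^sub>G B) K Q)) =
   gray_comp A' P (gray_comp A (curry_right A B K) (gray_hom_map B C Q))"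
proof -
  note A = gray_functorD[OF P] and I = gray_functor_id[OF B]
  have eq: "gray_comp (A' \<otimes>\<^sub>G B) (tensor_map A' B A B P (gray_id B)) (gray_comp (A \<otimes>\<^sub>G B) K Q) k (ten A' B m n x y)
      =
      Q k (K k (ten A B m n (P m x) y))" if "x \<in> cell A' m" "y \<in> cell B n" "m = 0 \<or> n = 0" "k = m + n" for k m n x y
    using ten_cell[OF A(1) B that] ten_cell[OF A(2) B _ that(2-4), of "P m x"] tensor_map_ten[OF P I that]
      gray_functor.map_cell[OF P that(1)] that(2) by simp
  have "curry_right A' B (gray_comp (A' \<otimes>\<^sub>G B) (tensor_map A' B A B P (gray_id B)) (gray_comp (A \<otimes>\<^sub>G B) K Q)) =
    transpose A' B (\<lambda>m n x y. Q (m + n) (K (m + n) (ten A B m n (P m x) y)))"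
    unfolding curry_right_def by (rule transpose_cong[OF A(1)]) (simp_all add: eq)
  then show ?thesis
    using transpose_natural[OF curry_right_quasi[OF A(2) B K] P Q] by (simp add: curry_right_def)
qed

lemma curry_left_natural:
  assumes B: "gray_cat B" and P: "gray_functor A' A P" and Q: "gray_functor C C' Q" and K: "gray_functor (B \<otimes>\<^sub>G A) C
      K"
  shows "curry_left A' B
     (gray_comp (B \<otimes>\<^sub>G A') (tensor_map B A' B A (gray_id B) P) (gray_comp (B \<otimes>\<^sub>G A) K Q)) =
   gray_comp A' P (gray_comp A (curry_left A B K) (gray_hom_map B C Q))"
proof -
  note A = gray_functorD[OF P] and I = gray_functor_id[OF B]
  have eq: "gray_comp (B \<otimes>\<^sub>G A') (tensor_map B A' B A (gray_id B) P) (gray_comp (B \<otimes>\<^sub>G A) K Q) k (ten B A' n m y x)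
      =
      Q k (K k (ten B A n m y (P m x)))" if "y \<in> cell B n" "x \<in> cell A' m" "n = 0 \<or> m = 0" "k = n + m" for k m n x y
    using ten_cell[OF B A(1) that] ten_cell[OF B A(2) that(1) _ that(3-4), of "P m x"] tensor_map_ten[OF I P that]
      gray_functor.map_cell[OF P that(2)] that(1) by simp
  have "curry_left A' B (gray_comp (B \<otimes>\<^sub>G A') (tensor_map B A' B A (gray_id B) P) (gray_comp (B \<otimes>\<^sub>G A) K Q)) =
    transpose A' B (\<lambda>m n x y. Q (m + n) (K (n + m) (ten B A n m y (P m x))))"
    unfolding curry_left_def by (rule transpose_cong[OF A(1)]) (simp_all add: eq)
  then show ?thesis
    using transpose_natural[OF curry_left_quasi[OF A(2) B K] P Q] by (simp add: curry_left_def)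
qed

lemma quasi_functor_ten:
  assumes "gray_cat A" "gray_cat B"
  shows "quasi_functor A B (A \<otimes>\<^sub>G B) (ten A B)"
  unfolding quasi_functor_def gray_functor_iff
  using gray_quasi.right[OF ten_gray_quasi[OF assms]] gray_quasi.left[OF ten_gray_quasi[OF assms]]
    gray_quasi.transpose_functor[OF ten_gray_quasi[OF assms]] by blast

text \<open>Each adjunction is expressed by a bijection of functor sets together with its naturality
  in the outer variables \<open>A\<close> and \<open>C\<close>, for fixed \<open>B\<close>.\<close>

theorem corollary6p8:
  shows
    \<comment> \<open>the category of Gray-categories and strict functors\<close>
    "(\<forall>A :: 'a gray. gray_category A \<longrightarrow> strict_gray_functor A A (gray_id A)) \<and>
     (\<forall>(A :: 'a gray) (B :: 'b gray) (C :: 'c gray) F G.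
        strict_gray_functor A B F \<and> strict_gray_functor B C G \<longrightarrow>
        strict_gray_functor A C (gray_comp A F G)) \<and>
     (\<forall>(A :: 'a gray) (B :: 'b gray) F. strict_gray_functor A B F \<longrightarrow>
        gray_comp A (gray_id A) F = F \<and> gray_comp A F (gray_id B) = F) \<and>
     (\<forall>(A :: 'a gray) (B :: 'b gray) (C :: 'c gray) (D :: 'd gray) F G H.
        strict_gray_functor A B F \<and> strict_gray_functor B C G \<and> strict_gray_functor C D H \<longrightarrow>
        gray_comp A (gray_comp A F G) H = gray_comp A F (gray_comp B G H)) \<and>

     \<comment> \<open>the tensor product is a functor in two variables\<close>
     (\<forall>(A :: 'a gray) (B :: 'b gray). gray_category A \<and> gray_category B \<longrightarrow>
        gray_category (A \<otimes>\<^sub>G B) \<and>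
        quasi_functor A B (A \<otimes>\<^sub>G B) (ten A B) \<and>
        tensor_map A B A B (gray_id A) (gray_id B) = gray_id (A \<otimes>\<^sub>G B)) \<and>
     (\<forall>(A :: 'a gray) (B :: 'b gray) (A' :: 'c gray) (B' :: 'd gray) F G.
        strict_gray_functor A A' F \<and> strict_gray_functor B B' G \<longrightarrow>
        strict_gray_functor (A \<otimes>\<^sub>G B) (A' \<otimes>\<^sub>G B') (tensor_map A B A' B' F G) \<and>
        (\<forall>m n. m = 0 \<or> n = 0 \<longrightarrow> (\<forall>x\<in>cell A m. \<forall>y\<in>cell B n.
           tensor_map A B A' B' F G (m + n) (ten A B m n x y) = ten A' B' m n (F m x) (G n y)))) \<and>
     (\<forall>(A :: 'a gray) (B :: 'b gray) (A' :: 'c gray) (B' :: 'd gray) (A'' :: 'e gray) (B'' :: 'f gray)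
        F G F' G'.
        strict_gray_functor A A' F \<and> strict_gray_functor A' A'' F' \<and>
        strict_gray_functor B B' G \<and> strict_gray_functor B' B'' G' \<longrightarrow>
        tensor_map A B A'' B'' (gray_comp A F F') (gray_comp B G G') =
        gray_comp (A \<otimes>\<^sub>G B) (tensor_map A B A' B' F G) (tensor_map A' B' A'' B'' F' G')) \<and>

     \<comment> \<open>unit object, associativity and unit isomorphisms, and their naturality\<close>
     gray_category gray_unit \<and>
     (\<forall>(A :: 'a gray) (B :: 'b gray) (C :: 'c gray).
        gray_category A \<and> gray_category B \<and> gray_category C \<longrightarrow>
        gray_iso ((A \<otimes>\<^sub>G B) \<otimes>\<^sub>G C) (A \<otimes>\<^sub>G (B \<otimes>\<^sub>G C)) (assoc A B C) \<and>
        (\<forall>l m n. l = 0 \<and> m = 0 \<or> l = 0 \<and> n = 0 \<or> m = 0 \<and> n = 0 \<longrightarrow>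
           (\<forall>x\<in>cell A l. \<forall>y\<in>cell B m. \<forall>z\<in>cell C n.
              assoc A B C (l + m + n) (ten (A \<otimes>\<^sub>G B) C (l + m) n (ten A B l m x y) z) =
              ten A (B \<otimes>\<^sub>G C) l (m + n) x (ten B C m n y z)))) \<and>
     (\<forall>A :: 'a gray. gray_category A \<longrightarrow>
        gray_iso (gray_unit \<otimes>\<^sub>G A) A (lunit A) \<and> gray_iso (A \<otimes>\<^sub>G gray_unit) A (runit A) \<and>
        (\<forall>n. \<forall>x\<in>cell A n. lunit A n (ten gray_unit A 0 n () x) = x \<and>
                         runit A n (ten A gray_unit n 0 x ()) = x)) \<and>
     (\<forall>(A :: 'a gray) (B :: 'b gray) (C :: 'c gray) (A' :: 'd gray) (B' :: 'e gray) (C' :: 'f gray) F G H.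
        strict_gray_functor A A' F \<and> strict_gray_functor B B' G \<and> strict_gray_functor C C' H \<longrightarrow>
        gray_comp ((A \<otimes>\<^sub>G B) \<otimes>\<^sub>G C)
          (tensor_map (A \<otimes>\<^sub>G B) C (A' \<otimes>\<^sub>G B') C' (tensor_map A B A' B' F G) H) (assoc A' B' C') =
        gray_comp ((A \<otimes>\<^sub>G B) \<otimes>\<^sub>G C)
          (assoc A B C) (tensor_map A (B \<otimes>\<^sub>G C) A' (B' \<otimes>\<^sub>G C') F (tensor_map B C B' C' G H))) \<and>
     (\<forall>(A :: 'a gray) (A' :: 'b gray) F. strict_gray_functor A A' F \<longrightarrow>
        gray_comp (gray_unit \<otimes>\<^sub>G A) (tensor_map gray_unit A gray_unit A' (gray_id gray_unit) F) (lunit A') =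
        gray_comp (gray_unit \<otimes>\<^sub>G A) (lunit A) F \<and>
        gray_comp (A \<otimes>\<^sub>G gray_unit) (tensor_map A gray_unit A' gray_unit F (gray_id gray_unit)) (runit A') =
        gray_comp (A \<otimes>\<^sub>G gray_unit) (runit A) F) \<and>

     \<comment> \<open>the pentagon and triangle axioms\<close>
     (\<forall>(A :: 'a gray) (B :: 'b gray) (C :: 'c gray) (D :: 'd gray).
        gray_category A \<and> gray_category B \<and> gray_category C \<and> gray_category D \<longrightarrow>
        gray_comp (((A \<otimes>\<^sub>G B) \<otimes>\<^sub>G C) \<otimes>\<^sub>G D) (assoc (A \<otimes>\<^sub>G B) C D) (assoc A B (C \<otimes>\<^sub>G D)) =
        gray_comp (((A \<otimes>\<^sub>G B) \<otimes>\<^sub>G C) \<otimes>\<^sub>G D)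
          (tensor_map ((A \<otimes>\<^sub>G B) \<otimes>\<^sub>G C) D (A \<otimes>\<^sub>G (B \<otimes>\<^sub>G C)) D (assoc A B C) (gray_id D))
          (gray_comp ((A \<otimes>\<^sub>G (B \<otimes>\<^sub>G C)) \<otimes>\<^sub>G D) (assoc A (B \<otimes>\<^sub>G C) D)
            (tensor_map A ((B \<otimes>\<^sub>G C) \<otimes>\<^sub>G D) A (B \<otimes>\<^sub>G (C \<otimes>\<^sub>G D)) (gray_id A) (assoc B C D)))) \<and>
     (\<forall>(A :: 'a gray) (B :: 'b gray). gray_category A \<and> gray_category B \<longrightarrow>
        gray_comp ((A \<otimes>\<^sub>G gray_unit) \<otimes>\<^sub>G B) (assoc A gray_unit B)
          (tensor_map A (gray_unit \<otimes>\<^sub>G B) A B (gray_id A) (lunit B)) =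
        tensor_map (A \<otimes>\<^sub>G gray_unit) B A B (runit A) (gray_id B)) \<and>

     \<comment> \<open>the inner hom is a functor in its second variable\<close>
     (\<forall>(B :: 'b gray) (C :: 'c gray). gray_category B \<and> gray_category C \<longrightarrow>
        gray_category (gray_hom B C) \<and>
        gray_hom_map B C (gray_id C) = gray_id (gray_hom B C)) \<and>
     (\<forall>(B :: 'b gray) (C :: 'c gray) (C' :: 'd gray) K.
        gray_category B \<and> strict_gray_functor C C' K \<longrightarrow>
        strict_gray_functor (gray_hom B C) (gray_hom B C') (gray_hom_map B C K)) \<and>
     (\<forall>(B :: 'b gray) (C :: 'c gray) (C' :: 'd gray) (C'' :: 'e gray) K L.
        gray_category B \<and> strict_gray_functor C C' K \<and> strict_gray_functor C' C'' L \<longrightarrow>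
        gray_hom_map B C (gray_comp C K L) =
        gray_comp (gray_hom B C) (gray_hom_map B C K) (gray_hom_map B C' L)) \<and>

     \<comment> \<open>it is right adjoint to tensoring with B on the right, and on the left\<close>
     (\<forall>(A :: 'a gray) (B :: 'b gray) (C :: 'c gray).
        gray_category A \<and> gray_category B \<and> gray_category C \<longrightarrow>
        bij_betw (curry_right A B)
          {K. strict_gray_functor (A \<otimes>\<^sub>G B) C K} {L. strict_gray_functor A (gray_hom B C) L} \<and>
        bij_betw (curry_left A B)
          {K. strict_gray_functor (B \<otimes>\<^sub>G A) C K} {L. strict_gray_functor A (gray_hom B C) L}) \<and>
     (\<forall>(A :: 'a gray) (A' :: 'd gray) (B :: 'b gray) (C :: 'c gray) (C' :: 'e gray) P Q K.
        gray_category B \<and> strict_gray_functor A' A P \<and> strict_gray_functor C C' Q \<and>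
        strict_gray_functor (A \<otimes>\<^sub>G B) C K \<longrightarrow>
        curry_right A' B
             (gray_comp (A' \<otimes>\<^sub>G B) (tensor_map A' B A B P (gray_id B)) (gray_comp (A \<otimes>\<^sub>G B) K Q)) =
           gray_comp A' P (gray_comp A (curry_right A B K) (gray_hom_map B C Q))) \<and>
     (\<forall>(A :: 'a gray) (A' :: 'd gray) (B :: 'b gray) (C :: 'c gray) (C' :: 'e gray) P Q K.
        gray_category B \<and> strict_gray_functor A' A P \<and> strict_gray_functor C C' Q \<and>
        strict_gray_functor (B \<otimes>\<^sub>G A) C K \<longrightarrow>
        curry_left A' B
             (gray_comp (B \<otimes>\<^sub>G A') (tensor_map B A' B A (gray_id B) P) (gray_comp (B \<otimes>\<^sub>G A) K Q)) =
           gray_comp A' P (gray_comp A (curry_left A B K) (gray_hom_map B C Q)))"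
  \<comment> \<open>The enriched notions of the statement are exchanged for the unpacked ones, after
    which each conjunct is one of the results above.\<close>
  unfolding gray_functor_iff gray_category_iff
  apply (intro conjI)
  subgoal using gray_functor_id by blast
  subgoal using gray_functor_comp by blast
  subgoal using gray_comp_id by blast
  subgoal using gray_comp_assoc by blast
  subgoal using tensor_gray_cat quasi_functor_ten tensor_map_id by blast
  subgoal using tensor_map_spec by blast
  subgoal using tensor_map_comp by blast
  subgoal by (rule gray_unit_cat)
  subgoal by (intro allI impI, elim conjE, intro conjI, erule (2) assoc_iso, erule (2) assoc_spec[THEN conjunct2])
  subgoal by (intro allI impI conjI ballI) (simp_all add: lunit_iso runit_iso lunit_ten runit_ten)
  subgoal using assoc_natural by blast
  subgoal using lunit_natural runit_natural by blast
  subgoal using pentagon by blast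
  subgoal using triangle by blast
  subgoal using gray_cat_hom hom_map_id by blast
  subgoal using hom_map_functor by blast
  subgoal using hom_map_comp by blast
  subgoal using curry_right_bij curry_left_bij by blast
  subgoal using curry_right_natural by blast
  subgoal using curry_left_natural by blast
  done

end
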